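(* Let $d\ge3$ and $0\le\alpha\le \frac{2}{d}$. For a non-empty open bounded set $\Omega\subset\mathbb{R}^d$ define \[ G_\alpha(\Omega)=\frac{T(\Omega)\operatorname{cap}(\overline\Omega)}{|\Omega|^{\alpha}P(\Omega)^{d(2-\alpha)/(d-1)}}. \] Then \[ \sup\{G_\alpha(\Omega):\ \Omega \text{ non-empty, open, bounded, convex in } \mathbb{R}^d\}=G_\alpha(B_1), \] and every ball is a maximiser.
   Context: $B_1$ is the open unit ball in $\mathbb{R}^d$. For a non-empty open $\Omega$ of finite measure, the torsion function $v_\Omega$ is the solution of $-\Delta v=1$, $v\in H^1_0(\Omega)$, and the torsional rigidity is $T(\Omega)=\int_\Omega v_\Omega$. For a compact $K\subset\mathbb{R}^d$, the Newtonian capacity is $\operatorname{cap}(K)=\inf\{\int_{\mathbb{R}^d}|Du|^2:\ u\ge \mathbf 1_K,\ u\in D^1(\mathbb{R}^d)\cap C^0(\mathbb{R}^d)\}$, where $D^1(\mathbb{R}^d)$ is the set of $f\in L^1_{\rm loc}(\mathbb{R}^d)$ with $Df\in L^2(\mathbb{R}^d)$ such that $|\{|f|>\varepsilon\}|<\infty$ for all $\varepsilon>0$. $|\cdot|$ is Lebesgue measure and $P(\cdot)$ perimeter. *)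

theory Defs
  imports "HOL-Analysis.Analysis"
begin

primrec iter_dd :: "'a::euclidean_space list \<Rightarrow> ('a \<Rightarrow> real) \<Rightarrow> 'a \<Rightarrow> real" where
  "iter_dd [] f = f"
| "iter_dd (v # vs) f = (\<lambda>x. frechet_derivative (iter_dd vs f) (at x) v)"

definition smooth :: "('a::euclidean_space \<Rightarrow> real) \<Rightarrow> bool" where
  "smooth f \<longleftrightarrow> (\<forall>vs x. iter_dd vs f differentiable (at x))"

definition tsupport :: "('a::euclidean_space \<Rightarrow> 'b::zero) \<Rightarrow> 'a set" where
  "tsupport f = closure {x. f x \<noteq> 0}"

definition test_fun :: "'a::euclidean_space set \<Rightarrow> ('a \<Rightarrow> real) \<Rightarrow> bool" where
  "test_fun U \<phi> \<longleftrightarrow> smooth \<phi> \<and> compact (tsupport \<phi>) \<and> tsupport \<phi> \<subseteq> U"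

definition test_field :: "('a::euclidean_space \<Rightarrow> 'a) \<Rightarrow> bool" where
  "test_field \<Phi> \<longleftrightarrow> (\<forall>b\<in>Basis. smooth (\<lambda>x. \<Phi> x \<bullet> b)) \<and> compact (tsupport \<Phi>)"

definition pd :: "('a::euclidean_space \<Rightarrow> real) \<Rightarrow> 'a \<Rightarrow> 'a \<Rightarrow> real" where
  "pd f b x = frechet_derivative f (at x) b"

definition grad :: "('a::euclidean_space \<Rightarrow> real) \<Rightarrow> 'a \<Rightarrow> 'a" where
  "grad f x = (\<Sum>b\<in>Basis. pd f b x *\<^sub>R b)"

definition divergence :: "('a::euclidean_space \<Rightarrow> 'a) \<Rightarrow> 'a \<Rightarrow> real" where
  "divergence \<Phi> x = (\<Sum>b\<in>Basis. pd (\<lambda>y. \<Phi> y \<bullet> b) b x)"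

definition loc_integrable :: "('a::euclidean_space \<Rightarrow> real) \<Rightarrow> bool" where
  "loc_integrable f \<longleftrightarrow> f \<in> borel_measurable lebesgue \<and>
     (\<forall>K. compact K \<longrightarrow> set_integrable lebesgue K f)"

definition weak_grad_L2 :: "('a::euclidean_space \<Rightarrow> real) \<Rightarrow> ('a \<Rightarrow> 'a) \<Rightarrow> bool" where
  "weak_grad_L2 u g \<longleftrightarrow> loc_integrable u \<and> g \<in> borel_measurable lebesgue \<and>
     integrable lebesgue (\<lambda>x. (norm (g x))\<^sup>2) \<and>
     (\<forall>\<phi> b. test_fun UNIV \<phi> \<longrightarrow> b \<in> Basis \<longrightarrow>
        (\<integral>x. u x * pd \<phi> b x \<partial>lebesgue) = - (\<integral>x. (g x \<bullet> b) * \<phi> x \<partial>lebesgue))"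

definition in_H1 :: "('a::euclidean_space \<Rightarrow> real) \<Rightarrow> ('a \<Rightarrow> 'a) \<Rightarrow> bool" where
  "in_H1 u g \<longleftrightarrow> weak_grad_L2 u g \<and> integrable lebesgue (\<lambda>x. (u x)\<^sup>2)"

text \<open>H^1_0(Omega): closure of C_c^infinity(Omega) in the H^1 norm (functions extended by 0).\<close>
definition in_H10 :: "'a::euclidean_space set \<Rightarrow> ('a \<Rightarrow> real) \<Rightarrow> ('a \<Rightarrow> 'a) \<Rightarrow> bool" where
  "in_H10 \<Omega> u g \<longleftrightarrow> in_H1 u g \<and>
     (\<exists>\<phi>s. (\<forall>n. test_fun \<Omega> (\<phi>s n)) \<and>
        (\<lambda>n. \<integral>x. (\<phi>s n x - u x)\<^sup>2 \<partial>lebesgue) \<longlonglongrightarrow> 0 \<and>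
        (\<lambda>n. \<integral>x. (norm (grad (\<phi>s n) x - g x))\<^sup>2 \<partial>lebesgue) \<longlonglongrightarrow> 0)"

definition is_torsion :: "'a::euclidean_space set \<Rightarrow> ('a \<Rightarrow> real) \<Rightarrow> bool" where
  "is_torsion \<Omega> v \<longleftrightarrow> (\<exists>g. in_H10 \<Omega> v g \<and>
     (\<forall>\<phi>. test_fun \<Omega> \<phi> \<longrightarrow>
        (\<integral>x. g x \<bullet> grad \<phi> x \<partial>lebesgue) = (\<integral>x. indicator \<Omega> x * \<phi> x \<partial>lebesgue)))"

definition torsional_rigidity :: "'a::euclidean_space set \<Rightarrow> real" where
  "torsional_rigidity \<Omega> =
     (THE t. \<exists>v. is_torsion \<Omega> v \<and> t = (\<integral>x. indicator \<Omega> x * v x \<partial>lebesgue))"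

definition in_D1 :: "('a::euclidean_space \<Rightarrow> real) \<Rightarrow> ('a \<Rightarrow> 'a) \<Rightarrow> bool" where
  "in_D1 f g \<longleftrightarrow> weak_grad_L2 f g \<and>
     (\<forall>\<epsilon>>0. emeasure lebesgue {x. \<bar>f x\<bar> > \<epsilon>} < \<infinity>)"

definition newton_cap :: "'a::euclidean_space set \<Rightarrow> real" where
  "newton_cap K = Inf {\<integral>x. (norm (g x))\<^sup>2 \<partial>lebesgue | u g.
      in_D1 u g \<and> continuous_on UNIV u \<and> (\<forall>x. u x \<ge> indicator K x)}"

definition perimeter :: "'a::euclidean_space set \<Rightarrow> real" where
  "perimeter E = Sup {\<integral>x. indicator E x * divergence \<Phi> x \<partial>lebesgue | \<Phi>.
      test_field \<Phi> \<and> (\<forall>x. norm (\<Phi> x) \<le> 1)}"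

definition G_alpha :: "real \<Rightarrow> 'a::euclidean_space set \<Rightarrow> real" where
  "G_alpha \<alpha> \<Omega> = torsional_rigidity \<Omega> * newton_cap (closure \<Omega>) /
     (measure lebesgue \<Omega> powr \<alpha> *
      perimeter \<Omega> powr (real DIM('a) * (2 - \<alpha>) / (real DIM('a) - 1)))"

end

theory Submission
  imports Defs
begin

text \<open>Saint-Venant's inequality says that at fixed volume the torsional rigidity is largest for a ball, so the
  point is to bound the capacity by the perimeter. For convex \<open>\<Omega>\<close> the Brunn-Minkowski inequality gives
  \<open>|\<Omega> + t B| \<le> |\<Omega>| (1 + c t)^d\<close> with \<open>c = P / (d |\<Omega>|)\<close>. Testing the capacity with \<open>(1 + c D)^(2 - d)\<close>,
  \<open>D\<close> the distance to \<open>\<Omega>\<close>, and integrating over the level sets of \<open>D\<close> yields \<open>cap \<le> (d - 2) P\<^sup>2 / (d |\<Omega>|)\<close>,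
  with equality for balls. What remains in the functional is a power of \<open>P\<close> with exponent
  \<open>2 - d (2 - \<alpha>) / (d - 1)\<close>, non-positive because \<open>\<alpha> \<le> 2 / d\<close>, and the isoperimetric inequality concludes.\<close>

text \<open>The perimeter is a supremum over test fields and the capacity an infimum over
  competitors; volumes of outer parallel sets are the common currency. The perimeter meets them
  through a single test field, the gradient of the mollified distance to a body slightly inside
  \<open>\<Omega>\<close>, whose divergence is nonnegative by convexity. Brunn-Minkowski serves
  twice: concavity of the root of the parallel volume carries a slope at 0 to every distance, and
  the same inequality, linearised and applied to superlevel sets, yields Saint-Venant without
  surface integrals or rearrangement. The comparison closes only because both estimates are
  equalities for balls, so exact values are needed there. A mollified radial torsion profile bounds
  the torsion of a ball from below; integration by parts against the Newtonian field, with
  Cauchy-Schwarz, does so for its capacity. \<open>torsional_rigidity\<close> is a definite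
  description: existence and uniqueness of its value come from maximising \<open>energy\<close> over
  test functions, which Saint-Venant bounds.\<close>

section \<open>Minkowski sums and the Brunn-Minkowski inequality\<close>

definition msum :: "'a::euclidean_space set \<Rightarrow> 'a set \<Rightarrow> 'a set" where
  "msum A B = (\<Union>x\<in>A. \<Union>y\<in>B. {x + y})"

lemma msumI: "x \<in> A \<Longrightarrow> y \<in> B \<Longrightarrow> x + y \<in> msum A B"
  by (auto simp: msum_def)

lemma msum_commute: "msum A B = msum B A"
  unfolding msum_def using add.commute by fastforce

lemma open_msum: "open A \<Longrightarrow> open (msum A B)"
  unfolding msum_def by (rule open_sums) simp

lemma bounded_msum: "bounded A \<Longrightarrow> bounded B \<Longrightarrow> bounded (msum A B)"
proof -
  assume AB: "bounded A" "bounded B"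
  show ?thesis using bounded_sums[OF AB] by (simp add: msum_def)
qed

lemma msum_mono: "A \<subseteq> A' \<Longrightarrow> B \<subseteq> B' \<Longrightarrow> msum A B \<subseteq> msum A' B'"
  by (auto simp: msum_def)

lemma lmeasurable_msum: "open A \<Longrightarrow> bounded A \<Longrightarrow> bounded B \<Longrightarrow> msum A B \<in> lmeasurable"
  by (simp add: bounded_msum lmeasurable_open open_msum)

lemma measure_open_pos:
  assumes "open A" "bounded A" "A \<noteq> {}"
  shows "0 < measure lebesgue (A::'a::euclidean_space set)"
proof -
  have "\<not> negligible A" using assms open_not_negligible by blast
  moreover have "A \<in> lmeasurable" using assms by (simp add: lmeasurable_open)
  ultimately show ?thesis
    by (metis measure_nonneg negligible_iff_measure order_le_less)
qed

text \<open>Dividing by the right-hand side turns the factors into \<open>u i / (u i + v i)\<close>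
  and \<open>v i / (u i + v i)\<close>; by the inequality of arithmetic and geometric means the two
  geometric means are at most arithmetic means that add up to 1. With side lengths for
  \<open>u\<close> and \<open>v\<close> this is Brunn-Minkowski for boxes.\<close>

lemma root_prod_add_le:
  fixes u v :: "'i \<Rightarrow> real"
  assumes fin: "finite I" "I \<noteq> {}" and "\<And>i. i \<in> I \<Longrightarrow> 0 < u i" "\<And>i. i \<in> I \<Longrightarrow> 0 < v i"
  shows "root (card I) (\<Prod>i\<in>I. u i) + root (card I) (\<Prod>i\<in>I. v i) \<le> root (card I) (\<Prod>i\<in>I. u i + v i)"
proof -
  let ?n = "card I"
  have n: "?n > 0" using fin by (simp add: card_gt_0_iff)
  have pos: "0 < u i + v i" if "i \<in> I" for i using assms that by (simp add: add_pos_pos)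
  have amgm: "root ?n (\<Prod>i\<in>I. w i) \<le> (\<Sum>i\<in>I. w i / ?n)" if w: "\<And>i. i \<in> I \<Longrightarrow> 0 < w i" for w :: "'i \<Rightarrow> real"
  proof -
    have "root ?n (\<Prod>i\<in>I. w i) = (\<Prod>i\<in>I. w i) powr (1 / ?n)"
      using n w by (subst root_powr_inverse) (auto intro!: prod_nonneg simp: field_simps less_imp_le)
    then show ?thesis using arith_geom_mean[of I w] fin w by (simp add: less_imp_le)
  qed
  define P where "P = root ?n (\<Prod>i\<in>I. u i + v i)"
  have P: "P > 0" unfolding P_def using n pos by (auto intro!: prod_pos real_root_gt_zero)
  have quot: "root ?n (\<Prod>i\<in>I. w i) = P * root ?n (\<Prod>i\<in>I. w i / (u i + v i))" for w
    using P n unfolding P_def by (simp add: prod_dividef real_root_divide)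
  have "root ?n (\<Prod>i\<in>I. u i / (u i + v i)) + root ?n (\<Prod>i\<in>I. v i / (u i + v i))
      \<le> (\<Sum>i\<in>I. u i / (u i + v i) / ?n) + (\<Sum>i\<in>I. v i / (u i + v i) / ?n)"
    using assms pos by (intro add_mono amgm) auto
  also have "\<dots> = (\<Sum>i\<in>I. 1 / ?n)"
    unfolding sum.distrib[symmetric]
  proof (rule sum.cong)
    fix i assume "i \<in> I"
    from pos[OF this] show "u i / (u i + v i) / ?n + v i / (u i + v i) / ?n = 1 / ?n"
      by (metis add_divide_distrib divide_self_if less_irrefl)
  qed simp
  also have "\<dots> = 1" using n by simp
  finally have "P * (root ?n (\<Prod>i\<in>I. u i / (u i + v i)) + root ?n (\<Prod>i\<in>I. v i / (u i + v i))) \<le> P * 1"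
    using P by (intro mult_left_mono) auto
  then show ?thesis by (simp add: quot[of u] quot[of v] P_def[symmetric] algebra_simps)
qed

text \<open>A point that sits at relative position \<open>t i\<close> along each axis of the large
  box is the sum of the points at the same relative positions in the two small boxes.\<close>

lemma box_add_subset_msum:
  fixes a b a' b' :: "'a::euclidean_space"
  assumes "box a b \<noteq> {}" "box a' b' \<noteq> {}"
  shows "box (a + a') (b + b') \<subseteq> msum (box a b) (box a' b')"
proof
  fix z assume z: "z \<in> box (a + a') (b + b')"
  have lt: "a \<bullet> i < b \<bullet> i" "a' \<bullet> i < b' \<bullet> i" if "i \<in> Basis" for i
    using assms that by (auto simp: box_ne_empty)
  define t where "t i = ((z - (a + a')) \<bullet> i) / ((b + b' - (a + a')) \<bullet> i)" for i
  have t: "0 < t i" "t i < 1" "t i * ((b + b' - (a + a')) \<bullet> i) = (z - (a + a')) \<bullet> i" if "i \<in> Basis" for i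
  proof -
    have "(a + a') \<bullet> i < z \<bullet> i" "z \<bullet> i < (b + b') \<bullet> i" using z that by (auto simp: box_def)
    then show "0 < t i" "t i < 1" "t i * ((b + b' - (a + a')) \<bullet> i) = (z - (a + a')) \<bullet> i"
      by (auto simp: t_def inner_diff_left)
  qed
  define x where "x = (\<Sum>i\<in>Basis. (a \<bullet> i + t i * ((b - a) \<bullet> i)) *\<^sub>R i)"
  define y where "y = (\<Sum>i\<in>Basis. (a' \<bullet> i + t i * ((b' - a') \<bullet> i)) *\<^sub>R i)"
  have conv: "l < l + s * (u - l) \<and> l + s * (u - l) < u" if "l < u" "0 < s" "s < 1" for l u s :: real
  proof -
    have "0 < s * (u - l)" using that by simp
    moreover have "s * (u - l) < 1 * (u - l)" using that by (intro mult_strict_right_mono) auto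
    ultimately show ?thesis by simp
  qed
  have "x \<in> box a b" "y \<in> box a' b'"
    using conv lt t by (auto simp: box_def x_def y_def inner_diff_left)
  moreover have "z = x + y"
  proof (rule euclidean_eqI)
    fix i :: 'a assume i: "i \<in> Basis"
    show "z \<bullet> i = (x + y) \<bullet> i"
    proof -
      have "x \<bullet> i = a \<bullet> i + t i * ((b - a) \<bullet> i)" "y \<bullet> i = a' \<bullet> i + t i * ((b' - a') \<bullet> i)"
        using i unfolding x_def y_def by (simp_all only: inner_sum_left_Basis)
      then show ?thesis using t(3)[OF i] by (simp add: inner_simps algebra_simps)
    qed
  qed
  ultimately show "z \<in> msum (box a b) (box a' b')" by (auto intro: msumI)
qed

lemma brunn_minkowski_box:
  fixes a b a' b' :: "'a::euclidean_space"
  assumes ne: "box a b \<noteq> {}" "box a' b' \<noteq> {}"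
  shows "root DIM('a) (measure lebesgue (box a b)) + root DIM('a) (measure lebesgue (box a' b'))
     \<le> root DIM('a) (measure lebesgue (msum (box a b) (box a' b')))"
proof -
  have lt: "a \<bullet> i < b \<bullet> i" "a' \<bullet> i < b' \<bullet> i" if "i \<in> Basis" for i
    using assms that by (auto simp: box_ne_empty)
  have m: "measure lebesgue (box c d) = (\<Prod>i\<in>Basis. (d - c) \<bullet> i)" if "\<And>i. i \<in> Basis \<Longrightarrow> c \<bullet> i < d \<bullet> i" for c d :: 'a
    using that by (simp add: measure_lborel_box_eq less_imp_le)
  have "root DIM('a) (measure lebesgue (box a b)) + root DIM('a) (measure lebesgue (box a' b'))
     \<le> root DIM('a) (\<Prod>i\<in>Basis. (b - a) \<bullet> i + (b' - a') \<bullet> i)"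
    using lt by (subst (1 2) m) (auto intro!: root_prod_add_le simp: inner_diff_left)
  also have "(\<Prod>i\<in>Basis. (b - a) \<bullet> i + (b' - a') \<bullet> i) = measure lebesgue (box (a + a') (b + b'))"
    using lt by (subst m) (auto simp: inner_simps add_strict_mono intro!: prod.cong)
  also have "\<dots> \<le> measure lebesgue (msum (box a b) (box a' b'))"
    by (intro measure_mono_fmeasurable box_add_subset_msum ne lmeasurable_msum) (auto simp: bounded_box)
  finally show ?thesis by (simp add: real_root_le_mono)
qed

lemma negligible_hyperplane_level: "i \<in> Basis \<Longrightarrow> negligible {x::'a::euclidean_space. x \<bullet> i = s}"
  using negligible_standard_hyperplane[of i s] by (simp add: inner_commute)

section \<open>Cutting finite families of boxes by hyperplanes\<close>

lemma measure_halfspace_split: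
  fixes A :: "'a::euclidean_space set"
  assumes "A \<in> lmeasurable" "i \<in> Basis"
  shows "measure lebesgue A = measure lebesgue (A \<inter> {x. x \<bullet> i < s}) + measure lebesgue (A \<inter> {x. s < x \<bullet> i})"
proof -
  have S: "{x::'a. x \<bullet> i < s} \<in> sets lebesgue" "{x::'a. s < x \<bullet> i} \<in> sets lebesgue"
    by (auto simp: open_halfspace_component_lt open_halfspace_component_gt borel_open)
  have "measure lebesgue A = measure lebesgue ((A \<inter> {x. x \<bullet> i < s}) \<union> (A \<inter> {x. s < x \<bullet> i}))"
    by (rule measure_negligible_symdiff)
       (use assms S in \<open>auto intro!: negligible_subset[OF negligible_hyperplane_level[of i s]] fmeasurable_Int_fmeasurable\<close>)
  also have "\<dots> = measure lebesgue (A \<inter> {x. x \<bullet> i < s}) + measure lebesgue (A \<inter> {x. s < x \<bullet> i})"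
    by (rule measure_Un_AE) (use assms S in \<open>auto intro!: fmeasurable_Int_fmeasurable\<close>)
  finally show ?thesis .
qed

text \<open>The volume on the left of the hyperplane is continuous in \<open>s\<close>: indicators
  can jump in the limit only on the limiting hyperplane, which is null, so dominated convergence
  applies. It runs from 0 to the full volume since \<open>B\<close> is bounded. This is what lets a
  second set be cut in a prescribed ratio.\<close>

lemma measure_halfspace_ivt:
  fixes B :: "'a::euclidean_space set"
  assumes B: "B \<in> lmeasurable" "bounded B" and i: "i \<in> Basis" and \<theta>: "0 \<le> \<theta>" "\<theta> \<le> 1"
  shows "\<exists>s. measure lebesgue (B \<inter> {x. x \<bullet> i < s}) = \<theta> * measure lebesgue B"
proof -
  define f where "f s = measure lebesgue (B \<inter> {x. x \<bullet> i < s})" for s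
  have S: "{x::'a. x \<bullet> i < s} \<in> sets lebesgue" for s
    by (auto simp: open_halfspace_component_lt borel_open)
  have f_int: "f s = (\<integral>x. indicator B x * indicator {x. x \<bullet> i < s} x \<partial>lebesgue)" for s
    using B(1) S[of s] by (simp add: f_def indicator_inter_arith[symmetric] Int_absorb2 fmeasurable_Int_fmeasurable)
  have cont: "continuous_on UNIV f"
    unfolding continuous_on_sequentially o_def
  proof safe
    fix X :: "nat \<Rightarrow> real" and s assume X: "X \<longlonglongrightarrow> s"
    show "(\<lambda>n. f (X n)) \<longlonglongrightarrow> f s"
      unfolding f_int
    proof (rule integral_dominated_convergence[where w="indicator B"])
      show "integrable lebesgue (indicator B :: 'a \<Rightarrow> real)" using B(1) by (intro integrable_real_indicator) (auto simp: fmeasurable_def)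
      have "AE x in lebesgue. x \<notin> {x. x \<bullet> i = s}"
        using negligible_hyperplane_level[OF i, of s] by (intro AE_not_in) (simp add: negligible_iff_null_sets)
      then show "AE x in lebesgue. (\<lambda>n. indicator B x * indicator {x. x \<bullet> i < X n} x) \<longlonglongrightarrow> (indicator B x * indicator {x. x \<bullet> i < s} x :: real)"
      proof eventually_elim
        case (elim x)
        have "eventually (\<lambda>n. indicator {x. x \<bullet> i < X n} x = (indicator {x. x \<bullet> i < s} x :: real)) sequentially"
        proof (cases "x \<bullet> i < s")
          case True
          from order_tendstoD(1)[OF X this] show ?thesis by eventually_elim (use True in auto)
        next
          case False
          with elim have "s < x \<bullet> i" by simp
          from order_tendstoD(2)[OF X this] show ?thesis by eventually_elim (use False in auto)
        qed
        then show ?case by (intro tendsto_mult tendsto_const tendsto_eventually) 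
      qed
    qed (use B(1) S in \<open>auto simp: fmeasurableD abs_mult mult_left_le indicator_le_1 intro!: borel_measurable_times borel_measurable_indicator simp del: indicator_simps\<close>)
  qed
  obtain c where c: "\<And>x. x \<in> B \<Longrightarrow> norm x < c" using B(2) by (meson bounded_pos_less)
  have xi: "\<bar>x \<bullet> i\<bar> < c" if "x \<in> B" for x
    using c[OF that] Basis_le_norm[OF i, of x] by linarith
  have "B \<inter> {x. x \<bullet> i < - \<bar>c\<bar>} = {}" "B \<inter> {x. x \<bullet> i < \<bar>c\<bar>} = B"
    using xi by fastforce+
  then have "f (- \<bar>c\<bar>) = 0" "f \<bar>c\<bar> = measure lebesgue B" by (auto simp: f_def)
  moreover have "0 \<le> \<theta> * measure lebesgue B" "\<theta> * measure lebesgue B \<le> measure lebesgue B"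
    using \<theta> by (auto simp: mult_left_le_one_le)
  ultimately have "\<exists>s\<ge>- \<bar>c\<bar>. s \<le> \<bar>c\<bar> \<and> f s = \<theta> * measure lebesgue B"
    using cont by (intro IVT') (auto intro: continuous_on_subset)
  then show ?thesis by (auto simp: f_def)
qed

text \<open>The boxes are open so that an open half-space cuts them into open boxes again; what is
  lost on the hyperplane is null.\<close>

definition box_family :: "'a::euclidean_space set set \<Rightarrow> bool" where
  "box_family F \<longleftrightarrow> finite F \<and> F \<noteq> {} \<and> (\<forall>X\<in>F. X \<noteq> {} \<and> (\<exists>a b. X = box a b)) \<and> pairwise disjnt F"

lemma box_family_open: "box_family F \<Longrightarrow> open (\<Union>F) \<and> bounded (\<Union>F) \<and> \<Union>F \<noteq> {}"
  by (auto simp: box_family_def intro!: open_Union bounded_Union)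

lemma box_Int_halfspace:
  fixes a b :: "'a::euclidean_space"
  assumes i: "i \<in> Basis"
  shows "\<exists>c d. box a b \<inter> {x. x \<bullet> i < s} = box c d" "\<exists>c d. box a b \<inter> {x. s < x \<bullet> i} = box c d"
proof -
  let ?d = "\<Sum>j\<in>Basis. (if j = i then min (b \<bullet> i) s else b \<bullet> j) *\<^sub>R j"
  let ?c = "\<Sum>j\<in>Basis. (if j = i then max (a \<bullet> i) s else a \<bullet> j) *\<^sub>R j"
  have "box a b \<inter> {x. x \<bullet> i < s} = box a ?d" "box a b \<inter> {x. s < x \<bullet> i} = box ?c b"
    using i by (auto simp: box_def split: if_splits)
  then show "\<exists>c d. box a b \<inter> {x. x \<bullet> i < s} = box c d" "\<exists>c d. box a b \<inter> {x. s < x \<bullet> i} = box c d"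
    by blast+
qed

text \<open>The two cardinality claims drive the induction on the number of boxes: a cut never
  creates boxes on one side, and it removes one as soon as some box lies entirely on the other
  side.\<close>

lemma box_family_cut:
  assumes F: "box_family F" and H: "H = {x::'a::euclidean_space. x \<bullet> i < s} \<or> H = {x. s < x \<bullet> i}" and i: "i \<in> Basis"
    and ne: "\<Union>F \<inter> H \<noteq> {}"
  defines "G \<equiv> (\<lambda>X. X \<inter> H) ` {X\<in>F. X \<inter> H \<noteq> {}}"
  shows "box_family G" "\<Union>G = \<Union>F \<inter> H" "card G \<le> card F" "X \<in> F \<Longrightarrow> X \<inter> H = {} \<Longrightarrow> card G < card F"
proof -
  have fin: "finite F" using F by (simp add: box_family_def)
  have "\<exists>a b. X \<inter> H = box a b" if "X \<in> F" for X
    using F H that box_Int_halfspace[OF i] unfolding box_family_def by metis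
  then show "box_family G"
    unfolding box_family_def
  proof (intro conjI ballI)
    show "pairwise disjnt G"
      using F unfolding box_family_def G_def pairwise_def disjnt_def by (smt (verit, best) Int_assoc Int_commute imageE inf_bot_right mem_Collect_eq)
  qed (use F ne in \<open>auto simp: box_family_def G_def\<close>)
  show "\<Union>G = \<Union>F \<inter> H" by (auto simp: G_def)
  have "card G \<le> card {X\<in>F. X \<inter> H \<noteq> {}}" unfolding G_def using fin by (intro card_image_le) auto
  also have "\<dots> \<le> card F" using fin by (intro card_mono) auto
  finally show "card G \<le> card F" .
  show "card G < card F" if "X \<in> F" "X \<inter> H = {}"
  proof -
    have "{X\<in>F. X \<inter> H \<noteq> {}} \<subset> F" using that by auto
    then have "card {X\<in>F. X \<inter> H \<noteq> {}} < card F" using fin by (intro psubset_card_mono)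
    then show ?thesis using \<open>card G \<le> card {X\<in>F. X \<inter> H \<noteq> {}}\<close> by linarith
  qed
qed

lemma disjoint_boxes_separated:
  fixes a b c d :: "'a::euclidean_space"
  assumes "box a b \<inter> box c d = {}" "box a b \<noteq> {}" "box c d \<noteq> {}"
  obtains i s where "i \<in> Basis" 
    "(box a b \<subseteq> {x. x \<bullet> i < s} \<and> box c d \<subseteq> {x. s < x \<bullet> i}) \<or> (box c d \<subseteq> {x. x \<bullet> i < s} \<and> box a b \<subseteq> {x. s < x \<bullet> i})"
proof -
  obtain i where i: "i \<in> Basis" "b\<bullet>i \<le> a\<bullet>i \<or> d\<bullet>i \<le> c\<bullet>i \<or> b\<bullet>i \<le> c\<bullet>i \<or> d\<bullet>i \<le> a\<bullet>i"
    using assms(1) unfolding disjoint_interval by blast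
  then have "b\<bullet>i \<le> c\<bullet>i \<or> d\<bullet>i \<le> a\<bullet>i" using assms(2,3) by (auto simp: box_eq_empty)
  then show thesis
  proof
    assume "b\<bullet>i \<le> c\<bullet>i" with i(1) show thesis by (intro that[of i "b \<bullet> i"]) (fastforce simp: box_def)+
  next
    assume "d\<bullet>i \<le> a\<bullet>i" with i(1) show thesis by (intro that[of i "d \<bullet> i"]) (fastforce simp: box_def)+
  qed
qed

text \<open>Volumes of the two halves add in the form with the power, whereas the induction
  hypothesis comes in the form with roots.\<close>

lemma root_add_pow_le_iff:
  assumes "n > 0" "0 \<le> x" "0 \<le> y" "0 \<le> (z::real)"
  shows "root n x + root n y \<le> root n z \<longleftrightarrow> (root n x + root n y) ^ n \<le> z"
proof -
  have "root n x + root n y = root n ((root n x + root n y) ^ n)" using assms by (simp add: real_root_power_cancel)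
  then show ?thesis using assms(1) real_root_le_iff by metis
qed

text \<open>Hadwiger-Ohmann: a hyperplane separating two boxes of one family cuts both families (the second one
  after a translation) in the same volume ratio, which lowers the total number of boxes on either side.\<close>
lemma brunn_minkowski_box_family:
  fixes F G :: "'a::euclidean_space set set"
  assumes "box_family F" "box_family G"
  shows "root DIM('a) (measure lebesgue (\<Union>F)) + root DIM('a) (measure lebesgue (\<Union>G))
     \<le> root DIM('a) (measure lebesgue (msum (\<Union>F) (\<Union>G)))"
  using assms
proof (induction "card F + card G" arbitrary: F G rule: less_induct)
  case less
  let ?d = "DIM('a)" and ?m = "measure lebesgue :: 'a set \<Rightarrow> real"
  \<comment> \<open>The induction hypothesis is restated as a premise so that the same argument can
    be called with \<open>F\<close> and \<open>G\<close> exchanged when only \<open>G\<close> has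
    two boxes.\<close>
  have main: "root ?d (?m (\<Union>F)) + root ?d (?m (\<Union>G)) \<le> root ?d (?m (msum (\<Union>F) (\<Union>G)))"
    if F: "box_family F" and G: "box_family G" and card: "card F \<ge> 2"
      and IH: "\<And>F' G'. card F' + card G' < card F + card G \<Longrightarrow> box_family F' \<Longrightarrow> box_family G' \<Longrightarrow>
         root ?d (?m (\<Union>F')) + root ?d (?m (\<Union>G')) \<le> root ?d (?m (msum (\<Union>F') (\<Union>G')))"
    for F G :: "'a set set"
  proof -
    define A where "A = \<Union>F" define B where "B = \<Union>G"
    have A: "open A" "bounded A" "A \<noteq> {}" and B: "open B" "bounded B" "B \<noteq> {}"
      using box_family_open[OF F] box_family_open[OF G] by (auto simp: A_def B_def)
    note AB = lmeasurable_open[OF A(2,1)] lmeasurable_open[OF B(2,1)]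
    obtain X Y where XY: "X \<in> F" "Y \<in> F" "X \<noteq> Y"
      using card by (metis One_nat_def Suc_1 card_le_Suc0_iff_eq card.infinite not_less_eq_eq zero_le)
    obtain i s where i: "i \<in> Basis" and sep: "(X \<subseteq> {x. x \<bullet> i < s} \<and> Y \<subseteq> {x. s < x \<bullet> i}) \<or> (Y \<subseteq> {x. x \<bullet> i < s} \<and> X \<subseteq> {x. s < x \<bullet> i})"
    proof -
      have "X \<inter> Y = {}" using F XY by (auto simp: box_family_def pairwise_def disjnt_def)
      moreover obtain a b c d where "X = box a b" "Y = box c d" using F XY unfolding box_family_def by metis
      moreover have "X \<noteq> {}" "Y \<noteq> {}" using F XY by (auto simp: box_family_def)
      ultimately show ?thesis using that disjoint_boxes_separated by metis
    qed
    obtain X Y where XY: "X \<in> F" "Y \<in> F" and sep: "X \<subseteq> {x. x \<bullet> i < s}" "Y \<subseteq> {x. s < x \<bullet> i}"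
      using XY sep by metis
    have XYne: "X \<noteq> {}" "Y \<noteq> {}" using F XY by (auto simp: box_family_def)
    let ?L = "\<lambda>s. {x::'a. x \<bullet> i < s}" and ?R = "\<lambda>s. {x::'a. s < x \<bullet> i}"
    have LR: "open (?L s)" "open (?R s)" for s by (auto simp: open_halfspace_component_lt open_halfspace_component_gt)
    define a1 a2 where "a1 = ?m (A \<inter> ?L s)" and "a2 = ?m (A \<inter> ?R s)"
    have AL: "A \<inter> ?L s \<noteq> {}" "A \<inter> ?R s \<noteq> {}" using XY XYne sep by (auto simp: A_def)
    have a12: "a1 > 0" "a2 > 0" "?m A = a1 + a2"
      unfolding a1_def a2_def using A AL LR AB i
      by (intro measure_open_pos measure_halfspace_split; simp add: bounded_Int open_Int)+
    define \<theta> where "\<theta> = a1 / ?m A"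
    have \<theta>: "0 < \<theta>" "\<theta> < 1" "a1 = \<theta> * ?m A" "a2 = (1 - \<theta>) * ?m A" using a12 by (auto simp: \<theta>_def field_simps)
    obtain t where t: "?m (B \<inter> ?L t) = \<theta> * ?m B"
      using measure_halfspace_ivt[OF AB(2) B(2) i, of \<theta>] \<theta> by auto
    have t': "?m (B \<inter> ?R t) = (1 - \<theta>) * ?m B"
      using measure_halfspace_split[OF AB(2) i, of t] t by (simp add: algebra_simps)
    have Bpos: "?m B > 0" using B measure_open_pos by blast
    have BL: "B \<inter> ?L t \<noteq> {}" "B \<inter> ?R t \<noteq> {}" using t t' \<theta> Bpos by (metis measure_empty mult_pos_pos less_irrefl, metis measure_empty mult_pos_pos less_irrefl diff_gt_0_iff_gt)
    \<comment> \<open>Both halves carry the fraction \<open>c\<close> of their volumes, so by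
      homogeneity the induction hypothesis gives exactly \<open>c\<close> times the desired bound;
      \<open>c\<close> is \<theta> on the left and 1 - \<theta> on the right. The box
      \<open>Z\<close> missed by the half-space makes the number of boxes drop.\<close>
    have part: "c * (root ?d (?m A) + root ?d (?m B)) ^ ?d \<le> ?m (msum (A \<inter> H s) (B \<inter> H t))"
      if H: "H = ?L \<or> H = ?R" and c: "c > 0" "?m (A \<inter> H s) = c * ?m A" "?m (B \<inter> H t) = c * ?m B"
        and Z: "Z \<in> F" "Z \<inter> H s = {}" for H c Z
    proof -
      define F' where "F' = (\<lambda>X. X \<inter> H s) ` {X\<in>F. X \<inter> H s \<noteq> {}}"
      define G' where "G' = (\<lambda>X. X \<inter> H t) ` {X\<in>G. X \<inter> H t \<noteq> {}}"
      have ne: "\<Union>F \<inter> H s \<noteq> {}" "\<Union>G \<inter> H t \<noteq> {}" using H AL BL by (auto simp: A_def B_def)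
      have Hs: "H s = ?L s \<or> H s = ?R s" "H t = ?L t \<or> H t = ?R t" using H by auto
      note cF = box_family_cut[OF F Hs(1) i ne(1), folded F'_def]
      note cG = box_family_cut[OF G Hs(2) i ne(2), folded G'_def]
      have le: "root ?d (?m (\<Union>F')) + root ?d (?m (\<Union>G')) \<le> root ?d (?m (msum (\<Union>F') (\<Union>G')))"
        using cF(1) cF(4)[OF Z] cG(1,3) by (intro IH) linarith+
      have "(root ?d (c * ?m A) + root ?d (c * ?m B)) ^ ?d \<le> ?m (msum (A \<inter> H s) (B \<inter> H t))"
        using le c by (subst root_add_pow_le_iff[symmetric]) (auto simp: cF cG A_def B_def)
      moreover have "(root ?d (c * ?m A) + root ?d (c * ?m B)) ^ ?d = c * (root ?d (?m A) + root ?d (?m B)) ^ ?d"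
        using c by (simp add: real_root_mult distrib_left[symmetric] power_mult_distrib)
      ultimately show ?thesis by simp
    qed
    have H0: "Y \<inter> ?L s = {}" "X \<inter> ?R s = {}" using sep by fastforce+
    have p1: "\<theta> * (root ?d (?m A) + root ?d (?m B)) ^ ?d \<le> ?m (msum (A \<inter> ?L s) (B \<inter> ?L t))"
      by (rule part[of ?L \<theta> Y]) (use \<theta> t a1_def XY H0 in auto)
    have p2: "(1 - \<theta>) * (root ?d (?m A) + root ?d (?m B)) ^ ?d \<le> ?m (msum (A \<inter> ?R s) (B \<inter> ?R t))"
      by (rule part[of ?R "1 - \<theta>" X]) (use \<theta> t' a2_def XY H0 in auto)
    have meas: "msum (A \<inter> H s) (B \<inter> H t) \<in> lmeasurable" if "H = ?L \<or> H = ?R" for H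
    proof (rule lmeasurable_msum)
      show "open (A \<inter> H s)" using that A LR by (auto intro: open_Int)
      show "bounded (A \<inter> H s)" "bounded (B \<inter> H t)" using A B by (simp_all add: bounded_Int)
    qed
    have "(root ?d (?m A) + root ?d (?m B)) ^ ?d \<le> ?m (msum (A \<inter> ?L s) (B \<inter> ?L t)) + ?m (msum (A \<inter> ?R s) (B \<inter> ?R t))"
      using p1 p2 by (simp add: algebra_simps)
    also have "\<dots> = ?m (msum (A \<inter> ?L s) (B \<inter> ?L t) \<union> msum (A \<inter> ?R s) (B \<inter> ?R t))"
    proof (rule measure_Un_AE[symmetric])
      \<comment> \<open>Sums of left halves have \<open>i\<close>-th coordinate below
        \<open>s + t\<close>, sums of right halves above it.\<close>
      have "msum (A \<inter> ?L s) (B \<inter> ?L t) \<inter> msum (A \<inter> ?R s) (B \<inter> ?R t) = {}"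
        by (auto simp: msum_def) (smt (verit) inner_add_left)
      then show "AE x in lebesgue. x \<notin> msum (A \<inter> ?L s) (B \<inter> ?L t) \<or> x \<notin> msum (A \<inter> ?R s) (B \<inter> ?R t)"
        by (intro AE_I2) blast
    qed (use meas in auto)
    also have "\<dots> \<le> ?m (msum A B)"
      using meas A B by (intro measure_mono_fmeasurable) (auto simp: msum_def intro: lmeasurable_msum[unfolded msum_def])
    finally show ?thesis unfolding A_def[symmetric] B_def[symmetric] by (subst root_add_pow_le_iff) auto
  qed
  show ?case
  proof (cases "card F \<ge> 2")
    case True
    show ?thesis by (rule main[OF less.prems True less.hyps])
  next
    case F1: False
    show ?thesis
    proof (cases "card G \<ge> 2")
      case True
      have "root ?d (?m (\<Union>G)) + root ?d (?m (\<Union>F)) \<le> root ?d (?m (msum (\<Union>G) (\<Union>F)))"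
        by (rule main[OF less.prems(2,1) True less.hyps]) (simp_all add: add.commute)
      then show ?thesis by (simp add: msum_commute add.commute)
    next
      case False
      have "\<exists>X. H = {X}" if "card H < 2" "box_family H" for H :: "'a set set"
        using that unfolding box_family_def by (metis One_nat_def Suc_1 card_0_eq card_1_singletonE less_2_cases)
      with F1 False less.prems obtain X Y where "F = {X}" "G = {Y}" by (meson not_le)
      moreover obtain a b c d where "X = box a b" "X \<noteq> {}" "Y = box c d" "Y \<noteq> {}"
        using less.prems unfolding box_family_def \<open>F = {X}\<close> \<open>G = {Y}\<close> by (metis singletonI)
      ultimately show ?thesis using brunn_minkowski_box by simp
    qed
  qed
qed

text \<open>An open set is a countable union of closed boxes; finitely many of them already carry
  almost all of the volume, and a division of their union into boxes makes them essentially
  disjoint.\<close>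

lemma open_approx_box_family:
  fixes A :: "'a::euclidean_space set"
  assumes A: "open A" "bounded A" "A \<noteq> {}" and e: "e > 0"
  obtains F where "box_family F" "\<Union>F \<subseteq> A" "measure lebesgue A - e \<le> measure lebesgue (\<Union>F)"
proof -
  obtain D where D: "countable D" "D \<subseteq> Pow A" "\<And>X. X \<in> D \<Longrightarrow> \<exists>a b. X = cbox a b" "\<Union>D = A"
    using open_countable_Union_open_cbox[OF A(1)] by metis
  have Apos: "measure lebesgue A > 0" using A measure_open_pos by blast
  have "D \<noteq> {}" using D A by auto
  define X where "X = from_nat_into D"
  have X: "range X = D" unfolding X_def using D(1) \<open>D \<noteq> {}\<close> by (simp add: range_from_nat_into)
  define U where "U n = (\<Union>k<n. X k)" for n :: nat
  have Xm: "X k \<in> lmeasurable" for k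
  proof -
    obtain a b where "X k = cbox a b" using D(3)[of "X k"] X by blast
    then show ?thesis by simp
  qed
  have "(\<lambda>n. measure lebesgue (U n)) \<longlonglongrightarrow> measure lebesgue (\<Union>n. U n)"
  proof (rule Lim_measure_incseq)
    show "range U \<subseteq> sets lebesgue" using Xm by (auto simp: U_def)
    show "incseq U" by (auto simp: U_def incseq_def) (meson lessThan_iff less_le_trans)
    have "(\<Union>n. U n) = A" using X D(4) by (fastforce simp: U_def)
    then show "emeasure lebesgue (\<Union>n. U n) \<noteq> \<infinity>" using A lmeasurable_open[OF A(2,1)] by (auto simp: fmeasurable_def)
  qed
  moreover have UA: "(\<Union>n. U n) = A" using X D(4) by (fastforce simp: U_def)
  \<comment> \<open>Limiting the loss to half of the volume of \<open>A\<close> keeps the family of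
    positive measure, hence nonempty as \<open>box_family\<close> demands.\<close>
  moreover have "measure lebesgue A - min e (measure lebesgue A) / 2 < measure lebesgue A" using e Apos by auto
  ultimately obtain n where n: "measure lebesgue A - min e (measure lebesgue A) / 2 < measure lebesgue (U n)"
    by (metis (no_types, lifting) order_tendstoD(1) eventually_sequentially le_refl)
  have "\<exists>a b. Y = cbox a b" if "Y \<in> X ` {..<n}" for Y using that D(3) X by (metis imageE rangeI)
  then obtain p where p: "p division_of U n"
    using elementary_unions_intervals[of "X ` {..<n}"] unfolding U_def by (metis finite_imageI finite_lessThan)
  \<comment> \<open>Interiors of the cells of a division are disjoint open boxes and miss only the
    cell frontiers, which are null. Cells with empty interior are dropped.\<close>
  define F where "F = {Y \<in> interior ` p. Y \<noteq> {}}"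
  have fin: "finite p" using p by auto
  have Um: "U n \<in> lmeasurable" using Xm by (auto simp: U_def)
  have sub: "\<Union>F \<subseteq> U n" using p interior_subset by (fastforce simp: F_def)
  have "U n \<subseteq> \<Union>F \<union> (\<Union>K\<in>p. frontier K)"
  proof
    fix x assume "x \<in> U n"
    then obtain K where K: "K \<in> p" "x \<in> K" using p by auto
    then show "x \<in> \<Union>F \<union> (\<Union>K\<in>p. frontier K)"
      using p K closure_subset[of K] by (cases "x \<in> interior K") (auto simp: F_def frontier_def)
  qed
  then have "sym_diff (U n) (\<Union>F) \<subseteq> (\<Union>K\<in>p. frontier K)" using sub by auto
  moreover have "negligible (\<Union>K\<in>p. frontier K)"
    using p fin by (intro negligible_Union) (auto intro!: negligible_convex_frontier dest!: division_ofD(4))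
  ultimately have "measure lebesgue (\<Union>F) = measure lebesgue (U n)"
    using Um by (intro measure_negligible_symdiff) (auto intro: negligible_subset)
  with n have m: "measure lebesgue A - min e (measure lebesgue A) / 2 < measure lebesgue (\<Union>F)" by simp
  have "measure lebesgue A - min e (measure lebesgue A) / 2 > 0" using Apos by linarith
  then have "F \<noteq> {}" using m by auto
  moreover have "pairwise disjnt F"
    using division_ofD(5)[OF p] by (auto simp: F_def pairwise_def disjnt_def)
  moreover have "\<exists>a b. Y = box a b" if "Y \<in> F" for Y
    using that division_ofD(4)[OF p] by (auto simp: F_def) (metis interior_cbox)
  ultimately have "box_family F" using fin by (auto simp: box_family_def F_def)
  moreover have "\<Union>F \<subseteq> A" using sub UA by auto
  moreover have "measure lebesgue A - e \<le> measure lebesgue (\<Union>F)" using m e by auto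
  ultimately show thesis using that by blast
qed

text \<open>Inner approximation suffices: sums of subsets lie in the sum, so only the left-hand side
  moves, and it does so continuously as the error \<open>e\<close> tends to 0.\<close>

lemma brunn_minkowski_open:
  fixes A B :: "'a::euclidean_space set"
  assumes A: "open A" "bounded A" "A \<noteq> {}" and B: "open B" "bounded B" "B \<noteq> {}"
  shows "root DIM('a) (measure lebesgue A) + root DIM('a) (measure lebesgue B) \<le> root DIM('a) (measure lebesgue (msum A B))"
proof -
  let ?d = "DIM('a)" and ?m = "measure lebesgue :: 'a set \<Rightarrow> real"
  have "eventually (\<lambda>e::real. root ?d (?m A - e) + root ?d (?m B - e) \<le> root ?d (?m (msum A B))) (at_right 0)"
    unfolding eventually_at_right_field
  proof (intro exI[of _ 1] conjI allI impI)
    fix e :: real assume "0 < e" 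
    obtain F where F: "box_family F" "\<Union>F \<subseteq> A" "?m A - e \<le> ?m (\<Union>F)" using open_approx_box_family[OF A \<open>0 < e\<close>] by metis
    obtain G where G: "box_family G" "\<Union>G \<subseteq> B" "?m B - e \<le> ?m (\<Union>G)" using open_approx_box_family[OF B \<open>0 < e\<close>] by metis
    have "root ?d (?m A - e) + root ?d (?m B - e) \<le> root ?d (?m (\<Union>F)) + root ?d (?m (\<Union>G))"
      using F G by (intro add_mono real_root_le_mono) auto
    also have "\<dots> \<le> root ?d (?m (msum (\<Union>F) (\<Union>G)))" using F G by (intro brunn_minkowski_box_family)
    also have "\<dots> \<le> root ?d (?m (msum A B))"
      using F G A B box_family_open[OF F(1)] box_family_open[OF G(1)]
      by (intro real_root_le_mono measure_mono_fmeasurable msum_mono) (auto intro!: lmeasurable_msum fmeasurableD)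
    finally show "root ?d (?m A - e) + root ?d (?m B - e) \<le> root ?d (?m (msum A B))" .
  qed simp
  moreover have "((\<lambda>e. root ?d (?m A - e) + root ?d (?m B - e)) \<longlongrightarrow> root ?d (?m A - 0) + root ?d (?m B - 0)) (at_right 0)"
    by (intro tendsto_intros)
  ultimately show ?thesis by (intro tendsto_upperbound[where F="at_right (0::real)"]) auto
qed

subsection \<open>Smooth functions\<close>

text \<open>\<open>iter_dd\<close> adds derivatives on the outside, while this recursion
  differentiates the function itself first. Closure under products, compositions and reflections is
  then a plain induction on the order with the function generalised.\<close>

primrec times_differentiable :: "nat \<Rightarrow> ('a::euclidean_space \<Rightarrow> real) \<Rightarrow> bool" where
  "times_differentiable 0 f \<longleftrightarrow> True"
| "times_differentiable (Suc n) f \<longleftrightarrow> (\<forall>x. f differentiable (at x)) \<and> (\<forall>v. times_differentiable n (\<lambda>x. frechet_derivative f (at x) v))"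

lemma iter_dd_append: "iter_dd (vs @ [v]) f = iter_dd vs (\<lambda>x. frechet_derivative f (at x) v)"
  by (induction vs) auto

lemma times_differentiable_iff:
  fixes f :: "'a::euclidean_space \<Rightarrow> real"
  shows "times_differentiable n f \<longleftrightarrow> (\<forall>vs x. length vs < n \<longrightarrow> iter_dd vs f differentiable (at x))"
proof (induction n arbitrary: f)
  case (Suc n)
  have "(\<forall>vs x. length vs < Suc n \<longrightarrow> iter_dd vs f differentiable (at x)) \<longleftrightarrow>
     (\<forall>x. f differentiable (at x)) \<and> (\<forall>v vs x. length vs < n \<longrightarrow> iter_dd (vs @ [v]) f differentiable (at x))"
  proof (intro iffI conjI allI impI)
    fix vs :: "'a list" and x :: 'a assume *: "(\<forall>x. f differentiable (at x)) \<and> (\<forall>v vs x. length vs < n \<longrightarrow> iter_dd (vs @ [v]) f differentiable (at x))"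
      "length vs < Suc n"
    then show "iter_dd vs f differentiable (at x)"
      by (cases vs rule: rev_cases) auto
  next
    fix x assume "\<forall>vs x. length vs < Suc n \<longrightarrow> iter_dd vs f differentiable (at x)"
    from this[rule_format, of "[]" x] show "f differentiable (at x)" by simp
  qed auto
  then show ?case by (simp add: Suc.IH iter_dd_append)
qed simp

lemma smooth_iff_times_differentiable: "smooth f \<longleftrightarrow> (\<forall>n. times_differentiable n f)"
  unfolding smooth_def times_differentiable_iff by blast

lemma smooth_times_differentiable: "smooth f \<Longrightarrow> times_differentiable n f"
  by (simp add: smooth_iff_times_differentiable)

lemma times_differentiable_Suc_imp: "times_differentiable (Suc n) f \<Longrightarrow> times_differentiable n f"
  by (simp add: times_differentiable_iff)

lemma smooth_differentiable: "smooth f \<Longrightarrow> f differentiable (at x)"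
  using smooth_times_differentiable[of f 1] by simp

lemma smooth_has_derivative: "smooth f \<Longrightarrow> (f has_derivative frechet_derivative f (at x)) (at x)"
  using frechet_derivative_works smooth_differentiable by blast

lemma smooth_derivative: "smooth f \<Longrightarrow> smooth (\<lambda>x. frechet_derivative f (at x) v)"
  unfolding smooth_iff_times_differentiable by (metis times_differentiable.simps(2))

lemma smooth_pd: "smooth f \<Longrightarrow> smooth (pd f b)"
  using smooth_derivative[of f b] by (simp add: pd_def[abs_def])

lemma smooth_continuous_on: "smooth f \<Longrightarrow> continuous_on S f"
  by (meson continuous_at_imp_continuous_on differentiable_imp_continuous_within smooth_differentiable)

lemma times_differentiable_SucI:
  assumes "\<And>x. (f has_derivative f' x) (at x)" "\<And>v. times_differentiable n (\<lambda>x. f' x v)"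
  shows "times_differentiable (Suc n) f"
proof -
  have "frechet_derivative f (at x) = f' x" for x using assms(1)[of x] by (rule frechet_derivative_at[symmetric])
  then show ?thesis using assms by (auto simp: differentiable_def)
qed

lemma times_differentiable_has_derivative: "times_differentiable (Suc n) f \<Longrightarrow> (f has_derivative frechet_derivative f (at x)) (at x)"
  using frechet_derivative_works by fastforce

lemma times_differentiable_const: "times_differentiable n (\<lambda>x. c)"
  by (induction n arbitrary: c) (auto intro!: times_differentiable_SucI derivative_eq_intros simp del: times_differentiable.simps(2))

lemma times_differentiable_inner: "times_differentiable n (\<lambda>x. x \<bullet> b)"
  by (cases n) (auto intro!: times_differentiable_SucI derivative_eq_intros times_differentiable_const simp del: times_differentiable.simps(2))

lemma times_differentiable_add: "times_differentiable n f \<Longrightarrow> times_differentiable n g \<Longrightarrow> times_differentiable n (\<lambda>x. f x + g x)"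
proof (induction n arbitrary: f g)
  case (Suc n)
  note d = times_differentiable_has_derivative[OF Suc.prems(1)] times_differentiable_has_derivative[OF Suc.prems(2)]
  show ?case by (rule times_differentiable_SucI, rule has_derivative_add[OF d]) (use Suc in auto)
qed simp

lemma times_differentiable_mult: "times_differentiable n f \<Longrightarrow> times_differentiable n g \<Longrightarrow> times_differentiable n (\<lambda>x. f x * g x)"
proof (induction n arbitrary: f g)
  case (Suc n)
  note d = times_differentiable_has_derivative[OF Suc.prems(1)] times_differentiable_has_derivative[OF Suc.prems(2)]
  note p = times_differentiable_Suc_imp[OF Suc.prems(1)] times_differentiable_Suc_imp[OF Suc.prems(2)]
  show ?case by (rule times_differentiable_SucI, rule has_derivative_mult[OF d]) (use Suc p in \<open>auto intro!: times_differentiable_add\<close>)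
qed simp

lemma times_differentiable_sum: "(\<And>i. i \<in> I \<Longrightarrow> times_differentiable n (f i)) \<Longrightarrow> times_differentiable n (\<lambda>x. \<Sum>i\<in>I. f i x)"
  by (induction I rule: infinite_finite_induct) (auto intro: times_differentiable_const times_differentiable_add)

lemma times_differentiable_compose: "times_differentiable n h \<Longrightarrow> times_differentiable n f \<Longrightarrow> times_differentiable n (\<lambda>x. h (f x))" for h :: "real \<Rightarrow> real"
proof (induction n arbitrary: h f)
  case (Suc n)
  note d = times_differentiable_has_derivative[OF Suc.prems(1)] times_differentiable_has_derivative[OF Suc.prems(2)]
  have eq: "frechet_derivative h (at t) s = frechet_derivative h (at t) 1 * s" for t s
    using linear_cmul[OF has_derivative_linear[OF d(1)[of t]], of s 1] by simp
  show ?case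
    by (rule times_differentiable_SucI, rule has_derivative_compose[OF d(2) d(1)], subst eq)
       (use Suc times_differentiable_Suc_imp[OF Suc.prems(2)] in \<open>auto intro!: times_differentiable_mult\<close>)
qed simp

lemma times_differentiable_reflect: "times_differentiable n f \<Longrightarrow> times_differentiable n (\<lambda>x. f (a - x))"
proof (induction n arbitrary: f)
  case (Suc n)
  note d = times_differentiable_has_derivative[OF Suc.prems(1)]
  have "((\<lambda>x. f (a - x)) has_derivative (\<lambda>v. -1 * frechet_derivative f (at (a - x)) v)) (at x)" for x
  proof -
    have "((\<lambda>x. f (a - x)) has_derivative (\<lambda>v. frechet_derivative f (at (a - x)) (- v))) (at x)"
      by (rule has_derivative_compose[where g=f, OF _ d]) (auto intro!: derivative_eq_intros)
    then show ?thesis using linear_neg[OF has_derivative_linear[OF d[of "a - x"]]] by simp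
  qed
  then show ?case by (rule times_differentiable_SucI) (use Suc in \<open>intro times_differentiable_mult times_differentiable_const, auto\<close>)
qed simp

lemma smooth_const: "smooth (\<lambda>x. c)"
  and smooth_inner: "smooth (\<lambda>x. x \<bullet> b)"
  and smooth_add: "smooth f \<Longrightarrow> smooth g \<Longrightarrow> smooth (\<lambda>x. f x + g x)"
  and smooth_mult: "smooth f \<Longrightarrow> smooth g \<Longrightarrow> smooth (\<lambda>x. f x * g x)"
  and smooth_sum: "(\<And>i. i \<in> I \<Longrightarrow> smooth (k i)) \<Longrightarrow> smooth (\<lambda>x. \<Sum>i\<in>I. k i x)"
  and smooth_compose: "smooth h \<Longrightarrow> smooth f \<Longrightarrow> smooth (\<lambda>x. h (f x))"
  and smooth_reflect: "smooth f \<Longrightarrow> smooth (\<lambda>x. f (a - x))"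
  for f g :: "'a::euclidean_space \<Rightarrow> real" and h :: "real \<Rightarrow> real"
  by (auto simp: smooth_iff_times_differentiable intro: times_differentiable_const times_differentiable_inner times_differentiable_add times_differentiable_mult times_differentiable_sum times_differentiable_compose times_differentiable_reflect)

lemma smooth_minus: "smooth f \<Longrightarrow> smooth (\<lambda>x. - f x)"
  using smooth_mult[OF smooth_const[of "-1"], of f] by simp

lemma smooth_diff: "smooth f \<Longrightarrow> smooth g \<Longrightarrow> smooth (\<lambda>x. f x - g x)"
  using smooth_add[OF _ smooth_minus, of f g] by simp

subsection \<open>A smooth bump\<close>

text \<open>The factor \<open>(1 / t) ^ k\<close> is carried along so that the family is closed
  under differentiation up to linear combinations; smoothness of all its members follows by one
  induction.\<close>

definition exp_flat :: "nat \<Rightarrow> real \<Rightarrow> real" where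
  "exp_flat k t = (if t > 0 then (1 / t) ^ k * exp (- (1 / t)) else 0)"

lemma exp_flat_tendsto_0: "(exp_flat k \<longlongrightarrow> 0) (at 0)"
proof -
  have "eventually (\<lambda>t. exp_flat k t = 0) (at_left 0)"
    using eventually_at_left_real[of "-1" "0::real"] by (auto elim!: eventually_mono simp: exp_flat_def)
  then have l: "(exp_flat k \<longlongrightarrow> 0) (at_left 0)" by (rule tendsto_eventually)
  have "((\<lambda>s::real. s ^ k / exp s) \<longlongrightarrow> 0) at_top" by (rule tendsto_power_div_exp_0)
  from filterlim_compose[OF this filterlim_inverse_at_top_right]
  have "((\<lambda>t::real. inverse t ^ k / exp (inverse t)) \<longlongrightarrow> 0) (at_right 0)" .
  moreover have "eventually (\<lambda>t. exp_flat k t = inverse t ^ k / exp (inverse t)) (at_right 0)"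
    using eventually_at_right_real[of "0::real" 1] by (auto elim!: eventually_mono simp: exp_flat_def exp_minus divide_simps)
  ultimately have "(exp_flat k \<longlongrightarrow> 0) (at_right 0)" by (simp cong: filterlim_cong)
  with l show ?thesis by (rule filterlim_split_at)
qed

lemma exp_flat_derivative:
  "(exp_flat k has_real_derivative exp_flat (k + 2) t + (- real k) * exp_flat (k + 1) t) (at t)"
proof -
  consider "t > 0" | "t < 0" | "t = 0" by linarith
  then show ?thesis
  proof cases
    case 1
    have "((\<lambda>t. (1 / t) ^ k * exp (- (1 / t))) has_real_derivative
       (1 / t) ^ (k + 2) * exp (- (1 / t)) + (- real k) * ((1 / t) ^ (k + 1) * exp (- (1 / t)))) (at t)"
    proof (cases k)
      case (Suc m)
      have "m = 0 \<or> t ^ m = t * t ^ (m - Suc 0)" by (cases m) auto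
      with Suc show ?thesis using 1 by (auto intro!: derivative_eq_intros simp: field_simps power2_eq_square)
    qed (use 1 in \<open>auto intro!: derivative_eq_intros simp: field_simps power2_eq_square\<close>)
    moreover have "eventually (\<lambda>t. (1 / t) ^ k * exp (- (1 / t)) = exp_flat k t) (nhds t)"
      using eventually_nhds_in_open[of "{0<..}" t] 1 by (auto elim!: eventually_mono simp: exp_flat_def)
    ultimately show ?thesis using 1 by (subst (asm) DERIV_cong_ev[OF refl _ refl]) (auto simp: exp_flat_def)
  next
    case 2
    have "eventually (\<lambda>t. 0 = exp_flat k t) (nhds t)"
      using eventually_nhds_in_open[of "{..<0}" t] 2 by (auto elim!: eventually_mono simp: exp_flat_def)
    moreover have "((\<lambda>t. 0) has_real_derivative 0) (at t)" by simp
    ultimately show ?thesis using 2 by (subst (asm) DERIV_cong_ev[OF refl _ refl]) (auto simp: exp_flat_def)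
  next
    case 3
    \<comment> \<open>The difference quotient at 0 of one member is the next member, which tends to
      0.\<close>
    have "exp_flat (Suc k) = (\<lambda>y. exp_flat k y / y)"
      by (simp add: exp_flat_def fun_eq_iff)
    then have "(\<lambda>y. exp_flat k y / y) \<midarrow>0\<rightarrow> 0" using exp_flat_tendsto_0[of "Suc k"] by simp
    then show ?thesis using 3 by (simp add: has_field_derivative_iff exp_flat_def[of _ 0])
  qed
qed

lemma smooth_exp_flat: "smooth (exp_flat k)"
proof -
  have "times_differentiable n (exp_flat k)" for n
  proof (induction n arbitrary: k)
    case (Suc n)
    note exp_flat_derivative[unfolded has_field_derivative_def]
    then show ?case by (rule times_differentiable_SucI) (use Suc in \<open>intro times_differentiable_mult times_differentiable_add times_differentiable_const, auto\<close>)
  qed simp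
  then show ?thesis by (simp add: smooth_iff_times_differentiable)
qed

subsection \<open>Test functions\<close>

lemma tsupport_outside: "x \<notin> tsupport f \<Longrightarrow> f x = 0"
  using closure_subset[of "{x. f x \<noteq> 0}"] by (auto simp: tsupport_def)

lemma tsupport_subset: "closed C \<Longrightarrow> (\<And>x. x \<notin> C \<Longrightarrow> f x = 0) \<Longrightarrow> tsupport f \<subseteq> C"
  unfolding tsupport_def by (rule closure_minimal) auto

lemma compact_tsupport: "compact C \<Longrightarrow> (\<And>x. x \<notin> C \<Longrightarrow> f x = 0) \<Longrightarrow> compact (tsupport f)"
  by (metis closed_closure compact_Int_closed compact_imp_closed inf.absorb_iff2 tsupport_def tsupport_subset)

lemma test_funI: "smooth f \<Longrightarrow> compact C \<Longrightarrow> C \<subseteq> U \<Longrightarrow> (\<And>x. x \<notin> C \<Longrightarrow> f x = 0) \<Longrightarrow> test_fun U f"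
  unfolding test_fun_def using compact_tsupport[of C f] tsupport_subset[of C f] compact_imp_closed[of C] by blast

lemma test_funE:
  assumes "test_fun U f"
  obtains C where "smooth f" "compact C" "C \<subseteq> U" "\<And>x. x \<notin> C \<Longrightarrow> f x = 0"
  using assms tsupport_outside[of _ f] unfolding test_fun_def by blast

lemma test_fun_smooth: "test_fun U f \<Longrightarrow> smooth f" by (simp add: test_fun_def)

lemma test_fun_outside: "test_fun U f \<Longrightarrow> x \<notin> U \<Longrightarrow> f x = 0"
  using tsupport_outside[of x f] by (auto simp: test_fun_def)

lemma test_fun_add: "test_fun U f \<Longrightarrow> test_fun U g \<Longrightarrow> test_fun U (\<lambda>x. f x + g x)"
  by (elim test_funE, rule_tac C="C \<union> Ca" in test_funI) (auto intro: smooth_add)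

lemma test_fun_cmult: "test_fun U f \<Longrightarrow> test_fun U (\<lambda>x. c * f x)"
  by (elim test_funE, rule_tac C="C" in test_funI) (auto intro: smooth_mult smooth_const)

lemma test_fun_diff: "test_fun U f \<Longrightarrow> test_fun U g \<Longrightarrow> test_fun U (\<lambda>x. f x - g x)"
  using test_fun_add[OF _ test_fun_cmult, of U f g "-1"] by simp

lemma test_fun_0: "test_fun U (\<lambda>x. 0)"
  by (rule test_funI[of _ "{}"]) (auto intro: smooth_const)

lemma derivative_zero_outside:
  assumes "closed C" "\<And>x. x \<notin> C \<Longrightarrow> f x = 0" "x \<notin> C"
  shows "(f has_derivative (\<lambda>v. 0)) (at x)"
proof -
  have "((\<lambda>x. 0) has_derivative (\<lambda>v. 0)) (at x)" by simp
  moreover have "open (- C)" "x \<in> - C" using assms by auto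
  ultimately show ?thesis by (rule has_derivative_transform_within_open) (use assms in auto)
qed

lemma test_fun_derivative:
  assumes "test_fun U f" shows "test_fun U (\<lambda>x. frechet_derivative f (at x) v)"
proof -
  obtain C where C: "smooth f" "compact C" "C \<subseteq> U" "\<And>x. x \<notin> C \<Longrightarrow> f x = 0" using assms by (rule test_funE) blast
  show ?thesis
  proof (rule test_funI[OF smooth_derivative C(2,3)])
    show "smooth f" by fact
    fix x assume "x \<notin> C"
    from derivative_zero_outside[of C f, OF compact_imp_closed[OF C(2)] C(4) this] 
    show "frechet_derivative f (at x) v = 0" by (simp add: frechet_derivative_at[symmetric])
  qed
qed

lemma test_fun_pd: "test_fun U f \<Longrightarrow> test_fun U (pd f b)"
  using test_fun_derivative[of U f b] by (simp add: pd_def[abs_def])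

lemma test_fun_bounded:
  assumes "test_fun U f" obtains B where "B \<ge> 0" "\<And>x. \<bar>f x\<bar> \<le> B"
proof -
  obtain C where C: "smooth f" "compact C" "\<And>x. x \<notin> C \<Longrightarrow> f x = 0" using assms by (rule test_funE) blast
  have "bounded (f ` C)" using C by (intro compact_imp_bounded compact_continuous_image smooth_continuous_on)
  then obtain B where "B > 0" "\<And>x. x \<in> C \<Longrightarrow> \<bar>f x\<bar> \<le> B" by (auto simp: bounded_pos)
  then show thesis using C(3) by (intro that[of B]) (auto, metis abs_zero less_imp_le)
qed

lemma linear_le_sum_Basis:
  fixes l :: "'a::euclidean_space \<Rightarrow> real"
  assumes "linear l" "\<And>b. b \<in> Basis \<Longrightarrow> \<bar>l b\<bar> \<le> M"
  shows "\<bar>l v\<bar> \<le> real DIM('a) * M * norm v"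
proof -
  have "l v = l (\<Sum>b\<in>Basis. (v \<bullet> b) *\<^sub>R b)" by (simp add: euclidean_representation)
  also have "\<dots> = (\<Sum>b\<in>Basis. (v \<bullet> b) * l b)" using assms(1) by (simp add: linear_sum linear_cmul)
  also have "\<bar>\<dots>\<bar> \<le> (\<Sum>b\<in>Basis. \<bar>(v \<bullet> b) * l b\<bar>)" by (rule sum_abs)
  also have "\<dots> \<le> (\<Sum>b\<in>(Basis::'a set). norm v * M)"
    using assms(2) by (intro sum_mono) (auto simp: abs_mult Basis_le_norm intro!: mult_mono)
  finally show ?thesis by (simp add: mult_ac)
qed

lemma test_fun_lipschitz:
  fixes f :: "'a::euclidean_space \<Rightarrow> real"
  assumes "test_fun U f" obtains L where "L-lipschitz_on UNIV f"
proof -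
  have "\<exists>B\<ge>0. \<forall>x. \<bar>frechet_derivative f (at x) b\<bar> \<le> B" for b :: 'a
    using test_fun_bounded[OF test_fun_derivative[OF assms, of b]] by metis
  then obtain B where B: "\<And>b. B b \<ge> 0" "\<And>x b. \<bar>frechet_derivative f (at x) b\<bar> \<le> B b" by metis
  define M where "M = (\<Sum>b\<in>(Basis::'a set). B b)"
  have M: "\<bar>frechet_derivative f (at x) b\<bar> \<le> M" if "b \<in> Basis" for x b
    using B(2)[of x b] member_le_sum[of b Basis B] that B(1) unfolding M_def by force
  have M0: "0 \<le> M" unfolding M_def by (intro sum_nonneg B)
  have "(real DIM('a) * M)-lipschitz_on UNIV f"
  proof (rule bounded_derivative_imp_lipschitz)
    show "(f has_derivative frechet_derivative f (at x)) (at x within UNIV)" for x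
      using smooth_has_derivative[OF test_fun_smooth[OF assms]] by simp
    show "onorm (frechet_derivative f (at x)) \<le> real DIM('a) * M" for x
      using linear_le_sum_Basis[OF has_derivative_linear[OF smooth_has_derivative[OF test_fun_smooth[OF assms]]] M]
      by (intro onorm_le) auto
  qed (use M0 in auto)
  then show thesis by (rule that)
qed

text \<open>Partial derivatives of a test function are again test functions, hence Lipschitz, so the
  derivative varies at most linearly along the segment from \<open>x\<close> to
  \<open>x + h\<close>. The uniform constant serves both differentiation under the convolution and
  the comparison of neighbourhoods of superlevel sets.\<close>

lemma test_fun_taylor:
  fixes f :: "'a::euclidean_space \<Rightarrow> real"
  assumes "test_fun U f" obtains C where "C \<ge> 0" "\<And>x h. \<bar>f (x + h) - f x - frechet_derivative f (at x) h\<bar> \<le> C * (norm h)\<^sup>2"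
proof -
  have "\<exists>L. L-lipschitz_on UNIV (\<lambda>x. frechet_derivative f (at x) b)" for b :: 'a
    using test_fun_lipschitz[OF test_fun_derivative[OF assms, of b]] by metis
  then obtain L where L: "\<And>b::'a. (L b)-lipschitz_on UNIV (\<lambda>x. frechet_derivative f (at x) b)" by metis
  have L0: "L b \<ge> 0" for b using L[of b] by (rule lipschitz_on_nonneg)
  define M where "M = (\<Sum>b\<in>(Basis::'a set). L b)"
  have M: "L b \<le> M" if "b \<in> Basis" for b
    using member_le_sum[of b Basis L] that L0 unfolding M_def by force
  have M0: "0 \<le> M" unfolding M_def by (intro sum_nonneg L0)
  note D = smooth_has_derivative[OF test_fun_smooth[OF assms]]
  have "\<bar>f (x + h) - f x - frechet_derivative f (at x) h\<bar> \<le> (real DIM('a) * M) * (norm h)\<^sup>2" for x h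
  proof -
    have "norm (f (x + h) - f x - frechet_derivative f (at x) (x + h - x)) \<le> norm (x + h - x) * (real DIM('a) * (M * norm h))"
    proof (rule differentiable_bound_linearization[where S="closed_segment x (x + h)"])
      show "(f has_derivative frechet_derivative f (at y)) (at y within closed_segment x (x + h))" for y
        using D by (rule has_derivative_at_withinI)
      show "x + t *\<^sub>R (x + h - x) \<in> closed_segment x (x + h)" if "t \<in> {0..1}" for t
        using that by (auto simp: in_segment algebra_simps intro!: exI[of _ t])
      fix y assume y: "y \<in> closed_segment x (x + h)"
      let ?l = "frechet_derivative f (at y) - frechet_derivative f (at x)"
      have "linear ?l" unfolding fun_diff_def by (intro linear_compose_sub has_derivative_linear[OF D])
      moreover have "\<bar>?l b\<bar> \<le> M * norm h" if "b \<in> Basis" for b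
      proof -
        have "\<bar>?l b\<bar> \<le> L b * dist y x" using lipschitz_onD[OF L, of y x b] by (simp add: dist_real_def)
        also have "\<dots> \<le> M * norm h"
        proof (rule mult_mono[OF M[OF that] _ M0])
          show "dist y x \<le> norm h" using segment_bound(1)[OF y] by (simp add: dist_norm)
        qed simp
        finally show ?thesis .
      qed
      ultimately have "\<bar>?l v\<bar> \<le> real DIM('a) * (M * norm h) * norm v" for v by (rule linear_le_sum_Basis)
      then show "onorm ?l \<le> real DIM('a) * (M * norm h)" by (intro onorm_le) auto
    qed auto
    then show ?thesis by (simp add: power2_eq_square mult_ac)
  qed
  then show thesis using M0 by (intro that[of "real DIM('a) * M"]) auto
qed

lemma test_fun_borel: "test_fun U f \<Longrightarrow> f \<in> borel_measurable borel"
  by (intro borel_measurable_continuous_onI smooth_continuous_on test_fun_smooth)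

lemma integrable_compact_support:
  fixes f :: "'a::euclidean_space \<Rightarrow> real"
  assumes "continuous_on UNIV f" "compact C" "\<And>x. x \<notin> C \<Longrightarrow> f x = 0"
  shows "integrable lebesgue f"
proof -
  have "set_integrable lborel C f"
    using borel_integrable_compact[OF assms(2) continuous_on_subset[OF assms(1)]] by (simp add: set_integrable_def indicator_scaleR_eq_if)
  moreover have "(\<lambda>x. indicator C x *\<^sub>R f x) = f"
  proof
    show "indicator C x *\<^sub>R f x = f x" for x using assms(3)[of x] by (cases "x \<in> C") auto
  qed
  ultimately have "integrable lborel f" by (simp add: set_integrable_def)
  then show ?thesis using assms(1) by (simp add: integrable_completion borel_measurable_continuous_onI)
qed

lemma test_fun_integrable:
  assumes "test_fun U f" shows "integrable lebesgue f"
  using assms by (rule test_funE) (rule integrable_compact_support, auto intro: smooth_continuous_on)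

lemma exists_mollifier:
  assumes "\<rho> > 0"
  obtains \<eta> :: "'a::euclidean_space \<Rightarrow> real" where "test_fun UNIV \<eta>" "\<And>x. \<eta> x \<ge> 0" "\<And>x. norm x \<ge> \<rho> \<Longrightarrow> \<eta> x = 0" "(\<integral>x. \<eta> x \<partial>lebesgue) = 1"
proof -
  define \<eta>0 :: "'a \<Rightarrow> real" where "\<eta>0 x = exp_flat 0 (\<rho>\<^sup>2 - x \<bullet> x)" for x
  have sm: "smooth \<eta>0"
  proof -
    have "smooth (\<lambda>x::'a. \<rho>\<^sup>2 - (\<Sum>b\<in>Basis. (x \<bullet> b) * (x \<bullet> b)))"
      by (intro smooth_diff smooth_const smooth_sum smooth_mult smooth_inner)
    then have "smooth (\<lambda>x::'a. \<rho>\<^sup>2 - x \<bullet> x)" by (simp add: euclidean_inner[symmetric])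
    then show ?thesis unfolding \<eta>0_def[abs_def] by (rule smooth_compose[OF smooth_exp_flat])
  qed
  have nn: "\<eta>0 x \<ge> 0" for x by (simp add: \<eta>0_def exp_flat_def)
  have z: "\<eta>0 x = 0" if "norm x \<ge> \<rho>" for x
  proof -
    have "\<rho>\<^sup>2 \<le> x \<bullet> x" using that assms power_mono[of \<rho> "norm x" 2] by (simp add: power2_norm_eq_inner)
    then show ?thesis by (simp add: \<eta>0_def exp_flat_def)
  qed
  have tf: "test_fun UNIV \<eta>0" by (rule test_funI[OF sm compact_cball[of 0 \<rho>]]) (auto intro: z)
  have int: "integrable lebesgue \<eta>0" using tf by (rule test_fun_integrable)
  define c where "c = (\<integral>x. \<eta>0 x \<partial>lebesgue)"
  have "c \<noteq> 0"
  proof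
    assume "c = 0"
    then have "AE x in lebesgue. \<eta>0 x = 0" using integral_nonneg_eq_0_iff_AE[OF int] nn by (simp add: c_def)
    then have "negligible {x. \<eta>0 x \<noteq> 0}"
      by (simp add: completion.AE_iff_null_sets negligible_iff_null_sets)
    moreover have "ball 0 \<rho> \<subseteq> {x. \<eta>0 x \<noteq> 0}"
    proof
      fix x :: 'a assume "x \<in> ball 0 \<rho>"
      then have "(norm x)\<^sup>2 < \<rho>\<^sup>2" by (intro power_strict_mono) auto
      then show "x \<in> {x. \<eta>0 x \<noteq> 0}" by (simp add: \<eta>0_def exp_flat_def power2_norm_eq_inner)
    qed
    ultimately have "negligible (ball (0::'a) \<rho>)" by (rule negligible_subset)
    then show False using assms open_not_negligible[of "ball (0::'a) \<rho>"] by auto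
  qed
  have "c \<ge> 0" unfolding c_def using nn by simp
  then show thesis using \<open>c \<noteq> 0\<close> z nn
    by (intro that[of "\<lambda>x. (1 / c) * \<eta>0 x"] test_fun_cmult tf) (auto simp: c_def)
qed

subsection \<open>Convolution with a test function\<close>

lemma lborel_reflect: "distr lborel borel (\<lambda>x. a - x) = (lborel :: 'a::euclidean_space measure)"
  using lborel_affine[of "-1" a] by (simp add: density_1)

lemma lborel_translate: "distr lborel borel (\<lambda>x. x + a) = (lborel :: 'a::euclidean_space measure)"
  using lborel_affine[of "1" a] by (simp add: density_1 add.commute)

lemma lebesgue_integral_reflect:
  fixes f :: "'a::euclidean_space \<Rightarrow> real"
  assumes [measurable]: "f \<in> borel_measurable borel"
  shows "(\<integral>x. f (a - x) \<partial>lebesgue) = (\<integral>x. f x \<partial>lebesgue)"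
proof -
  have "(\<integral>x. f (a - x) \<partial>lebesgue) = (\<integral>x. f (a - x) \<partial>lborel)" by (rule integral_completion) simp
  also have "\<dots> = (\<integral>x. f x \<partial>distr lborel borel (\<lambda>x. a - x))" by (rule integral_distr[symmetric]) simp_all
  also have "\<dots> = (\<integral>x. f x \<partial>lborel)" by (simp only: lborel_reflect)
  also have "\<dots> = (\<integral>x. f x \<partial>lebesgue)" by (rule integral_completion[symmetric]) simp
  finally show ?thesis .
qed

lemma lebesgue_integral_translate:
  fixes f :: "'a::euclidean_space \<Rightarrow> real"
  assumes [measurable]: "f \<in> borel_measurable borel"
  shows "(\<integral>x. f (x + a) \<partial>lebesgue) = (\<integral>x. f x \<partial>lebesgue)"
proof -
  have "(\<integral>x. f (x + a) \<partial>lebesgue) = (\<integral>x. f (x + a) \<partial>lborel)" by (rule integral_completion) simp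
  also have "\<dots> = (\<integral>x. f x \<partial>distr lborel borel (\<lambda>x. x + a))" by (rule integral_distr[symmetric]) simp_all
  also have "\<dots> = (\<integral>x. f x \<partial>lborel)" by (simp only: lborel_translate)
  also have "\<dots> = (\<integral>x. f x \<partial>lebesgue)" by (rule integral_completion[symmetric]) simp
  finally show ?thesis .
qed

lemma borel_imp_lebesgue: "f \<in> borel_measurable borel \<Longrightarrow> f \<in> borel_measurable lebesgue"
  by (rule measurable_completion) simp

lemma loc_integrableD: "loc_integrable g \<Longrightarrow> compact K \<Longrightarrow> integrable lebesgue (\<lambda>x. indicator K x * g x)"
  by (simp add: loc_integrable_def set_integrable_def)

lemma loc_integrable_integrable:
  assumes "integrable lebesgue g" shows "loc_integrable g"
  unfolding loc_integrable_def set_integrable_def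
proof (intro conjI allI impI)
  show "integrable lebesgue (\<lambda>x. indicator K x *\<^sub>R g x)" if "compact K" for K
    by (rule integrable_mult_indicator[OF fmeasurableD[OF lmeasurable_compact[OF that]] assms])
qed (use assms in auto)

lemma loc_integrable_continuous:
  fixes g :: "'a::euclidean_space \<Rightarrow> real"
  assumes "continuous_on UNIV g" shows "loc_integrable g"
  unfolding loc_integrable_def
proof (intro conjI allI impI)
  show g: "g \<in> borel_measurable lebesgue" using assms by (intro borel_imp_lebesgue borel_measurable_continuous_onI)
  fix K :: "'a set" assume "compact K"
  then have "integrable lborel (\<lambda>x. indicator K x *\<^sub>R g x)"
    using borel_integrable_compact[OF \<open>compact K\<close> continuous_on_subset[OF assms]] by simp
  moreover have "(\<lambda>x. indicator K x *\<^sub>R g x) \<in> borel_measurable borel"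
    using assms \<open>compact K\<close> by (intro borel_measurable_scaleR borel_measurable_indicator) (auto intro: borel_measurable_continuous_onI borel_compact)
  ultimately show "set_integrable lebesgue K g" by (simp add: set_integrable_def integrable_completion)
qed

lemma loc_integrable_bounded_mult:
  fixes g f :: "'a::euclidean_space \<Rightarrow> real"
  assumes g: "loc_integrable g" and f: "f \<in> borel_measurable lebesgue" and "compact K"
    and B: "\<And>x. \<bar>f x\<bar> \<le> B" and z: "\<And>x. x \<notin> K \<Longrightarrow> f x = 0"
  shows "integrable lebesgue (\<lambda>x. g x * f x)"
proof (rule Bochner_Integration.integrable_bound)
  show "integrable lebesgue (\<lambda>x. B * (indicator K x * g x))"
    by (intro integrable_mult_right loc_integrableD assms)
  show "(\<lambda>x. g x * f x) \<in> borel_measurable lebesgue" using g f by (auto simp: loc_integrable_def)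
  have "B \<ge> 0" using B[of 0] by (meson abs_ge_zero order_trans)
  show "AE x in lebesgue. norm (g x * f x) \<le> norm (B * (indicator K x * g x))"
  proof (rule AE_I2)
    fix x show "norm (g x * f x) \<le> norm (B * (indicator K x * g x))"
      using B[of x] z[of x] \<open>B \<ge> 0\<close> by (cases "x \<in> K") (auto simp: abs_mult mult.commute intro: mult_right_mono)
  qed
qed

text \<open>The variable sits in the kernel, so every derivative falls on the test function and
  \<open>g\<close> need only be locally integrable.\<close>

definition conv :: "('a::euclidean_space \<Rightarrow> real) \<Rightarrow> ('a \<Rightarrow> real) \<Rightarrow> 'a \<Rightarrow> real" where
  "conv g \<eta> x = (\<integral>y. g y * \<eta> (x - y) \<partial>lebesgue)"

lemma test_fun_reflect: "test_fun UNIV f \<Longrightarrow> test_fun UNIV (\<lambda>x. f (a - x))"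
proof (elim test_funE)
  fix C assume C: "smooth f" "compact C" "\<And>x. x \<notin> C \<Longrightarrow> f x = 0"
  have "compact ((\<lambda>x. a - x) ` C)" by (intro compact_continuous_image C continuous_intros)
  then show ?thesis
    by (rule test_funI[OF smooth_reflect[OF C(1)]]) (use C(3) in \<open>auto, metis diff_diff_eq2 add_diff_cancel_left' image_eqI\<close>)
qed

lemma conv_integrable:
  assumes "loc_integrable g" "test_fun UNIV \<eta>"
  shows "integrable lebesgue (\<lambda>y. g y * \<eta> (x - y))"
proof -
  have t: "test_fun UNIV (\<lambda>y. \<eta> (x - y))" using assms by (intro test_fun_reflect)
  obtain B where B: "\<And>y. \<bar>\<eta> (x - y)\<bar> \<le> B" using test_fun_bounded[OF t] by blast
  obtain C where "compact C" "\<And>y. y \<notin> C \<Longrightarrow> \<eta> (x - y) = 0" using t by (rule test_funE) blast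
  then show ?thesis by (intro loc_integrable_bounded_mult[OF assms(1) borel_imp_lebesgue[OF test_fun_borel[OF t]] _ B])
qed

lemma test_fun_cball:
  assumes "test_fun U f" obtains R where "R > 0" "\<And>x. norm x > R \<Longrightarrow> f x = 0"
proof -
  obtain C where C: "compact C" "\<And>y. y \<notin> C \<Longrightarrow> f y = 0" using assms by (rule test_funE) blast
  obtain R where "R > 0" "\<And>x. x \<in> C \<Longrightarrow> norm x \<le> R" using compact_imp_bounded[OF C(1)] by (auto simp: bounded_pos)
  then show thesis using C(2) by (intro that[of R]) (auto, meson not_le)
qed

text \<open>The remainder is the convolution of \<open>g\<close> with a Taylor remainder of the
  kernel, which is uniformly of order two in the increment.\<close>

lemma conv_has_derivative:
  fixes g \<eta> :: "'a::euclidean_space \<Rightarrow> real"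
  assumes g: "loc_integrable g" and \<eta>: "test_fun UNIV \<eta>"
  shows "(conv g \<eta> has_derivative (\<lambda>h. conv g (\<lambda>z. frechet_derivative \<eta> (at z) h) x)) (at x)"
proof -
  obtain C where C: "C \<ge> 0" "\<And>x h. \<bar>\<eta> (x + h) - \<eta> x - frechet_derivative \<eta> (at x) h\<bar> \<le> C * (norm h)\<^sup>2"
    using test_fun_taylor[OF \<eta>] by blast
  obtain R where R: "R > 0" "\<And>x. norm x > R \<Longrightarrow> \<eta> x = 0" using test_fun_cball[OF \<eta>] by blast
  note D = smooth_has_derivative[OF test_fun_smooth[OF \<eta>]]
  let ?D = "\<lambda>h z. frechet_derivative \<eta> (at z) h"
  have DR: "?D h z = 0" if "norm z > R" for h z
  proof -
    have "(\<eta> has_derivative (\<lambda>v. 0)) (at z)"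
      by (rule derivative_zero_outside[of "cball 0 R"]) (use R that in auto)
    then show ?thesis by (simp add: frechet_derivative_at[symmetric])
  qed
  note int = conv_integrable[OF g \<eta>] conv_integrable[OF g test_fun_derivative[OF \<eta>]]
  \<comment> \<open>For increments of norm below 1 all three kernel terms vanish outside this ball,
    since \<open>\<eta>\<close> and its derivative vanish beyond radius \<open>R\<close>.\<close>
  define G where "G = (\<integral>y. \<bar>indicator (cball x (R + 1)) y * g y\<bar> \<partial>lebesgue)"
  have Gint: "integrable lebesgue (\<lambda>y. \<bar>indicator (cball x (R + 1)) y * g y\<bar>)"
    by (intro integrable_abs loc_integrableD g compact_cball)
  show ?thesis
  proof (rule has_derivativeI_sandwich[where e=1 and H="\<lambda>y. C * G * norm (y - x)"])
    have "linear (\<lambda>h. conv g (?D h) x)"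
    proof (rule linearI)
      fix h k :: 'a and c :: real
      have "conv g (?D (h + k)) x = (\<integral>y. g y * ?D h (x - y) + g y * ?D k (x - y) \<partial>lebesgue)"
        unfolding conv_def by (simp add: linear_add[OF has_derivative_linear[OF D]] distrib_left)
      then show "conv g (?D (h + k)) x = conv g (?D h) x + conv g (?D k) x"
        unfolding conv_def using int(2) by (simp add: Bochner_Integration.integral_add)
      show "conv g (?D (c *\<^sub>R h)) x = c *\<^sub>R conv g (?D h) x"
        unfolding conv_def by (simp add: linear_cmul[OF has_derivative_linear[OF D]] mult.left_commute)
    qed
    then show "bounded_linear (\<lambda>h. conv g (?D h) x)" by (simp add: linear_conv_bounded_linear)
    have "((\<lambda>y. C * G * norm (y - x)) \<longlongrightarrow> C * G * norm (x - x)) (at x)" by (intro tendsto_intros)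
    then show "((\<lambda>y. C * G * norm (y - x)) \<longlongrightarrow> 0) (at x)" by simp
    fix z assume z: "z \<noteq> x" "dist z x < 1"
    define h where "h = z - x"
    have zx: "z = x + h" "norm h < 1" "norm h > 0" using z by (auto simp: h_def dist_norm)
    have "conv g \<eta> z - conv g \<eta> x - conv g (?D h) x
       = (\<integral>y. g y * (\<eta> (z - y) - \<eta> (x - y) - ?D h (x - y)) \<partial>lebesgue)"
      unfolding conv_def using int by (simp add: right_diff_distrib)
    also have "\<bar>\<dots>\<bar> \<le> (\<integral>y. \<bar>g y * (\<eta> (z - y) - \<eta> (x - y) - ?D h (x - y))\<bar> \<partial>lebesgue)"
      by (rule integral_abs_bound)
    also have "\<dots> \<le> (\<integral>y. C * (norm h)\<^sup>2 * \<bar>indicator (cball x (R + 1)) y * g y\<bar> \<partial>lebesgue)"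
    proof (rule integral_mono)
      show "integrable lebesgue (\<lambda>y. \<bar>g y * (\<eta> (z - y) - \<eta> (x - y) - ?D h (x - y))\<bar>)"
        using int by (simp add: right_diff_distrib)
      show "integrable lebesgue (\<lambda>y. C * (norm h)\<^sup>2 * \<bar>indicator (cball x (R + 1)) y * g y\<bar>)"
        using Gint by simp
      fix y
      show "\<bar>g y * (\<eta> (z - y) - \<eta> (x - y) - ?D h (x - y))\<bar> \<le> C * (norm h)\<^sup>2 * \<bar>indicator (cball x (R + 1)) y * g y\<bar>"
      proof (cases "y \<in> cball x (R + 1)")
        case True
        have "\<bar>\<eta> (z - y) - \<eta> (x - y) - ?D h (x - y)\<bar> \<le> C * (norm h)\<^sup>2"
          using C(2)[of "x - y" h] by (simp add: zx(1) algebra_simps)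
        then have "\<bar>g y\<bar> * \<bar>\<eta> (z - y) - \<eta> (x - y) - ?D h (x - y)\<bar> \<le> \<bar>g y\<bar> * (C * (norm h)\<^sup>2)"
          by (rule mult_left_mono) simp
        then show ?thesis using True by (simp add: abs_mult mult.commute)
      next
        case False
        then have f: "norm (x - y) > R + 1" by (simp add: dist_norm)
        have "norm (x - y) \<le> norm (z - y) + norm h" using norm_triangle_ineq4[of "z - y" h] by (simp add: zx(1))
        then have "norm (z - y) > R" using f zx(2) by linarith
        then show ?thesis using f R DR C(1) by simp
      qed
    qed
    also have "\<dots> = C * G * norm h * norm h" by (simp add: G_def power2_eq_square)
    finally show "norm (conv g \<eta> z - conv g \<eta> x - conv g (?D (z - x)) x) / norm (z - x) \<le> C * G * norm (z - x)"
      using zx by (simp add: h_def[symmetric] divide_le_eq)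
  qed simp
qed

lemma frechet_derivative_conv:
  "loc_integrable g \<Longrightarrow> test_fun UNIV \<eta> \<Longrightarrow> frechet_derivative (conv g \<eta>) (at x) h = conv g (\<lambda>z. frechet_derivative \<eta> (at z) h) x"
  by (simp only: frechet_derivative_at[OF conv_has_derivative, symmetric])

text \<open>Each iterated derivative of the convolution is the convolution with the iterated
  derivative of the kernel, which is again a test function.\<close>

lemma smooth_conv:
  assumes g: "loc_integrable g" and \<eta>: "test_fun UNIV \<eta>"
  shows "smooth (conv g \<eta>)"
proof -
  have "iter_dd vs (conv g \<eta>) = conv g (iter_dd vs \<eta>) \<and> test_fun UNIV (iter_dd vs \<eta>)" for vs
  proof (induction vs)
    case (Cons v vs)
    then have "iter_dd vs (conv g \<eta>) = conv g (iter_dd vs \<eta>)" by blast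
    with Cons show ?case
      using frechet_derivative_conv[OF g, of "iter_dd vs \<eta>"] test_fun_derivative[of UNIV "iter_dd vs \<eta>" v] by simp
  qed (simp add: \<eta>)
  then show ?thesis unfolding smooth_def differentiable_def using conv_has_derivative[OF g] by metis
qed

lemma conv_eq_0: "(\<And>y. norm (x - y) < \<rho> \<Longrightarrow> g y = 0) \<Longrightarrow> (\<And>x. norm x \<ge> \<rho> \<Longrightarrow> \<eta> x = 0) \<Longrightarrow> conv g \<eta> x = 0"
proof -
  assume a: "\<And>y. norm (x - y) < \<rho> \<Longrightarrow> g y = 0" "\<And>x. norm x \<ge> \<rho> \<Longrightarrow> \<eta> x = 0"
  have "(\<lambda>y. g y * \<eta> (x - y)) = (\<lambda>y. 0)" using a by (auto simp: fun_eq_iff) (meson not_le)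
  then show ?thesis by (simp add: conv_def)
qed

definition mollifier :: "real \<Rightarrow> ('a::euclidean_space \<Rightarrow> real) \<Rightarrow> bool" where
  "mollifier \<rho> \<eta> \<longleftrightarrow> test_fun UNIV \<eta> \<and> (\<forall>x. \<eta> x \<ge> 0) \<and> (\<forall>x. norm x \<ge> \<rho> \<longrightarrow> \<eta> x = 0) \<and> (\<integral>x. \<eta> x \<partial>lebesgue) = 1"

lemma mollifier_exists: "\<rho> > 0 \<Longrightarrow> \<exists>\<eta>. mollifier \<rho> \<eta>"
  unfolding mollifier_def by (erule exists_mollifier) blast

lemma mollifierD:
  assumes "mollifier \<rho> \<eta>"
  shows "test_fun UNIV \<eta>" "\<eta> x \<ge> 0" "norm x \<ge> \<rho> \<Longrightarrow> \<eta> x = 0" "(\<integral>y. \<eta> (x - y) \<partial>lebesgue) = 1"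
    "integrable lebesgue (\<lambda>y. \<eta> (x - y))"
proof -
  show "test_fun UNIV \<eta>" "\<eta> x \<ge> 0" "norm x \<ge> \<rho> \<Longrightarrow> \<eta> x = 0" using assms by (auto simp: mollifier_def)
  then show "(\<integral>y. \<eta> (x - y) \<partial>lebesgue) = 1" "integrable lebesgue (\<lambda>y. \<eta> (x - y))"
    using assms by (auto simp: mollifier_def lebesgue_integral_reflect test_fun_borel intro!: test_fun_integrable test_fun_reflect)
qed

lemma conv_mono_at:
  assumes g: "loc_integrable g" "loc_integrable f" and m: "mollifier \<rho> \<eta>" and le: "\<And>y. norm (x - y) < \<rho> \<Longrightarrow> g y \<le> f y"
  shows "conv g \<eta> x \<le> conv f \<eta> x"
  unfolding conv_def
proof (rule integral_mono)
  fix y show "g y * \<eta> (x - y) \<le> f y * \<eta> (x - y)"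
    using le[of y] mollifierD(2,3)[OF m, of "x - y"] by (cases "norm (x - y) < \<rho>") (auto intro: mult_right_mono)
qed (intro conv_integrable mollifierD(1)[OF m] g)+

lemma conv_const:
  assumes "mollifier \<rho> \<eta>" shows "conv (\<lambda>y. c) \<eta> x = c"
  using mollifierD(4)[OF assms, of x] by (simp add: conv_def)

lemma conv_le:
  assumes "loc_integrable g" "mollifier \<rho> \<eta>" "\<And>y. norm (x - y) < \<rho> \<Longrightarrow> g y \<le> c"
  shows "conv g \<eta> x \<le> c"
proof -
  have "conv g \<eta> x \<le> conv (\<lambda>y. c) \<eta> x"
    by (rule conv_mono_at[OF assms(1) loc_integrable_continuous[OF continuous_on_const] assms(2)]) (rule assms(3))
  then show ?thesis by (simp only: conv_const[OF assms(2)])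
qed

lemma conv_ge:
  assumes "loc_integrable g" "mollifier \<rho> \<eta>" "\<And>y. norm (x - y) < \<rho> \<Longrightarrow> c \<le> g y"
  shows "c \<le> conv g \<eta> x"
proof -
  have "loc_integrable (\<lambda>y. c)" by (intro loc_integrable_continuous continuous_on_const)
  then have "conv (\<lambda>y. c) \<eta> x \<le> conv g \<eta> x"
  proof (rule conv_mono_at)
    show "c \<le> g y" if "norm (x - y) < \<rho>" for y using assms(3) that .
  qed (use assms(1,2) in simp_all)
  then show ?thesis by (simp only: conv_const[OF assms(2)])
qed

lemma conv_shift:
  assumes [measurable]: "g \<in> borel_measurable borel" "\<eta> \<in> borel_measurable borel"
  shows "conv g \<eta> x = (\<integral>z. g (x - z) * \<eta> z \<partial>lebesgue)"
  unfolding conv_def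
  using lebesgue_integral_reflect[of "\<lambda>y. g y * \<eta> (x - y)" x] by simp

text \<open>After the substitution \<open>conv_shift\<close> the convolution is an average, with
  nonnegative weights, of translates of a convex function. \<open>conv_lipschitz\<close> rests on
  the same picture.\<close>

lemma conv_convex:
  assumes g: "continuous_on UNIV g" "convex_on UNIV g" and m: "mollifier \<rho> \<eta>"
  shows "convex_on UNIV (conv g \<eta>)"
proof (rule convex_onI)
  fix t :: real and x y :: 'a assume t: "0 < t" "t < 1"
  note \<eta> = mollifierD(1)[OF m] and B = borel_measurable_continuous_onI[OF g(1)] 
  have int: "integrable lebesgue (\<lambda>z. g (a - z) * \<eta> z)" for a
  proof -
    have "continuous_on UNIV (\<lambda>z. g (a - z))" using g(1) by (intro continuous_on_compose2[OF g(1)] continuous_intros) auto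
    then show ?thesis using conv_integrable[OF loc_integrable_continuous test_fun_reflect[OF \<eta>, of 0], of _ 0] by simp
  qed
  have "conv g \<eta> ((1 - t) *\<^sub>R x + t *\<^sub>R y) \<le> (\<integral>z. (1 - t) * (g (x - z) * \<eta> z) + t * (g (y - z) * \<eta> z) \<partial>lebesgue)"
    unfolding conv_shift[OF B test_fun_borel[OF \<eta>]]
  proof (rule integral_mono[OF int])
    fix z
    have "((1 - t) *\<^sub>R x + t *\<^sub>R y) - z = (1 - t) *\<^sub>R (x - z) + t *\<^sub>R (y - z)" by (simp add: algebra_simps)
    then have "g (((1 - t) *\<^sub>R x + t *\<^sub>R y) - z) \<le> (1 - t) * g (x - z) + t * g (y - z)"
      using convex_onD[OF g(2), of t "x - z" "y - z"] t by simp
    then have "g (((1 - t) *\<^sub>R x + t *\<^sub>R y) - z) * \<eta> z \<le> ((1 - t) * g (x - z) + t * g (y - z)) * \<eta> z"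
      using mollifierD(2)[OF m] by (rule mult_right_mono)
    then show "g (((1 - t) *\<^sub>R x + t *\<^sub>R y) - z) * \<eta> z \<le> (1 - t) * (g (x - z) * \<eta> z) + t * (g (y - z) * \<eta> z)"
      by (simp add: algebra_simps)
  qed (use int in simp)
  also have "\<dots> = (1 - t) * conv g \<eta> x + t * conv g \<eta> y"
    unfolding conv_shift[OF B test_fun_borel[OF \<eta>]] using int by simp
  finally show "conv g \<eta> ((1 - t) *\<^sub>R x + t *\<^sub>R y) \<le> (1 - t) * conv g \<eta> x + t * conv g \<eta> y" .
qed simp

lemma conv_lipschitz:
  assumes g: "L-lipschitz_on UNIV g" and m: "mollifier \<rho> \<eta>"
  shows "L-lipschitz_on UNIV (conv g \<eta>)"
proof (rule lipschitz_onI)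
  have c: "continuous_on UNIV g" using g by (rule lipschitz_on_continuous_on)
  note \<eta> = mollifierD(1)[OF m] and B = borel_measurable_continuous_onI[OF c]
  have int: "integrable lebesgue (\<lambda>z. g (a - z) * \<eta> z)" for a
  proof -
    have "continuous_on UNIV (\<lambda>z. g (a - z))" by (intro continuous_on_compose2[OF c] continuous_intros) auto
    then show ?thesis using conv_integrable[OF loc_integrable_continuous test_fun_reflect[OF \<eta>, of 0], of _ 0] by simp
  qed
  show "0 \<le> L" using g by (rule lipschitz_on_nonneg)
  fix x y
  have "conv g \<eta> x - conv g \<eta> y = (\<integral>z. (g (x - z) - g (y - z)) * \<eta> z \<partial>lebesgue)"
    unfolding conv_shift[OF B test_fun_borel[OF \<eta>]] using int by (simp add: left_diff_distrib)
  also have "\<bar>\<dots>\<bar> \<le> (\<integral>z. \<bar>(g (x - z) - g (y - z)) * \<eta> z\<bar> \<partial>lebesgue)" by (rule integral_abs_bound)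
  also have "\<dots> \<le> (\<integral>z. L * dist x y * \<eta> z \<partial>lebesgue)"
  proof (rule integral_mono)
    fix z
    have "\<bar>g (x - z) - g (y - z)\<bar> \<le> L * dist (x - z) (y - z)" using lipschitz_onD[OF g, of "x - z" "y - z"] by (simp add: dist_real_def)
    also have "dist (x - z) (y - z) = dist x y" by (simp add: dist_norm)
    finally show "\<bar>(g (x - z) - g (y - z)) * \<eta> z\<bar> \<le> L * dist x y * \<eta> z"
      using mollifierD(2)[OF m, of z] by (auto simp: abs_mult intro: mult_right_mono)
  qed (use int test_fun_integrable[OF \<eta>] in \<open>auto simp: left_diff_distrib\<close>)
  also have "\<dots> = L * dist x y" using m by (simp add: mollifier_def)
  finally show "dist (conv g \<eta> x) (conv g \<eta> y) \<le> L * dist x y" by (simp add: dist_real_def)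
qed

subsection \<open>Gradients\<close>

lemma grad_inner_Basis: "b \<in> Basis \<Longrightarrow> grad f x \<bullet> b = pd f b x"
  by (simp add: grad_def)

lemma grad_eqI:
  assumes "(f has_derivative (\<lambda>h. g \<bullet> h)) (at x)" shows "grad f x = g"
  by (rule euclidean_eqI) (simp add: grad_inner_Basis pd_def frechet_derivative_at[OF assms, symmetric])

lemma has_derivative_grad:
  assumes "f differentiable (at x)"
  shows "(f has_derivative (\<lambda>h. grad f x \<bullet> h)) (at x)"
proof -
  have d: "(f has_derivative frechet_derivative f (at x)) (at x)" using assms frechet_derivative_works by blast
  have "frechet_derivative f (at x) h = grad f x \<bullet> h" for h
  proof -
    have "frechet_derivative f (at x) h = frechet_derivative f (at x) (\<Sum>b\<in>Basis. (h \<bullet> b) *\<^sub>R b)" by (simp add: euclidean_representation)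
    also have "\<dots> = (\<Sum>b\<in>Basis. (h \<bullet> b) * pd f b x)"
      using has_derivative_linear[OF d] by (simp add: linear_sum linear_cmul pd_def)
    also have "\<dots> = grad f x \<bullet> h" by (simp add: grad_def inner_sum_left inner_commute[of h] mult.commute)
    finally show ?thesis .
  qed
  then show ?thesis using d by (metis (no_types, lifting) ext)
qed

lemma smooth_has_derivative_grad: "smooth f \<Longrightarrow> (f has_derivative (\<lambda>h. grad f x \<bullet> h)) (at x)"
  by (simp add: has_derivative_grad smooth_differentiable)

lemma grad_continuous: "smooth f \<Longrightarrow> continuous_on S (grad f)"
  unfolding grad_def[abs_def] by (intro continuous_intros smooth_continuous_on smooth_pd)

lemma grad_borel: "smooth f \<Longrightarrow> grad f \<in> borel_measurable borel"
  by (simp add: borel_measurable_continuous_onI grad_continuous)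

lemma grad_lebesgue: "smooth f \<Longrightarrow> grad f \<in> borel_measurable lebesgue"
  by (intro borel_imp_lebesgue grad_borel)

lemma norm_sq_Basis: "(norm (v::'a::euclidean_space))\<^sup>2 = (\<Sum>b\<in>Basis. (v \<bullet> b)\<^sup>2)"
  unfolding power2_norm_eq_inner euclidean_inner[of v v] by (simp add: power2_eq_square)

lemma test_fun_grad_outside:
  "test_fun U f \<Longrightarrow> x \<notin> U \<Longrightarrow> grad f x = 0"
  by (simp add: grad_def test_fun_outside[OF test_fun_pd])

lemma test_fun_grad_sq_integrable:
  assumes "test_fun U f" shows "integrable lebesgue (\<lambda>x. (norm (grad f x))\<^sup>2)"
proof -
  obtain C where C: "compact C" "C \<subseteq> U" "\<And>y. y \<notin> C \<Longrightarrow> f y = 0" "smooth f" using assms by (rule test_funE) blast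
  then have t: "test_fun C f" by (intro test_funI) auto
  show ?thesis
    by (rule integrable_compact_support[OF _ C(1)])
       (use test_fun_grad_outside[OF t] in \<open>auto intro!: continuous_intros grad_continuous C\<close>)
qed

subsection \<open>Mollification of weak gradients\<close>

lemma weak_grad_loc_integrable:
  fixes u :: "'a::euclidean_space \<Rightarrow> real"
  assumes "weak_grad_L2 u g" shows "loc_integrable (\<lambda>x. g x \<bullet> b)" "loc_integrable (\<lambda>x. (norm (g x))\<^sup>2)"
proof -
  have m: "g \<in> borel_measurable lebesgue" and i: "integrable lebesgue (\<lambda>x. (norm (g x))\<^sup>2)" using assms by (auto simp: weak_grad_L2_def)
  have K: "K \<in> lmeasurable" if "compact K" for K :: "'a set" using that by (rule lmeasurable_compact)
  show *: "loc_integrable (\<lambda>x. (norm (g x))\<^sup>2)"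
    using i by (rule loc_integrable_integrable)
  show "loc_integrable (\<lambda>x. g x \<bullet> b)"
    unfolding loc_integrable_def
  proof (intro conjI allI impI)
    show mb: "(\<lambda>x. g x \<bullet> b) \<in> borel_measurable lebesgue" using m by simp
    fix K :: "'a set" assume "compact K"
    show "set_integrable lebesgue K (\<lambda>x. g x \<bullet> b)"
      unfolding set_integrable_def
    proof (rule Bochner_Integration.integrable_bound)
      show "integrable lebesgue (\<lambda>x. indicator K x * (norm (g x))\<^sup>2 + (norm b)\<^sup>2 * indicator K x)"
        using loc_integrableD[OF * \<open>compact K\<close>] K[OF \<open>compact K\<close>]
        by (intro Bochner_Integration.integrable_add integrable_mult_right) (auto simp: fmeasurable_def intro: integrable_real_indicator)
      show "(\<lambda>x. indicator K x *\<^sub>R (g x \<bullet> b)) \<in> borel_measurable lebesgue"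
        using mb K[OF \<open>compact K\<close>] by (intro borel_measurable_scaleR borel_measurable_indicator fmeasurableD)
      have "\<bar>g x \<bullet> b\<bar> \<le> (norm (g x))\<^sup>2 + (norm b)\<^sup>2" for x
        using Cauchy_Schwarz_ineq2[of "g x" b] sum_squares_bound[of "norm (g x)" "norm b"] mult_nonneg_nonneg[of "norm (g x)" "norm b"] by simp
      then show "AE x in lebesgue. norm (indicator K x *\<^sub>R (g x \<bullet> b)) \<le> norm (indicator K x * (norm (g x))\<^sup>2 + (norm b)\<^sup>2 * indicator K x)"
        by (intro AE_I2) (auto simp: indicator_def)
    qed
  qed
qed

text \<open>The reflected kernel is an admissible test function; the sign from the reflection
  cancels the sign in the definition of the weak gradient.\<close>

lemma pd_conv_weak_grad:
  assumes w: "weak_grad_L2 u g" and \<eta>: "test_fun UNIV \<eta>" and b: "b \<in> Basis"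
  shows "pd (conv u \<eta>) b x = conv (\<lambda>y. g y \<bullet> b) \<eta> x"
proof -
  have u: "loc_integrable u" using w by (simp add: weak_grad_L2_def)
  have "pd (\<lambda>y. \<eta> (x - y)) b y = - frechet_derivative \<eta> (at (x - y)) b" for y
  proof -
    have "((\<lambda>y. \<eta> (x - y)) has_derivative (\<lambda>v. frechet_derivative \<eta> (at (x - y)) (- v))) (at y)"
      by (rule has_derivative_compose[where g=\<eta>, OF _ smooth_has_derivative[OF test_fun_smooth[OF \<eta>]]]) (auto intro!: derivative_eq_intros)
    then have "pd (\<lambda>y. \<eta> (x - y)) b y = frechet_derivative \<eta> (at (x - y)) (- b)"
      by (simp add: pd_def frechet_derivative_at[symmetric])
    then show ?thesis
      using linear_neg[OF has_derivative_linear[OF smooth_has_derivative[OF test_fun_smooth[OF \<eta>]]]] by simp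
  qed
  then have "pd (conv u \<eta>) b x = - (\<integral>y. u y * pd (\<lambda>y. \<eta> (x - y)) b y \<partial>lebesgue)"
    by (simp add: pd_def[of "conv u \<eta>"] frechet_derivative_conv[OF u \<eta>] conv_def)
  also have "\<dots> = (\<integral>y. (g y \<bullet> b) * \<eta> (x - y) \<partial>lebesgue)"
    using w test_fun_reflect[OF \<eta>, of x] b unfolding weak_grad_L2_def by simp
  finally show ?thesis by (simp add: conv_def)
qed

text \<open>Jensen's inequality for the probability density \<open>\<eta> (x - y)\<close>, obtained
  from nonnegativity of the variance.\<close>

lemma conv_square_le:
  assumes f: "loc_integrable f" "loc_integrable (\<lambda>y. (f y)\<^sup>2)" and m: "mollifier \<rho> \<eta>"
  shows "(conv f \<eta> x)\<^sup>2 \<le> conv (\<lambda>y. (f y)\<^sup>2) \<eta> x"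
proof -
  let ?c = "conv f \<eta> x"
  note \<eta> = mollifierD(1)[OF m]
  have "0 \<le> (\<integral>y. (f y - ?c)\<^sup>2 * \<eta> (x - y) \<partial>lebesgue)" by (intro integral_nonneg_AE) (simp add: mollifierD(2)[OF m])
  also have "\<dots> = (\<integral>y. (f y)\<^sup>2 * \<eta> (x - y) - 2 * ?c * (f y * \<eta> (x - y)) + ?c\<^sup>2 * \<eta> (x - y) \<partial>lebesgue)"
    by (rule Bochner_Integration.integral_cong) (auto simp: power2_eq_square algebra_simps)
  also have "\<dots> = (\<integral>y. (f y)\<^sup>2 * \<eta> (x - y) - 2 * ?c * (f y * \<eta> (x - y)) \<partial>lebesgue) + (\<integral>y. ?c\<^sup>2 * \<eta> (x - y) \<partial>lebesgue)"
    using conv_integrable[OF f(1) \<eta>] conv_integrable[OF f(2) \<eta>] mollifierD(5)[OF m]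
    by (intro Bochner_Integration.integral_add) auto
  also have "\<dots> = conv (\<lambda>y. (f y)\<^sup>2) \<eta> x - 2 * ?c * ?c + ?c\<^sup>2"
    using conv_integrable[OF f(1) \<eta>] conv_integrable[OF f(2) \<eta>] mollifierD(4)[OF m, of x]
    by (subst Bochner_Integration.integral_diff) (auto simp: conv_def)
  finally show ?thesis by (simp add: power2_eq_square)
qed

text \<open>Tonelli together with the unit mass of the kernel: mollification preserves the integral
  of a nonnegative function.\<close>

lemma nn_integral_conv:
  fixes G :: "'a::euclidean_space \<Rightarrow> real"
  assumes G: "integrable lebesgue G" "\<And>x. G x \<ge> 0" and m: "mollifier \<rho> \<eta>"
  shows "(\<integral>\<^sup>+x. ennreal (conv G \<eta> x) \<partial>lborel) = ennreal (\<integral>x. G x \<partial>lebesgue)"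
proof -
  note \<eta> = mollifierD(1)[OF m] and [measurable] = test_fun_borel[OF mollifierD(1)[OF m]]
  have Gl: "loc_integrable G"
    using G(1) by (rule loc_integrable_integrable)
  \<comment> \<open>Tonelli is applied on \<open>lborel\<close>, so the Lebesgue measurable
    \<open>G\<close> is replaced by a Borel function that agrees with it almost everywhere.\<close>
  obtain G' where G'[measurable]: "G' \<in> borel_measurable lborel" and ae: "AE x in lborel. G x = G' x"
    using completion_ex_borel_measurable_real[of G lborel] G(1) by (auto dest: borel_measurable_integrable)
  have "ennreal (conv G \<eta> x) = (\<integral>\<^sup>+y. ennreal (G' y) * ennreal (\<eta> (x - y)) \<partial>lborel)" for x
  proof -
    have "ennreal (conv G \<eta> x) = (\<integral>\<^sup>+y. ennreal (G y * \<eta> (x - y)) \<partial>lebesgue)"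
      unfolding conv_def using G(2) mollifierD(2)[OF m] by (intro nn_integral_eq_integral[symmetric] conv_integrable Gl \<eta>) auto
    also have "\<dots> = (\<integral>\<^sup>+y. ennreal (G y * \<eta> (x - y)) \<partial>lborel)" by (rule nn_integral_completion)
    also have "\<dots> = (\<integral>\<^sup>+y. ennreal (G' y) * ennreal (\<eta> (x - y)) \<partial>lborel)"
      using ae by (intro nn_integral_cong_AE) (auto elim!: eventually_mono simp: ennreal_mult'' mollifierD(2)[OF m])
    finally show ?thesis .
  qed
  then have "(\<integral>\<^sup>+x. ennreal (conv G \<eta> x) \<partial>lborel) = (\<integral>\<^sup>+x. (\<integral>\<^sup>+y. ennreal (G' y) * ennreal (\<eta> (x - y)) \<partial>lborel) \<partial>lborel)" by simp
  also have "\<dots> = (\<integral>\<^sup>+y. (\<integral>\<^sup>+x. ennreal (G' y) * ennreal (\<eta> (x - y)) \<partial>lborel) \<partial>lborel)"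
    by (rule lborel_pair.Fubini') simp
  also have "\<dots> = (\<integral>\<^sup>+y. ennreal (G' y) \<partial>lborel)"
  proof (rule nn_integral_cong)
    fix y
    have "(\<integral>\<^sup>+x. ennreal (\<eta> (x - y)) \<partial>lborel) = (\<integral>\<^sup>+x. ennreal (\<eta> x) \<partial>lborel)"
      by (subst (2) lborel_translate[of "-y", symmetric]) (simp add: nn_integral_distr)
    also have "\<dots> = ennreal (\<integral>x. \<eta> x \<partial>lebesgue)"
      using test_fun_integrable[OF \<eta>] mollifierD(2)[OF m] by (subst nn_integral_eq_integral[symmetric]) (auto simp: nn_integral_completion)
    also have "\<dots> = 1" using m by (simp add: mollifier_def)
    finally show "(\<integral>\<^sup>+x. ennreal (G' y) * ennreal (\<eta> (x - y)) \<partial>lborel) = ennreal (G' y)" by (simp add: nn_integral_cmult)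
  qed
  also have "\<dots> = (\<integral>\<^sup>+y. ennreal (G y) \<partial>lborel)" using ae by (intro nn_integral_cong_AE) (auto elim!: eventually_mono)
  also have "\<dots> = ennreal (\<integral>x. G x \<partial>lebesgue)" using G by (subst nn_integral_eq_integral[symmetric]) (auto simp: nn_integral_completion)
  finally show ?thesis .
qed

text \<open>Each partial derivative is mollified separately. Jensen bounds the squares pointwise by
  the mollified squared norm of \<open>g\<close>, whose integral is that of the original.\<close>

lemma mollified_energy_le:
  fixes u :: "'a::euclidean_space \<Rightarrow> real"
  assumes w: "weak_grad_L2 u g" and m: "mollifier \<rho> \<eta>"
  shows "integrable lebesgue (\<lambda>x. (norm (grad (conv u \<eta>) x))\<^sup>2)"
    "(\<integral>x. (norm (grad (conv u \<eta>) x))\<^sup>2 \<partial>lebesgue) \<le> (\<integral>x. (norm (g x))\<^sup>2 \<partial>lebesgue)"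
proof -
  note \<eta> = mollifierD(1)[OF m]
  have u: "loc_integrable u" and gm: "g \<in> borel_measurable lebesgue" and gi: "integrable lebesgue (\<lambda>x. (norm (g x))\<^sup>2)"
    using w by (auto simp: weak_grad_L2_def)
  have li: "loc_integrable (\<lambda>x. (g x \<bullet> b)\<^sup>2)" if "b \<in> Basis" for b
  proof (rule loc_integrable_integrable, rule Bochner_Integration.integrable_bound[OF gi])
    have "\<bar>g x \<bullet> b\<bar>\<^sup>2 \<le> (norm (g x))\<^sup>2" for x by (intro power_mono Basis_le_norm that) simp
    then show "AE x in lebesgue. norm ((g x \<bullet> b)\<^sup>2) \<le> norm ((norm (g x))\<^sup>2)" by simp
  qed (use gm in simp)
  have le: "(norm (grad (conv u \<eta>) x))\<^sup>2 \<le> conv (\<lambda>y. (norm (g y))\<^sup>2) \<eta> x" for x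
  proof -
    have "(norm (grad (conv u \<eta>) x))\<^sup>2 = (\<Sum>b\<in>Basis. (conv (\<lambda>y. g y \<bullet> b) \<eta> x)\<^sup>2)"
      by (simp add: norm_sq_Basis grad_inner_Basis pd_conv_weak_grad[OF w \<eta>])
    also have "\<dots> \<le> (\<Sum>b\<in>Basis. conv (\<lambda>y. (g y \<bullet> b)\<^sup>2) \<eta> x)"
      by (intro sum_mono conv_square_le[OF _ _ m] weak_grad_loc_integrable[OF w] li)
    also have "\<dots> = conv (\<lambda>y. (norm (g y))\<^sup>2) \<eta> x"
      unfolding conv_def norm_sq_Basis sum_distrib_right
      using conv_integrable[OF li \<eta>] by (intro Bochner_Integration.integral_sum[symmetric]) auto
    finally show ?thesis .
  qed
  have "(\<integral>\<^sup>+x. ennreal ((norm (grad (conv u \<eta>) x))\<^sup>2) \<partial>lborel) \<le> (\<integral>\<^sup>+x. ennreal (conv (\<lambda>y. (norm (g y))\<^sup>2) \<eta> x) \<partial>lborel)"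
    by (intro nn_integral_mono ennreal_leI le)
  also have "\<dots> = ennreal (\<integral>x. (norm (g x))\<^sup>2 \<partial>lebesgue)" by (rule nn_integral_conv[OF gi _ m]) simp
  finally have fin: "(\<integral>\<^sup>+x. ennreal ((norm (grad (conv u \<eta>) x))\<^sup>2) \<partial>lebesgue) \<le> ennreal (\<integral>x. (norm (g x))\<^sup>2 \<partial>lebesgue)"
    by (simp add: nn_integral_completion)
  show int: "integrable lebesgue (\<lambda>x. (norm (grad (conv u \<eta>) x))\<^sup>2)"
  proof (rule integrableI_nonneg)
    show "(\<lambda>x. (norm (grad (conv u \<eta>) x))\<^sup>2) \<in> borel_measurable lebesgue"
      using grad_lebesgue[OF smooth_conv[OF u \<eta>]] by simp
    show "(\<integral>\<^sup>+x. ennreal ((norm (grad (conv u \<eta>) x))\<^sup>2) \<partial>lebesgue) < \<infinity>"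
      using le_less_trans[OF fin ennreal_less_top] by simp
  qed simp
  then have "ennreal (\<integral>x. (norm (grad (conv u \<eta>) x))\<^sup>2 \<partial>lebesgue) \<le> ennreal (\<integral>x. (norm (g x))\<^sup>2 \<partial>lebesgue)"
    using fin by (subst nn_integral_eq_integral[symmetric]) auto
  then show "(\<integral>x. (norm (grad (conv u \<eta>) x))\<^sup>2 \<partial>lebesgue) \<le> (\<integral>x. (norm (g x))\<^sup>2 \<partial>lebesgue)" by simp
qed

subsection \<open>Integration by parts for Lipschitz functions\<close>

lemma lipschitz_derivative_le:
  fixes f :: "'a::euclidean_space \<Rightarrow> real"
  assumes L: "L-lipschitz_on S f" and x: "x \<in> interior S" and d: "(f has_derivative f') (at x)"
  shows "\<bar>f' h\<bar> \<le> L * norm h"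
proof -
  obtain e where e: "e > 0" "ball x e \<subseteq> S" using x mem_interior by blast
  have lin: "linear f'" using d has_derivative_linear by blast
  have "((\<lambda>t. (f (x + t *\<^sub>R h) - f x) / t) \<longlongrightarrow> f' h) (at 0)"
  proof -
    have "((\<lambda>t. f (x + t *\<^sub>R h)) has_derivative (\<lambda>t. f' (t *\<^sub>R h))) (at 0)"
      by (rule has_derivative_compose[where g=f and f="\<lambda>t. x + t *\<^sub>R h"]) (auto intro!: derivative_eq_intros d)
    moreover have "(\<lambda>t. f' (t *\<^sub>R h)) = (*) (f' h)" by (auto simp: fun_eq_iff linear_cmul[OF lin])
    ultimately have "((\<lambda>t. f (x + t *\<^sub>R h)) has_real_derivative f' h) (at 0)"
      by (simp only: has_field_derivative_def)
    then show ?thesis by (simp add: has_field_derivative_iff)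
  qed
  then have "((\<lambda>t. \<bar>(f (x + t *\<^sub>R h) - f x) / t\<bar>) \<longlongrightarrow> \<bar>f' h\<bar>) (at 0)" by (rule tendsto_rabs)
  moreover have "eventually (\<lambda>t. \<bar>(f (x + t *\<^sub>R h) - f x) / t\<bar> \<le> L * norm h) (at 0)"
  proof -
    have "((\<lambda>t::real. x + t *\<^sub>R h) \<longlongrightarrow> x + 0 *\<^sub>R h) (at 0)" by (intro tendsto_intros)
    then have "eventually (\<lambda>t::real. x + t *\<^sub>R h \<in> ball x e) (at 0)"
      using e by (intro topological_tendstoD) auto
    moreover have "eventually (\<lambda>t::real. t \<noteq> 0) (at 0)" by (simp add: eventually_at_filter)
    ultimately show ?thesis
    proof eventually_elim
      case (elim t)
      have "\<bar>f (x + t *\<^sub>R h) - f x\<bar> \<le> L * dist (x + t *\<^sub>R h) x"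
        using lipschitz_onD[OF L, of "x + t *\<^sub>R h" x] elim e x interior_subset[of S] by (auto simp: dist_real_def subset_iff)
      then show ?case using elim by (simp add: abs_divide divide_le_eq dist_norm mult_ac)
    qed
  qed
  ultimately show ?thesis by (intro tendsto_upperbound[where F="at (0::real)"]) auto
qed

lemma lipschitz_borel:
  fixes f :: "'a::euclidean_space \<Rightarrow> real"
  shows "L-lipschitz_on UNIV f \<Longrightarrow> f \<in> borel_measurable borel"
  by (intro borel_measurable_continuous_onI lipschitz_on_continuous_on)

text \<open>Difference quotients of a compactly supported function integrate to 0 by translation
  invariance. The Lipschitz bound dominates them, so the integral of the derivative is their limit;
  differentiability almost everywhere is enough.\<close>

lemma lipschitz_integral_derivative:
  fixes f :: "'a::euclidean_space \<Rightarrow> real"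
  assumes L: "L-lipschitz_on UNIV f" and R: "\<And>x. norm x > R \<Longrightarrow> f x = 0"
    and D: "D \<in> borel_measurable lebesgue"
    and ae: "AE x in lebesgue. \<exists>f'. (f has_derivative f') (at x) \<and> f' b = D x"
  shows "integrable lebesgue D" "(\<integral>x. D x \<partial>lebesgue) = 0"
proof -
  define s where "s n x = (f (x + (1 / real (Suc n)) *\<^sub>R b) - f x) * real (Suc n)" for n x
  \<comment> \<open>The difference quotients shift by at most the length of \<open>b\<close>, so
    they all vanish outside this ball.\<close>
  define w :: "'a \<Rightarrow> real" where "w x = L * norm b * indicator (cball 0 (R + norm b)) x" for x
  have fb[measurable]: "f \<in> borel_measurable borel" using L by (rule lipschitz_borel)
  have fi: "integrable lebesgue f"
    by (rule integrable_compact_support[OF lipschitz_on_continuous_on[OF L] compact_cball[of 0 R]]) (use R in auto)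
  have fti: "integrable lebesgue (\<lambda>x. f (x + a))" for a
  proof (rule integrable_compact_support)
    show "continuous_on UNIV (\<lambda>x. f (x + a))"
      by (intro continuous_on_compose2[OF lipschitz_on_continuous_on[OF L]] continuous_intros) auto
    show "compact (cball (- a) R)" by simp
    show "x \<notin> cball (- a) R \<Longrightarrow> f (x + a) = 0" for x
      using R[of "x + a"] by (simp add: dist_norm norm_minus_commute)
  qed
  have s0: "(\<integral>x. s n x \<partial>lebesgue) = 0" for n
    unfolding s_def using fi fti by (simp add: lebesgue_integral_translate)
  have sm: "s n \<in> borel_measurable lebesgue" for n
    unfolding s_def[abs_def] by (intro borel_imp_lebesgue) simp
  have wi: "integrable lebesgue w"
    unfolding w_def[abs_def] by (intro integrable_mult_right integrable_real_indicator) (auto simp: emeasure_lborel_cball_finite[simplified])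
  have lim: "AE x in lebesgue. (\<lambda>n. s n x) \<longlonglongrightarrow> D x"
    using ae
  proof eventually_elim
    case (elim x)
    then obtain f' where f': "(f has_derivative f') (at x)" "f' b = D x" by blast
    have "((\<lambda>t. f (x + t *\<^sub>R b)) has_derivative (\<lambda>t. f' (t *\<^sub>R b))) (at 0)"
      by (rule has_derivative_compose[where g=f and f="\<lambda>t. x + t *\<^sub>R b"]) (auto intro!: derivative_eq_intros f')
    moreover have "(\<lambda>t. f' (t *\<^sub>R b)) = (*) (D x)"
      using f'(2) by (auto simp: fun_eq_iff linear_cmul[OF has_derivative_linear[OF f'(1)]])
    ultimately have "((\<lambda>t. f (x + t *\<^sub>R b)) has_real_derivative D x) (at 0)"
      by (simp only: has_field_derivative_def)
    then have "((\<lambda>t. (f (x + t *\<^sub>R b) - f x) / t) \<longlongrightarrow> D x) (at 0)" by (simp add: has_field_derivative_iff)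
    moreover have "filterlim (\<lambda>n. 1 / real (Suc n)) (at 0) sequentially"
      using LIMSEQ_inverse_real_of_nat by (intro filterlim_atI) (auto simp: inverse_eq_divide)
    ultimately have "(\<lambda>n. (f (x + (1 / real (Suc n)) *\<^sub>R b) - f x) / (1 / real (Suc n))) \<longlonglongrightarrow> D x"
      by (rule filterlim_compose)
    then show ?case by (simp add: s_def)
  qed
  have bd: "AE x in lebesgue. norm (s n x) \<le> w x" for n
  proof (rule AE_I2)
    fix x
    show "norm (s n x) \<le> w x"
    proof (cases "x \<in> cball 0 (R + norm b)")
      case True
      have "\<bar>f (x + (1 / real (Suc n)) *\<^sub>R b) - f x\<bar> \<le> L * (1 / real (Suc n) * norm b)"
        using lipschitz_onD[OF L, of "x + (1 / real (Suc n)) *\<^sub>R b" x] by (simp add: dist_norm)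
      then have "\<bar>s n x\<bar> \<le> L * (1 / real (Suc n) * norm b) * real (Suc n)"
        unfolding s_def abs_mult by (intro mult_mono) auto
      then show ?thesis using True by (simp add: w_def)
    next
      case False
      then have x: "norm x > R + norm b" by simp
      have "norm ((1 / real (Suc n)) *\<^sub>R b) \<le> norm b" by (simp add: divide_le_eq distrib_left)
      moreover have "norm x \<le> norm (x + (1 / real (Suc n)) *\<^sub>R b) + norm ((1 / real (Suc n)) *\<^sub>R b)"
        using norm_triangle_ineq4[of "x + (1 / real (Suc n)) *\<^sub>R b" "(1 / real (Suc n)) *\<^sub>R b"] by simp
      ultimately have "norm (x + (1 / real (Suc n)) *\<^sub>R b) > R" using x by linarith
      moreover have "norm x > R" using x norm_ge_zero[of b] by linarith
      ultimately have "s n x = 0" using R by (simp add: s_def)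
      then show ?thesis using False by (simp add: w_def)
    qed
  qed
  show "integrable lebesgue D" by (rule integrable_dominated_convergence[OF D sm wi lim bd])
  have "(\<lambda>n. \<integral>x. s n x \<partial>lebesgue) \<longlonglongrightarrow> (\<integral>x. D x \<partial>lebesgue)"
    by (rule integral_dominated_convergence[OF D sm wi lim bd])
  then have "(\<lambda>n::nat. 0::real) \<longlonglongrightarrow> (\<integral>x. D x \<partial>lebesgue)" by (simp only: s0)
  then show "(\<integral>x. D x \<partial>lebesgue) = 0" using LIMSEQ_unique[OF _ tendsto_const[of 0]] by blast
qed

text \<open>Where the second factor vanishes, the values of the first do not matter; a Lipschitz
  bound on the ball that carries the support is enough.\<close>

lemma lipschitz_mult_compact_support:
  fixes u f :: "'a::euclidean_space \<Rightarrow> real"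
  assumes u: "L-lipschitz_on (cball 0 R) u" and f: "M-lipschitz_on UNIV f" and R: "\<And>x. norm x > R \<Longrightarrow> f x = 0"
  obtains N where "N-lipschitz_on UNIV (\<lambda>x. u x * f x)"
proof -
  have "bounded (u ` cball 0 R)"
    using lipschitz_on_continuous_on[OF u] by (intro compact_imp_bounded compact_continuous_image) auto
  then obtain A where A: "A > 0" "\<And>x. norm x \<le> R \<Longrightarrow> \<bar>u x\<bar> \<le> A" by (auto simp: bounded_pos)
  have "bounded (f ` cball 0 R)"
    using lipschitz_on_continuous_on[OF f] by (intro compact_imp_bounded compact_continuous_image) (auto intro: continuous_on_subset)
  then obtain B where B: "B > 0" "\<And>x. norm x \<le> R \<Longrightarrow> \<bar>f x\<bar> \<le> B" by (auto simp: bounded_pos)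
  have L0: "L \<ge> 0" "M \<ge> 0" using u f lipschitz_on_nonneg by auto
  have out: "\<bar>u x * f x - u y * f y\<bar> \<le> (A * M + B * L) * dist x y" if "norm x \<le> R" for x y
  proof (cases "norm y \<le> R")
    case True
    have "u x * f x - u y * f y = u x * (f x - f y) + f y * (u x - u y)" by (simp add: algebra_simps)
    also have "\<bar>\<dots>\<bar> \<le> \<bar>u x\<bar> * \<bar>f x - f y\<bar> + \<bar>f y\<bar> * \<bar>u x - u y\<bar>" by (simp add: abs_triangle_ineq[THEN order_trans] abs_mult)
    also have "\<dots> \<le> A * (M * dist x y) + B * (L * dist x y)"
      using A(2)[OF that] B(2)[OF True] lipschitz_onD[OF f, of x y] lipschitz_onD[OF u, of x y] that True A(1) B(1)
      by (intro add_mono mult_mono) (auto simp: dist_real_def)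
    finally show ?thesis by (simp add: algebra_simps)
  next
    case False
    then have fy: "f y = 0" using R by simp
    have "\<bar>u x * f x - u y * f y\<bar> = \<bar>u x\<bar> * \<bar>f x - f y\<bar>" by (simp add: fy abs_mult)
    also have "\<dots> \<le> A * (M * dist x y)"
      using A(2)[OF that] lipschitz_onD[OF f, of x y] A(1) by (intro mult_mono) (auto simp: dist_real_def)
    also have "\<dots> \<le> (A * M + B * L) * dist x y" using L0 B(1) by (simp add: algebra_simps)
    finally show ?thesis .
  qed
  have "(A * M + B * L)-lipschitz_on UNIV (\<lambda>x. u x * f x)"
  proof (rule lipschitz_onI)
    fix x y
    show "dist (u x * f x) (u y * f y) \<le> (A * M + B * L) * dist x y"
    proof (cases "norm x \<le> R")
      case True then show ?thesis using out by (simp add: dist_real_def)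
    next
      case F: False
      show ?thesis
      proof (cases "norm y \<le> R")
        case True then show ?thesis using out[of y x] by (simp add: dist_real_def abs_minus_commute dist_commute)
      next
        case False then show ?thesis using F R L0 A B by (simp add: dist_real_def)
      qed
    qed
  qed (use L0 A B in auto)
  then show thesis by (rule that)
qed

text \<open>The previous facts are applied to the product \<open>u x * f x\<close>. The Lipschitz
  condition on \<open>u\<close> is local so that arbitrary smooth functions qualify; it bounds
  \<open>gu\<close> inside the ball, which gives the integrability needed to split the product
  rule.\<close>

lemma lipschitz_ibp:
  fixes u f :: "'a::euclidean_space \<Rightarrow> real"
  assumes u: "L-lipschitz_on (cball 0 R) u" and f: "M-lipschitz_on UNIV f" and R: "\<And>x. norm x > R \<Longrightarrow> f x = 0"
    and um: "u \<in> borel_measurable lebesgue" and gu: "gu \<in> borel_measurable lebesgue" and gf: "gf \<in> borel_measurable lebesgue"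
    and du: "AE x in lebesgue. (u has_derivative (\<lambda>h. gu x \<bullet> h)) (at x)"
    and df: "AE x in lebesgue. (f has_derivative (\<lambda>h. gf x \<bullet> h)) (at x)"
  shows "integrable lebesgue (\<lambda>x. (gu x \<bullet> b) * f x)" "integrable lebesgue (\<lambda>x. u x * (gf x \<bullet> b))"
    "(\<integral>x. u x * (gf x \<bullet> b) \<partial>lebesgue) = - (\<integral>x. (gu x \<bullet> b) * f x \<partial>lebesgue)"
proof -
  have fb: "f \<in> borel_measurable lebesgue" using lipschitz_borel[OF f] by (rule borel_imp_lebesgue)
  obtain N where N: "N-lipschitz_on UNIV (\<lambda>x. u x * f x)" using lipschitz_mult_compact_support[OF u f R] by blast
  let ?D = "\<lambda>x. u x * (gf x \<bullet> b) + (gu x \<bullet> b) * f x"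
  have Dm: "?D \<in> borel_measurable lebesgue" using um gu gf fb by simp
  have ae: "AE x in lebesgue. \<exists>f'. ((\<lambda>x. u x * f x) has_derivative f') (at x) \<and> f' b = ?D x"
    using du df by eventually_elim (rule exI, rule conjI, erule (1) has_derivative_mult, simp)
  note D = lipschitz_integral_derivative[OF N _ Dm ae, of R]
  have "bounded (f ` cball 0 R)"
    using lipschitz_on_continuous_on[OF f] by (intro compact_imp_bounded compact_continuous_image) (auto intro: continuous_on_subset)
  then obtain B where B: "B > 0" "\<And>x. norm x \<le> R \<Longrightarrow> \<bar>f x\<bar> \<le> B" by (auto simp: bounded_pos)
  show i1: "integrable lebesgue (\<lambda>x. (gu x \<bullet> b) * f x)"
  proof (rule Bochner_Integration.integrable_bound)
    show "integrable lebesgue (\<lambda>x. (L * norm b) * B * indicator (cball (0::'a) R) x :: real)"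
      by (intro integrable_mult_right integrable_real_indicator) (auto simp: emeasure_lborel_cball_finite[simplified])
    have "AE x in lebesgue. x \<notin> sphere (0::'a) R"
      using negligible_sphere[of "0::'a" R] by (intro AE_not_in) (simp add: negligible_iff_null_sets)
    with du show "AE x in lebesgue. norm ((gu x \<bullet> b) * f x) \<le> norm ((L * norm b) * B * indicator (cball (0::'a) R) x :: real)"
    proof eventually_elim
      case (elim x)
      have L0: "L \<ge> 0" using u lipschitz_on_nonneg by auto
      show ?case
      proof (cases "norm x < R")
        case True
        then have "\<bar>gu x \<bullet> b\<bar> \<le> L * norm b" using lipschitz_derivative_le[OF u _ elim(1), of b] by simp
        then have "\<bar>gu x \<bullet> b\<bar> * \<bar>f x\<bar> \<le> L * norm b * B" using B True L0 by (intro mult_mono) auto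
        then show ?thesis using True L0 B by (simp add: abs_mult)
      next
        case False
        with elim(2) have "norm x > R" by (auto simp: sphere_def)
        then show ?thesis using R by simp
      qed
    qed
  qed (use gu fb in simp)
  have Di: "integrable lebesgue ?D" using D R by auto
  have "integrable lebesgue (\<lambda>x. ?D x - (gu x \<bullet> b) * f x)" using Di i1 by (rule Bochner_Integration.integrable_diff)
  then show i2: "integrable lebesgue (\<lambda>x. u x * (gf x \<bullet> b))" by simp
  have "(\<integral>x. ?D x \<partial>lebesgue) = 0" using D R by auto
  then show "(\<integral>x. u x * (gf x \<bullet> b) \<partial>lebesgue) = - (\<integral>x. (gu x \<bullet> b) * f x \<partial>lebesgue)"
    using i1 i2 by simp
qed

lemma smooth_lipschitz_cball:
  fixes f :: "'a::euclidean_space \<Rightarrow> real"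
  assumes "smooth f" obtains L where "L-lipschitz_on (cball a R) f"
proof -
  have "bounded (grad f ` cball a R)"
    by (intro compact_imp_bounded compact_continuous_image grad_continuous assms) auto
  then obtain B where B: "B > 0" "\<And>x. x \<in> cball a R \<Longrightarrow> norm (grad f x) \<le> B" by (auto simp: bounded_pos)
  have "B-lipschitz_on (cball a R) f"
  proof (rule bounded_derivative_imp_lipschitz)
    show "(f has_derivative (\<lambda>h. grad f x \<bullet> h)) (at x within cball a R)" for x
      using smooth_has_derivative_grad[OF assms] by (rule has_derivative_at_withinI)
    show "onorm (\<lambda>h. grad f x \<bullet> h) \<le> B" if "x \<in> cball a R" for x
    proof (rule onorm_le)
      fix h show "norm (grad f x \<bullet> h) \<le> B * norm h"
        using Cauchy_Schwarz_ineq2[of "grad f x" h] B(2)[OF that] by (simp add: order_trans mult_right_mono)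
    qed
  qed (use B in auto)
  then show thesis by (rule that)
qed

lemma weak_grad_lipschitz:
  fixes u :: "'a::euclidean_space \<Rightarrow> real"
  assumes u: "L-lipschitz_on UNIV u" and g: "g \<in> borel_measurable lebesgue"
    and d: "AE x in lebesgue. (u has_derivative (\<lambda>h. g x \<bullet> h)) (at x)"
    and i: "integrable lebesgue (\<lambda>x. (norm (g x))\<^sup>2)"
  shows "weak_grad_L2 u g"
  unfolding weak_grad_L2_def
proof (intro conjI allI impI)
  show "loc_integrable u" using u by (intro loc_integrable_continuous lipschitz_on_continuous_on)
  fix \<phi> :: "'a \<Rightarrow> real" and b :: 'a assume \<phi>: "test_fun UNIV \<phi>" and b: "b \<in> Basis"
  obtain M where M: "M-lipschitz_on UNIV \<phi>" using test_fun_lipschitz[OF \<phi>] by blast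
  obtain R where R: "\<And>x. norm x > R \<Longrightarrow> \<phi> x = 0" using test_fun_cball[OF \<phi>] by blast
  have "(\<integral>x. u x * (grad \<phi> x \<bullet> b) \<partial>lebesgue) = - (\<integral>x. (g x \<bullet> b) * \<phi> x \<partial>lebesgue)"
  proof (rule lipschitz_ibp(3))
    show "L-lipschitz_on (cball 0 R) u" using u lipschitz_on_subset by blast
    show "u \<in> borel_measurable lebesgue" using lipschitz_borel[OF u] by (rule borel_imp_lebesgue)
    show "AE x in lebesgue. (\<phi> has_derivative (\<lambda>h. grad \<phi> x \<bullet> h)) (at x)"
      using smooth_has_derivative_grad[OF test_fun_smooth[OF \<phi>]] by simp
  qed (use M R g d grad_lebesgue[OF test_fun_smooth[OF \<phi>]] in auto)
  then show "(\<integral>x. u x * pd \<phi> b x \<partial>lebesgue) = - (\<integral>x. (g x \<bullet> b) * \<phi> x \<partial>lebesgue)"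
    by (simp add: grad_inner_Basis[OF b])
qed (use g i in auto)

subsection \<open>Distance to a convex set\<close>

definition cbody :: "'a::euclidean_space set \<Rightarrow> bool" where
  "cbody A \<longleftrightarrow> A \<noteq> {} \<and> open A \<and> bounded A \<and> convex A"

text \<open>For convex \<open>A\<close> this is the gradient of the distance: the unit vector
  pointing away from the nearest point, extended by 0 over the closure.\<close>

definition dgrad :: "'a::euclidean_space set \<Rightarrow> 'a \<Rightarrow> 'a" where
  "dgrad A x = (if x \<in> closure A then 0 else sgn (x - closest_point (closure A) x))"

lemma norm_dgrad: "A \<noteq> {} \<Longrightarrow> norm (dgrad A x) = (if x \<in> closure A then 0 else 1)"
  using closest_point_in_set[of "closure A" x] by (auto simp: dgrad_def norm_sgn)

lemma infdist_closest: "A \<noteq> {} \<Longrightarrow> infdist x A = dist x (closest_point (closure A) x)"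
  using setdist_closest_point[of "closure A" x] by (simp add: infdist_eq_setdist)

lemma infdist_lipschitz: "1-lipschitz_on UNIV (\<lambda>x. infdist x A)"
  by (rule lipschitz_onI) (auto simp: infdist_triangle_abs dist_real_def)

lemma infdist_closure: "infdist x (closure A) = infdist x A"
  by (simp add: infdist_eq_setdist)

lemma infdist_zero_iff: "A \<noteq> {} \<Longrightarrow> infdist x A = 0 \<longleftrightarrow> x \<in> closure A"
  by (simp add: in_closure_iff_infdist_zero)

lemma infdist_pos_iff: "A \<noteq> {} \<Longrightarrow> 0 < infdist x A \<longleftrightarrow> x \<notin> closure A"
  using infdist_zero_iff[of A x] infdist_nonneg[of x A] by linarith

lemma infdist_less_iff: "A \<noteq> {} \<Longrightarrow> infdist x A < t \<longleftrightarrow> x \<in> msum A (ball 0 t)"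
proof
  assume "A \<noteq> {}" "infdist x A < t"
  then obtain a where a: "a \<in> A" "dist x a < t"
    by (auto simp: infdist_def cInf_less_iff split: if_splits)
  then have "a + (x - a) \<in> msum A (ball 0 t)" by (intro msumI) (auto simp: dist_norm norm_minus_commute)
  then show "x \<in> msum A (ball 0 t)" by simp
next
  assume "A \<noteq> {}" "x \<in> msum A (ball 0 t)"
  then obtain a z where "a \<in> A" "z \<in> ball 0 t" "x = a + z" unfolding msum_def by blast
  then show "infdist x A < t" using infdist_le[of a A x] by (simp add: dist_norm)
qed

text \<open>The hyperplane through the nearest point, orthogonal to \<open>dgrad A x\<close>,
  supports \<open>A\<close>; the left-hand side is the signed distance to it.\<close>

lemma infdist_ge_inner:
  assumes A: "convex A" "A \<noteq> {}" and x: "x \<notin> closure A"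
  shows "dgrad A x \<bullet> (y - closest_point (closure A) x) \<le> infdist y A"
proof -
  let ?p = "closest_point (closure A) x" and ?q = "closest_point (closure A) y"
  have q: "?q \<in> closure A" using A by (intro closest_point_in_set) auto
  have "(x - ?p) \<bullet> (?q - ?p) \<le> 0" using A q by (intro closest_point_dot) auto
  then have "dgrad A x \<bullet> (?q - ?p) \<le> 0"
    using x by (simp add: dgrad_def sgn_div_norm mult_nonneg_nonpos)
  moreover have "dgrad A x \<bullet> (y - ?q) \<le> norm (y - ?q)"
    using norm_cauchy_schwarz[of "dgrad A x" "y - ?q"] A x by (simp add: norm_dgrad)
  moreover have "dgrad A x \<bullet> (y - ?p) = dgrad A x \<bullet> (y - ?q) + dgrad A x \<bullet> (?q - ?p)"
    by (simp add: inner_diff_right)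
  ultimately show ?thesis using infdist_closest[OF A(2), of y] by (simp add: dist_norm)
qed

lemma dgrad_inner_self:
  assumes "A \<noteq> {}" "x \<notin> closure A"
  shows "dgrad A x \<bullet> (x - closest_point (closure A) x) = infdist x A"
proof -
  let ?v = "x - closest_point (closure A) x"
  have "?v \<bullet> ?v = norm ?v * norm ?v" by (simp add: power2_norm_eq_inner[symmetric] power2_eq_square)
  then show ?thesis using assms infdist_closest[OF assms(1), of x]
    by (cases "?v = 0") (simp_all add: dgrad_def sgn_div_norm dist_norm)
qed

text \<open>The distance is squeezed between the affine bound of \<open>infdist_ge_inner\<close> and
  the distance to the nearest point of \<open>x\<close>. Both touch it at \<open>x\<close> with the
  same gradient.\<close>

lemma infdist_has_derivative_outside:
  fixes A :: "'a::euclidean_space set"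
  assumes A: "convex A" "A \<noteq> {}" and x: "x \<notin> closure A"
  shows "((\<lambda>y. infdist y A) has_derivative (\<lambda>h. dgrad A x \<bullet> h)) (at x)"
proof -
  let ?p = "closest_point (closure A) x"
  have xp: "x - ?p \<noteq> 0" using x A closest_point_in_set[of "closure A" x] by auto
  have p: "?p \<in> closure A" using A by (intro closest_point_in_set) auto
  have "((\<lambda>y. norm (y - ?p)) has_derivative (\<lambda>h. h \<bullet> sgn (x - ?p))) (at x)"
    by (rule has_derivative_compose[where f="\<lambda>y. y - ?p" and f'="\<lambda>h. h" and g=norm and g'="\<lambda>h. h \<bullet> sgn (x - ?p)"])
       (auto intro!: derivative_eq_intros has_derivative_norm[OF xp])
  then have U: "((\<lambda>y. norm ((norm (y - ?p) - norm (x - ?p)) - dgrad A x \<bullet> (y - x)) / norm (y - x)) \<longlongrightarrow> 0) (at x)"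
    using x by (simp add: has_derivative_iff_norm dgrad_def inner_commute)
  show ?thesis
  proof (rule has_derivativeI_sandwich[OF zero_less_one _ _ U])
    show "bounded_linear (\<lambda>h. dgrad A x \<bullet> h)" by (rule bounded_linear_inner_right)
    fix y assume "y \<noteq> x"
    have up: "infdist y A \<le> norm (y - ?p)"
      using infdist_le[OF p, of y] by (simp add: dist_norm infdist_closure)
    have "dgrad A x \<bullet> (y - ?p) \<le> infdist y A" by (rule infdist_ge_inner[OF A x])
    moreover have "dgrad A x \<bullet> (y - ?p) = dgrad A x \<bullet> (y - x) + infdist x A"
      using dgrad_inner_self[OF A(2) x] by (simp add: inner_diff_right)
    moreover have "infdist x A = norm (x - ?p)" using infdist_closest[OF A(2), of x] by (simp add: dist_norm)
    ultimately have "norm (infdist y A - infdist x A - dgrad A x \<bullet> (y - x)) \<le> norm ((norm (y - ?p) - norm (x - ?p)) - dgrad A x \<bullet> (y - x))"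
      using up by simp
    then show "norm (infdist y A - infdist x A - dgrad A x \<bullet> (y - x)) / norm (y - x)
       \<le> norm ((norm (y - ?p) - norm (x - ?p)) - dgrad A x \<bullet> (y - x)) / norm (y - x)"
      by (intro divide_right_mono) auto
  qed
qed

lemma infdist_has_derivative_inside:
  assumes "x \<in> interior (closure A)" "A \<noteq> {}"
  shows "((\<lambda>y. infdist y A) has_derivative (\<lambda>h. dgrad A x \<bullet> h)) (at x)"
proof -
  have "x \<in> closure A" using assms interior_subset by blast
  then have "((\<lambda>y. 0) has_derivative (\<lambda>h. dgrad A x \<bullet> h)) (at x)" by (simp add: dgrad_def)
  then show ?thesis
    by (rule has_derivative_transform_within_open[OF _ open_interior assms(1)])
       (use assms(2) interior_subset in \<open>auto simp: infdist_zero_iff\<close>)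
qed

lemma AE_not_frontier_convex:
  fixes A :: "'a::euclidean_space set"
  assumes "convex A" shows "AE x in lebesgue. x \<notin> frontier A"
  using negligible_convex_frontier[OF assms] by (intro AE_not_in) (simp add: negligible_iff_null_sets)

lemma infdist_AE_derivative:
  fixes A :: "'a::euclidean_space set"
  assumes A: "convex A" "A \<noteq> {}"
  shows "AE x in lebesgue. ((\<lambda>y. infdist y A) has_derivative (\<lambda>h. dgrad A x \<bullet> h)) (at x)"
  using AE_not_frontier_convex[OF convex_closure[OF A(1)]]
proof eventually_elim
  case (elim x)
  then show ?case
    using infdist_has_derivative_outside[OF A, of x] infdist_has_derivative_inside[OF _ A(2), of x] closure_subset[of "closure A"]
    by (cases "x \<in> closure A") (auto simp: frontier_def)
qed

lemma dgrad_borel: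
  fixes A :: "'a::euclidean_space set"
  assumes A: "convex A" "A \<noteq> {}"
  shows "dgrad A \<in> borel_measurable borel"
proof -
  have "continuous_on UNIV (closest_point (closure A))"
    using A by (intro continuous_on_closest_point) (auto intro: convex_closure)
  then have [measurable]: "closest_point (closure A) \<in> borel_measurable borel" by (rule borel_measurable_continuous_onI)
  show ?thesis unfolding dgrad_def[abs_def] sgn_div_norm by measurable
qed

lemma convex_on_infdist:
  fixes A :: "'a::euclidean_space set"
  assumes A: "convex A" "A \<noteq> {}"
  shows "convex_on UNIV (\<lambda>x. infdist x A)"
proof (rule convex_onI)
  fix t :: real and x y :: 'a assume t: "0 < t" "t < 1"
  let ?p = "closest_point (closure A) x" and ?q = "closest_point (closure A) y"
  have "?p \<in> closure A" "?q \<in> closure A" using A by (auto intro!: closest_point_in_set)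
  then have "(1 - t) *\<^sub>R ?p + t *\<^sub>R ?q \<in> closure A"
    using convexD[OF convex_closure[OF A(1)], of ?p ?q "1 - t" t] t by simp
  then have "infdist ((1 - t) *\<^sub>R x + t *\<^sub>R y) (closure A) \<le> dist ((1 - t) *\<^sub>R x + t *\<^sub>R y) ((1 - t) *\<^sub>R ?p + t *\<^sub>R ?q)"
    by (rule infdist_le)
  also have "\<dots> = norm ((1 - t) *\<^sub>R (x - ?p) + t *\<^sub>R (y - ?q))" by (simp add: dist_norm algebra_simps)
  also have "\<dots> \<le> (1 - t) * norm (x - ?p) + t * norm (y - ?q)"
    using t norm_triangle_ineq[of "(1 - t) *\<^sub>R (x - ?p)" "t *\<^sub>R (y - ?q)"] by simp
  finally show "infdist ((1 - t) *\<^sub>R x + t *\<^sub>R y) A \<le> (1 - t) * infdist x A + t * infdist y A"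
    using A(2) by (simp add: infdist_closest[OF A(2)] dist_norm infdist_eq_setdist[of _ "closure A"] infdist_eq_setdist[of _ A, symmetric])
qed simp

lemma cbody_msum_ball:
  assumes "cbody A" "0 < \<delta>" shows "cbody (msum A (ball 0 \<delta>))"
proof -
  obtain x where "x \<in> A" using assms by (auto simp: cbody_def)
  then have "x + 0 \<in> msum A (ball 0 \<delta>)" using assms by (intro msumI) auto
  then have "msum A (ball 0 \<delta>) \<noteq> {}" by blast
  moreover have "convex (msum A (ball 0 \<delta>))"
    using assms convex_sums[of A "ball 0 \<delta>"] by (simp add: cbody_def msum_def)
  ultimately show ?thesis using assms by (simp add: cbody_def open_msum bounded_msum)
qed

lemma cbody_lmeasurable: "cbody A \<Longrightarrow> A \<in> lmeasurable"
  by (simp add: cbody_def lmeasurable_open)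

lemma measure_closure_cbody: "cbody A \<Longrightarrow> measure lebesgue (closure A) = measure lebesgue A"
  using measure_closure[of A] negligible_convex_frontier[of A] by (simp add: cbody_def)

lemma cbody_measure_pos: "cbody A \<Longrightarrow> 0 < measure lebesgue A"
  unfolding cbody_def by (intro measure_open_pos) auto

lemma cbody_subset_msum: "0 < \<delta> \<Longrightarrow> closure A \<subseteq> msum A (ball 0 \<delta>)"
proof
  fix x assume "0 < \<delta>" "x \<in> closure A"
  moreover from this have "A \<noteq> {}" by auto
  ultimately show "x \<in> msum A (ball 0 \<delta>)" using infdist_less_iff[of A x \<delta>] infdist_zero_iff[of A x] by simp
qed

text \<open>Moving slightly towards the nearest point lowers the distance below the level. Hence a
  level set lies in the frontier of a convex parallel set and is null, which makes the kink of
  \<open>dcut\<close> at this level harmless.\<close>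

lemma infdist_level_frontier:
  assumes A: "A \<noteq> {}" and x: "infdist x A = \<delta>" "0 < \<delta>"
  shows "x \<in> frontier (msum A (ball 0 \<delta>))"
proof -
  have "x \<notin> msum A (ball 0 \<delta>)" using x infdist_less_iff[OF A, of x \<delta>] by simp
  moreover have "x \<in> closure (msum A (ball 0 \<delta>))"
  proof (rule closure_approachable[THEN iffD2], intro allI impI)
    fix e :: real assume e: "e > 0"
    let ?p = "closest_point (closure A) x"
    have xp: "dist x ?p = \<delta>" using infdist_closest[OF A, of x] x by simp
    define t where "t = min 1 (e / (2 * \<delta>))"
    have t: "0 < t" "t \<le> 1" "t * \<delta> < e" using e x(2) by (auto simp: t_def min_def field_simps)
    define y where "y = x + t *\<^sub>R (?p - x)"
    have "y - ?p = (1 - t) *\<^sub>R (x - ?p)" by (simp add: y_def algebra_simps)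
    then have "dist y ?p = (1 - t) * \<delta>" using t xp by (simp add: dist_norm)
    also have "\<dots> < \<delta>" using t x(2) by (simp add: algebra_simps)
    finally have "dist y ?p < \<delta>" .
    moreover have "?p \<in> closure A" using A by (intro closest_point_in_set) auto
    ultimately have "infdist y (closure A) < \<delta>" using infdist_le[of ?p "closure A" y] by simp
    then have "infdist y A < \<delta>" by (simp add: infdist_eq_setdist)
    then have "y \<in> msum A (ball 0 \<delta>)" using infdist_less_iff[OF A] by simp
    moreover have "dist y x < e" using t xp by (simp add: y_def dist_norm norm_minus_commute)
    ultimately show "\<exists>y\<in>msum A (ball 0 \<delta>). dist y x < e" by blast
  qed
  ultimately show ?thesis using interior_subset by (auto simp: frontier_def)
qed

text \<open>Divided by \<delta> this is a Lipschitz replacement for the indicator of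
  \<open>A\<close>: it is constant on \<open>A\<close> and falls with slope 1 to 0 across the shell
  of width \<delta>.\<close>

definition dcut :: "'a::euclidean_space set \<Rightarrow> real \<Rightarrow> 'a \<Rightarrow> real" where
  "dcut A \<delta> x = max 0 (\<delta> - infdist x A)"

lemma dcut_props:
  fixes A :: "'a::euclidean_space set"
  assumes A: "cbody A" and \<delta>: "0 < \<delta>"
  shows "1-lipschitz_on UNIV (dcut A \<delta>)" "0 \<le> dcut A \<delta> x" "dcut A \<delta> x \<le> \<delta>"
    "x \<notin> msum A (ball 0 \<delta>) \<Longrightarrow> dcut A \<delta> x = 0"
    "x \<in> A \<Longrightarrow> dcut A \<delta> x = \<delta>"
    "AE x in lebesgue. (dcut A \<delta> has_derivative (\<lambda>h. (- indicator (msum A (ball 0 \<delta>)) x *\<^sub>R dgrad A x) \<bullet> h)) (at x)"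
    "(\<lambda>x. - indicator (msum A (ball 0 \<delta>)) x *\<^sub>R dgrad A x) \<in> borel_measurable borel"
proof -
  have A': "A \<noteq> {}" "convex A" using A by (auto simp: cbody_def)
  show "1-lipschitz_on UNIV (dcut A \<delta>)"
  proof (rule lipschitz_onI)
    show "dist (dcut A \<delta> x) (dcut A \<delta> y) \<le> 1 * dist x y" for x y
      using infdist_triangle_abs[of x A y] by (auto simp: dcut_def dist_real_def max_def)
  qed simp
  show "0 \<le> dcut A \<delta> x" "dcut A \<delta> x \<le> \<delta>" "x \<in> A \<Longrightarrow> dcut A \<delta> x = \<delta>" using infdist_nonneg[of x A] \<delta> by (auto simp: dcut_def)
  show "x \<notin> msum A (ball 0 \<delta>) \<Longrightarrow> dcut A \<delta> x = 0" using infdist_less_iff[OF A'(1), of x \<delta>] by (auto simp: dcut_def)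
  have M: "cbody (msum A (ball 0 \<delta>))" using A \<delta> by (rule cbody_msum_ball)
  then have ae: "AE x in lebesgue. x \<notin> frontier (msum A (ball 0 \<delta>))" by (intro AE_not_frontier_convex) (simp add: cbody_def)
  have cont: "continuous_on UNIV (\<lambda>x. infdist x A)" by (intro continuous_intros)
  show "AE x in lebesgue. (dcut A \<delta> has_derivative (\<lambda>h. (- indicator (msum A (ball 0 \<delta>)) x *\<^sub>R dgrad A x) \<bullet> h)) (at x)"
    using ae infdist_AE_derivative[OF A'(2,1)]
  proof eventually_elim
    case (elim x)
    consider "infdist x A < \<delta>" | "infdist x A > \<delta>" using infdist_level_frontier[OF A'(1) _ \<delta>] elim(1) by fastforce
    then show ?case
    proof cases
      case 1
      have "((\<lambda>y. \<delta> - infdist y A) has_derivative (\<lambda>h. (- indicator (msum A (ball 0 \<delta>)) x *\<^sub>R dgrad A x) \<bullet> h)) (at x)"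
        using 1 infdist_less_iff[OF A'(1), of x \<delta>] by (auto intro!: derivative_eq_intros elim(2) )
      moreover have "open {y. infdist y A < \<delta>}" using cont by (intro open_Collect_less) auto
      ultimately show ?thesis
        by (rule has_derivative_transform_within_open) (use 1 in \<open>auto simp: dcut_def\<close>)
    next
      case 2
      have "((\<lambda>y. 0) has_derivative (\<lambda>h. (- indicator (msum A (ball 0 \<delta>)) x *\<^sub>R dgrad A x) \<bullet> h)) (at x)"
        using 2 infdist_less_iff[OF A'(1), of x \<delta>] by auto
      moreover have "open {y. infdist y A > \<delta>}" using cont by (intro open_Collect_less) auto
      ultimately show ?thesis
        by (rule has_derivative_transform_within_open) (use 2 in \<open>auto simp: dcut_def\<close>)
    qed
  qed
  have [measurable]: "msum A (ball 0 \<delta>) \<in> sets borel" using M by (auto simp: cbody_def)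
  note [measurable] = dgrad_borel[OF A'(2,1)]
  show "(\<lambda>x. - indicator (msum A (ball 0 \<delta>)) x *\<^sub>R dgrad A x) \<in> borel_measurable borel" by measurable
qed

lemma dcut_outside:
  assumes "cbody A" "0 < \<delta>"
  obtains R where "\<And>x. norm x > R \<Longrightarrow> dcut A \<delta> x = 0"
proof -
  have "bounded (msum A (ball 0 \<delta>))" using cbody_msum_ball[OF assms] by (simp add: cbody_def)
  then obtain R where "\<And>x. x \<in> msum A (ball 0 \<delta>) \<Longrightarrow> norm x \<le> R" by (auto simp: bounded_iff)
  then show thesis using dcut_props(4)[OF assms] by (intro that[of R]) (meson not_le)
qed

text \<open>A volume integral of the divergence becomes the flux through the shell around
  \<open>A\<close>, averaged over its width. The fields need not have compact support because
  \<open>dcut\<close> has it; this admits gradients of mollified distances.\<close>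

lemma dcut_ibp:
  fixes A :: "'a::euclidean_space set"
  assumes A: "cbody A" and \<delta>: "0 < \<delta>" and \<Phi>: "\<And>b. b \<in> Basis \<Longrightarrow> smooth (\<lambda>x. \<Phi> x \<bullet> b)"
  shows "(\<integral>x. dcut A \<delta> x * divergence \<Phi> x \<partial>lebesgue) = (\<integral>x. indicator (msum A (ball 0 \<delta>)) x * (dgrad A x \<bullet> \<Phi> x) \<partial>lebesgue)"
    "integrable lebesgue (\<lambda>x. dcut A \<delta> x * divergence \<Phi> x)"
    "integrable lebesgue (\<lambda>x. indicator (msum A (ball 0 \<delta>)) x * (dgrad A x \<bullet> \<Phi> x))"
proof -
  obtain R where R: "\<And>x. norm x > R \<Longrightarrow> dcut A \<delta> x = 0" using dcut_outside[OF A \<delta>] by blast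
  let ?g = "\<lambda>x. - indicator (msum A (ball 0 \<delta>)) x *\<^sub>R dgrad A x"
  let ?\<Phi> = "\<lambda>b x. \<Phi> x \<bullet> b"
  have *: "integrable lebesgue (\<lambda>x. (grad (?\<Phi> b) x \<bullet> b) * dcut A \<delta> x) \<and> integrable lebesgue (\<lambda>x. ?\<Phi> b x * (?g x \<bullet> b)) \<and>
     (\<integral>x. ?\<Phi> b x * (?g x \<bullet> b) \<partial>lebesgue) = - (\<integral>x. (grad (?\<Phi> b) x \<bullet> b) * dcut A \<delta> x \<partial>lebesgue)"
    if b: "b \<in> Basis" for b
  proof -
    obtain L where L: "L-lipschitz_on (cball 0 R) (?\<Phi> b)" using smooth_lipschitz_cball[OF \<Phi>[OF b]] by blast
    have 1: "?\<Phi> b \<in> borel_measurable lebesgue"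
      by (intro borel_imp_lebesgue borel_measurable_continuous_onI smooth_continuous_on \<Phi> b)
    have 2: "AE x in lebesgue. (?\<Phi> b has_derivative (\<lambda>h. grad (?\<Phi> b) x \<bullet> h)) (at x)"
      using smooth_has_derivative_grad[OF \<Phi>[OF b]] by simp
    note ibp = lipschitz_ibp[OF L dcut_props(1)[OF A \<delta>] R 1 grad_lebesgue[OF \<Phi>[OF b]] borel_imp_lebesgue[OF dcut_props(7)[OF A \<delta>]] 2 dcut_props(6)[OF A \<delta>], of b]
    show ?thesis using ibp by blast
  qed
  have d: "dcut A \<delta> x * divergence \<Phi> x = (\<Sum>b\<in>Basis. (grad (?\<Phi> b) x \<bullet> b) * dcut A \<delta> x)" for x
    by (simp add: divergence_def grad_inner_Basis sum_distrib_left mult.commute)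
  have e: "indicator (msum A (ball 0 \<delta>)) x * (dgrad A x \<bullet> \<Phi> x) = - (\<Sum>b\<in>Basis. ?\<Phi> b x * (?g x \<bullet> b))" for x
    by (subst euclidean_inner) (simp add: sum_distrib_left sum_negf[symmetric] mult_ac)
  show "integrable lebesgue (\<lambda>x. dcut A \<delta> x * divergence \<Phi> x)" unfolding d using * by (intro Bochner_Integration.integrable_sum) blast
  show "integrable lebesgue (\<lambda>x. indicator (msum A (ball 0 \<delta>)) x * (dgrad A x \<bullet> \<Phi> x))"
    unfolding e using * by (intro Bochner_Integration.integrable_minus Bochner_Integration.integrable_sum) blast
  have "(\<integral>x. dcut A \<delta> x * divergence \<Phi> x \<partial>lebesgue) = (\<Sum>b\<in>Basis. (\<integral>x. (grad (?\<Phi> b) x \<bullet> b) * dcut A \<delta> x \<partial>lebesgue))"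
    unfolding d using * by (intro Bochner_Integration.integral_sum) blast
  also have "\<dots> = - (\<Sum>b\<in>Basis. (\<integral>x. ?\<Phi> b x * (?g x \<bullet> b) \<partial>lebesgue))"
    using * by (simp add: sum_negf[symmetric])
  also have "\<dots> = - (\<integral>x. (\<Sum>b\<in>Basis. ?\<Phi> b x * (?g x \<bullet> b)) \<partial>lebesgue)"
    using * by (subst Bochner_Integration.integral_sum) blast+
  also have "\<dots> = (\<integral>x. indicator (msum A (ball 0 \<delta>)) x * (dgrad A x \<bullet> \<Phi> x) \<partial>lebesgue)"
    unfolding e by simp
  finally show "(\<integral>x. dcut A \<delta> x * divergence \<Phi> x \<partial>lebesgue) = (\<integral>x. indicator (msum A (ball 0 \<delta>)) x * (dgrad A x \<bullet> \<Phi> x) \<partial>lebesgue)" .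
qed

lemma cbody_homothety:
  fixes A :: "'a::euclidean_space set"
  assumes A: "cbody A" and l: "0 < l"
  shows "cbody ((\<lambda>x. l *\<^sub>R x + v) ` A)" "measure lebesgue ((\<lambda>x. l *\<^sub>R x + v) ` A) = l ^ DIM('a) * measure lebesgue A"
proof -
  have eq: "(\<lambda>x. l *\<^sub>R x + v) ` A = (+) v ` (*\<^sub>R) l ` A" by (auto simp: image_image add.commute)
  show "cbody ((\<lambda>x. l *\<^sub>R x + v) ` A)"
    unfolding eq using A l by (auto simp: cbody_def open_translation open_scaling bounded_translation bounded_scaling convex_translation convex_scaling)
  show "measure lebesgue ((\<lambda>x. l *\<^sub>R x + v) ` A) = l ^ DIM('a) * measure lebesgue A"
    using measure_lebesgue_affine[of l v A] l by (simp add: add.commute)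
qed

subsection \<open>Perimeter of convex sets\<close>

text \<open>Contracting towards the centre of an inscribed ball leaves room: the perturbation
  \<open>z\<close> is absorbed by moving the centre to \<open>c + (1 / (1 - l)) *\<^sub>R z\<close>,
  still in the inscribed ball.\<close>

lemma cbody_contraction_subset:
  fixes \<Omega> :: "'a::euclidean_space set"
  assumes \<Omega>: "convex \<Omega>" "ball c r \<subseteq> \<Omega>" and l: "0 < l" "l < 1"
  shows "msum ((\<lambda>x. l *\<^sub>R x + (1 - l) *\<^sub>R c) ` \<Omega>) (ball 0 ((1 - l) * r)) \<subseteq> \<Omega>"
proof
  fix y assume "y \<in> msum ((\<lambda>x. l *\<^sub>R x + (1 - l) *\<^sub>R c) ` \<Omega>) (ball 0 ((1 - l) * r))"
  then obtain x z where xz: "x \<in> \<Omega>" "norm z < (1 - l) * r" "y = l *\<^sub>R x + (1 - l) *\<^sub>R c + z"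
    by (auto simp: msum_def)
  have "norm ((1 / (1 - l)) *\<^sub>R z) < r" using xz(2) l by (simp add: field_simps)
  then have "c + (1 / (1 - l)) *\<^sub>R z \<in> \<Omega>" using \<Omega>(2) by (auto simp: dist_norm subset_iff)
  then have "l *\<^sub>R x + (1 - l) *\<^sub>R (c + (1 / (1 - l)) *\<^sub>R z) \<in> \<Omega>"
    using convexD[OF \<Omega>(1) xz(1), of _ l "1 - l"] l by simp
  then show "y \<in> \<Omega>" using l by (simp add: xz(3) scaleR_add_right add.assoc)
qed

lemma lmeasurable_closure_cbody: "cbody A \<Longrightarrow> closure A \<in> lmeasurable"
  by (simp add: cbody_def lmeasurable_compact compact_closure)

lemma test_field_component:
  assumes "test_field \<Phi>" "b \<in> Basis" shows "test_fun UNIV (\<lambda>x. \<Phi> x \<bullet> b)"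
proof (rule test_funI)
  show "smooth (\<lambda>x. \<Phi> x \<bullet> b)" "compact (tsupport \<Phi>)" using assms by (auto simp: test_field_def)
  show "x \<notin> tsupport \<Phi> \<Longrightarrow> \<Phi> x \<bullet> b = 0" for x using tsupport_outside[of x \<Phi>] by simp
qed simp

lemma divergence_test_fun:
  fixes \<Phi> :: "'a::euclidean_space \<Rightarrow> 'a"
  assumes "test_field \<Phi>" shows "test_fun UNIV (divergence \<Phi>)"
proof -
  have "test_fun UNIV (\<lambda>x. \<Sum>b\<in>I. pd (\<lambda>y. \<Phi> y \<bullet> b) b x)" if "I \<subseteq> Basis" "finite I" for I :: "'a set"
    using that(2,1)
  proof (induction I)
    case empty then show ?case by (simp add: test_fun_0)
  next
    case (insert b I)
    then show ?case using test_fun_add[OF test_fun_pd[OF test_field_component[OF assms, of b], of b], of "\<lambda>x. \<Sum>b\<in>I. pd (\<lambda>y. \<Phi> y \<bullet> b) b x"] by simp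
  qed
  then show ?thesis by (simp add: divergence_def[abs_def])
qed

lemma integrable_indicator_bounded:
  fixes f :: "'a::euclidean_space \<Rightarrow> real"
  assumes "f \<in> borel_measurable lebesgue" "\<And>x. \<bar>f x\<bar> \<le> B" "A \<in> lmeasurable"
  shows "integrable lebesgue (\<lambda>x. indicator A x * f x)"
proof (rule Bochner_Integration.integrable_bound)
  show "integrable lebesgue (\<lambda>x. B * indicator A x)"
    using assms(3) by (intro integrable_mult_right integrable_real_indicator) (auto simp: fmeasurable_def)
  show "AE x in lebesgue. norm (indicator A x * f x) \<le> norm (B * indicator A x)"
    using order_trans[OF assms(2) abs_ge_self] by (intro AE_I2) (auto simp: indicator_def)
qed (use assms(1,3) in \<open>auto intro: fmeasurableD\<close>)

text \<open>The indicator of \<open>\<Omega>\<close> is replaced by \<open>dcut\<close> of a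
  contraction whose neighbourhood stays inside \<open>\<Omega>\<close>; the flux is then at most the
  volume of the shell divided by its width. Besides bounding the perimeter by the inradius, this
  makes its defining supremum bounded above.\<close>

lemma flux_bound:
  fixes \<Omega> :: "'a::euclidean_space set"
  assumes \<Omega>: "cbody \<Omega>" and r: "0 < r" "ball c r \<subseteq> \<Omega>" and \<Phi>: "test_field \<Phi>" "\<And>x. norm (\<Phi> x) \<le> 1"
  shows "(\<integral>x. indicator \<Omega> x * divergence \<Phi> x \<partial>lebesgue) \<le> DIM('a) * measure lebesgue \<Omega> / r"
proof -
  let ?d = "real DIM('a)" and ?V = "measure lebesgue \<Omega>"
  let ?I = "\<integral>x. indicator \<Omega> x * divergence \<Phi> x \<partial>lebesgue"
  note dv = divergence_test_fun[OF \<Phi>(1)]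
  obtain C where C: "C \<ge> 0" "\<And>x. \<bar>divergence \<Phi> x\<bar> \<le> C" using test_fun_bounded[OF dv] by blast
  have dvm: "divergence \<Phi> \<in> borel_measurable lebesgue" using test_fun_borel[OF dv] by (rule borel_imp_lebesgue)
  have key: "?I \<le> (1 + C * e) * (?d * ?V / r)" if e: "0 < e" "e < r" for e
  proof -
    \<comment> \<open>Chosen so that the room left by the contraction, \<open>(1 - l) * r\<close>,
      equals the shell width \<open>e\<close>. Bernoulli's inequality then bounds the lost volume
      linearly in \<open>e\<close>.\<close>
    define l where "l = 1 - e / r"
    have l: "0 < l" "l < 1" "(1 - l) * r = e" using e r by (auto simp: l_def field_simps)
    define A where "A = (\<lambda>x. l *\<^sub>R x + (1 - l) *\<^sub>R c) ` \<Omega>"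
    have A: "cbody A" "measure lebesgue A = l ^ DIM('a) * ?V" unfolding A_def using cbody_homothety[OF \<Omega> l(1)] by auto
    let ?M = "msum A (ball 0 e)"
    have M: "?M \<subseteq> \<Omega>" using cbody_contraction_subset[OF _ r(2) l(1,2)] \<Omega> l(3) by (simp add: A_def cbody_def)
    have AM: "closure A \<subseteq> ?M" using e(1) by (rule cbody_subset_msum)
    have Mm: "?M \<in> lmeasurable" "closure A \<in> lmeasurable" "\<Omega> \<in> lmeasurable" "\<Omega> - closure A \<in> lmeasurable"
      by (intro cbody_lmeasurable lmeasurable_closure_cbody fmeasurable.Diff cbody_msum_ball A(1) e(1) \<Omega>)+
    have vol: "measure lebesgue (\<Omega> - closure A) = ?V - measure lebesgue A"
      using measurable_measure_Diff[OF Mm(3) fmeasurableD[OF Mm(2)]] M AM unfolding measure_closure_cbody[OF A(1)] by blast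
    have "1 + ?d * (l - 1) \<le> l ^ DIM('a)" using Bernoulli_inequality[of "l - 1" "DIM('a)"] l by simp
    then have "?V - measure lebesgue A \<le> ?d * (1 - l) * ?V"
      using mult_right_mono[of "1 + ?d * (l - 1)" "l ^ DIM('a)" ?V] by (simp add: A(2) algebra_simps)
    then have vol2: "measure lebesgue (\<Omega> - closure A) \<le> e * (?d * ?V / r)" using vol e r by (simp add: l_def mult_ac)
    have comp: "smooth (\<lambda>x. \<Phi> x \<bullet> b)" if "b \<in> Basis" for b using \<Phi>(1) that by (simp add: test_field_def)
    note ibp = dcut_ibp[OF A(1) e(1) comp]
    have i1: "integrable lebesgue (\<lambda>x. indicator \<Omega> x * divergence \<Phi> x)" by (rule integrable_indicator_bounded[OF dvm C(2) Mm(3)])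
    have i2: "integrable lebesgue (indicator (\<Omega> - closure A) :: 'a \<Rightarrow> real)" using Mm(4) by (intro integrable_real_indicator) (auto simp: fmeasurable_def)
    \<comment> \<open>Both integrands agree on the closure of \<open>A\<close> and vanish outside
      \<open>\<Omega>\<close>, so the error lives on the thin shell and is of second order in
      \<open>e\<close>.\<close>
    have "e * ?I - (\<integral>x. dcut A e x * divergence \<Phi> x \<partial>lebesgue) = (\<integral>x. e * (indicator \<Omega> x * divergence \<Phi> x) - dcut A e x * divergence \<Phi> x \<partial>lebesgue)"
      using i1 ibp(2) by simp
    also have "\<dots> \<le> (\<integral>x. e * C * indicator (\<Omega> - closure A) x \<partial>lebesgue)"
    proof (rule integral_mono)
      fix x
      have *: "0 \<le> dcut A e x" "dcut A e x \<le> e" using dcut_props(2,3)[OF A(1) e(1)] by auto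
      consider "x \<notin> \<Omega>" | "x \<in> closure A" | "x \<in> \<Omega> - closure A" by blast
      then show "e * (indicator \<Omega> x * divergence \<Phi> x) - dcut A e x * divergence \<Phi> x \<le> e * C * indicator (\<Omega> - closure A) x"
      proof cases
        case 1
        then have "x \<notin> ?M" using M by blast
        then show ?thesis using dcut_props(4)[OF A(1) e(1), of x] 1 by simp
      next
        case 2
        then have "infdist x A = 0" using A(1) by (simp add: infdist_zero_iff cbody_def)
        then have "dcut A e x = e" using e by (simp add: dcut_def)
        moreover have "x \<in> \<Omega>" using 2 AM M by blast
        ultimately show ?thesis using 2 by simp
      next
        case 3
        then have "e * (indicator \<Omega> x * divergence \<Phi> x) - dcut A e x * divergence \<Phi> x = (e - dcut A e x) * divergence \<Phi> x" by (simp add: left_diff_distrib)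
        also have "\<dots> \<le> (e - dcut A e x) * C" using C(2)[of x] * by (intro mult_left_mono) auto
        also have "\<dots> \<le> e * C" using * C(1) by (intro mult_right_mono) auto
        finally show ?thesis using 3 by simp
      qed
    qed (use i1 i2 ibp(2) in auto)
    also have "\<dots> = e * C * measure lebesgue (\<Omega> - closure A)" using Mm(4) by simp
    finally have 1: "e * ?I \<le> (\<integral>x. dcut A e x * divergence \<Phi> x \<partial>lebesgue) + e * C * measure lebesgue (\<Omega> - closure A)" by simp
    have "(\<integral>x. indicator ?M x * (dgrad A x \<bullet> \<Phi> x) \<partial>lebesgue) \<le> (\<integral>x. indicator (\<Omega> - closure A) x \<partial>lebesgue)"
    proof (rule integral_mono[OF ibp(3) i2])
      fix x
      have "dgrad A x \<bullet> \<Phi> x \<le> norm (dgrad A x) * norm (\<Phi> x)" by (rule norm_cauchy_schwarz)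
      also have "\<dots> \<le> norm (dgrad A x) * 1" using \<Phi>(2) by (intro mult_left_mono) auto
      finally have "dgrad A x \<bullet> \<Phi> x \<le> (if x \<in> closure A then 0 else 1)" using A(1) by (simp add: norm_dgrad cbody_def)
      then show "indicator ?M x * (dgrad A x \<bullet> \<Phi> x) \<le> indicator (\<Omega> - closure A) x"
        using M by (auto simp: indicator_def split: if_splits)
    qed
    then have "(\<integral>x. dcut A e x * divergence \<Phi> x \<partial>lebesgue) \<le> measure lebesgue (\<Omega> - closure A)"
      using ibp(1) Mm(4) by simp
    with 1 have "e * ?I \<le> (1 + e * C) * measure lebesgue (\<Omega> - closure A)" by (simp add: algebra_simps)
    also have "\<dots> \<le> (1 + e * C) * (e * (?d * ?V / r))" using vol2 e C by (intro mult_left_mono) auto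
    finally have "e * ?I \<le> e * ((1 + C * e) * (?d * ?V / r))" by (simp add: mult_ac)
    then show ?thesis by (rule mult_left_le_imp_le) (rule e(1))
  qed
  have "eventually (\<lambda>e. ?I \<le> (1 + C * e) * (?d * ?V / r)) (at_right 0)"
    unfolding eventually_at_right_field using key r by (intro exI[of _ r]) auto
  moreover have "((\<lambda>e. (1 + C * e) * (?d * ?V / r)) \<longlongrightarrow> (1 + C * 0) * (?d * ?V / r)) (at_right 0)"
    by (intro tendsto_intros)
  ultimately have "?I \<le> (1 + C * 0) * (?d * ?V / r)" by (intro tendsto_lowerbound[where F="at_right (0::real)"]) auto
  then show ?thesis by simp
qed

lemma test_field_0: "test_field (\<lambda>x. 0)"
  by (simp add: test_field_def smooth_const tsupport_def)

lemma cbody_ball_subset: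
  assumes "cbody \<Omega>" obtains c r where "0 < r" "ball c r \<subseteq> \<Omega>"
  using assms unfolding cbody_def by (metis ex_in_conv openE)

lemma perimeter_ge:
  assumes \<Omega>: "cbody \<Omega>" and \<Phi>: "test_field \<Phi>" "\<And>x. norm (\<Phi> x) \<le> 1"
  shows "(\<integral>x. indicator \<Omega> x * divergence \<Phi> x \<partial>lebesgue) \<le> perimeter \<Omega>"
  unfolding perimeter_def
proof (rule cSup_upper)
  obtain c r where r: "0 < r" "ball c r \<subseteq> \<Omega>" using cbody_ball_subset[OF \<Omega>] by blast
  show "bdd_above {\<integral>x. indicator \<Omega> x * divergence \<Phi> x \<partial>lebesgue | \<Phi>. test_field \<Phi> \<and> (\<forall>x. norm (\<Phi> x) \<le> 1)}"
    using flux_bound[OF \<Omega> r] by (intro bdd_aboveI) blast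
qed (use \<Phi> in blast)

lemma perimeter_le_inradius:
  fixes \<Omega> :: "'a::euclidean_space set"
  assumes \<Omega>: "cbody \<Omega>" and r: "0 < r" "ball c r \<subseteq> \<Omega>"
  shows "perimeter \<Omega> \<le> DIM('a) * measure lebesgue \<Omega> / r"
  unfolding perimeter_def
proof (rule cSup_least)
  show "{\<integral>x. indicator \<Omega> x * divergence \<Phi> x \<partial>lebesgue | \<Phi>. test_field \<Phi> \<and> (\<forall>x. norm (\<Phi> x) \<le> 1)} \<noteq> {}"
    using test_field_0 by fastforce
qed (use flux_bound[OF \<Omega> r] in blast)

section \<open>Parallel volumes as lower bounds for the perimeter\<close>

lemma convex_tangent:
  fixes f :: "'a::euclidean_space \<Rightarrow> real"
  assumes f: "convex_on UNIV f" "(f has_derivative f') (at x)"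
  shows "f' h \<le> f (x + h) - f x"
proof -
  have "((\<lambda>t. f (x + t *\<^sub>R h)) has_derivative (\<lambda>t. f' (t *\<^sub>R h))) (at 0)"
    by (rule has_derivative_compose[where g=f and f="\<lambda>t. x + t *\<^sub>R h"]) (auto intro!: derivative_eq_intros f)
  moreover have "(\<lambda>t. f' (t *\<^sub>R h)) = (*) (f' h)" by (auto simp: fun_eq_iff linear_cmul[OF has_derivative_linear[OF f(2)]])
  ultimately have "((\<lambda>t. f (x + t *\<^sub>R h)) has_real_derivative f' h) (at 0)" by (simp only: has_field_derivative_def)
  then have "((\<lambda>t. (f (x + t *\<^sub>R h) - f x) / t) \<longlongrightarrow> f' h) (at_right 0)"
    by (auto simp: has_field_derivative_iff intro: tendsto_within_subset)
  moreover have "eventually (\<lambda>t. (f (x + t *\<^sub>R h) - f x) / t \<le> f (x + h) - f x) (at_right 0)"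
    unfolding eventually_at_right_field
  proof (intro exI[of _ 1] conjI allI impI)
    fix t :: real assume t: "0 < t" "t < 1"
    have "x + t *\<^sub>R h = (1 - t) *\<^sub>R x + t *\<^sub>R (x + h)" by (simp add: algebra_simps)
    then have "f (x + t *\<^sub>R h) \<le> (1 - t) * f x + t * f (x + h)" using convex_onD[OF f(1), of t x "x + h"] t by simp
    then have "f (x + t *\<^sub>R h) - f x \<le> (f (x + h) - f x) * t" by (simp add: algebra_simps)
    then show "(f (x + t *\<^sub>R h) - f x) / t \<le> f (x + h) - f x" using t by (simp only: divide_le_eq if_True)
  qed simp
  ultimately show ?thesis by (intro tendsto_upperbound[where F="at_right (0::real)"]) auto
qed

text \<open>Adding the tangent inequalities at \<open>x\<close> and at
  \<open>x + t *\<^sub>R b\<close> shows that the directional derivative is monotone.\<close>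

lemma convex_second_derivative_nonneg:
  fixes f :: "'a::euclidean_space \<Rightarrow> real"
  assumes f: "convex_on UNIV f" "smooth f"
  shows "0 \<le> pd (pd f b) b x"
proof -
  note D = smooth_has_derivative[OF f(2)]
  have "((\<lambda>t. pd f b (x + t *\<^sub>R b)) has_derivative (\<lambda>t. frechet_derivative (pd f b) (at x) (t *\<^sub>R b))) (at 0)"
    using smooth_has_derivative[OF smooth_pd[OF f(2)]]
    by (intro has_derivative_compose[where g="pd f b" and f="\<lambda>t. x + t *\<^sub>R b"]) (auto intro!: derivative_eq_intros)
  moreover have "(\<lambda>t. frechet_derivative (pd f b) (at x) (t *\<^sub>R b)) = (*) (pd (pd f b) b x)"
    using linear_cmul[OF has_derivative_linear[OF smooth_has_derivative[OF smooth_pd[OF f(2)]]]] by (auto simp: fun_eq_iff pd_def[of "pd f b"])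
  ultimately have "((\<lambda>t. pd f b (x + t *\<^sub>R b)) has_real_derivative pd (pd f b) b x) (at 0)" by (simp only: has_field_derivative_def)
  then have "((\<lambda>t. (pd f b (x + t *\<^sub>R b) - pd f b x) / t) \<longlongrightarrow> pd (pd f b) b x) (at_right 0)"
    by (auto simp: has_field_derivative_iff intro: tendsto_within_subset)
  moreover have "eventually (\<lambda>t. 0 \<le> (pd f b (x + t *\<^sub>R b) - pd f b x) / t) (at_right 0)"
    unfolding eventually_at_right_field
  proof (intro exI[of _ 1] conjI allI impI)
    fix t :: real assume t: "0 < t" "t < 1"
    have "t * pd f b x \<le> f (x + t *\<^sub>R b) - f x"
      using convex_tangent[OF f(1) D, of x "t *\<^sub>R b"] linear_cmul[OF has_derivative_linear[OF D]] by (simp add: pd_def)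
    moreover have "- t * pd f b (x + t *\<^sub>R b) \<le> f x - f (x + t *\<^sub>R b)"
      using convex_tangent[OF f(1) D, of "x + t *\<^sub>R b" "(- t) *\<^sub>R b"] linear_cmul[OF has_derivative_linear[OF D], of _ "- t"] by (simp add: pd_def)
    ultimately have "t * pd f b x \<le> t * pd f b (x + t *\<^sub>R b)" by linarith
    then show "0 \<le> (pd f b (x + t *\<^sub>R b) - pd f b x) / t" using t by simp
  qed simp
  ultimately show ?thesis by (intro tendsto_lowerbound[where F="at_right (0::real)"]) auto
qed

lemma exists_cutoff:
  assumes "0 < R"
  obtains \<theta> :: "'a::euclidean_space \<Rightarrow> real" where "test_fun UNIV \<theta>" "\<And>x. norm x < R \<Longrightarrow> \<theta> x = 1" "\<And>x. 0 \<le> \<theta> x" "\<And>x. \<theta> x \<le> 1"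
proof -
  obtain \<eta> :: "'a \<Rightarrow> real" where m: "mollifier 1 \<eta>" using mollifier_exists[of 1] by auto
  let ?g = "indicator (ball 0 (R + 1)) :: 'a \<Rightarrow> real"
  have g: "loc_integrable ?g"
    by (intro loc_integrable_integrable integrable_real_indicator) (auto simp: emeasure_lborel_ball_finite[simplified])
  have 1: "0 \<le> conv ?g \<eta> x" "conv ?g \<eta> x \<le> 1" for x by (rule conv_ge[OF g m] conv_le[OF g m], simp add: indicator_def)+
  have 2: "conv ?g \<eta> x = 1" if "norm x < R" for x
  proof (rule antisym[OF 1(2)], rule conv_ge[OF g m])
    fix y assume "norm (x - y) < 1"
    then have "norm y < R + 1" using that norm_triangle_ineq4[of x "x - y"] by simp
    then show "1 \<le> ?g y" by simp
  qed
  have "test_fun UNIV (conv ?g \<eta>)"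
  proof (rule test_funI)
    show "smooth (conv ?g \<eta>)" using g mollifierD(1)[OF m] by (rule smooth_conv)
    show "compact (cball (0::'a) (R + 2))" by simp
    fix x :: 'a assume x: "x \<notin> cball 0 (R + 2)"
    show "conv ?g \<eta> x = 0"
    proof (rule conv_eq_0)
      fix y assume "norm (x - y) < 1"
      then have "norm y > R + 1" using x norm_triangle_ineq[of "x - y" y] by simp
      then show "?g y = 0" by simp
    qed (rule mollifierD(3)[OF m])
  qed simp
  then show thesis using 1 2 that by blast
qed

lemma pd_cong_open:
  assumes "open S" "x \<in> S" "\<And>y. y \<in> S \<Longrightarrow> f y = g y" "f differentiable (at x)"
  shows "pd g b x = pd f b x"
proof -
  have "(f has_derivative frechet_derivative f (at x)) (at x)" using assms(4) frechet_derivative_works by blast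
  then have "(g has_derivative frechet_derivative f (at x)) (at x)"
    by (rule has_derivative_transform_within_open[OF _ assms(1,2)]) (rule assms(3))
  then show ?thesis by (simp add: pd_def frechet_derivative_at[symmetric])
qed

lemma norm_grad_lipschitz_le:
  fixes f :: "'a::euclidean_space \<Rightarrow> real"
  assumes "1-lipschitz_on UNIV f" "(f has_derivative (\<lambda>h. g \<bullet> h)) (at x)"
  shows "norm g \<le> 1"
proof -
  have "\<bar>g \<bullet> g\<bar> \<le> 1 * norm g" using lipschitz_derivative_le[OF assms(1) _ assms(2), of g] by simp
  then have "norm g * norm g \<le> 1 * norm g" by (simp add: power2_norm_eq_inner[symmetric] power2_eq_square)
  then show ?thesis by (cases "norm g = 0") auto
qed

text \<open>The parallel sets decrease to the closure, and the frontier of a convex set is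
  null.\<close>

lemma measure_parallel_tendsto:
  assumes A: "cbody A"
  shows "(\<lambda>n. measure lebesgue (msum A (ball 0 (1 / real (Suc n))))) \<longlonglongrightarrow> measure lebesgue A"
proof -
  have A': "A \<noteq> {}" using A by (simp add: cbody_def)
  let ?M = "\<lambda>n. msum A (ball 0 (1 / real (Suc n)))"
  have M: "?M n \<in> lmeasurable" for n using cbody_msum_ball[OF A] by (intro cbody_lmeasurable) simp
  have "(\<lambda>n. measure lebesgue (?M n)) \<longlonglongrightarrow> measure lebesgue (\<Inter>n. ?M n)"
  proof (rule Lim_measure_decseq)
    show "range ?M \<subseteq> sets lebesgue" using M by auto
    show "decseq ?M" unfolding decseq_def by (intro allI impI msum_mono subset_ball) (auto simp: frac_le)
    show "emeasure lebesgue (?M n) \<noteq> \<infinity>" for n using M[of n] by (auto simp: fmeasurable_def)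
  qed
  also have "(\<Inter>n. ?M n) = closure A"
  proof (intro equalityI subsetI)
    fix x assume "x \<in> (\<Inter>n. ?M n)"
    then have *: "infdist x A < 1 / real (Suc n)" for n using infdist_less_iff[OF A'] by auto
    have "\<not> 0 < infdist x A" using reals_Archimedean[of "infdist x A"] * by (metis inverse_eq_divide less_asym)
    then show "x \<in> closure A" using infdist_pos_iff[OF A'] by simp
  next
    fix x assume "x \<in> closure A"
    then show "x \<in> (\<Inter>n. ?M n)" using cbody_subset_msum[of _ A] by (auto intro!: subsetD[OF cbody_subset_msum])
  qed
  finally show ?thesis unfolding measure_closure_cbody[OF A] .
qed

text \<open>The test field is the gradient of the mollified distance to \<open>A\<close>. It has
  norm at most 1 and nonnegative divergence, and in the shell around \<open>A\<close> it nearly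
  agrees with the outer normal \<open>dgrad A\<close>, so its averaged flux is nearly the volume of
  the shell over \<delta>.\<close>

lemma perimeter_ge_parallel:
  fixes \<Omega> A :: "'a::euclidean_space set"
  assumes \<Omega>: "cbody \<Omega>" and A: "cbody A" and \<delta>: "0 < \<delta>" and sub: "msum A (ball 0 \<delta>) \<subseteq> \<Omega>"
  shows "measure lebesgue (msum A (ball 0 \<delta>)) - measure lebesgue A \<le> \<delta> * perimeter \<Omega>"
proof -
  have A': "A \<noteq> {}" "convex A" using A by (auto simp: cbody_def)
  define W where "W s = measure lebesgue (msum A (ball 0 s))" for s
  let ?g = "\<lambda>x. infdist x A"
  have gl: "1-lipschitz_on UNIV ?g" by (rule infdist_lipschitz)
  have gc: "continuous_on UNIV ?g" using gl by (rule lipschitz_on_continuous_on)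
  have gli: "loc_integrable ?g" using gc by (rule loc_integrable_continuous)
  \<comment> \<open>Mollifying at radius \<open>s\<^sup>2\<close> moves the distance by at most
    \<open>s\<^sup>2\<close>, while slopes are measured over a step of length \<open>s\<close>; this
    leaves a normal slope of at least \<open>1 - 2 * s\<close> at distance \<open>s\<close> or more
    from \<open>A\<close>. The inner shell of width \<open>s\<close> is charged with the worst sign
    and shrinks away with \<open>s\<close>.\<close>
  have key: "(1 - 2 * s) * (W \<delta> - W s) - (W s - measure lebesgue A) \<le> \<delta> * perimeter \<Omega>" if s: "0 < s" "s < \<delta>" for s
  proof -
    obtain \<eta> :: "'a \<Rightarrow> real" where m: "mollifier (s\<^sup>2) \<eta>" using mollifier_exists[of "s\<^sup>2"] s by auto
    define f where "f = conv ?g \<eta>"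
    have fs: "smooth f" unfolding f_def using gli mollifierD(1)[OF m] by (rule smooth_conv)
    have fc: "convex_on UNIV f" unfolding f_def by (rule conv_convex[OF gc convex_on_infdist[OF A'(2,1)] m])
    have fl: "1-lipschitz_on UNIV f" unfolding f_def by (rule conv_lipschitz[OF gl m])
    have fg: "f x \<le> ?g x + s\<^sup>2" "?g x - s\<^sup>2 \<le> f x" for x
      unfolding f_def using infdist_triangle_abs[of x A]
      by (auto intro!: conv_le[OF gli m] conv_ge[OF gli m] simp: dist_norm) (smt (verit))+
    note fD = smooth_has_derivative_grad[OF fs]
    have F1: "norm (grad f x) \<le> 1" for x by (rule norm_grad_lipschitz_le[OF fl fD])
    obtain R where R: "R > 0" "\<And>x. x \<in> \<Omega> \<Longrightarrow> norm x < R" using \<Omega> bounded_pos_less by (metis cbody_def)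
    obtain \<theta> :: "'a \<Rightarrow> real" where \<theta>: "test_fun UNIV \<theta>" "\<And>x. norm x < R \<Longrightarrow> \<theta> x = 1" "\<And>x. 0 \<le> \<theta> x" "\<And>x. \<theta> x \<le> 1"
      using exists_cutoff[OF R(1)] by blast
    \<comment> \<open>The cutoff supplies compact support. It equals 1 on an open ball containing
      \<open>\<Omega>\<close>, so the divergence there is unchanged.\<close>
    define \<Phi> where "\<Phi> x = \<theta> x *\<^sub>R grad f x" for x
    have Fb: "smooth (\<lambda>x. grad f x \<bullet> b)" if "b \<in> Basis" for b using smooth_pd[OF fs, of b] that by (simp add: grad_inner_Basis)
    have \<Phi>t: "test_field \<Phi>"
      unfolding test_field_def
    proof (intro conjI ballI)
      show "smooth (\<lambda>x. \<Phi> x \<bullet> b)" if "b \<in> Basis" for b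
        using smooth_mult[OF test_fun_smooth[OF \<theta>(1)] Fb[OF that]] by (simp add: \<Phi>_def)
      obtain C where "compact C" "\<And>x. x \<notin> C \<Longrightarrow> \<theta> x = 0" using \<theta>(1) by (rule test_funE) blast
      then show "compact (tsupport \<Phi>)" by (intro compact_tsupport[of C]) (auto simp: \<Phi>_def)
    qed
    have "norm (\<Phi> x) \<le> 1 * 1" for x
      unfolding \<Phi>_def norm_scaleR using \<theta>(3,4)[of x] F1[of x] by (intro mult_mono) auto
    then have P: "(\<integral>x. indicator \<Omega> x * divergence \<Phi> x \<partial>lebesgue) \<le> perimeter \<Omega>" by (intro perimeter_ge[OF \<Omega> \<Phi>t]) simp
    have div0: "0 \<le> divergence (grad f) x" for x
      unfolding divergence_def using convex_second_derivative_nonneg[OF fc fs] by (intro sum_nonneg) (simp add: grad_inner_Basis)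
    have div_eq: "divergence \<Phi> x = divergence (grad f) x" if "x \<in> \<Omega>" for x
      unfolding divergence_def
    proof (rule sum.cong)
      fix b :: 'a assume b: "b \<in> Basis"
      show "pd (\<lambda>y. \<Phi> y \<bullet> b) b x = pd (\<lambda>y. grad f y \<bullet> b) b x"
        by (rule pd_cong_open[of "ball 0 R"]) (use R \<theta>(2) that b in \<open>auto simp: \<Phi>_def intro: smooth_differentiable Fb\<close>)
    qed simp
    note ibp = dcut_ibp[OF A \<delta> Fb]
    obtain C where C: "\<And>x. \<bar>divergence \<Phi> x\<bar> \<le> C" using test_fun_bounded[OF divergence_test_fun[OF \<Phi>t]] by blast
    have iO: "integrable lebesgue (\<lambda>x. indicator \<Omega> x * divergence \<Phi> x)"
      by (rule integrable_indicator_bounded[OF borel_imp_lebesgue[OF test_fun_borel[OF divergence_test_fun[OF \<Phi>t]]] C cbody_lmeasurable[OF \<Omega>]])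
    \<comment> \<open>Here convexity pays off: since the divergence is nonnegative,
      \<open>dcut\<close> may be raised to the constant \<delta> on all of
      \<open>\<Omega>\<close>.\<close>
    have "(\<integral>x. dcut A \<delta> x * divergence (grad f) x \<partial>lebesgue) \<le> (\<integral>x. \<delta> * (indicator \<Omega> x * divergence \<Phi> x) \<partial>lebesgue)"
    proof (rule integral_mono[OF ibp(2)])
      fix x
      show "dcut A \<delta> x * divergence (grad f) x \<le> \<delta> * (indicator \<Omega> x * divergence \<Phi> x)"
      proof (cases "x \<in> \<Omega>")
        case True
        then show ?thesis using div_eq[OF True] div0[of x] dcut_props(3)[OF A \<delta>, of x] by (simp add: mult_right_mono)
      next
        case False
        then have "x \<notin> msum A (ball 0 \<delta>)" using sub by blast
        then show ?thesis using dcut_props(4)[OF A \<delta>, of x] False by simp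
      qed
    qed (use iO in auto)
    then have 1: "(\<integral>x. indicator (msum A (ball 0 \<delta>)) x * (dgrad A x \<bullet> grad f x) \<partial>lebesgue) \<le> \<delta> * perimeter \<Omega>"
      using ibp(1) P \<delta> by (simp add: mult_left_mono[OF P, of \<delta>] order_trans)
    let ?Md = "msum A (ball 0 \<delta>)" and ?Ms = "msum A (ball 0 s)"
    have ml: "?Md \<in> lmeasurable" "?Ms \<in> lmeasurable" "closure A \<in> lmeasurable"
      by (intro cbody_lmeasurable lmeasurable_closure_cbody cbody_msum_ball A \<delta> s(1))+
    have sub2: "?Ms \<subseteq> ?Md" "closure A \<subseteq> ?Ms"
      using msum_mono[OF order_refl[of A] subset_ball[of s \<delta> 0]] cbody_subset_msum[OF s(1), of A] s by simp_all
    have "(1 - 2 * s) * (W \<delta> - W s) - (W s - measure lebesgue A)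
       = (\<integral>x. (1 - 2 * s) * indicator (?Md - ?Ms) x - indicator (?Ms - closure A) x \<partial>lebesgue)"
    proof -
      have "integrable lebesgue (indicator (?Md - ?Ms) :: 'a \<Rightarrow> real)" "integrable lebesgue (indicator (?Ms - closure A) :: 'a \<Rightarrow> real)"
        using ml fmeasurable.Diff[of ?Md lebesgue ?Ms] fmeasurable.Diff[of ?Ms lebesgue "closure A"] by (auto intro!: integrable_real_indicator simp: fmeasurable_def)
      moreover have "measure lebesgue (?Md - ?Ms) = W \<delta> - W s" "measure lebesgue (?Ms - closure A) = W s - measure lebesgue A"
        by (simp_all only: W_def measurable_measure_Diff[OF ml(1) fmeasurableD[OF ml(2)] sub2(1)]
            measurable_measure_Diff[OF ml(2) fmeasurableD[OF ml(3)] sub2(2)] measure_closure_cbody[OF A])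
      ultimately show ?thesis using ml by (simp add: fmeasurable.Diff)
    qed
    also have "\<dots> \<le> (\<integral>x. indicator ?Md x * (dgrad A x \<bullet> grad f x) \<partial>lebesgue)"
    proof (rule integral_mono[OF _ ibp(3)])
      show "integrable lebesgue (\<lambda>x. (1 - 2 * s) * indicator (?Md - ?Ms) x - indicator (?Ms - closure A) x)"
        using ml fmeasurable.Diff[of ?Md lebesgue ?Ms] fmeasurable.Diff[of ?Ms lebesgue "closure A"]
        by (intro Bochner_Integration.integrable_diff integrable_mult_right integrable_real_indicator) (auto simp: fmeasurable_def)
      fix x
      consider "x \<notin> ?Md" | "x \<in> closure A" | "x \<in> ?Ms - closure A" | "x \<in> ?Md - ?Ms" by blast
      then show "(1 - 2 * s) * indicator (?Md - ?Ms) x - indicator (?Ms - closure A) x \<le> indicator ?Md x * (dgrad A x \<bullet> grad f x)"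
      proof cases
        case 1 then show ?thesis using sub2 by auto
      next
        case 2 then have "x \<in> ?Ms" "x \<in> ?Md" using sub2 by auto
        with 2 show ?thesis by (simp add: dgrad_def)
      next
        case 3
        have "\<bar>dgrad A x \<bullet> grad f x\<bar> \<le> norm (dgrad A x) * norm (grad f x)" by (rule Cauchy_Schwarz_ineq2)
        also have "\<dots> \<le> 1" using 3 F1[of x] A'(1) by (simp add: norm_dgrad)
        finally show ?thesis using 3 sub2 by auto
      next
        case 4
        then have sx: "s \<le> ?g x" using infdist_less_iff[OF A'(1), of x s] by auto
        then have xA: "x \<notin> closure A" using s infdist_pos_iff[OF A'(1), of x] by linarith
        define n p where "n = dgrad A x" and "p = closest_point (closure A) x"
        \<comment> \<open>Going back by \<open>s\<close> along the normal lowers the distance by at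
          least \<open>s\<close>; the tangent inequality for the convex \<open>f\<close> turns this
          drop into a lower bound for the normal component of its gradient.\<close>
        have "grad f x \<bullet> (- s *\<^sub>R n) \<le> f (x + (- s *\<^sub>R n)) - f x" by (rule convex_tangent[OF fc fD])
        then have a: "f x - f (x - s *\<^sub>R n) \<le> s * (n \<bullet> grad f x)" by (simp add: inner_commute)
        have "?g x > 0" using sx s by linarith
        then have "norm (x - p) \<noteq> 0" using infdist_closest[OF A'(1), of x] by (simp add: p_def dist_norm)
        then have "x - p = ?g x *\<^sub>R n" using xA infdist_closest[OF A'(1), of x] by (simp add: n_def p_def dgrad_def sgn_div_norm dist_norm)
        then have "x - s *\<^sub>R n - p = (?g x - s) *\<^sub>R n" by (simp add: algebra_simps)
        then have "dist (x - s *\<^sub>R n) p = ?g x - s" using sx xA A'(1) by (simp add: dist_norm norm_dgrad n_def)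
        moreover have "p \<in> closure A" unfolding p_def using A'(1) by (intro closest_point_in_set) auto
        ultimately have "?g (x - s *\<^sub>R n) \<le> ?g x - s" using infdist_le[of p "closure A" "x - s *\<^sub>R n"] by (simp add: infdist_closure)
        then have "s - 2 * s\<^sup>2 \<le> s * (n \<bullet> grad f x)" using a fg(1)[of "x - s *\<^sub>R n"] fg(2)[of x] by linarith
        then have "s * (1 - 2 * s) \<le> s * (n \<bullet> grad f x)" by (simp add: power2_eq_square algebra_simps)
        then have "1 - 2 * s \<le> n \<bullet> grad f x" using s by simp
        then show ?thesis using 4 by (simp add: n_def)
      qed
    qed
    finally show ?thesis using 1 by linarith
  qed
  have W: "(\<lambda>n. W (1 / real (Suc n))) \<longlonglongrightarrow> measure lebesgue A" unfolding W_def by (rule measure_parallel_tendsto[OF A])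
  have s0: "(\<lambda>n. 1 / real (Suc n)) \<longlonglongrightarrow> 0" using LIMSEQ_inverse_real_of_nat by (simp add: inverse_eq_divide)
  have "(\<lambda>n. (1 - 2 * (1 / real (Suc n))) * (W \<delta> - W (1 / real (Suc n))) - (W (1 / real (Suc n)) - measure lebesgue A))
     \<longlonglongrightarrow> (1 - 2 * 0) * (W \<delta> - measure lebesgue A) - (measure lebesgue A - measure lebesgue A)"
    by (intro tendsto_intros W s0)
  moreover have "eventually (\<lambda>n. (1 - 2 * (1 / real (Suc n))) * (W \<delta> - W (1 / real (Suc n))) - (W (1 / real (Suc n)) - measure lebesgue A) \<le> \<delta> * perimeter \<Omega>) sequentially"
    using order_tendstoD(2)[OF s0 \<delta>] by eventually_elim (rule key, auto)
  ultimately have "(1 - 2 * 0) * (W \<delta> - measure lebesgue A) - (measure lebesgue A - measure lebesgue A) \<le> \<delta> * perimeter \<Omega>"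
    by (intro tendsto_upperbound[where F=sequentially]) auto
  then show ?thesis by (simp add: W_def)
qed

lemma msum_homothety:
  assumes "0 < l"
  shows "msum ((\<lambda>x. l *\<^sub>R x + v) ` A) (ball 0 (l * e)) = (\<lambda>x. l *\<^sub>R x + v) ` msum A (ball 0 e)"
proof (intro equalityI subsetI)
  fix y assume "y \<in> msum ((\<lambda>x. l *\<^sub>R x + v) ` A) (ball 0 (l * e))"
  then obtain x z where xz: "x \<in> A" "norm z < l * e" "y = l *\<^sub>R x + v + z" by (auto simp: msum_def)
  have "norm ((1 / l) *\<^sub>R z) < e" using xz(2) assms by (simp add: field_simps)
  then have "x + (1 / l) *\<^sub>R z \<in> msum A (ball 0 e)" using xz(1) by (intro msumI) auto
  moreover have "y = l *\<^sub>R (x + (1 / l) *\<^sub>R z) + v" using assms by (simp add: xz(3) scaleR_add_right)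
  ultimately show "y \<in> (\<lambda>x. l *\<^sub>R x + v) ` msum A (ball 0 e)" by blast
next
  fix y assume "y \<in> (\<lambda>x. l *\<^sub>R x + v) ` msum A (ball 0 e)"
  then obtain x z where xz: "x \<in> A" "norm z < e" "y = l *\<^sub>R (x + z) + v" by (auto simp: msum_def)
  then have y: "y = (l *\<^sub>R x + v) + l *\<^sub>R z" by (simp add: scaleR_add_right)
  show "y \<in> msum ((\<lambda>x. l *\<^sub>R x + v) ` A) (ball 0 (l * e))"
    unfolding y by (rule msumI) (use xz assms in auto)
qed

text \<open>By Brunn-Minkowski the \<open>d\<close>-th root of the volume of the outer parallel sets is concave in the distance,
  and its slope at \<open>0\<close> is controlled by the perimeter.\<close>
lemma measure_parallel_le:
  fixes \<Omega> :: "'a::euclidean_space set"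
  assumes \<Omega>: "cbody \<Omega>" and t: "0 < t"
  shows "measure lebesgue (msum \<Omega> (ball 0 t)) \<le> measure lebesgue \<Omega> * (1 + t * perimeter \<Omega> / (DIM('a) * measure lebesgue \<Omega>)) ^ DIM('a)"
proof -
  let ?d = "DIM('a)" and ?m = "measure lebesgue :: 'a set \<Rightarrow> real"
  define v0 where "v0 = root ?d (?m \<Omega>)"
  define vt where "vt = root ?d (?m (msum \<Omega> (ball 0 t)))"
  define a where "a = (vt - v0) / t"
  have v0: "0 < v0" "v0 ^ ?d = ?m \<Omega>" unfolding v0_def using cbody_measure_pos[OF \<Omega>] by (auto simp: real_root_gt_zero)
  have vt: "vt ^ ?d = ?m (msum \<Omega> (ball 0 t))" unfolding vt_def by simp
  have vt_ge: "v0 \<le> vt" unfolding v0_def vt_def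
  proof (rule real_root_le_mono, simp, rule measure_mono_fmeasurable)
    show "\<Omega> \<subseteq> msum \<Omega> (ball 0 t)" using cbody_subset_msum[OF t] closure_subset by blast
  qed (use cbody_lmeasurable[OF cbody_msum_ball[OF \<Omega> t]] cbody_lmeasurable[OF \<Omega>] in auto)
  have a0: "0 \<le> a" using vt_ge t by (simp add: a_def)
  \<comment> \<open>For \<open>s = e / t\<close>, convexity puts \<open>(1 - s)\<close> times
    \<open>\<Omega>\<close> plus \<open>s\<close> times the parallel set at distance
    \<open>t\<close> inside the parallel set at distance \<open>e\<close>. Brunn-Minkowski then says
    that the root of the volume lies above its chord, whose slope is \<open>a\<close>.\<close>
  have bm: "v0 + e * a \<le> root ?d (?m (msum \<Omega> (ball 0 e)))" if e: "0 < e" "e < t" for e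
  proof -
    define s where "s = e / t"
    have s: "0 < s" "s < 1" using e by (auto simp: s_def)
    let ?A = "(\<lambda>x. (1 - s) *\<^sub>R x + 0) ` \<Omega>" and ?B = "(\<lambda>x. s *\<^sub>R x + 0) ` msum \<Omega> (ball 0 t)"
    have A: "cbody ?A" "?m ?A = (1 - s) ^ ?d * ?m \<Omega>" using cbody_homothety[OF \<Omega>, of "1 - s" 0] s by auto
    have B: "cbody ?B" "?m ?B = s ^ ?d * ?m (msum \<Omega> (ball 0 t))" using cbody_homothety[OF cbody_msum_ball[OF \<Omega> t] s(1), of 0] by auto
    have "v0 + e * a = (1 - s) * v0 + s * vt" using e by (simp add: s_def a_def field_simps)
    also have "\<dots> = root ?d (?m ?A) + root ?d (?m ?B)"
      unfolding A(2) B(2) using s by (simp add: real_root_mult real_root_power_cancel v0_def vt_def)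
    also have "\<dots> \<le> root ?d (?m (msum ?A ?B))"
      using A(1) B(1) by (intro brunn_minkowski_open) (auto simp: cbody_def)
    also have "\<dots> \<le> root ?d (?m (msum \<Omega> (ball 0 e)))"
    proof (rule real_root_le_mono, simp, rule measure_mono_fmeasurable)
      show "msum ?A ?B \<subseteq> msum \<Omega> (ball 0 e)"
      proof
        fix w assume "w \<in> msum ?A ?B"
        then obtain x y z where xyz: "x \<in> \<Omega>" "y \<in> \<Omega>" "norm z < t" "w = (1 - s) *\<^sub>R x + s *\<^sub>R (y + z)"
          by (auto simp: msum_def)
        have "(1 - s) *\<^sub>R x + s *\<^sub>R y \<in> \<Omega>" using convexD[of \<Omega> x y "1 - s" s] \<Omega> xyz s by (simp add: cbody_def)
        moreover have "norm (s *\<^sub>R z) < e" using xyz(3) s e by (simp add: s_def field_simps)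
        moreover have "w = ((1 - s) *\<^sub>R x + s *\<^sub>R y) + s *\<^sub>R z" by (simp add: xyz(4) scaleR_add_right)
        ultimately show "w \<in> msum \<Omega> (ball 0 e)" by (auto intro!: msumI)
      qed
      show "msum \<Omega> (ball 0 e) \<in> lmeasurable" using cbody_msum_ball[OF \<Omega> e(1)] by (rule cbody_lmeasurable)
      show "msum ?A ?B \<in> sets lebesgue" using A(1) B(1) by (intro fmeasurableD lmeasurable_msum) (auto simp: cbody_def)
    qed
    finally show ?thesis .
  qed
  obtain c r where r: "0 < r" "ball c r \<subseteq> \<Omega>" using cbody_ball_subset[OF \<Omega>] by blast
  \<comment> \<open>The perimeter estimate needs a parallel set inside \<open>\<Omega>\<close>, so
    everything is contracted by \<open>l\<close>. The value \<open>1 / (1 + e / r)\<close> solves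
    \<open>(1 - l) * r = l * e\<close>, and the factors \<open>l ^ DIM('a)\<close> and
    \<open>l\<close> disappear as \<open>e\<close> tends to 0.\<close>
  have key: "(1 / (1 + e / r)) ^ ?d * (?d * a * v0 ^ (?d - 1)) \<le> 1 / (1 + e / r) * perimeter \<Omega>" if e: "0 < e" "e < t" for e
  proof -
    define l where "l = 1 / (1 + e / r)"
    have l: "0 < l" "l < 1" "(1 - l) * r = l * e" using e r by (auto simp: l_def field_simps)
    let ?A = "(\<lambda>x. l *\<^sub>R x + (1 - l) *\<^sub>R c) ` \<Omega>"
    have A: "cbody ?A" "?m ?A = l ^ ?d * ?m \<Omega>" using cbody_homothety[OF \<Omega> l(1)] by auto
    have Me: "cbody (msum \<Omega> (ball 0 e))" using \<Omega> e(1) by (rule cbody_msum_ball)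
    have sub: "msum ?A (ball 0 (l * e)) \<subseteq> \<Omega>" using cbody_contraction_subset[OF _ r(2) l(1,2)] \<Omega> l(3) by (simp add: cbody_def)
    have "?m (msum ?A (ball 0 (l * e))) - ?m ?A \<le> l * e * perimeter \<Omega>"
      by (rule perimeter_ge_parallel[OF \<Omega> A(1) _ sub]) (use l e in simp)
    also have "?m (msum ?A (ball 0 (l * e))) = l ^ ?d * ?m (msum \<Omega> (ball 0 e))"
      unfolding msum_homothety[OF l(1)] using cbody_homothety(2)[OF Me l(1)] .
    finally have 1: "l ^ ?d * (?m (msum \<Omega> (ball 0 e)) - ?m \<Omega>) \<le> l * e * perimeter \<Omega>" unfolding A(2) by (simp only: right_diff_distrib)
    have "(v0 + e * a) ^ ?d \<le> root ?d (?m (msum \<Omega> (ball 0 e))) ^ ?d"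
      using bm[OF e] v0 a0 e by (intro power_mono) auto
    also have "\<dots> = ?m (msum \<Omega> (ball 0 e))" by simp
    finally have "(v0 + e * a) ^ ?d \<le> ?m (msum \<Omega> (ball 0 e))" .
    moreover have "v0 ^ ?d + e * (?d * a * v0 ^ (?d - 1)) \<le> (v0 + e * a) ^ ?d"
    proof -
      have "v0 ^ ?d * (1 + real ?d * (e * a / v0)) \<le> v0 ^ ?d * (1 + e * a / v0) ^ ?d"
        using v0 a0 e by (intro mult_left_mono Bernoulli_inequality) (auto intro: order_trans[of _ 0])
      also have "\<dots> = (v0 * (1 + e * a / v0)) ^ ?d" by (simp only: power_mult_distrib)
      also have "v0 * (1 + e * a / v0) = v0 + e * a" using v0(1) by (simp add: distrib_left)
      also have "v0 ^ ?d * (1 + real ?d * (e * a / v0)) = v0 ^ ?d + e * (?d * a * v0 ^ (?d - 1))"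
        using v0(1) by (simp add: power_eq_if[of v0 ?d] field_simps)
      finally show ?thesis .
    qed
    ultimately have "e * (?d * a * v0 ^ (?d - 1)) \<le> ?m (msum \<Omega> (ball 0 e)) - ?m \<Omega>" using v0(2) by linarith
    then have "l ^ ?d * (e * (?d * a * v0 ^ (?d - 1))) \<le> l * e * perimeter \<Omega>"
      using 1 l by (meson mult_left_mono order_trans zero_le_power less_imp_le)
    then have "e * (l ^ ?d * (?d * a * v0 ^ (?d - 1))) \<le> e * (l * perimeter \<Omega>)" by (simp add: mult_ac)
    then show ?thesis unfolding l_def by (rule mult_left_le_imp_le) (rule e(1))
  qed
  have "eventually (\<lambda>e. (1 / (1 + e / r)) ^ ?d * (?d * a * v0 ^ (?d - 1)) \<le> 1 / (1 + e / r) * perimeter \<Omega>) (at_right 0)"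
    unfolding eventually_at_right_field using key t by (intro exI[of _ t]) auto
  moreover have "((\<lambda>e. (1 / (1 + e / r)) ^ ?d * (?d * a * v0 ^ (?d - 1))) \<longlongrightarrow> (1 / (1 + 0 / r)) ^ ?d * (?d * a * v0 ^ (?d - 1))) (at_right 0)"
    by (intro tendsto_intros) (use r in auto)
  moreover have "((\<lambda>e. 1 / (1 + e / r) * perimeter \<Omega>) \<longlongrightarrow> 1 / (1 + 0 / r) * perimeter \<Omega>) (at_right 0)"
    by (intro tendsto_intros) (use r in auto)
  ultimately have "(1 / (1 + 0 / r)) ^ ?d * (?d * a * v0 ^ (?d - 1)) \<le> 1 / (1 + 0 / r) * perimeter \<Omega>"
    by (intro tendsto_le[where F="at_right (0::real)"]) auto
  \<comment> \<open>The right-hand side is the derivative of the \<open>d\<close>-th root of the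
    volume when the volume grows at rate \<open>perimeter \<Omega>\<close>. The chord slope
    \<open>a\<close> obeys the same bound, which is the claim at distance \<open>t\<close> after
    taking powers.\<close>
  then have "a \<le> perimeter \<Omega> / (?d * v0 ^ (?d - 1))" using v0 by (simp add: field_simps)
  then have "vt \<le> v0 + t * (perimeter \<Omega> / (?d * v0 ^ (?d - 1)))" using t by (simp add: a_def field_simps)
  also have "\<dots> = v0 * (1 + t * perimeter \<Omega> / (?d * ?m \<Omega>))"
    using v0(1) by (simp add: v0(2)[symmetric] power_eq_if[of v0 ?d] field_simps)
  finally have "vt ^ ?d \<le> (v0 * (1 + t * perimeter \<Omega> / (?d * ?m \<Omega>))) ^ ?d"
    using vt_ge v0 by (intro power_mono) auto
  then show ?thesis by (simp add: vt power_mult_distrib v0(2))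
qed

subsection \<open>Layer cake\<close>

text \<open>The primitive of \<open>w\<close> from 0, which is 0 for nonpositive arguments. Taking
  values in \<open>ennreal\<close> makes the layer cake formula an instance of Tonelli, with no
  integrability to check.\<close>

definition layer :: "(real \<Rightarrow> real) \<Rightarrow> real \<Rightarrow> ennreal" where
  "layer w s = (\<integral>\<^sup>+t. (if 0 \<le> t \<and> t < s then ennreal (w t) else 0) \<partial>lborel)"

lemma layer_borel:
  assumes [measurable]: "w \<in> borel_measurable borel" shows "layer w \<in> borel_measurable borel"
  unfolding layer_def[abs_def] by measurable

lemma layer_cake:
  fixes f :: "'a::euclidean_space \<Rightarrow> real"
  assumes [measurable]: "f \<in> borel_measurable borel" "w \<in> borel_measurable borel"
  shows "(\<integral>\<^sup>+x. layer w (f x) \<partial>lborel) = (\<integral>\<^sup>+t. (if 0 \<le> t then ennreal (w t) * emeasure lborel {x. t < f x} else 0) \<partial>lborel)"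
proof -
  have "(\<integral>\<^sup>+x. layer w (f x) \<partial>lborel) = (\<integral>\<^sup>+t. (\<integral>\<^sup>+x. (if 0 \<le> t \<and> t < f x then ennreal (w t) else 0) \<partial>lborel) \<partial>lborel)"
    unfolding layer_def by (rule lborel_pair.Fubini') measurable
  also have "\<dots> = (\<integral>\<^sup>+t. (if 0 \<le> t then ennreal (w t) * emeasure lborel {x. t < f x} else 0) \<partial>lborel)"
  proof (rule nn_integral_cong)
    fix t
    have S: "{x. t < f x} \<in> sets lborel" by measurable
    have "(\<integral>\<^sup>+x. (if 0 \<le> t \<and> t < f x then ennreal (w t) else 0) \<partial>lborel)
       = (\<integral>\<^sup>+x. (if 0 \<le> t then ennreal (w t) else 0) * indicator {x. t < f x} x \<partial>lborel)"
      by (rule nn_integral_cong) (auto simp: indicator_def)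
    also have "\<dots> = (if 0 \<le> t then ennreal (w t) else 0) * emeasure lborel {x. t < f x}"
      using S by (rule nn_integral_cmult_indicator)
    finally show "(\<integral>\<^sup>+x. (if 0 \<le> t \<and> t < f x then ennreal (w t) else 0) \<partial>lborel)
       = (if 0 \<le> t then ennreal (w t) * emeasure lborel {x. t < f x} else 0)" by simp
  qed
  finally show ?thesis .
qed

lemma layer_le_0: "s \<le> 0 \<Longrightarrow> layer w s = 0"
proof -
  assume "s \<le> 0"
  then have "(\<lambda>t. if 0 \<le> t \<and> t < s then ennreal (w t) else 0) = (\<lambda>t. 0)" by (auto simp: fun_eq_iff)
  then show ?thesis by (simp add: layer_def)
qed

lemma layer_eq_FTC:
  fixes F w :: "real \<Rightarrow> real"
  assumes w: "w \<in> borel_measurable borel" and F: "\<And>t. 0 \<le> t \<Longrightarrow> (F has_real_derivative w t) (at t)"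
    and nn: "\<And>t. 0 \<le> t \<Longrightarrow> t \<le> s \<Longrightarrow> 0 \<le> w t" and s: "0 \<le> s"
  shows "layer w s = ennreal (F s - F 0)"
proof -
  have "layer w s = (\<integral>\<^sup>+t. ennreal (w t) * indicator {0..s} t \<partial>lborel)"
    unfolding layer_def
  proof (rule nn_integral_cong_AE)
    show "AE t in lborel. (if 0 \<le> t \<and> t < s then ennreal (w t) else 0) = ennreal (w t) * indicator {0..s} t"
      using AE_lborel_singleton[of s] by eventually_elim (auto simp: indicator_def)
  qed
  also have "\<dots> = ennreal (F s - F 0)"
    by (rule nn_integral_FTC_Icc) (use assms in \<open>auto intro: has_field_derivative_at_within\<close>)
  finally show ?thesis .
qed

lemma layer_1: "0 \<le> s \<Longrightarrow> layer (\<lambda>_. 1) s = ennreal s"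
  using layer_eq_FTC[of "\<lambda>_. 1" "\<lambda>t. t" s] by simp

lemma layer_square: "0 \<le> s \<Longrightarrow> layer (\<lambda>t. 2 * t) s = ennreal (s\<^sup>2)"
proof -
  assume "0 \<le> s"
  then have "layer (\<lambda>t. 2 * t) s = ennreal (s\<^sup>2 - 0\<^sup>2)"
    by (intro layer_eq_FTC) (auto intro!: derivative_eq_intros)
  then show ?thesis by simp
qed

text \<open>The primitive of a decreasing weight is concave, so it lies below its tangent at
  \<open>a\<close>.\<close>

lemma layer_step:
  assumes [measurable]: "w \<in> borel_measurable borel" and w: "antimono w" "\<And>t. 0 \<le> w t" and ab: "0 \<le> a" "a \<le> b"
  shows "layer w b \<le> layer w a + ennreal (w a * (b - a))"
proof -
  have "layer w b = (\<integral>\<^sup>+t. (if 0 \<le> t \<and> t < a then ennreal (w t) else 0) + (if a \<le> t \<and> t < b then ennreal (w t) else 0) \<partial>lborel)"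
    unfolding layer_def using ab by (intro nn_integral_cong) auto
  also have "\<dots> = layer w a + (\<integral>\<^sup>+t. (if a \<le> t \<and> t < b then ennreal (w t) else 0) \<partial>lborel)"
    unfolding layer_def by (rule nn_integral_add) measurable
  also have "(\<integral>\<^sup>+t. (if a \<le> t \<and> t < b then ennreal (w t) else 0) \<partial>lborel) \<le> (\<integral>\<^sup>+t. ennreal (w a) * indicator {a..<b} t \<partial>lborel)"
    using w by (intro nn_integral_mono) (auto simp: indicator_def antimono_def intro: ennreal_leI)
  also have "\<dots> = ennreal (w a * (b - a))"
    using ab w by (simp add: nn_integral_cmult_indicator ennreal_mult)
  finally show ?thesis by (simp add: add_left_mono)
qed

subsection \<open>The Saint-Venant inequality\<close>

text \<open>The torsional rigidity of a ball of radius \<open>R\<close>, that is the integral over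
  it of \<open>(R\<^sup>2 - (norm x)\<^sup>2) / (2 * d)\<close>.\<close>

abbreviation torsion_const :: "nat \<Rightarrow> real \<Rightarrow> real" where
  "torsion_const d R \<equiv> unit_ball_vol (real d) * R ^ (d + 2) / (real d * (real d + 2))"

lemma measure_lebesgue_ball: "0 \<le> r \<Longrightarrow> measure lebesgue (ball (c::'a::euclidean_space) r) = unit_ball_vol (real DIM('a)) * r ^ DIM('a)"
  by (simp add: content_ball)

text \<open>The bound is attained by \<open>f x = norm x / d\<close> on the ball of radius \<open>R\<close>.\<close>
lemma rank_square:
  fixes f :: "'a::euclidean_space \<Rightarrow> real"
  assumes f[measurable]: "f \<in> borel_measurable borel" and \<Omega>[measurable]: "\<Omega> \<in> sets borel" and R: "0 \<le> R"
    and f0: "\<And>x. x \<in> \<Omega> \<Longrightarrow> 0 \<le> f x" and fR: "\<And>x. x \<in> \<Omega> \<Longrightarrow> f x \<le> R / DIM('a)"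
    and le: "\<And>q::real. 0 \<le> q \<Longrightarrow> q < R / DIM('a) \<Longrightarrow> emeasure lborel {x\<in>\<Omega>. q < f x}
        \<le> ennreal (unit_ball_vol (real DIM('a)) * R ^ DIM('a) - unit_ball_vol (real DIM('a)) * (DIM('a) * q) ^ DIM('a))"
  shows "(\<integral>\<^sup>+x. ennreal (indicator \<Omega> x * (f x)\<^sup>2) \<partial>lborel) \<le> ennreal (torsion_const DIM('a) R)"
proof -
  let ?d = "DIM('a)" and ?o = "unit_ball_vol (real DIM('a))"
  define h where "h x = indicator \<Omega> x * f x" for x
  have [measurable]: "h \<in> borel_measurable borel" unfolding h_def[abs_def] by measurable
  have o: "?o > 0" by simp
  define m where "m q = 2 * q * (?o * R ^ ?d - ?o * (?d * q) ^ ?d)" for q :: real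
  \<comment> \<open>A primitive of \<open>m\<close>, the density that the layer cake formula for
    squares produces from the assumed bound on the distribution.\<close>
  define G where "G q = ?o * R ^ ?d * q\<^sup>2 - 2 * ?o * real ?d ^ ?d * q ^ (?d + 2) / (?d + 2)" for q :: real
  have "(\<integral>\<^sup>+x. ennreal (indicator \<Omega> x * (f x)\<^sup>2) \<partial>lborel) = (\<integral>\<^sup>+x. layer (\<lambda>t. 2 * t) (h x) \<partial>lborel)"
    using f0 by (intro nn_integral_cong) (auto simp: h_def indicator_def layer_square layer_le_0)
  also have "\<dots> = (\<integral>\<^sup>+t. (if 0 \<le> t then ennreal (2 * t) * emeasure lborel {x. t < h x} else 0) \<partial>lborel)"
    by (rule layer_cake) measurable
  also have "\<dots> \<le> (\<integral>\<^sup>+t. ennreal (m t) * indicator {0..R / ?d} t \<partial>lborel)"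
  proof (rule nn_integral_mono)
    fix t
    show "(if 0 \<le> t then ennreal (2 * t) * emeasure lborel {x. t < h x} else 0) \<le> ennreal (m t) * indicator {0..R / ?d} t"
    proof (cases "0 \<le> t")
      case True
      then have eq: "{x. t < h x} = {x\<in>\<Omega>. t < f x}" by (auto simp: h_def indicator_def)
      show ?thesis
      proof (cases "t < R / ?d")
        case lt: True
        have "(?d * t) ^ ?d \<le> R ^ ?d" using True lt by (intro power_mono) (auto simp: field_simps)
        then have "0 \<le> ?o * R ^ ?d - ?o * (?d * t) ^ ?d" using o by simp
        then have "ennreal (m t) = ennreal (2 * t) * ennreal (?o * R ^ ?d - ?o * (?d * t) ^ ?d)"
          using True by (simp add: m_def ennreal_mult[symmetric])
        then show ?thesis using True lt le[OF True lt] by (simp add: eq mult_left_mono)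
      next
        case False
        then have e0: "{x\<in>\<Omega>. t < f x} = {}" using fR by fastforce
        show ?thesis unfolding eq e0 by simp
      qed
    qed simp
  qed
  also have "\<dots> = ennreal (G (R / ?d) - G 0)"
  proof (rule nn_integral_FTC_Icc)
    show "m \<in> borel_measurable borel" unfolding m_def[abs_def] by measurable
    show "0 \<le> m t" if "t \<in> {0..R / ?d}" for t
    proof -
      have "(?d * t) ^ ?d \<le> R ^ ?d" using that by (intro power_mono) (auto simp: field_simps)
      then show ?thesis using that o by (simp add: m_def)
    qed
    show "(G has_real_derivative m t) (at t)" if "t \<in> {0..R / ?d}" for t
      unfolding G_def[abs_def] m_def
      by (rule derivative_eq_intros refl | simp)+ (simp add: field_simps power_mult_distrib)
  qed (use R in simp)
  also have "G (R / ?d) - G 0 = torsion_const ?d R"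
  proof -
    define D X where "D = real ?d" and "X = ?o * R ^ (?d + 2)"
    have D: "D > 0" by (simp add: D_def)
    have "?o * R ^ ?d * (R / D)\<^sup>2 = X / D\<^sup>2" by (simp add: X_def power_divide power_add power2_eq_square)
    moreover have "D ^ ?d * (R / D) ^ (?d + 2) = R ^ (?d + 2) / D\<^sup>2" using D by (simp add: power_divide power_add power2_eq_square)
    then have "2 * ?o * D ^ ?d * (R / D) ^ (?d + 2) / (?d + 2) = 2 * ?o * (R ^ (?d + 2) / D\<^sup>2) / (?d + 2)"
      by (simp only: mult.assoc)
    then have "2 * ?o * D ^ ?d * (R / D) ^ (?d + 2) / (?d + 2) = 2 * (X / D\<^sup>2) / (D + 2)"
      by (simp add: X_def D_def add.commute)
    moreover have "X / D\<^sup>2 - 2 * (X / D\<^sup>2) / (D + 2) = X / (D * (D + 2))"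
    proof -
      have "D + 2 \<noteq> 0" using D by linarith
      then have "1 - 2 / (D + 2) = D / (D + 2)" by (simp add: field_simps)
      then have "X / D\<^sup>2 * (1 - 2 / (D + 2)) = X / D\<^sup>2 * (D / (D + 2))" by simp
      then show ?thesis using D by (simp add: right_diff_distrib power2_eq_square mult.commute[of 2 X])
    qed
    ultimately show ?thesis by (simp only: G_def D_def X_def) simp
  qed
  finally show ?thesis .
qed

text \<open>Here \<open>w\<close> is the radius of the ball with the volume of \<open>A\<close>,
  divided by the dimension, so the volume of \<open>A\<close> divided by \<open>w\<close> is the
  surface area of that ball. This is the isoperimetric inequality for the neighbourhood of width
  \<open>e\<close>, from Brunn-Minkowski and Bernoulli; multiplying by \<open>w\<close> rather than
  dividing also covers empty \<open>A\<close>.\<close>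

lemma brunn_minkowski_ball_derivative:
  fixes A :: "'a::euclidean_space set"
  assumes A: "open A" "bounded A" and e: "0 < e"
  defines "w \<equiv> root DIM('a) (measure lebesgue A / unit_ball_vol (real DIM('a))) / DIM('a)"
  shows "w * measure lebesgue A + e * measure lebesgue A \<le> w * measure lebesgue (msum A (ball 0 e))"
proof (cases "A = {}")
  case False
  let ?d = "DIM('a)" and ?m = "measure lebesgue :: 'a set \<Rightarrow> real"
  define u b where "u = root ?d (?m A)" and "b = root ?d (unit_ball_vol (real ?d))"
  have u: "u > 0" "u ^ ?d = ?m A" unfolding u_def using measure_open_pos[OF A False] by auto
  have b: "b > 0" "b ^ ?d = unit_ball_vol (real ?d)" unfolding b_def by auto
  have w: "w = u / b / ?d" by (simp add: w_def u_def b_def real_root_divide)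
  have "u + root ?d (?m (ball (0::'a) e)) \<le> root ?d (?m (msum A (ball 0 e)))"
    unfolding u_def using A False e by (intro brunn_minkowski_open) auto
  moreover have "root ?d (?m (ball (0::'a) e)) = e * b"
    unfolding measure_lebesgue_ball[OF less_imp_le[OF e]] b_def using e by (simp add: real_root_mult real_root_power_cancel)
  ultimately have "u + e * b \<le> root ?d (?m (msum A (ball 0 e)))" by simp
  then have "(u + e * b) ^ ?d \<le> root ?d (?m (msum A (ball 0 e))) ^ ?d"
    using u b e by (intro power_mono) auto
  also have "\<dots> = ?m (msum A (ball 0 e))" by simp
  finally have M: "(u + e * b) ^ ?d \<le> ?m (msum A (ball 0 e))" .
  have "u ^ ?d * (1 + real ?d * (e * b / u)) \<le> u ^ ?d * (1 + e * b / u) ^ ?d"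
    using u(1) b(1) e by (intro mult_left_mono Bernoulli_inequality) (auto intro: order_trans[of _ 0])
  also have "\<dots> = (u * (1 + e * b / u)) ^ ?d" by (simp only: power_mult_distrib)
  also have "u * (1 + e * b / u) = u + e * b" using u(1) by (simp add: distrib_left)
  finally have "u ^ ?d * (1 + real ?d * (e * b / u)) \<le> ?m (msum A (ball 0 e))" using M by linarith
  then have "w * (u ^ ?d * (1 + real ?d * (e * b / u))) \<le> w * ?m (msum A (ball 0 e))"
    using u(1) b(1) by (intro mult_left_mono) (auto simp: w)
  also have "w * (u ^ ?d * (1 + real ?d * (e * b / u))) = w * ?m A + e * ?m A"
    unfolding u(2)[symmetric] w using u(1) b(1) by (simp add: field_simps)
  finally show ?thesis .
qed (simp add: msum_def)

text \<open>Points are ranked by the measure of the strict superlevel set through them; ties only lower the rank.\<close>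
lemma measure_rank_le:
  fixes \<psi> :: "'a::euclidean_space \<Rightarrow> real"
  assumes \<psi>[measurable]: "\<psi> \<in> borel_measurable borel" and \<Omega>: "\<Omega> \<in> lmeasurable" "\<Omega> \<in> sets borel" and s: "s \<le> measure lebesgue \<Omega>"
    and S: "S = {x\<in>\<Omega>. s < measure lebesgue {y\<in>\<Omega>. \<psi> x < \<psi> y}}"
    and bd: "\<And>x. x \<in> \<Omega> \<Longrightarrow> \<psi> x \<le> B"
  shows "emeasure lebesgue S \<le> ennreal (measure lebesgue \<Omega> - s)"
proof (cases "S = {}")
  case False
  let ?m = "measure lebesgue :: 'a set \<Rightarrow> real"
  have [measurable]: "\<Omega> \<in> sets borel" by fact
  define L where "L t = {y\<in>\<Omega>. \<psi> y \<le> t}" for t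
  have Lm: "L t \<in> lmeasurable" for t
  proof -
    have "{y\<in>\<Omega>. \<psi> y \<le> t} \<in> sets borel" by measurable
    then show ?thesis unfolding L_def using \<Omega>(1) by (intro fmeasurableI2[OF \<Omega>(1)]) auto
  qed
  have Lle: "?m (L (\<psi> x)) \<le> ?m \<Omega> - s" if "x \<in> S" for x
  proof -
    have "{y\<in>\<Omega>. \<psi> x < \<psi> y} \<in> sets borel" by measurable
    then have U: "{y\<in>\<Omega>. \<psi> x < \<psi> y} \<in> sets lebesgue" by auto
    have "L (\<psi> x) = \<Omega> - {y\<in>\<Omega>. \<psi> x < \<psi> y}" by (auto simp: L_def)
    then have "?m (L (\<psi> x)) = ?m \<Omega> - ?m {y\<in>\<Omega>. \<psi> x < \<psi> y}" using measurable_measure_Diff[OF \<Omega>(1) U] by auto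
    then show ?thesis using that S by auto
  qed
  \<comment> \<open>If the supremum is attained in \<open>S\<close>, a single sublevel set of small
    measure contains \<open>S\<close>. Otherwise \<open>S\<close> is exhausted by the increasing
    sublevel sets at heights below \<sigma>, and the bound passes to the limit.\<close>
  define \<sigma> where "\<sigma> = Sup (\<psi> ` S)"
  have ne: "\<psi> ` S \<noteq> {}" and ba: "bdd_above (\<psi> ` S)" using False bd S by (auto intro!: bdd_aboveI[of _ B])
  have up: "\<psi> x \<le> \<sigma>" if "x \<in> S" for x unfolding \<sigma>_def using that ba by (intro cSup_upper) auto
  show ?thesis
  proof (cases "\<exists>x\<in>S. \<psi> x = \<sigma>")
    case True
    then obtain x where x: "x \<in> S" "\<psi> x = \<sigma>" by blast
    have "S \<subseteq> L (\<psi> x)" using up x S by (auto simp: L_def)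
    then have "emeasure lebesgue S \<le> emeasure lebesgue (L (\<psi> x))" using Lm by (intro emeasure_mono) auto
    also have "\<dots> = ennreal (?m (L (\<psi> x)))" using Lm by (rule emeasure_eq_measure2)
    also have "\<dots> \<le> ennreal (?m \<Omega> - s)" by (intro ennreal_leI Lle x)
    finally show ?thesis .
  next
    case noatt: False
    define T where "T n = L (\<sigma> - 1 / real (Suc n))" for n
    have "S \<subseteq> (\<Union>n. T n)"
    proof
      fix x assume x: "x \<in> S"
      then have "\<psi> x < \<sigma>" using up[OF x] noatt by (meson less_le)
      then obtain n where "inverse (real (Suc n)) < \<sigma> - \<psi> x" using reals_Archimedean[of "\<sigma> - \<psi> x"] by auto
      then have "\<psi> x \<le> \<sigma> - 1 / real (Suc n)" by (simp add: inverse_eq_divide)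
      then show "x \<in> (\<Union>n. T n)" using x S by (auto simp: T_def L_def)
    qed
    then have "emeasure lebesgue S \<le> emeasure lebesgue (\<Union>n. T n)"
      using Lm by (intro emeasure_mono) (auto simp: T_def)
    also have "\<dots> = (SUP n. emeasure lebesgue (T n))"
    proof (rule SUP_emeasure_incseq[symmetric])
      show "range T \<subseteq> sets lebesgue" using Lm by (auto simp: T_def)
      show "incseq T" unfolding incseq_def T_def L_def
      proof (intro allI impI subsetI)
        fix i j :: nat and y assume "i \<le> j" and y: "y \<in> {y \<in> \<Omega>. \<psi> y \<le> \<sigma> - 1 / real (Suc i)}"
        then have "1 / real (Suc j) \<le> 1 / real (Suc i)" by (simp add: frac_le)
        then show "y \<in> {y \<in> \<Omega>. \<psi> y \<le> \<sigma> - 1 / real (Suc j)}" using y by auto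
      qed
    qed
    also have "\<dots> \<le> ennreal (?m \<Omega> - s)"
    proof (rule SUP_least)
      fix n
      have "\<sigma> - 1 / real (Suc n) < \<sigma>" by simp
      then obtain x where x: "x \<in> S" "\<sigma> - 1 / real (Suc n) < \<psi> x" unfolding \<sigma>_def using less_cSup_iff[OF ne ba] by auto
      then have "T n \<subseteq> L (\<psi> x)" by (auto simp: T_def L_def)
      then have "emeasure lebesgue (T n) \<le> emeasure lebesgue (L (\<psi> x))" using Lm by (intro emeasure_mono) auto
      also have "\<dots> = ennreal (?m (L (\<psi> x)))" using Lm by (rule emeasure_eq_measure2)
      also have "\<dots> \<le> ennreal (?m \<Omega> - s)" by (intro ennreal_leI Lle x)
      finally show "emeasure lebesgue (T n) \<le> ennreal (?m \<Omega> - s)" .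
    qed
    finally show ?thesis .
  qed
qed simp

text \<open>The superlevel sets of \<open>\<phi>\<close> are compared with their \<open>\<epsilon>\<close>-neighbourhoods, weighted by the gradient
  that the torsion function of a ball has on a level set of the same volume.\<close>
lemma saint_venant:
  fixes \<phi> :: "'a::euclidean_space \<Rightarrow> real"
  assumes \<phi>: "test_fun \<Omega> \<phi>" and \<Omega>: "open \<Omega>" "bounded \<Omega>" and R: "0 \<le> R" "measure lebesgue \<Omega> = unit_ball_vol (real DIM('a)) * R ^ DIM('a)"
  shows "2 * (\<integral>x. \<phi> x \<partial>lebesgue) - (\<integral>x. (norm (grad \<phi> x))\<^sup>2 \<partial>lebesgue) \<le> torsion_const DIM('a) R"
proof -
  let ?d = "DIM('a)" and ?o = "unit_ball_vol (real DIM('a))" and ?m = "measure lebesgue :: 'a set \<Rightarrow> real"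
  have \<Omega>m: "\<Omega> \<in> lmeasurable" using \<Omega> by (intro lmeasurable_open)
  have \<Omega>b[measurable]: "\<Omega> \<in> sets borel" using \<Omega> by simp
  have o: "?o > 0" by simp
  obtain Cs where Cs: "compact Cs" "Cs \<subseteq> \<Omega>" "\<And>x. x \<notin> Cs \<Longrightarrow> \<phi> x = 0" using \<phi> by (rule test_funE) blast
  have sm: "smooth \<phi>" using \<phi> by (rule test_fun_smooth)
  have \<phi>b[measurable]: "\<phi> \<in> borel_measurable borel" using \<phi> by (rule test_fun_borel)
  have gb[measurable]: "grad \<phi> \<in> borel_measurable borel" using sm by (rule grad_borel)
  obtain C where C: "C \<ge> 0" "\<And>x h. \<bar>\<phi> (x + h) - \<phi> x - frechet_derivative \<phi> (at x) h\<bar> \<le> C * (norm h)\<^sup>2"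
    using test_fun_taylor[OF \<phi>] by blast
  have C2: "\<phi> (x + h) \<le> \<phi> x + norm (grad \<phi> x) * norm h + C * (norm h)\<^sup>2" for x h
  proof -
    have "frechet_derivative \<phi> (at x) h = grad \<phi> x \<bullet> h"
      using frechet_derivative_at[OF smooth_has_derivative_grad[OF sm]] by metis
    then show ?thesis using C(2)[of x h] norm_cauchy_schwarz[of "grad \<phi> x" h] by linarith
  qed
  obtain B where B: "B \<ge> 0" "\<And>x. \<bar>\<phi> x\<bar> \<le> B" using test_fun_bounded[OF \<phi>] by blast
  \<comment> \<open>Passing to the positive part can only increase the integral of \<phi>, and its
    superlevel sets at nonnegative heights are compactly contained in
    \<open>\<Omega>\<close>.\<close>
  define \<psi> where "\<psi> x = max 0 (\<phi> x)" for x
  have [measurable]: "\<psi> \<in> borel_measurable borel" unfolding \<psi>_def[abs_def] by measurable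
  have \<psi>0: "0 \<le> \<psi> x" "\<psi> x \<le> B" "\<phi> x \<le> \<psi> x" for x using B(2)[of x] B(1) by (auto simp: \<psi>_def)
  define A where "A t = {x. max 0 t < \<phi> x}" for t
  have Ao: "open (A t)" for t unfolding A_def by (intro open_Collect_less smooth_continuous_on sm continuous_intros)
  have ACs: "A t \<subseteq> Cs" for t using Cs(3) by (fastforce simp: A_def)
  have Abd: "bounded (A t)" for t using ACs compact_imp_bounded[OF Cs(1)] bounded_subset by blast
  have Am: "A t \<in> lmeasurable" for t using Ao Abd by (intro lmeasurable_open)
  have A\<psi>: "{x. t < \<psi> x} = A t" if "0 \<le> t" for t using that by (auto simp: A_def \<psi>_def)
  define \<mu> where "\<mu> t = ?m (A t)" for t
  have \<mu>0: "0 \<le> \<mu> t" "\<mu> t \<le> ?m \<Omega>" for t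
    unfolding \<mu>_def using measure_mono_fmeasurable[OF order_trans[OF ACs Cs(2)] fmeasurableD[OF Am] \<Omega>m] by simp_all
  have \<mu>am: "antimono \<mu>"
    unfolding antimono_def \<mu>_def by (intro allI impI measure_mono_fmeasurable Am fmeasurableD) (auto simp: A_def)
  have Ae: "emeasure lborel (A t) = ennreal (\<mu> t)" for t
    using emeasure_eq_measure2[OF Am[of t]] Ao[of t] by (simp add: \<mu>_def)
  \<comment> \<open>The radius \<rho> of the ball with volume \<open>\<mu> t\<close>, over the
    dimension: the length of the gradient of
    \<open>(\<rho>\<^sup>2 - (norm x)\<^sup>2) / (2 * d)\<close> on the sphere of radius
    \<rho>.\<close>
  define w where "w t = root ?d (\<mu> t / ?o) / ?d" for t
  have wam: "antimono w"
    using \<mu>am o unfolding antimono_def w_def by (auto intro!: divide_right_mono real_root_le_mono)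
  have w0: "0 \<le> w t" for t using \<mu>0 o by (simp add: w_def)
  have wR: "w t \<le> R / ?d" for t
  proof -
    have "\<mu> t / ?o \<le> R ^ ?d" using \<mu>0(2)[of t] R(2) o by (simp add: field_simps)
    then have "root ?d (\<mu> t / ?o) \<le> root ?d (R ^ ?d)" by (intro real_root_le_mono) auto
    then show ?thesis using R(1) by (simp add: w_def real_root_power_cancel divide_right_mono)
  qed
  have anti_borel: "f \<in> borel_measurable borel" if "antimono f" for f :: "real \<Rightarrow> real"
  proof -
    have "mono (\<lambda>x. - f x)" using that by (auto simp: mono_def antimono_def)
    then have "(\<lambda>x. - (- f x)) \<in> borel_measurable borel" by (intro borel_measurable_uminus borel_measurable_mono)
    then show ?thesis by simp
  qed
  have [measurable]: "w \<in> borel_measurable borel" "\<mu> \<in> borel_measurable borel" using anti_borel wam \<mu>am by auto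
  \<comment> \<open>By layer cake \<open>X\<close> is the space integral of the primitive of
    \<open>w\<close> evaluated at \<psi>, and \<open>Y\<close> is that of \<psi> itself. Finiteness
    of \<open>X\<close> is needed because it will be cancelled from both sides.\<close>
  define X where "X = (\<integral>\<^sup>+t. (if 0 \<le> t then ennreal (w t * \<mu> t) else 0) \<partial>lborel)"
  define Y where "Y = (\<integral>\<^sup>+t. (if 0 \<le> t then ennreal (\<mu> t) else 0) \<partial>lborel)"
  have XF: "(\<integral>\<^sup>+x. layer w (\<psi> x) \<partial>lborel) = X"
    unfolding X_def by (subst layer_cake) (auto simp: A\<psi> Ae ennreal_mult w0 \<mu>0 intro!: nn_integral_cong)
  have Xfin: "X \<noteq> \<infinity>"
  proof -
    have "w t * \<mu> t \<le> R / ?d * ?m \<Omega>" for t using wR[of t] w0[of t] \<mu>0[of t] R(1) by (intro mult_mono) auto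
    moreover have "\<mu> t = 0" if "t > B" for t
    proof -
      have "A t = {}" using B(2) that by (auto simp: A_def) (meson abs_le_D1 leD le_less_trans less_imp_le)
      then show ?thesis by (simp add: \<mu>_def)
    qed
    ultimately have "X \<le> (\<integral>\<^sup>+t. ennreal (R / ?d * ?m \<Omega>) * indicator {0..B} t \<partial>lborel)"
      unfolding X_def by (intro nn_integral_mono) (auto simp: indicator_def not_le intro!: ennreal_leI)
    also have "\<dots> < \<infinity>" using B(1) by (simp add: nn_integral_cmult_indicator ennreal_mult_less_top)
    finally show ?thesis by simp
  qed
  have Y\<psi>: "Y = (\<integral>\<^sup>+x. ennreal (\<psi> x) \<partial>lborel)"
  proof -
    have "(\<integral>\<^sup>+x. ennreal (\<psi> x) \<partial>lborel) = (\<integral>\<^sup>+x. layer (\<lambda>_. 1) (\<psi> x) \<partial>lborel)" by (simp add: layer_1 \<psi>0)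
    also have "\<dots> = Y" unfolding Y_def by (subst layer_cake) (auto simp: A\<psi> Ae intro!: nn_integral_cong)
    finally show ?thesis by simp
  qed
  \<comment> \<open>Neighbourhoods of width below \<delta> of the superlevel sets stay in
    \<open>\<Omega>\<close>, where the comparison function of the next step lives.\<close>
  obtain \<delta> where \<delta>: "\<delta> > 0" "(\<Union>x\<in>Cs. ball x \<delta>) \<subseteq> \<Omega>"
    using compact_subset_open_imp_ball_epsilon_subset[OF Cs(1) \<Omega>(1) Cs(2)] by blast
  obtain M where M: "M \<ge> 0" "\<And>x. norm (grad \<phi> x) \<le> M"
  proof -
    obtain L where "L-lipschitz_on UNIV \<phi>" using test_fun_lipschitz[OF \<phi>] by blast
    then have "norm (grad \<phi> x) \<le> L" for x
      using lipschitz_derivative_le[OF _ _ smooth_has_derivative_grad[OF sm], of L UNIV x "grad \<phi> x"]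
      by (cases "grad \<phi> x = 0") (auto simp: power2_norm_eq_inner[symmetric] power2_eq_square lipschitz_on_nonneg)
    then show thesis using that \<open>L-lipschitz_on UNIV \<phi>\<close> lipschitz_on_nonneg by blast
  qed
  \<comment> \<open>By Taylor, the \<open>e\<close>-neighbourhood of a superlevel set of \<phi> lies
    in the superlevel set of \<open>f\<close> at the same height. Integrating the linearised
    Brunn-Minkowski inequality over heights gives \<open>X + e Y\<close> on the left and the
    primitive of \<open>w\<close> at \<open>f\<close> on the right; the tangent bound
    \<open>layer_step\<close> splits off \<open>X\<close>, and \<open>e\<close> is divided
    out.\<close>
  have key: "Y \<le> (\<integral>\<^sup>+x. ennreal (indicator \<Omega> x * (w (\<psi> x) * (norm (grad \<phi> x) + C * e))) \<partial>lborel)" if e: "0 < e" "e < \<delta>" for e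
  proof -
    define k where "k x = norm (grad \<phi> x) + C * e" for x
    have k0: "0 \<le> k x" for x using C(1) e by (simp add: k_def)
    have [measurable]: "k \<in> borel_measurable borel" unfolding k_def[abs_def] by measurable
    define f where "f x = indicator \<Omega> x * (\<psi> x + e * k x)" for x
    have [measurable]: "f \<in> borel_measurable borel" unfolding f_def[abs_def] by measurable
    have sub: "msum (A t) (ball 0 e) \<subseteq> {x. t < f x}" if t: "0 \<le> t" for t
    proof
      fix x assume "x \<in> msum (A t) (ball 0 e)"
      then obtain y z where yz: "y \<in> A t" "norm z < e" "x = y + z" by (auto simp: msum_def)
      have "x \<in> ball y \<delta>" using yz e by (simp add: dist_norm)
      then have x\<Omega>: "x \<in> \<Omega>" using \<delta>(2) ACs yz(1) by blast
      have "t < \<phi> y" using yz(1) t by (simp add: A_def)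
      also have "\<phi> y = \<phi> (x + (- z))" using yz(3) by simp
      also have "\<dots> \<le> \<phi> x + norm (grad \<phi> x) * norm (- z) + C * (norm (- z))\<^sup>2" by (rule C2)
      also have "\<dots> \<le> \<psi> x + norm (grad \<phi> x) * e + C * e\<^sup>2"
        using yz(2) C(1) \<psi>0(3)[of x] by (intro add_mono mult_left_mono power_mono) auto
      also have "\<dots> = f x" using x\<Omega> by (simp add: f_def k_def power2_eq_square algebra_simps)
      finally show "x \<in> {x. t < f x}" by simp
    qed
    have "X + ennreal e * Y = (\<integral>\<^sup>+t. (if 0 \<le> t then ennreal (w t * \<mu> t) else 0) + ennreal e * (if 0 \<le> t then ennreal (\<mu> t) else 0) \<partial>lborel)"
      unfolding X_def Y_def by (subst nn_integral_add) (auto simp: nn_integral_cmult)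
    also have "\<dots> \<le> (\<integral>\<^sup>+t. (if 0 \<le> t then ennreal (w t) * emeasure lborel {x. t < f x} else 0) \<partial>lborel)"
    proof (rule nn_integral_mono)
      fix t :: real
      show "(if 0 \<le> t then ennreal (w t * \<mu> t) else 0) + ennreal e * (if 0 \<le> t then ennreal (\<mu> t) else 0)
        \<le> (if 0 \<le> t then ennreal (w t) * emeasure lborel {x. t < f x} else 0)"
      proof (cases "0 \<le> t")
        case True
        have Mm: "msum (A t) (ball 0 e) \<in> lmeasurable" using Ao Abd by (intro lmeasurable_msum) auto
        have "ennreal (w t * \<mu> t) + ennreal e * ennreal (\<mu> t) = ennreal (w t * \<mu> t + e * \<mu> t)"
          using w0 \<mu>0 e by (simp add: ennreal_mult[symmetric] ennreal_plus[symmetric] del: ennreal_plus)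
        also have "\<dots> \<le> ennreal (w t * ?m (msum (A t) (ball 0 e)))"
          using brunn_minkowski_ball_derivative[OF Ao Abd e(1)] unfolding w_def \<mu>_def by (intro ennreal_leI)
        also have "\<dots> = ennreal (w t) * emeasure lebesgue (msum (A t) (ball 0 e))"
          using emeasure_eq_measure2[OF Mm] w0 by (simp add: ennreal_mult)
        also have "\<dots> = ennreal (w t) * emeasure lborel (msum (A t) (ball 0 e))"
          using open_msum[OF Ao] by simp
        also have "\<dots> \<le> ennreal (w t) * emeasure lborel {x. t < f x}"
          by (intro mult_left_mono emeasure_mono sub True) auto
        finally show ?thesis using True by simp
      qed simp
    qed
    also have "\<dots> = (\<integral>\<^sup>+x. layer w (f x) \<partial>lborel)" by (rule layer_cake[symmetric]) auto
    also have "\<dots> \<le> (\<integral>\<^sup>+x. layer w (\<psi> x) + ennreal e * ennreal (indicator \<Omega> x * (w (\<psi> x) * k x)) \<partial>lborel)"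
    proof (rule nn_integral_mono)
      fix x
      show "layer w (f x) \<le> layer w (\<psi> x) + ennreal e * ennreal (indicator \<Omega> x * (w (\<psi> x) * k x))"
      proof (cases "x \<in> \<Omega>")
        case True
        have "layer w (f x) \<le> layer w (\<psi> x) + ennreal (w (\<psi> x) * (f x - \<psi> x))"
          using True \<psi>0(1) k0[of x] e by (intro layer_step wam w0) (auto simp: f_def)
        also have "w (\<psi> x) * (f x - \<psi> x) = e * (w (\<psi> x) * k x)" using True by (simp add: f_def)
        finally show ?thesis using True e w0 k0 by (simp add: ennreal_mult)
      qed (simp add: f_def layer_le_0)
    qed
    also have "\<dots> = X + ennreal e * (\<integral>\<^sup>+x. ennreal (indicator \<Omega> x * (w (\<psi> x) * k x)) \<partial>lborel)"
      unfolding XF[symmetric] using layer_borel[of w] by (subst nn_integral_add) (auto simp: nn_integral_cmult intro!: measurable_compose[of \<psi> borel borel "layer w" borel])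
    finally have "ennreal e * Y \<le> ennreal e * (\<integral>\<^sup>+x. ennreal (indicator \<Omega> x * (w (\<psi> x) * k x)) \<partial>lborel)"
      using Xfin by (simp add: ennreal_add_left_cancel_le)
    then show ?thesis using e by (simp add: k_def ennreal_mult_le_mult_iff)
  qed
  define Z where "Z = (\<integral>x. indicator \<Omega> x * (w (\<psi> x) * norm (grad \<phi> x)) \<partial>lebesgue)"
  have bi: "integrable lebesgue (\<lambda>x. indicator \<Omega> x * g x)" if "g \<in> borel_measurable borel" "\<And>x. \<bar>g x\<bar> \<le> N" for g :: "'a \<Rightarrow> real" and N
    by (rule integrable_indicator_bounded[OF borel_imp_lebesgue[OF that(1)] that(2) \<Omega>m])
  have wb: "\<bar>w (\<psi> x)\<bar> \<le> R / ?d" for x using w0 wR by simp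
  have wg: "\<bar>w (\<psi> x) * norm (grad \<phi> x)\<bar> \<le> R / ?d * M" for x
    unfolding abs_mult using wb[of x] M(1) M(2)[of x] R(1) by (intro mult_mono) auto
  have iw: "integrable lebesgue (\<lambda>x. indicator \<Omega> x * w (\<psi> x))" by (rule bi[OF _ wb]) measurable
  have iwg: "integrable lebesgue (\<lambda>x. indicator \<Omega> x * (w (\<psi> x) * norm (grad \<phi> x)))" by (rule bi[OF _ wg]) measurable
  have i\<psi>: "integrable lebesgue \<psi>"
  proof -
    have "integrable lebesgue (\<lambda>x. indicator \<Omega> x * \<psi> x)" by (rule bi[of _ B]) (use \<psi>0 in auto)
    moreover have "(\<lambda>x. indicator \<Omega> x * \<psi> x) = \<psi>"
      using test_fun_outside[OF \<phi>] by (auto simp: fun_eq_iff indicator_def \<psi>_def)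
    ultimately show ?thesis by simp
  qed
  have "(\<integral>x. \<psi> x \<partial>lebesgue) \<le> Z + C * e * (\<integral>x. indicator \<Omega> x * w (\<psi> x) \<partial>lebesgue)" if e: "0 < e" "e < \<delta>" for e
  proof -
    let ?h = "\<lambda>x. indicator \<Omega> x * (w (\<psi> x) * (norm (grad \<phi> x) + C * e))"
    have h: "?h x = indicator \<Omega> x * (w (\<psi> x) * norm (grad \<phi> x)) + C * e * (indicator \<Omega> x * w (\<psi> x))" for x
      by (simp add: algebra_simps)
    have ih: "integrable lebesgue ?h" unfolding h using iw iwg by simp
    have "ennreal (\<integral>x. \<psi> x \<partial>lebesgue) = Y"
      unfolding Y\<psi> using i\<psi> \<psi>0(1) by (subst nn_integral_eq_integral[symmetric]) (auto simp: nn_integral_completion)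
    also have "\<dots> \<le> (\<integral>\<^sup>+x. ennreal (?h x) \<partial>lborel)" by (rule key[OF e])
    also have "\<dots> = ennreal (\<integral>x. ?h x \<partial>lebesgue)"
      using ih w0 C(1) e by (subst nn_integral_eq_integral[symmetric]) (auto simp: nn_integral_completion)
    finally have "(\<integral>x. \<psi> x \<partial>lebesgue) \<le> (\<integral>x. ?h x \<partial>lebesgue)"
      using w0 C(1) e by (subst (asm) ennreal_le_iff) (auto intro!: integral_nonneg_AE)
    also have "\<dots> = Z + C * e * (\<integral>x. indicator \<Omega> x * w (\<psi> x) \<partial>lebesgue)"
      unfolding h Z_def using iw iwg by simp
    finally show ?thesis .
  qed
  then have "eventually (\<lambda>e. (\<integral>x. \<psi> x \<partial>lebesgue) \<le> Z + C * e * (\<integral>x. indicator \<Omega> x * w (\<psi> x) \<partial>lebesgue)) (at_right 0)"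
    unfolding eventually_at_right_field using \<delta>(1) by blast
  moreover have "((\<lambda>e. Z + C * e * (\<integral>x. indicator \<Omega> x * w (\<psi> x) \<partial>lebesgue)) \<longlongrightarrow> Z + C * 0 * (\<integral>x. indicator \<Omega> x * w (\<psi> x) \<partial>lebesgue)) (at_right 0)"
    by (intro tendsto_intros)
  ultimately have "(\<integral>x. \<psi> x \<partial>lebesgue) \<le> Z + C * 0 * (\<integral>x. indicator \<Omega> x * w (\<psi> x) \<partial>lebesgue)"
    by (intro tendsto_lowerbound[where F="at_right (0::real)"]) auto
  then have \<psi>Z: "(\<integral>x. \<psi> x \<partial>lebesgue) \<le> Z" by simp
  have "(\<integral>x. \<phi> x \<partial>lebesgue) \<le> (\<integral>x. \<psi> x \<partial>lebesgue)"
    by (rule integral_mono[OF test_fun_integrable[OF \<phi>] i\<psi> \<psi>0(3)])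
  then have "2 * (\<integral>x. \<phi> x \<partial>lebesgue) \<le> 2 * Z" using \<psi>Z by linarith
  have w2: "\<bar>(w (\<psi> x))\<^sup>2\<bar> \<le> (R / ?d)\<^sup>2" for x using wb[of x] w0 by (simp add: power_mono)
  have iw2: "integrable lebesgue (\<lambda>x. indicator \<Omega> x * (w (\<psi> x))\<^sup>2)" by (rule bi[OF _ w2]) measurable
  \<comment> \<open>The inequality \<open>2 a b \<le> a\<^sup>2 + b\<^sup>2\<close> produces exactly
    the Dirichlet energy to be subtracted, leaving the integral of \<open>w\<^sup>2\<close> along
    \<psi>.\<close>
  have "2 * Z = (\<integral>x. 2 * (indicator \<Omega> x * (w (\<psi> x) * norm (grad \<phi> x))) \<partial>lebesgue)" using iwg by (simp add: Z_def)
  also have "\<dots> \<le> (\<integral>x. indicator \<Omega> x * (w (\<psi> x))\<^sup>2 + (norm (grad \<phi> x))\<^sup>2 \<partial>lebesgue)"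
  proof (rule integral_mono)
    fix x
    show "2 * (indicator \<Omega> x * (w (\<psi> x) * norm (grad \<phi> x))) \<le> indicator \<Omega> x * (w (\<psi> x))\<^sup>2 + (norm (grad \<phi> x))\<^sup>2"
      using sum_squares_bound[of "w (\<psi> x)" "norm (grad \<phi> x)"] by (auto simp: indicator_def)
  qed (use iwg iw2 test_fun_grad_sq_integrable[OF \<phi>] in auto)
  also have "\<dots> = (\<integral>x. indicator \<Omega> x * (w (\<psi> x))\<^sup>2 \<partial>lebesgue) + (\<integral>x. (norm (grad \<phi> x))\<^sup>2 \<partial>lebesgue)"
    using iw2 test_fun_grad_sq_integrable[OF \<phi>] by simp
  finally have fin: "2 * (\<integral>x. \<phi> x \<partial>lebesgue) \<le> (\<integral>x. indicator \<Omega> x * (w (\<psi> x))\<^sup>2 \<partial>lebesgue) + (\<integral>x. (norm (grad \<phi> x))\<^sup>2 \<partial>lebesgue)"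
    using \<open>2 * (\<integral>x. \<phi> x \<partial>lebesgue) \<le> 2 * Z\<close> by linarith
  have "ennreal (\<integral>x. indicator \<Omega> x * (w (\<psi> x))\<^sup>2 \<partial>lebesgue) = (\<integral>\<^sup>+x. ennreal (indicator \<Omega> x * (w (\<psi> x))\<^sup>2) \<partial>lborel)"
    using iw2 by (subst nn_integral_eq_integral[symmetric]) (auto simp: nn_integral_completion)
  also have "\<dots> \<le> ennreal (torsion_const ?d R)"
  proof (rule rank_square[OF _ \<Omega>b R(1)])
    show "(\<lambda>x. w (\<psi> x)) \<in> borel_measurable borel" by measurable
    fix q :: real assume q: "0 \<le> q" "q < R / ?d"
    let ?s = "?o * (?d * q) ^ ?d"
    \<comment> \<open>Since \<open>w\<close> encodes the volume of the superlevel set through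
      \<open>x\<close>, a large value of \<open>w (\<psi> x)\<close> means a large rank;
      \<open>measure_rank_le\<close> bounds how often this happens.\<close>
    have "{x\<in>\<Omega>. q < w (\<psi> x)} = {x\<in>\<Omega>. ?s < ?m {y\<in>\<Omega>. \<psi> x < \<psi> y}}"
    proof -
      have "q < w (\<psi> x) \<longleftrightarrow> ?s < ?m {y\<in>\<Omega>. \<psi> x < \<psi> y}" for x
      proof -
        have "{y\<in>\<Omega>. \<psi> x < \<psi> y} = A (\<psi> x)" using A\<psi>[OF \<psi>0(1), of x] ACs[of "\<psi> x"] Cs(2) by auto
        moreover have "q < w (\<psi> x) \<longleftrightarrow> ?d * q < root ?d (\<mu> (\<psi> x) / ?o)" by (simp add: w_def field_simps)
        moreover have "\<dots> \<longleftrightarrow> root ?d ((?d * q) ^ ?d) < root ?d (\<mu> (\<psi> x) / ?o)" using q by (simp add: real_root_power_cancel)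
        moreover have "\<dots> \<longleftrightarrow> (?d * q) ^ ?d < \<mu> (\<psi> x) / ?o" by (rule real_root_less_iff) simp
        moreover have "\<dots> \<longleftrightarrow> ?s < \<mu> (\<psi> x)" using o by (simp add: field_simps)
        ultimately show ?thesis by (simp add: \<mu>_def)
      qed
      then show ?thesis by blast
    qed
    moreover have "emeasure lebesgue {x\<in>\<Omega>. ?s < ?m {y\<in>\<Omega>. \<psi> x < \<psi> y}} \<le> ennreal (?m \<Omega> - ?s)"
    proof (rule measure_rank_le[OF _ \<Omega>m \<Omega>b _ refl \<psi>0(2)])
      have "(?d * q) ^ ?d \<le> R ^ ?d" using q by (intro power_mono) (auto simp: field_simps)
      then show "?s \<le> ?m \<Omega>" using o by (simp add: R(2))
    qed measurable
    moreover have "{x\<in>\<Omega>. q < w (\<psi> x)} \<in> sets borel" by measurable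
    ultimately show "emeasure lborel {x\<in>\<Omega>. q < w (\<psi> x)} \<le> ennreal (?o * R ^ ?d - ?s)" by (simp add: R(2))
  qed (use w0 wR in auto)
  finally have "(\<integral>x. indicator \<Omega> x * (w (\<psi> x))\<^sup>2 \<partial>lebesgue) \<le> torsion_const ?d R"
    using o R(1) by (subst (asm) ennreal_le_iff) auto
  then show ?thesis using fin by linarith
qed

subsection \<open>Square integrable functions\<close>

definition sqint :: "('a::euclidean_space \<Rightarrow> 'b::euclidean_space) \<Rightarrow> bool" where
  "sqint f \<longleftrightarrow> f \<in> borel_measurable lebesgue \<and> integrable lebesgue (\<lambda>x. (norm (f x))\<^sup>2)"

lemma sqintD:
  assumes "sqint f"
  shows "f \<in> borel_measurable lebesgue" "integrable lebesgue (\<lambda>x. (norm (f x))\<^sup>2)"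
  using assms by (auto simp: sqint_def)

lemma norm_sq_add_le: "(norm (a + b))\<^sup>2 \<le> 2 * (norm a)\<^sup>2 + 2 * (norm (b::'b::euclidean_space))\<^sup>2"
proof -
  have "(norm (a + b))\<^sup>2 \<le> (norm a + norm b)\<^sup>2" by (intro power_mono norm_triangle_ineq) auto
  also have "\<dots> \<le> 2 * (norm a)\<^sup>2 + 2 * (norm b)\<^sup>2"
    using sum_squares_bound[of "norm a" "norm b"] by (simp add: power2_sum)
  finally show ?thesis .
qed

lemma sqint_inner:
  assumes "sqint f" "sqint g" shows "integrable lebesgue (\<lambda>x. f x \<bullet> g x)"
proof (rule Bochner_Integration.integrable_bound)
  show "integrable lebesgue (\<lambda>x. (norm (f x))\<^sup>2 + (norm (g x))\<^sup>2)" using assms by (simp add: sqint_def)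
  show "(\<lambda>x. f x \<bullet> g x) \<in> borel_measurable lebesgue" using assms[THEN sqintD(1)] by simp
  have "\<bar>f x \<bullet> g x\<bar> \<le> (norm (f x))\<^sup>2 + (norm (g x))\<^sup>2" for x
    using Cauchy_Schwarz_ineq2[of "f x" "g x"] sum_squares_bound[of "norm (f x)" "norm (g x)"]
      mult_nonneg_nonneg[of "norm (f x)" "norm (g x)"] by simp
  then show "AE x in lebesgue. norm (f x \<bullet> g x) \<le> norm ((norm (f x))\<^sup>2 + (norm (g x))\<^sup>2)" by simp
qed

lemma sqint_add:
  assumes "sqint f" "sqint g" shows "sqint (\<lambda>x. f x + g x)"
  unfolding sqint_def
proof
  show m: "(\<lambda>x. f x + g x) \<in> borel_measurable lebesgue" using assms[THEN sqintD(1)] by simp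
  show "integrable lebesgue (\<lambda>x. (norm (f x + g x))\<^sup>2)"
  proof (rule Bochner_Integration.integrable_bound)
    show "integrable lebesgue (\<lambda>x. 2 * (norm (f x))\<^sup>2 + 2 * (norm (g x))\<^sup>2)" using assms by (simp add: sqint_def)
    show "(\<lambda>x. (norm (f x + g x))\<^sup>2) \<in> borel_measurable lebesgue" using m by simp
  qed (use norm_sq_add_le in \<open>auto\<close>)
qed

lemma sqint_cmult:
  assumes "sqint f" shows "sqint (\<lambda>x. c *\<^sub>R f x)"
  unfolding sqint_def using sqintD[OF assms] by (simp add: power_mult_distrib)

lemma sqint_diff: "sqint f \<Longrightarrow> sqint g \<Longrightarrow> sqint (\<lambda>x. f x - g x)"
  using sqint_add[OF _ sqint_cmult, of f g "-1"] by simp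

lemma sqint_real: "sqint (f::'a::euclidean_space \<Rightarrow> real) \<longleftrightarrow> f \<in> borel_measurable lebesgue \<and> integrable lebesgue (\<lambda>x. (f x)\<^sup>2)"
  by (simp add: sqint_def)

text \<open>A quadratic polynomial in \<open>t\<close> that never becomes negative has nonpositive
  discriminant. If its leading coefficient vanishes, the linear one must vanish too.\<close>

lemma sqint_Cauchy_Schwarz:
  assumes f: "sqint f" and g: "sqint g"
  shows "(\<integral>x. f x \<bullet> g x \<partial>lebesgue)\<^sup>2 \<le> (\<integral>x. (norm (f x))\<^sup>2 \<partial>lebesgue) * (\<integral>x. (norm (g x))\<^sup>2 \<partial>lebesgue)"
proof -
  let ?A = "\<integral>x. (norm (f x))\<^sup>2 \<partial>lebesgue" and ?B = "\<integral>x. (norm (g x))\<^sup>2 \<partial>lebesgue" and ?C = "\<integral>x. f x \<bullet> g x \<partial>lebesgue"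
  have i: "integrable lebesgue (\<lambda>x. (norm (f x))\<^sup>2)" "integrable lebesgue (\<lambda>x. (norm (g x))\<^sup>2)" "integrable lebesgue (\<lambda>x. f x \<bullet> g x)"
    using f g sqint_inner[OF f g] by (auto simp: sqint_def)
  have q: "0 \<le> ?A - 2 * t * ?C + t\<^sup>2 * ?B" for t :: real
  proof -
    have "0 \<le> (\<integral>x. (norm (f x - t *\<^sub>R g x))\<^sup>2 \<partial>lebesgue)" by simp
    also have "(\<lambda>x. (norm (f x - t *\<^sub>R g x))\<^sup>2) = (\<lambda>x. (norm (f x))\<^sup>2 - 2 * t * (f x \<bullet> g x) + t\<^sup>2 * (norm (g x))\<^sup>2)"
      unfolding power2_norm_eq_inner by (auto simp: fun_eq_iff inner_diff_left inner_diff_right inner_commute power2_eq_square algebra_simps)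
    also have "(\<integral>x. (norm (f x))\<^sup>2 - 2 * t * (f x \<bullet> g x) + t\<^sup>2 * (norm (g x))\<^sup>2 \<partial>lebesgue) = ?A - 2 * t * ?C + t\<^sup>2 * ?B"
      using i by simp
    finally show ?thesis .
  qed
  have B0: "?B \<ge> 0" by simp
  show ?thesis
  proof (cases "?B = 0")
    case True
    have "?C = 0"
    proof (rule ccontr)
      assume "?C \<noteq> 0"
      then have "2 * ((?A + 1) / (2 * ?C)) * ?C = ?A + 1" by simp
      then show False using q[of "(?A + 1) / (2 * ?C)"] unfolding True by linarith
    qed
    then show ?thesis by simp
  next
    case False
    then have B: "?B > 0" using B0 by linarith
    have "?A - 2 * (?C / ?B) * ?C + (?C / ?B)\<^sup>2 * ?B = ?A - ?C\<^sup>2 / ?B" using B by (simp add: power2_eq_square field_simps)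
    then have "?C\<^sup>2 / ?B \<le> ?A" using q[of "?C / ?B"] by simp
    then show ?thesis using B by (simp add: divide_le_eq)
  qed
qed

text \<open>The distance is kept squared, which is the form in which convergence appears in
  \<open>in_H10\<close>.\<close>

definition l2dist :: "('a::euclidean_space \<Rightarrow> 'b::euclidean_space) \<Rightarrow> ('a \<Rightarrow> 'b) \<Rightarrow> real" where
  "l2dist f g = (\<integral>x. (norm (f x - g x))\<^sup>2 \<partial>lebesgue)"

lemma l2_tendsto_inner:
  assumes f: "\<And>n. sqint (f n)" "sqint g" and lim: "(\<lambda>n. l2dist (f n) g) \<longlonglongrightarrow> 0" and h: "sqint h"
  shows "(\<lambda>n. \<integral>x. f n x \<bullet> h x \<partial>lebesgue) \<longlonglongrightarrow> (\<integral>x. g x \<bullet> h x \<partial>lebesgue)"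
proof (rule LIM_zero_cancel)
  let ?H = "\<integral>x. (norm (h x))\<^sup>2 \<partial>lebesgue"
  have a1: "(\<lambda>n. sqrt (l2dist (f n) g * ?H)) \<longlonglongrightarrow> sqrt (0 * ?H)" by (intro tendsto_intros lim)
  have a2: "norm ((\<integral>x. f n x \<bullet> h x \<partial>lebesgue) - (\<integral>x. g x \<bullet> h x \<partial>lebesgue)) \<le> sqrt (l2dist (f n) g * ?H)" for n
  proof -
    have "(\<integral>x. f n x \<bullet> h x \<partial>lebesgue) - (\<integral>x. g x \<bullet> h x \<partial>lebesgue) = (\<integral>x. (f n x - g x) \<bullet> h x \<partial>lebesgue)"
      by (simp add: inner_diff_left Bochner_Integration.integral_diff[OF sqint_inner[OF f(1)[of n] h] sqint_inner[OF f(2) h]])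
    then show ?thesis
      using sqint_Cauchy_Schwarz[OF sqint_diff[OF f(1)[of n] f(2)] h] by (simp add: l2dist_def real_le_rsqrt)
  qed
  show "(\<lambda>n. (\<integral>x. f n x \<bullet> h x \<partial>lebesgue) - (\<integral>x. g x \<bullet> h x \<partial>lebesgue)) \<longlonglongrightarrow> 0"
    by (rule Lim_null_comparison[OF always_eventually[OF allI[OF a2]]]) (use a1 in simp)
qed

lemma l2_tendsto_norm:
  assumes f: "\<And>n. sqint (f n)" "sqint g" and lim: "(\<lambda>n. l2dist (f n) g) \<longlonglongrightarrow> 0"
  shows "(\<lambda>n. \<integral>x. (norm (f n x))\<^sup>2 \<partial>lebesgue) \<longlonglongrightarrow> (\<integral>x. (norm (g x))\<^sup>2 \<partial>lebesgue)"
proof -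
  have eq: "(\<integral>x. (norm (f n x))\<^sup>2 \<partial>lebesgue) = l2dist (f n) g + 2 * (\<integral>x. f n x \<bullet> g x \<partial>lebesgue) - (\<integral>x. (norm (g x))\<^sup>2 \<partial>lebesgue)" for n
  proof -
    have "(\<lambda>x. (norm (f n x))\<^sup>2) = (\<lambda>x. (norm (f n x - g x))\<^sup>2 + 2 * (f n x \<bullet> g x) - (norm (g x))\<^sup>2)"
      by (auto simp: fun_eq_iff power2_norm_eq_inner inner_diff_left inner_diff_right inner_commute)
    then show ?thesis
      using sqint_inner[OF f(1)[of n] f(2)] sqint_diff[OF f(1)[of n] f(2)] f(2) by (simp add: l2dist_def sqint_def)
  qed
  have "(\<lambda>n. l2dist (f n) g + 2 * (\<integral>x. f n x \<bullet> g x \<partial>lebesgue) - (\<integral>x. (norm (g x))\<^sup>2 \<partial>lebesgue))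
      \<longlonglongrightarrow> 0 + 2 * (\<integral>x. g x \<bullet> g x \<partial>lebesgue) - (\<integral>x. (norm (g x))\<^sup>2 \<partial>lebesgue)"
    by (intro tendsto_intros lim l2_tendsto_inner f)
  moreover have "(\<integral>x. g x \<bullet> g x \<partial>lebesgue) = (\<integral>x. (norm (g x))\<^sup>2 \<partial>lebesgue)" by (simp add: power2_norm_eq_inner)
  ultimately show ?thesis unfolding eq by simp
qed

text \<open>Riesz-Fischer for concrete functions: a fast subsequence converges almost everywhere,
  and Fatou's lemma shows that the whole sequence converges to its limit in the mean.\<close>

lemma l2_complete:
  fixes f :: "nat \<Rightarrow> 'a::euclidean_space \<Rightarrow> 'b::euclidean_space"
  assumes f: "\<And>n. sqint (f n)" and cauchy: "\<And>e. e > 0 \<Longrightarrow> \<exists>N. \<forall>m\<ge>N. \<forall>n\<ge>N. l2dist (f m) (f n) \<le> e"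
  obtains g where "sqint g" "(\<lambda>n. l2dist (f n) g) \<longlonglongrightarrow> 0"
proof -
  have fm[measurable]: "f n \<in> borel_measurable lebesgue" for n using f by (simp add: sqint_def)
  have "\<forall>k. \<exists>N. \<forall>m\<ge>N. \<forall>n\<ge>N. l2dist (f m) (f n) \<le> (1/8) ^ k" using cauchy by simp
  then obtain N where N: "\<And>k m n. N k \<le> m \<Longrightarrow> N k \<le> n \<Longrightarrow> l2dist (f m) (f n) \<le> (1/8) ^ k" by metis
  \<comment> \<open>Summing the thresholds makes the index nondecreasing, and the added
    \<open>k\<close> makes it unbounded.\<close>
  define r where "r k = (\<Sum>j\<le>k. N j) + k" for k
  have rN: "N k \<le> r k" for k using member_le_sum[of k "{..k}" N] by (simp add: r_def)
  have rmono: "r k \<le> r (Suc k)" for k by (simp add: r_def)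
  have rk: "k \<le> r k" for k by (simp add: r_def)
  define D where "D k x = norm (f (r (Suc k)) x - f (r k) x)" for k x
  have D2: "(\<integral>\<^sup>+x. ennreal ((D k x)\<^sup>2) \<partial>lebesgue) \<le> ennreal ((1/8) ^ k)" for k
  proof -
    have "l2dist (f (r (Suc k))) (f (r k)) \<le> (1/8) ^ k" using rN[of k] rmono[of k] by (intro N) auto
    moreover have "(\<integral>\<^sup>+x. ennreal ((D k x)\<^sup>2) \<partial>lebesgue) = ennreal (l2dist (f (r (Suc k))) (f (r k)))"
      unfolding D_def l2dist_def using sqint_diff[OF f f] by (intro nn_integral_eq_integral) (auto simp: sqint_def)
    ultimately show ?thesis by (simp add: ennreal_leI)
  qed
  \<comment> \<open>The weights \<open>2 ^ k\<close> still leave integrals of size at most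
    \<open>(1/4) ^ k\<close>. Almost everywhere the weighted terms are therefore bounded, so the
    increments decay geometrically.\<close>
  have "AE x in lebesgue. (\<Sum>k. ennreal (2 ^ k * (D k x)\<^sup>2)) \<noteq> \<infinity>"
  proof (rule nn_integral_noteq_infinite)
    show "(\<lambda>x. \<Sum>k. ennreal (2 ^ k * (D k x)\<^sup>2)) \<in> borel_measurable lebesgue" unfolding D_def by measurable
    have "(\<integral>\<^sup>+x. (\<Sum>k. ennreal (2 ^ k * (D k x)\<^sup>2)) \<partial>lebesgue) = (\<Sum>k. \<integral>\<^sup>+x. ennreal (2 ^ k * (D k x)\<^sup>2) \<partial>lebesgue)"
      unfolding D_def by (rule nn_integral_suminf) measurable
    also have "\<dots> \<le> (\<Sum>k. ennreal ((1/4) ^ k))"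
    proof (rule suminf_le)
      fix k
      have "(\<integral>\<^sup>+x. ennreal (2 ^ k * (D k x)\<^sup>2) \<partial>lebesgue) = ennreal (2 ^ k) * (\<integral>\<^sup>+x. ennreal ((D k x)\<^sup>2) \<partial>lebesgue)"
        unfolding D_def by (subst nn_integral_cmult[symmetric]) (auto simp: ennreal_mult)
      also have "\<dots> \<le> ennreal (2 ^ k) * ennreal ((1/8) ^ k)" by (intro mult_left_mono D2) auto
      also have "\<dots> = ennreal ((1/4) ^ k)" by (simp add: ennreal_mult[symmetric] power_mult_distrib[symmetric])
      finally show "(\<integral>\<^sup>+x. ennreal (2 ^ k * (D k x)\<^sup>2) \<partial>lebesgue) \<le> ennreal ((1/4) ^ k)" .
    qed auto
    also have "\<dots> = ennreal (\<Sum>k. (1/4) ^ k)" by (intro suminf_ennreal_eq summable_sums) (auto intro: summable_geometric)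
    finally show "(\<integral>\<^sup>+x. (\<Sum>k. ennreal (2 ^ k * (D k x)\<^sup>2)) \<partial>lebesgue) \<noteq> \<infinity>" by (auto simp: top_unique)
  qed
  then have conv: "AE x in lebesgue. convergent (\<lambda>k. f (r k) x)"
  proof eventually_elim
    case (elim x)
    have "summable (\<lambda>k. 2 ^ k * (D k x)\<^sup>2)" by (rule summable_suminf_not_top) (use elim in auto)
    then have "Bseq (\<lambda>k. 2 ^ k * (D k x)\<^sup>2)" using summable_LIMSEQ_zero convergent_imp_Bseq convergentI by blast
    then obtain M where M: "M > 0" "\<And>k. norm (2 ^ k * (D k x)\<^sup>2) \<le> M" by (rule BseqE) blast
    have "2 ^ k * (D k x)\<^sup>2 \<le> M" for k using M(2)[of k] by simp
    then have Dk: "D k x \<le> sqrt M * (sqrt (1/2)) ^ k" for k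
    proof -
      have "(D k x)\<^sup>2 \<le> M * (1/2) ^ k" using \<open>2 ^ k * (D k x)\<^sup>2 \<le> M\<close> by (simp add: power_divide field_simps)
      then have "D k x \<le> sqrt (M * (1/2) ^ k)" by (rule real_le_rsqrt)
      then show ?thesis by (simp add: real_sqrt_mult real_sqrt_power)
    qed
    have "summable (\<lambda>k. sqrt M * (sqrt (1/2)) ^ k)" by (intro summable_mult summable_geometric) simp
    then have "summable (\<lambda>k. f (r (Suc k)) x - f (r k) x)"
      by (rule summable_comparison_test'[of _ 0]) (use Dk in \<open>simp add: D_def\<close>)
    then have "convergent (\<lambda>n. \<Sum>k<n. f (r (Suc k)) x - f (r k) x)" by (simp add: summable_iff_convergent)
    then have "convergent (\<lambda>n. f (r n) x - f (r 0) x)" by (simp only: sum_lessThan_telescope[of "\<lambda>k. f (r k) x"])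
    then have "convergent (\<lambda>n. (f (r n) x - f (r 0) x) + f (r 0) x)" by (intro convergent_add convergent_const)
    then show ?case by simp
  qed
  define g where "g x = lim (\<lambda>k. f (r k) x)" for x
  have gm[measurable]: "g \<in> borel_measurable lebesgue" unfolding g_def by (rule borel_measurable_lim_metric) measurable
  have lim: "AE x in lebesgue. (\<lambda>k. f (r k) x) \<longlonglongrightarrow> g x" using conv by eventually_elim (simp add: g_def convergent_LIMSEQ_iff)
  have fatou: "(\<integral>\<^sup>+x. ennreal ((norm (f n x - g x))\<^sup>2) \<partial>lebesgue) \<le> ennreal e"
    if e: "e \<ge> 0" and n: "\<And>m. N0 \<le> m \<Longrightarrow> l2dist (f n) (f m) \<le> e" for n e N0
  proof -
    have "(\<integral>\<^sup>+x. ennreal ((norm (f n x - g x))\<^sup>2) \<partial>lebesgue) = (\<integral>\<^sup>+x. liminf (\<lambda>k. ennreal ((norm (f n x - f (r k) x))\<^sup>2)) \<partial>lebesgue)"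
    proof (rule nn_integral_cong_AE)
      show "AE x in lebesgue. ennreal ((norm (f n x - g x))\<^sup>2) = liminf (\<lambda>k. ennreal ((norm (f n x - f (r k) x))\<^sup>2))"
        using lim
      proof eventually_elim
        case (elim x)
        have "(\<lambda>k. ennreal ((norm (f n x - f (r k) x))\<^sup>2)) \<longlonglongrightarrow> ennreal ((norm (f n x - g x))\<^sup>2)"
          by (intro tendsto_ennrealI tendsto_intros elim)
        then show ?case by (intro lim_imp_Liminf[symmetric]) auto
      qed
    qed
    also have "\<dots> \<le> liminf (\<lambda>k. \<integral>\<^sup>+x. ennreal ((norm (f n x - f (r k) x))\<^sup>2) \<partial>lebesgue)"
      by (rule nn_integral_liminf) measurable
    also have "\<dots> \<le> liminf (\<lambda>k. ennreal e)"
    proof (rule Liminf_mono)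
      show "eventually (\<lambda>k. (\<integral>\<^sup>+x. ennreal ((norm (f n x - f (r k) x))\<^sup>2) \<partial>lebesgue) \<le> ennreal e) sequentially"
        using eventually_ge_at_top[of N0]
      proof eventually_elim
        case (elim k)
        have "(\<integral>\<^sup>+x. ennreal ((norm (f n x - f (r k) x))\<^sup>2) \<partial>lebesgue) = ennreal (l2dist (f n) (f (r k)))"
          unfolding l2dist_def using sqint_diff[OF f f] by (intro nn_integral_eq_integral) (auto simp: sqint_def)
        also have "\<dots> \<le> ennreal e" using n[of "r k"] elim rk[of k] by (intro ennreal_leI) auto
        finally show ?case .
      qed
    qed
    also have "\<dots> = ennreal e" by (simp add: Liminf_const)
    finally show ?thesis .
  qed
  have diff: "sqint (\<lambda>x. f n x - g x)" if "e \<ge> 0" "\<And>m. N0 \<le> m \<Longrightarrow> l2dist (f n) (f m) \<le> e" for n e N0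
    unfolding sqint_def
  proof
    show "(\<lambda>x. f n x - g x) \<in> borel_measurable lebesgue" by measurable
    show "integrable lebesgue (\<lambda>x. (norm (f n x - g x))\<^sup>2)"
      using le_less_trans[OF fatou[OF that] ennreal_less_top] by (intro integrableI_nonneg) auto
  qed
  obtain N1 where N1: "\<And>m n. N1 \<le> m \<Longrightarrow> N1 \<le> n \<Longrightarrow> l2dist (f m) (f n) \<le> 1" using cauchy[of 1] by auto
  have "sqint (\<lambda>x. f N1 x - (f N1 x - g x))"
    by (rule sqint_diff[OF f diff[of 1 N1]]) (use N1 in auto)
  then have g: "sqint g" by simp
  have "(\<lambda>n. l2dist (f n) g) \<longlonglongrightarrow> 0"
  proof (rule LIMSEQ_I)
    fix e :: real assume e: "e > 0"
    obtain N2 where N2: "\<And>m n. N2 \<le> m \<Longrightarrow> N2 \<le> n \<Longrightarrow> l2dist (f m) (f n) \<le> e / 2" using cauchy[of "e/2"] e by auto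
    have "l2dist (f n) g < e" if "N2 \<le> n" for n
    proof -
      have "ennreal (l2dist (f n) g) = (\<integral>\<^sup>+x. ennreal ((norm (f n x - g x))\<^sup>2) \<partial>lebesgue)"
        unfolding l2dist_def using sqint_diff[OF f g] by (intro nn_integral_eq_integral[symmetric]) (auto simp: sqint_def)
      also have "\<dots> \<le> ennreal (e / 2)" by (rule fatou[of _ N2]) (use e that N2 in auto)
      finally show ?thesis using e by simp
    qed
    moreover have "0 \<le> l2dist (f n) g" for n by (simp add: l2dist_def)
    ultimately show "\<exists>no. \<forall>n\<ge>no. norm (l2dist (f n) g - 0) < e" by auto
  qed
  with g show thesis by (rule that)
qed

subsection \<open>The torsion function as an energy maximiser\<close>

lemma sqint_test_fun: "test_fun U \<phi> \<Longrightarrow> sqint \<phi>"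
proof -
  assume t: "test_fun U \<phi>"
  obtain C where C: "compact C" "\<And>y. y \<notin> C \<Longrightarrow> \<phi> y = 0" "smooth \<phi>" using t by (rule test_funE) blast
  have "integrable lebesgue (\<lambda>x. (\<phi> x)\<^sup>2)"
    by (rule integrable_compact_support[OF _ C(1)]) (use C in \<open>auto intro!: continuous_on_power[OF smooth_continuous_on]\<close>)
  then show ?thesis using borel_imp_lebesgue[OF test_fun_borel[OF t]] by (simp add: sqint_real)
qed

lemma sqint_grad_test_fun: "test_fun U \<phi> \<Longrightarrow> sqint (grad \<phi>)"
  by (simp add: sqint_def test_fun_grad_sq_integrable grad_lebesgue test_fun_smooth)

lemma grad_add: "smooth f \<Longrightarrow> smooth g \<Longrightarrow> grad (\<lambda>x. f x + g x) x = grad f x + grad g x"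
  using has_derivative_add[OF smooth_has_derivative_grad smooth_has_derivative_grad, of f g x]
  by (intro grad_eqI) (simp add: inner_add_left)

lemma grad_cmult: "smooth f \<Longrightarrow> grad (\<lambda>x. c * f x) x = c *\<^sub>R grad f x"
  using has_derivative_mult_right[OF smooth_has_derivative_grad[of f x], of c] by (intro grad_eqI) simp

lemma grad_diff: "smooth f \<Longrightarrow> smooth g \<Longrightarrow> grad (\<lambda>x. f x - g x) x = grad f x - grad g x"
  using has_derivative_diff[OF smooth_has_derivative_grad smooth_has_derivative_grad, of f g x]
  by (intro grad_eqI) (simp add: inner_diff_left)

text \<open>Its supremum over test functions on \<open>\<Omega>\<close> is the torsional rigidity,
  and the torsion function is its maximiser; Saint-Venant bounds it from above.\<close>

definition energy :: "('a::euclidean_space \<Rightarrow> real) \<Rightarrow> real" where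
  "energy \<phi> = 2 * (\<integral>x. \<phi> x \<partial>lebesgue) - (\<integral>x. (norm (grad \<phi> x))\<^sup>2 \<partial>lebesgue)"

lemma indicator_test_fun: "test_fun \<Omega> \<phi> \<Longrightarrow> indicator \<Omega> x * \<phi> x = \<phi> x"
  using test_fun_outside[of \<Omega> \<phi> x] by (auto simp: indicator_def)

text \<open>From the divergence of \<open>x \<phi>\<^sup>2\<close>.\<close>
lemma poincare:
  fixes \<phi> :: "'a::euclidean_space \<Rightarrow> real"
  assumes \<phi>: "test_fun \<Omega> \<phi>" and R: "\<And>x. x \<in> \<Omega> \<Longrightarrow> norm x \<le> R" "0 \<le> R"
  shows "(\<integral>x. (\<phi> x)\<^sup>2 \<partial>lebesgue) \<le> (2 * R / DIM('a))\<^sup>2 * (\<integral>x. (norm (grad \<phi> x))\<^sup>2 \<partial>lebesgue)"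
proof -
  let ?d = "real DIM('a)" and ?N = "\<integral>x. (\<phi> x)\<^sup>2 \<partial>lebesgue" and ?G = "\<integral>x. (norm (grad \<phi> x))\<^sup>2 \<partial>lebesgue"
  note sm = test_fun_smooth[OF \<phi>] and sq = sqint_test_fun[OF \<phi>] and sqg = sqint_grad_test_fun[OF \<phi>]
  note D = smooth_has_derivative_grad[OF sm]
  obtain M where M: "M-lipschitz_on UNIV \<phi>" using test_fun_lipschitz[OF \<phi>] by blast
  have out: "\<phi> x = 0" if "norm x > R" for x using test_fun_outside[OF \<phi>, of x] R(1)[of x] that by fastforce
  have m: "\<phi> \<in> borel_measurable lebesgue" "grad \<phi> \<in> borel_measurable lebesgue" using sq sqg by (auto simp: sqint_def)
  have step: "(\<integral>x. (\<phi> x)\<^sup>2 \<partial>lebesgue) = - 2 * (\<integral>x. (x \<bullet> b) * \<phi> x * (grad \<phi> x \<bullet> b) \<partial>lebesgue) \<and> integrable lebesgue (\<lambda>x. (x \<bullet> b) * \<phi> x * (grad \<phi> x \<bullet> b))"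
    if b: "b \<in> Basis" for b
  proof -
    obtain L where L: "L-lipschitz_on (cball 0 R) (\<lambda>x. (x \<bullet> b) * \<phi> x)"
      using smooth_lipschitz_cball[OF smooth_mult[OF smooth_inner sm]] by blast
    have gu: "((\<lambda>x. (x \<bullet> b) * \<phi> x) has_derivative (\<lambda>h. (\<phi> x *\<^sub>R b + (x \<bullet> b) *\<^sub>R grad \<phi> x) \<bullet> h)) (at x)" for x
    proof -
      have "((\<lambda>x. (x \<bullet> b) * \<phi> x) has_derivative (\<lambda>h. (x \<bullet> b) * (grad \<phi> x \<bullet> h) + (h \<bullet> b) * \<phi> x)) (at x)"
        by (rule has_derivative_mult[OF _ D]) (auto intro!: derivative_eq_intros)
      moreover have "(\<lambda>h. (x \<bullet> b) * (grad \<phi> x \<bullet> h) + (h \<bullet> b) * \<phi> x) = (\<lambda>h. (\<phi> x *\<^sub>R b + (x \<bullet> b) *\<^sub>R grad \<phi> x) \<bullet> h)"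
        by (auto simp: fun_eq_iff inner_add_left inner_add_right inner_commute)
      ultimately show ?thesis by (simp only:)
    qed
    have m1: "(\<lambda>x. (x \<bullet> b) * \<phi> x) \<in> borel_measurable lebesgue"
      by (intro borel_imp_lebesgue borel_measurable_continuous_onI smooth_continuous_on smooth_mult smooth_inner sm)
    have m2: "(\<lambda>x. \<phi> x *\<^sub>R b + (x \<bullet> b) *\<^sub>R grad \<phi> x) \<in> borel_measurable lebesgue"
      by (intro borel_imp_lebesgue borel_measurable_continuous_onI continuous_intros smooth_continuous_on grad_continuous sm)
    note ibp = lipschitz_ibp[OF L M out m1 m2 m(2) AE_I2[OF gu] AE_I2[OF D], of b]
    have bb: "b \<bullet> b = 1" using b by simp
    have e1: "((\<phi> x *\<^sub>R b + (x \<bullet> b) *\<^sub>R grad \<phi> x) \<bullet> b) * \<phi> x = (\<phi> x)\<^sup>2 + (x \<bullet> b) * \<phi> x * (grad \<phi> x \<bullet> b)" for x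
      by (simp add: inner_add_left bb power2_eq_square algebra_simps)
    have i: "integrable lebesgue (\<lambda>x. (x \<bullet> b) * \<phi> x * (grad \<phi> x \<bullet> b))" using ibp(2) by (simp add: mult_ac)
    have "(\<integral>x. (x \<bullet> b) * \<phi> x * (grad \<phi> x \<bullet> b) \<partial>lebesgue) = - (?N + (\<integral>x. (x \<bullet> b) * \<phi> x * (grad \<phi> x \<bullet> b) \<partial>lebesgue))"
      using ibp(3) i sq unfolding e1 by (simp add: sqint_real mult_ac)
    then show ?thesis using i by simp
  qed
  have inn: "(\<Sum>b\<in>Basis. (x \<bullet> b) * \<phi> x * (grad \<phi> x \<bullet> b)) = \<phi> x * (x \<bullet> grad \<phi> x)" for x
    by (subst (2) euclidean_inner) (simp add: sum_distrib_left mult_ac)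
  have "?d * ?N = (\<Sum>b\<in>(Basis::'a set). - 2 * (\<integral>x. (x \<bullet> b) * \<phi> x * (grad \<phi> x \<bullet> b) \<partial>lebesgue))"
    using step by (simp add: sum_constant[symmetric] del: sum_constant)
  also have "\<dots> = - 2 * (\<integral>x. (\<Sum>b\<in>Basis. (x \<bullet> b) * \<phi> x * (grad \<phi> x \<bullet> b)) \<partial>lebesgue)"
    using step by (subst Bochner_Integration.integral_sum) (auto simp: sum_distrib_left)
  also have "\<dots> \<le> 2 * \<bar>\<integral>x. \<phi> x * (x \<bullet> grad \<phi> x) \<partial>lebesgue\<bar>" unfolding inn by simp
  also have "(\<integral>x. \<phi> x * (x \<bullet> grad \<phi> x) \<partial>lebesgue) = (\<integral>x. (\<phi> x *\<^sub>R x) \<bullet> grad \<phi> x \<partial>lebesgue)" by simp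
  finally have 1: "?d * ?N \<le> 2 * \<bar>\<integral>x. (\<phi> x *\<^sub>R x) \<bullet> grad \<phi> x \<partial>lebesgue\<bar>" .
  have le: "(norm (\<phi> x *\<^sub>R x))\<^sup>2 \<le> R\<^sup>2 * (\<phi> x)\<^sup>2" for x
  proof (cases "\<phi> x = 0")
    case False
    then have "norm x \<le> R" using out[of x] by force
    then have "(norm x)\<^sup>2 \<le> R\<^sup>2" by (intro power_mono) auto
    then have "(norm x)\<^sup>2 * (\<phi> x)\<^sup>2 \<le> R\<^sup>2 * (\<phi> x)\<^sup>2" by (rule mult_right_mono) simp
    then show ?thesis by (simp add: power_mult_distrib mult.commute)
  qed simp
  have sx: "sqint (\<lambda>x. \<phi> x *\<^sub>R x)"
    unfolding sqint_def
  proof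
    show mm: "(\<lambda>x. \<phi> x *\<^sub>R x) \<in> borel_measurable lebesgue"
      by (intro borel_imp_lebesgue borel_measurable_continuous_onI continuous_intros smooth_continuous_on sm)
    show "integrable lebesgue (\<lambda>x. (norm (\<phi> x *\<^sub>R x))\<^sup>2)"
    proof (rule Bochner_Integration.integrable_bound[of _ "\<lambda>x. R\<^sup>2 * (\<phi> x)\<^sup>2"])
      show "(\<lambda>x. (norm (\<phi> x *\<^sub>R x))\<^sup>2) \<in> borel_measurable lebesgue" 
        by (intro borel_imp_lebesgue borel_measurable_continuous_onI continuous_intros smooth_continuous_on sm)
    qed (use sq le in \<open>auto simp: sqint_real\<close>)
  qed
  have "(\<integral>x. (norm (\<phi> x *\<^sub>R x))\<^sup>2 \<partial>lebesgue) \<le> (\<integral>x. R\<^sup>2 * (\<phi> x)\<^sup>2 \<partial>lebesgue)"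
    by (rule integral_mono) (use sx sq le in \<open>auto simp: sqint_def\<close>)
  then have 2: "(\<integral>x. (norm (\<phi> x *\<^sub>R x))\<^sup>2 \<partial>lebesgue) \<le> R\<^sup>2 * ?N" by simp
  have N0: "0 \<le> ?N" "0 \<le> ?G" by simp_all
  have "(?d * ?N)\<^sup>2 \<le> (2 * \<bar>\<integral>x. (\<phi> x *\<^sub>R x) \<bullet> grad \<phi> x \<partial>lebesgue\<bar>)\<^sup>2" using 1 N0 by (intro power_mono) auto
  also have "\<dots> = 4 * (\<integral>x. (\<phi> x *\<^sub>R x) \<bullet> grad \<phi> x \<partial>lebesgue)\<^sup>2" by (simp add: power_mult_distrib)
  also have "\<dots> \<le> 4 * ((R\<^sup>2 * ?N) * ?G)"
    using sqint_Cauchy_Schwarz[OF sx sqg] mult_right_mono[OF 2 N0(2)] by simp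
  finally have "?N * (?d\<^sup>2 * ?N) \<le> ?N * (4 * R\<^sup>2 * ?G)" by (simp add: power2_eq_square mult_ac)
  moreover have "?N = 0 \<or> 0 < ?N" using N0(1) by linarith
  ultimately have "?d\<^sup>2 * ?N \<le> 4 * R\<^sup>2 * ?G \<or> ?N = 0" using mult_left_le_imp_le by blast
  then show ?thesis
  proof
    assume "?d\<^sup>2 * ?N \<le> 4 * R\<^sup>2 * ?G"
    then show ?thesis by (simp add: power_divide power_mult_distrib field_simps)
  next
    assume "?N = 0" then show ?thesis using N0 by simp
  qed
qed

lemma sqint_indicator:
  fixes K :: "'a::euclidean_space set"
  assumes "K \<in> lmeasurable" shows "sqint (indicator K :: 'a \<Rightarrow> real)"
proof -
  have "(\<lambda>x. (indicator K x :: real)\<^sup>2) = indicator K" by (auto simp: fun_eq_iff indicator_def)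
  then show ?thesis using assms by (auto simp: sqint_real fmeasurable_def intro!: integrable_real_indicator borel_measurable_indicator)
qed

lemma loc_integrable_sqint:
  fixes f :: "'a::euclidean_space \<Rightarrow> real"
  assumes "sqint f" shows "loc_integrable f"
  unfolding loc_integrable_def set_integrable_def
proof (intro conjI allI impI)
  show m: "f \<in> borel_measurable lebesgue" using assms by (simp add: sqint_def)
  fix K :: "'a set" assume "compact K"
  then have K: "K \<in> lmeasurable" by (rule lmeasurable_compact)
  from sqint_inner[OF sqint_indicator[OF K] assms] show "integrable lebesgue (\<lambda>x. indicator K x *\<^sub>R f x)" by simp
qed

lemma test_fun_weak_grad:
  assumes \<phi>: "test_fun U \<phi>" shows "weak_grad_L2 \<phi> (grad \<phi>)"
proof -
  obtain L where L: "L-lipschitz_on UNIV \<phi>" using test_fun_lipschitz[OF \<phi>] by blast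
  note sm = test_fun_smooth[OF \<phi>]
  show ?thesis
    by (rule weak_grad_lipschitz[OF L grad_lebesgue[OF sm] AE_I2[OF smooth_has_derivative_grad[OF sm]] test_fun_grad_sq_integrable[OF \<phi>]])
qed

text \<open>The arithmetic of uniform concavity: if \<open>x\<close> and \<open>y\<close> nearly
  reach the supremum and the midpoint cannot exceed it, the gain \<open>N / 4\<close> of the
  midpoint must be small.\<close>

lemma midpoint_gap:
  fixes N a b E x y S :: real
  assumes "E = (1/2) * x + (1/2) * y + (1/4) * N" "E \<le> S" "S - a < x" "S - b < y"
  shows "N \<le> 2 * (a + b)"
  using assms by (simp add: field_simps)

text \<open>The direct method. By the parallelogram identity the gradients of a maximising sequence
  are Cauchy, by Poincare so are the functions, and the limit satisfies the Euler-Lagrange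
  equation.\<close>

lemma torsion_exists:
  fixes \<Omega> :: "'a::euclidean_space set"
  assumes \<Omega>: "bounded \<Omega>" "\<Omega> \<in> lmeasurable" and bd: "\<And>\<phi>. test_fun \<Omega> \<phi> \<Longrightarrow> energy \<phi> \<le> T"
  shows "\<exists>v. is_torsion \<Omega> v"
proof -
  define S where "S = Sup (energy ` {\<phi>. test_fun \<Omega> \<phi>})"
  have ne: "energy ` {\<phi>. test_fun \<Omega> \<phi>} \<noteq> {}" using test_fun_0 by blast
  have ba: "bdd_above (energy ` {\<phi>. test_fun \<Omega> \<phi>})" using bd by (intro bdd_aboveI) auto
  have up: "energy \<phi> \<le> S" if "test_fun \<Omega> \<phi>" for \<phi> unfolding S_def using that ba by (intro cSup_upper) auto
  have "\<exists>\<phi>. test_fun \<Omega> \<phi> \<and> S - 1 / real (Suc n) < energy \<phi>" for n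
  proof -
    have "S - 1 / real (Suc n) < S" by simp
    then show ?thesis unfolding S_def using less_cSup_iff[OF ne ba] by auto
  qed
  then obtain p where p: "\<And>n. test_fun \<Omega> (p n)" "\<And>n. S - 1 / real (Suc n) < energy (p n)" by metis
  note sm = test_fun_smooth[OF p(1)] and ip = test_fun_integrable[OF p(1)] and sq = sqint_test_fun[OF p(1)] and sqg = sqint_grad_test_fun[OF p(1)]
  have par: "(\<integral>x. (norm (grad (p m) x - grad (p n) x))\<^sup>2 \<partial>lebesgue) \<le> 2 * (1 / real (Suc m) + 1 / real (Suc n))" for m n
  proof -
    define h where "h = (\<lambda>x. (1/2) * (p m x + p n x))"
    have th: "test_fun \<Omega> h" unfolding h_def by (intro test_fun_cmult test_fun_add p)
    have gh: "grad h x = (1/2) *\<^sub>R (grad (p m) x + grad (p n) x)" for x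
      unfolding h_def by (simp only: grad_cmult[OF smooth_add[OF sm sm]] grad_add[OF sm sm])
    have "(\<integral>x. (norm (grad h x))\<^sup>2 \<partial>lebesgue) = (\<integral>x. (1/2) * (norm (grad (p m) x))\<^sup>2 + (1/2) * (norm (grad (p n) x))\<^sup>2 - (1/4) * (norm (grad (p m) x - grad (p n) x))\<^sup>2 \<partial>lebesgue)"
      by (rule Bochner_Integration.integral_cong)
         (unfold gh power2_norm_eq_inner, auto simp: inner_simps inner_commute field_simps)
    also have "\<dots> = (1/2) * (\<integral>x. (norm (grad (p m) x))\<^sup>2 \<partial>lebesgue) + (1/2) * (\<integral>x. (norm (grad (p n) x))\<^sup>2 \<partial>lebesgue) - (1/4) * (\<integral>x. (norm (grad (p m) x - grad (p n) x))\<^sup>2 \<partial>lebesgue)"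
      using sqg sqint_diff[OF sqg sqg] by (simp add: sqint_def)
    finally have 1: "(\<integral>x. (norm (grad h x))\<^sup>2 \<partial>lebesgue) = \<dots>" .
    have 2: "(\<integral>x. h x \<partial>lebesgue) = (1/2) * (\<integral>x. p m x \<partial>lebesgue) + (1/2) * (\<integral>x. p n x \<partial>lebesgue)"
      unfolding h_def using ip by (simp add: field_simps)
    have "energy h = (1/2) * energy (p m) + (1/2) * energy (p n) + (1/4) * (\<integral>x. (norm (grad (p m) x - grad (p n) x))\<^sup>2 \<partial>lebesgue)"
      unfolding energy_def 1 2 by (simp add: field_simps)
    then show ?thesis using midpoint_gap[OF _ up[OF th] p(2)[of m] p(2)[of n]] by blast
  qed
  obtain R where R: "R > 0" "\<And>x. x \<in> \<Omega> \<Longrightarrow> norm x \<le> R" using \<Omega>(1) by (auto simp: bounded_pos)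
  define K where "K = (2 * R / DIM('a))\<^sup>2"
  have K0: "K \<ge> 0" by (simp add: K_def)
  have dp: "l2dist (p m) (p n) \<le> K * l2dist (grad (p m)) (grad (p n))" for m n
    using poincare[OF test_fun_diff[OF p(1)[of m] p(1)[of n]] R(2)] R(1)
    by (simp add: l2dist_def K_def grad_diff[OF sm sm])
  have small: "\<exists>N. \<forall>m\<ge>N. \<forall>n\<ge>N. 2 * (1 / real (Suc m) + 1 / real (Suc n)) \<le> e" if e: "e > 0" for e :: real
  proof -
    obtain N where N: "1 / real (Suc N) < e / 4" using reals_Archimedean[of "e/4"] e by (auto simp: inverse_eq_divide)
    have le: "1 / real (Suc m) \<le> 1 / real (Suc N)" if "N \<le> m" for m using that by (simp add: frac_le)
    show ?thesis
    proof (intro exI[of _ N] allI impI)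
      fix m n assume "N \<le> m" "N \<le> n"
      from le[OF this(1)] le[OF this(2)] N show "2 * (1 / real (Suc m) + 1 / real (Suc n)) \<le> e"
        unfolding distrib_left by linarith
    qed
  qed
  obtain g where g: "sqint g" "(\<lambda>n. l2dist (grad (p n)) g) \<longlonglongrightarrow> 0"
  proof (rule l2_complete[OF sqg])
    show "\<exists>N. \<forall>m\<ge>N. \<forall>n\<ge>N. l2dist (grad (p m)) (grad (p n)) \<le> e" if "e > 0" for e
      using small[OF that] par unfolding l2dist_def by (meson order_trans)
  qed
  obtain u where u: "sqint u" "(\<lambda>n. l2dist (p n) u) \<longlonglongrightarrow> 0"
  proof (rule l2_complete[OF sq])
    show "\<exists>N. \<forall>m\<ge>N. \<forall>n\<ge>N. l2dist (p m) (p n) \<le> e" if "e > 0" for e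
    proof -
      have "e / (K + 1) > 0" using that K0 by simp
      from small[OF this] obtain N where N: "\<And>m n. N \<le> m \<Longrightarrow> N \<le> n \<Longrightarrow> 2 * (1 / real (Suc m) + 1 / real (Suc n)) \<le> e / (K + 1)" by blast
      have "l2dist (p m) (p n) \<le> e" if "N \<le> m" "N \<le> n" for m n
      proof -
        have "l2dist (grad (p m)) (grad (p n)) \<le> e / (K + 1)" using par[of m n] N[OF that] by (simp add: l2dist_def)
        then have "l2dist (p m) (p n) \<le> K * (e / (K + 1))" using dp[of m n] K0 by (meson mult_left_mono order_trans)
        also have "\<dots> \<le> e" using K0 \<open>e > 0\<close> by (simp add: field_simps)
        finally show ?thesis .
      qed
      then show ?thesis by blast
    qed
  qed
  have wg: "weak_grad_L2 u g"
    unfolding weak_grad_L2_def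
  proof (intro conjI allI impI)
    show "loc_integrable u" using u(1) by (rule loc_integrable_sqint)
    show "g \<in> borel_measurable lebesgue" "integrable lebesgue (\<lambda>x. (norm (g x))\<^sup>2)" using g by (auto simp: sqint_def)
    fix \<chi>1 :: "'a \<Rightarrow> real" and b :: 'a assume c: "test_fun UNIV \<chi>1" and b: "b \<in> Basis"
    have "(\<lambda>n. \<integral>x. p n x \<bullet> pd \<chi>1 b x \<partial>lebesgue) \<longlonglongrightarrow> (\<integral>x. u x \<bullet> pd \<chi>1 b x \<partial>lebesgue)"
      by (rule l2_tendsto_inner[OF sq u sqint_test_fun[OF test_fun_pd[OF c]]])
    moreover have "sqint (\<lambda>x. \<chi>1 x *\<^sub>R b)"
      using sqint_test_fun[OF c] b by (auto simp: sqint_def power_mult_distrib)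
    from l2_tendsto_inner[OF sqg g this]
    have "(\<lambda>n. - (\<integral>x. grad (p n) x \<bullet> (\<chi>1 x *\<^sub>R b) \<partial>lebesgue)) \<longlonglongrightarrow> - (\<integral>x. g x \<bullet> (\<chi>1 x *\<^sub>R b) \<partial>lebesgue)" by (rule tendsto_minus)
    moreover have "(\<integral>x. p n x \<bullet> pd \<chi>1 b x \<partial>lebesgue) = - (\<integral>x. grad (p n) x \<bullet> (\<chi>1 x *\<^sub>R b) \<partial>lebesgue)" for n
      using test_fun_weak_grad[OF p(1)[of n]] c b by (simp add: weak_grad_L2_def mult.commute)
    ultimately have "(\<integral>x. u x \<bullet> pd \<chi>1 b x \<partial>lebesgue) = - (\<integral>x. g x \<bullet> (\<chi>1 x *\<^sub>R b) \<partial>lebesgue)"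
      using LIMSEQ_unique by simp
    then show "(\<integral>x. u x * pd \<chi>1 b x \<partial>lebesgue) = - (\<integral>x. (g x \<bullet> b) * \<chi>1 x \<partial>lebesgue)" by (simp add: mult.commute)
  qed
  have H: "in_H10 \<Omega> u g"
    unfolding in_H10_def in_H1_def using wg u g p(1) by (auto simp: sqint_real l2dist_def intro!: exI[of _ p])
  have EL: "(\<integral>x. g x \<bullet> grad \<phi> x \<partial>lebesgue) = (\<integral>x. indicator \<Omega> x * \<phi> x \<partial>lebesgue)" if \<phi>: "test_fun \<Omega> \<phi>" for \<phi>
  proof -
    note smf = test_fun_smooth[OF \<phi>] and sqf = sqint_grad_test_fun[OF \<phi>]
    define J B A where "J = (\<integral>x. \<phi> x \<partial>lebesgue)" and "B = (\<integral>x. (norm (grad \<phi> x))\<^sup>2 \<partial>lebesgue)" and "A = (\<integral>x. g x \<bullet> grad \<phi> x \<partial>lebesgue)"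
    \<comment> \<open>The perturbation is added to the maximising sequence and not to its limit, so
      that only test functions compete; the defect \<open>1 / real (Suc n)\<close> vanishes in the
      limit.\<close>
    have q: "2 * t * (J - A) - t\<^sup>2 * B \<le> 0" for t :: real
    proof -
      have "2 * t * J - 2 * t * (\<integral>x. grad (p n) x \<bullet> grad \<phi> x \<partial>lebesgue) - t\<^sup>2 * B \<le> 1 / real (Suc n)" for n
      proof -
        define h where "h = (\<lambda>x. p n x + t * \<phi> x)"
        have th: "test_fun \<Omega> h" unfolding h_def by (intro test_fun_cmult test_fun_add p \<phi>)
        have gh: "grad h x = grad (p n) x + t *\<^sub>R grad \<phi> x" for x
          unfolding h_def by (simp only: grad_add[OF sm smooth_mult[OF smooth_const smf]] grad_cmult[OF smf])
        have "(\<integral>x. (norm (grad h x))\<^sup>2 \<partial>lebesgue) = (\<integral>x. (norm (grad (p n) x))\<^sup>2 + 2 * t * (grad (p n) x \<bullet> grad \<phi> x) + t\<^sup>2 * (norm (grad \<phi> x))\<^sup>2 \<partial>lebesgue)"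
          by (rule Bochner_Integration.integral_cong)
             (unfold gh power2_norm_eq_inner, auto simp: inner_simps inner_commute power2_eq_square algebra_simps)
        also have "\<dots> = (\<integral>x. (norm (grad (p n) x))\<^sup>2 \<partial>lebesgue) + 2 * t * (\<integral>x. grad (p n) x \<bullet> grad \<phi> x \<partial>lebesgue) + t\<^sup>2 * B"
          using sqg sqf sqint_inner[OF sqg sqf] by (simp add: sqint_def B_def)
        moreover have "(\<integral>x. h x \<partial>lebesgue) = (\<integral>x. p n x \<partial>lebesgue) + t * J"
          unfolding h_def J_def using ip test_fun_integrable[OF \<phi>] by simp
        ultimately have "energy h = energy (p n) + 2 * t * J - 2 * t * (\<integral>x. grad (p n) x \<bullet> grad \<phi> x \<partial>lebesgue) - t\<^sup>2 * B"
          by (simp add: energy_def algebra_simps)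
        then show ?thesis using up[OF th] p(2)[of n] by linarith
      qed
      moreover have "(\<lambda>n. 2 * t * J - 2 * t * (\<integral>x. grad (p n) x \<bullet> grad \<phi> x \<partial>lebesgue) - t\<^sup>2 * B) \<longlonglongrightarrow> 2 * t * J - 2 * t * A - t\<^sup>2 * B"
        unfolding A_def by (intro tendsto_intros l2_tendsto_inner[OF sqg g sqf])
      moreover have "(\<lambda>n. 1 / real (Suc n)) \<longlonglongrightarrow> 0" using LIMSEQ_inverse_real_of_nat by (simp add: inverse_eq_divide)
      ultimately have "2 * t * J - 2 * t * A - t\<^sup>2 * B \<le> 0" by (intro LIMSEQ_le) auto
      then show ?thesis by (simp add: algebra_simps)
    qed
    have B0: "B \<ge> 0" by (simp add: B_def)
    \<comment> \<open>The extra 1 avoids division by zero, and this \<open>t\<close> turns the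
      quadratic into \<open>t\<^sup>2 * (B + 2)\<close>, which forces \<open>t = 0\<close>.\<close>
    define t where "t = (J - A) / (B + 1)"
    have JA: "J - A = t * (B + 1)" using B0 by (simp add: t_def)
    have "2 * t * (J - A) - t\<^sup>2 * B = t\<^sup>2 * (B + 2)" unfolding JA by (simp add: power2_eq_square algebra_simps)
    then have "t\<^sup>2 * (B + 2) \<le> 0" using q[of t] by simp
    then have "t = 0" using B0 by (simp add: mult_le_0_iff)
    then have "J = A" using B0 by (simp add: t_def)
    then show ?thesis by (simp add: J_def A_def indicator_test_fun[OF \<phi>])
  qed
  from H EL show ?thesis unfolding is_torsion_def by blast
qed

text \<open>Testing the equation with the approximating sequence gives \<open>T\<close> as the
  Dirichlet integral of the torsion function. Completing the square, the energy of a test function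
  falls short of \<open>T\<close> by the squared distance of the gradients. So \<open>T\<close> is a
  supremum that does not depend on \<open>v\<close>.\<close>

lemma torsion_value:
  fixes \<Omega> :: "'a::euclidean_space set"
  assumes \<Omega>: "\<Omega> \<in> lmeasurable" and v: "is_torsion \<Omega> v"
  defines "T \<equiv> \<integral>x. indicator \<Omega> x * v x \<partial>lebesgue"
  shows "\<And>\<phi>. test_fun \<Omega> \<phi> \<Longrightarrow> energy \<phi> \<le> T" "\<exists>p. (\<forall>n. test_fun \<Omega> (p n)) \<and> (\<lambda>n. energy (p n)) \<longlonglongrightarrow> T"
proof -
  obtain g where g: "in_H10 \<Omega> v g" and EL: "\<And>\<phi>. test_fun \<Omega> \<phi> \<Longrightarrow> (\<integral>x. g x \<bullet> grad \<phi> x \<partial>lebesgue) = (\<integral>x. indicator \<Omega> x * \<phi> x \<partial>lebesgue)"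
    using v by (auto simp: is_torsion_def)
  have sv: "sqint v" and sg: "sqint g"
    using g by (auto simp: in_H10_def in_H1_def weak_grad_L2_def sqint_real sqint_def loc_integrable_def)
  obtain p where p: "\<And>n. test_fun \<Omega> (p n)" "(\<lambda>n. l2dist (p n) v) \<longlonglongrightarrow> 0" "(\<lambda>n. l2dist (grad (p n)) g) \<longlonglongrightarrow> 0"
    using g by (auto simp: in_H10_def l2dist_def)
  note sq = sqint_test_fun[OF p(1)] and sqg = sqint_grad_test_fun[OF p(1)]
  note si = sqint_indicator[OF \<Omega>]
  have l1: "(\<lambda>n. \<integral>x. p n x \<partial>lebesgue) \<longlonglongrightarrow> T"
    using l2_tendsto_inner[OF sq sv p(2) si] by (simp add: T_def mult.commute[of "v _"] mult.commute[of "p _ _"] indicator_test_fun[OF p(1)])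
  have l2: "(\<lambda>n. \<integral>x. (norm (grad (p n) x))\<^sup>2 \<partial>lebesgue) \<longlonglongrightarrow> (\<integral>x. (norm (g x))\<^sup>2 \<partial>lebesgue)" by (rule l2_tendsto_norm[OF sqg sg p(3)])
  have "(\<lambda>n. \<integral>x. grad (p n) x \<bullet> g x \<partial>lebesgue) \<longlonglongrightarrow> (\<integral>x. g x \<bullet> g x \<partial>lebesgue)" by (rule l2_tendsto_inner[OF sqg sg p(3) sg])
  moreover have "(\<integral>x. grad (p n) x \<bullet> g x \<partial>lebesgue) = (\<integral>x. p n x \<partial>lebesgue)" for n
    using EL[OF p(1)[of n]] by (simp add: inner_commute[of "grad _ _"] indicator_test_fun[OF p(1)])
  ultimately have Tg: "T = (\<integral>x. (norm (g x))\<^sup>2 \<partial>lebesgue)" using l1 LIMSEQ_unique by (simp add: power2_norm_eq_inner)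
  show "energy \<phi> \<le> T" if \<phi>: "test_fun \<Omega> \<phi>" for \<phi>
  proof -
    note sf = sqint_grad_test_fun[OF \<phi>]
    have "0 \<le> (\<integral>x. (norm (g x - grad \<phi> x))\<^sup>2 \<partial>lebesgue)" by simp
    also have "\<dots> = (\<integral>x. (norm (g x))\<^sup>2 - 2 * (g x \<bullet> grad \<phi> x) + (norm (grad \<phi> x))\<^sup>2 \<partial>lebesgue)"
      by (rule Bochner_Integration.integral_cong) (auto simp: power2_norm_eq_inner inner_simps inner_commute)
    also have "\<dots> = T - 2 * (\<integral>x. \<phi> x \<partial>lebesgue) + (\<integral>x. (norm (grad \<phi> x))\<^sup>2 \<partial>lebesgue)"
      using sg sf sqint_inner[OF sg sf] EL[OF \<phi>] by (simp add: sqint_def Tg indicator_test_fun[OF \<phi>])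
    finally show ?thesis by (simp add: energy_def)
  qed
  have "(\<lambda>n. energy (p n)) \<longlonglongrightarrow> 2 * T - (\<integral>x. (norm (g x))\<^sup>2 \<partial>lebesgue)" unfolding energy_def by (intro tendsto_intros l1 l2)
  then show "\<exists>p. (\<forall>n. test_fun \<Omega> (p n)) \<and> (\<lambda>n. energy (p n)) \<longlonglongrightarrow> T" using p(1) Tg by auto
qed

text \<open>The definite description is resolved here: a torsion function exists, and any two give
  the same value because each value is a limit of energies bounded by the other.\<close>

lemma torsional_rigidity_bounds:
  fixes \<Omega> :: "'a::euclidean_space set"
  assumes \<Omega>: "bounded \<Omega>" "\<Omega> \<in> lmeasurable" and bd: "\<And>\<phi>. test_fun \<Omega> \<phi> \<Longrightarrow> energy \<phi> \<le> M"
  shows "torsional_rigidity \<Omega> \<le> M" "test_fun \<Omega> \<phi> \<Longrightarrow> energy \<phi> \<le> torsional_rigidity \<Omega>"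
proof -
  let ?T = "\<lambda>v. \<integral>x. indicator \<Omega> x * v x \<partial>lebesgue"
  have "\<exists>v. is_torsion \<Omega> v" by (rule torsion_exists[OF \<Omega>]) (rule bd)
  then obtain v where v: "is_torsion \<Omega> v" by blast
  have le: "?T u \<le> ?T w" if u: "is_torsion \<Omega> u" and w: "is_torsion \<Omega> w" for u w
  proof -
    obtain p where p: "\<And>n. test_fun \<Omega> (p n)" "(\<lambda>n. energy (p n)) \<longlonglongrightarrow> ?T u" using torsion_value(2)[OF \<Omega>(2) u] by blast
    show ?thesis by (rule LIMSEQ_le_const2[OF p(2)]) (use torsion_value(1)[OF \<Omega>(2) w p(1)] in auto)
  qed
  have T: "torsional_rigidity \<Omega> = ?T v"
    unfolding torsional_rigidity_def
  proof (rule the_equality)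
    show "\<exists>w. is_torsion \<Omega> w \<and> ?T v = ?T w" using v by blast
    show "t = ?T v" if "\<exists>w. is_torsion \<Omega> w \<and> t = ?T w" for t using that le v by (auto intro: antisym)
  qed
  show "test_fun \<Omega> \<phi> \<Longrightarrow> energy \<phi> \<le> torsional_rigidity \<Omega>" unfolding T by (rule torsion_value(1)[OF \<Omega>(2) v])
  obtain p where p: "\<And>n. test_fun \<Omega> (p n)" "(\<lambda>n. energy (p n)) \<longlonglongrightarrow> ?T v" using torsion_value(2)[OF \<Omega>(2) v] by blast
  show "torsional_rigidity \<Omega> \<le> M" unfolding T by (rule LIMSEQ_le_const2[OF p(2)]) (use bd[OF p(1)] in auto)
qed

subsection \<open>Balls\<close>

lemma cbody_ball: "0 < r \<Longrightarrow> cbody (ball c r)"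
  by (simp add: cbody_def)

lemma perimeter_nonneg: "cbody \<Omega> \<Longrightarrow> 0 \<le> perimeter \<Omega>"
  using perimeter_ge[of \<Omega>, OF _ test_field_0] by (simp add: divergence_def pd_def)

section \<open>The isoperimetric inequality and the perimeter of balls\<close>

text \<open>The parallel set at distance \<open>t\<close> contains a ball of radius
  \<open>t\<close>. Dividing the bound on its volume by \<open>t ^ DIM('a)\<close> and letting
  \<open>t\<close> tend to infinity leaves only leading coefficients.\<close>

lemma isoperimetric:
  fixes \<Omega> :: "'a::euclidean_space set"
  assumes \<Omega>: "cbody \<Omega>"
  shows "unit_ball_vol (real DIM('a)) \<le> measure lebesgue \<Omega> * (perimeter \<Omega> / (DIM('a) * measure lebesgue \<Omega>)) ^ DIM('a)"
proof -
  let ?d = "DIM('a)" and ?o = "unit_ball_vol (real DIM('a))" and ?V = "measure lebesgue \<Omega>"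
  define c where "c = perimeter \<Omega> / (?d * ?V)"
  obtain x where x: "x \<in> \<Omega>" using \<Omega> by (auto simp: cbody_def)
  have "?o \<le> ?V * (1 / t + c) ^ ?d" if t: "0 < t" for t
  proof -
    have "ball x t \<subseteq> msum \<Omega> (ball 0 t)"
    proof
      fix y assume "y \<in> ball x t"
      then have "x + (y - x) \<in> msum \<Omega> (ball 0 t)" using x by (intro msumI) (auto simp: dist_norm norm_minus_commute)
      then show "y \<in> msum \<Omega> (ball 0 t)" by simp
    qed
    then have "measure lebesgue (ball x t) \<le> measure lebesgue (msum \<Omega> (ball 0 t))"
      using cbody_lmeasurable[OF cbody_msum_ball[OF \<Omega> t]] by (intro measure_mono_fmeasurable) auto
    also have "\<dots> \<le> ?V * (1 + t * perimeter \<Omega> / (?d * ?V)) ^ ?d" by (rule measure_parallel_le[OF \<Omega> t])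
    finally have "?o * t ^ ?d \<le> ?V * (1 + t * perimeter \<Omega> / (?d * ?V)) ^ ?d"
      using t by (simp only: measure_lebesgue_ball[OF less_imp_le])
    also have "1 + t * perimeter \<Omega> / (?d * ?V) = t * (1 / t + c)" using t by (simp add: c_def distrib_left)
    also have "?V * (t * (1 / t + c)) ^ ?d = ?V * (1 / t + c) ^ ?d * t ^ ?d" by (simp add: power_mult_distrib)
    finally show ?thesis using t by simp
  qed
  then have "eventually (\<lambda>t. ?o \<le> ?V * (1 / t + c) ^ ?d) at_top"
    by (rule eventually_mono[OF eventually_gt_at_top[of "0::real"]])
  moreover have "((\<lambda>t. ?V * (1 / t + c) ^ ?d) \<longlongrightarrow> ?V * (0 + c) ^ ?d) at_top"
    using tendsto_inverse_0_at_top[OF filterlim_ident] by (intro tendsto_intros) (simp add: inverse_eq_divide)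
  ultimately have "?o \<le> ?V * (0 + c) ^ ?d" by (intro tendsto_lowerbound) auto
  then show ?thesis by (simp add: c_def)
qed

lemma perimeter_pos:
  fixes \<Omega> :: "'a::euclidean_space set"
  assumes "cbody \<Omega>" shows "0 < perimeter \<Omega>"
proof (rule ccontr)
  assume "\<not> 0 < perimeter \<Omega>"
  then have "perimeter \<Omega> = 0" using perimeter_nonneg[OF assms] by simp
  then have "unit_ball_vol (real DIM('a)) \<le> 0" using isoperimetric[OF assms] by (simp add: zero_power)
  moreover have "0 < unit_ball_vol (real DIM('a))" by (rule unit_ball_vol_pos) simp
  ultimately show False by linarith
qed

lemma perimeter_ge_ball:
  fixes \<Omega> :: "'a::euclidean_space set"
  assumes \<Omega>: "cbody \<Omega>" and r: "0 < r" and V: "measure lebesgue \<Omega> = unit_ball_vol (real DIM('a)) * r ^ DIM('a)"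
  shows "DIM('a) * unit_ball_vol (real DIM('a)) * r ^ (DIM('a) - 1) \<le> perimeter \<Omega>"
proof -
  let ?d = "DIM('a)" and ?o = "unit_ball_vol (real DIM('a))" and ?P = "perimeter \<Omega>"
  have o: "?o > 0" by simp
  have rd: "r ^ ?d = r * r ^ (?d - 1)" by (simp add: power_eq_if)
  have "?o \<le> ?o * r ^ ?d * (?P / (?d * (?o * r ^ ?d))) ^ ?d"
    using isoperimetric[OF \<Omega>] unfolding V .
  also have "\<dots> = ?o * (r * (?P / (?d * (?o * r ^ ?d)))) ^ ?d" by (simp only: power_mult_distrib mult.assoc)
  finally have "1 ^ ?d \<le> (r * (?P / (?d * (?o * r ^ ?d)))) ^ ?d" using o by simp
  then have "1 \<le> r * (?P / (?d * (?o * r ^ ?d)))"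
    using perimeter_nonneg[OF \<Omega>] r o by (subst (asm) power_mono_iff) auto
  then show ?thesis using r o unfolding rd by (simp add: field_simps)
qed

text \<open>The bound by volume over inradius is sharp for balls, and so is the isoperimetric
  inequality.\<close>

lemma perimeter_ball:
  assumes r: "0 < r"
  shows "perimeter (ball (c::'a::euclidean_space) r) = DIM('a) * unit_ball_vol (real DIM('a)) * r ^ (DIM('a) - 1)"
proof (rule antisym)
  let ?d = "DIM('a)"
  have V: "measure lebesgue (ball c r) = unit_ball_vol (real ?d) * r ^ ?d" using r by (simp only: measure_lebesgue_ball less_imp_le)
  have rd: "r ^ ?d = r * r ^ (?d - 1)" by (simp add: power_eq_if)
  show "perimeter (ball c r) \<le> ?d * unit_ball_vol (real ?d) * r ^ (?d - 1)"
    using perimeter_le_inradius[OF cbody_ball[OF r] r order_refl, of c] r unfolding V rd by simp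
  show "?d * unit_ball_vol (real ?d) * r ^ (?d - 1) \<le> perimeter (ball c r)"
    by (rule perimeter_ge_ball[OF cbody_ball[OF r] r V])
qed

section \<open>Torsional rigidity of balls\<close>

lemma torsional_rigidity_le:
  fixes \<Omega> :: "'a::euclidean_space set"
  assumes \<Omega>: "open \<Omega>" "bounded \<Omega>" and R: "0 \<le> R" "measure lebesgue \<Omega> = unit_ball_vol (real DIM('a)) * R ^ DIM('a)"
  shows "torsional_rigidity \<Omega> \<le> torsion_const DIM('a) R" "test_fun \<Omega> \<phi> \<Longrightarrow> energy \<phi> \<le> torsional_rigidity \<Omega>"
proof -
  have e: "energy \<phi> \<le> torsion_const DIM('a) R" if "test_fun \<Omega> \<phi>" for \<phi>
    unfolding energy_def using saint_venant[OF that \<Omega> R] .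
  have m: "\<Omega> \<in> lmeasurable" using \<Omega> by (intro lmeasurable_open)
  show "torsional_rigidity \<Omega> \<le> torsion_const DIM('a) R" by (rule torsional_rigidity_bounds(1)[OF \<Omega>(2) m]) (rule e)
  show "test_fun \<Omega> \<phi> \<Longrightarrow> energy \<phi> \<le> torsional_rigidity \<Omega>" by (rule torsional_rigidity_bounds(2)[OF \<Omega>(2) m]) (rule e)
qed

text \<open>The radial function satisfies the distribution bound of \<open>rank_square\<close> with
  equality, its superlevel sets being annuli.\<close>

lemma rank_ball:
  fixes c :: "'a::euclidean_space"
  assumes R: "0 < R"
  shows "(\<integral>x. indicator (ball c R) x * (norm (x - c) / DIM('a))\<^sup>2 \<partial>lebesgue) \<le> torsion_const DIM('a) R"
    "integrable lebesgue (\<lambda>x. indicator (ball c R) x * (norm (x - c) / DIM('a))\<^sup>2)"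
proof -
  let ?d = "DIM('a)" and ?o = "unit_ball_vol (real DIM('a))"
  have "(\<integral>\<^sup>+x. ennreal (indicator (ball c R) x * (norm (x - c) / ?d)\<^sup>2) \<partial>lborel) \<le> ennreal (torsion_const ?d R)"
  proof (rule rank_square)
    fix q :: real assume q: "0 \<le> q" "q < R / ?d"
    have dq: "0 \<le> ?d * q" "?d * q \<le> R" using q by (auto simp: field_simps)
    have "{x \<in> ball c R. q < norm (x - c) / ?d} = ball c R - cball c (?d * q)"
      by (auto simp: field_simps dist_norm norm_minus_commute)
    also have "emeasure lborel \<dots> = emeasure lborel (ball c R) - emeasure lborel (cball c (?d * q))"
    proof (cases "?d * q < R")
      case True
      show ?thesis
        by (rule emeasure_Diff) (use True dq in \<open>auto simp: emeasure_cball\<close>)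
    next
      case False
      then show ?thesis using q by (simp add: field_simps)
    qed
    also have "\<dots> = ennreal (?o * R ^ ?d) - ennreal (?o * (?d * q) ^ ?d)"
      using R dq by (simp only: emeasure_ball emeasure_cball less_imp_le)
    also have "\<dots> = ennreal (?o * R ^ ?d - ?o * (?d * q) ^ ?d)" using dq by (intro ennreal_minus) simp
    finally show "emeasure lborel {x \<in> ball c R. q < norm (x - c) / ?d} \<le> ennreal (?o * R ^ ?d - ?o * (?d * q) ^ ?d)" by simp
  qed (use R in \<open>auto simp: divide_right_mono dist_norm norm_minus_commute\<close>)
  moreover show i: "integrable lebesgue (\<lambda>x. indicator (ball c R) x * (norm (x - c) / ?d)\<^sup>2)"
  proof (rule integrableI_nonneg)
    show "(\<lambda>x. indicator (ball c R) x * (norm (x - c) / ?d)\<^sup>2) \<in> borel_measurable lebesgue"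
      by (intro borel_imp_lebesgue borel_measurable_times borel_measurable_indicator borel_measurable_continuous_onI continuous_intros) auto
    show "(\<integral>\<^sup>+x. ennreal (indicator (ball c R) x * (norm (x - c) / ?d)\<^sup>2) \<partial>lebesgue) < \<infinity>"
      using le_less_trans[OF calculation ennreal_less_top] by (simp add: nn_integral_completion)
  qed simp
  ultimately have "ennreal (\<integral>x. indicator (ball c R) x * (norm (x - c) / ?d)\<^sup>2 \<partial>lebesgue) \<le> ennreal (torsion_const ?d R)"
    by (subst nn_integral_eq_integral[symmetric]) (auto simp: nn_integral_completion)
  then show "(\<integral>x. indicator (ball c R) x * (norm (x - c) / ?d)\<^sup>2 \<partial>lebesgue) \<le> torsion_const ?d R"
    using R by (subst (asm) ennreal_le_iff) auto
qed

text \<open>The torsion function of the smaller ball is mollified at radius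
  \<open>(r - R) / 2\<close>, which makes it a test function on the larger one. Mollification keeps
  its integral and does not increase its Dirichlet energy.\<close>

lemma torsional_rigidity_ball_ge:
  fixes c :: "'a::euclidean_space"
  assumes R: "0 < R" "R < r"
  shows "torsion_const DIM('a) R \<le> torsional_rigidity (ball c r)"
proof -
  let ?d = "real DIM('a)" and ?o = "unit_ball_vol (real DIM('a))"
  define u where "u x = max 0 ((R\<^sup>2 - (norm (x - c))\<^sup>2) / (2 * ?d))" for x
  define g where "g x = indicator (ball c R) x *\<^sub>R ((- 1 / ?d) *\<^sub>R (x - c))" for x
  have d: "?d > 0" by simp
  have u_eq: "u x = (R\<^sup>2 - (min (norm (x - c)) R)\<^sup>2) / (2 * ?d)" for x
  proof (cases "norm (x - c) \<le> R")
    case True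
    then have "(norm (x - c))\<^sup>2 \<le> R\<^sup>2" by (intro power_mono) auto
    then show ?thesis using True d by (simp add: u_def)
  next
    case False
    then have "R\<^sup>2 \<le> (norm (x - c))\<^sup>2" using R by (intro power_mono) auto
    then have "(R\<^sup>2 - (norm (x - c))\<^sup>2) / (2 * ?d) \<le> 0" using d by (simp add: divide_nonpos_pos)
    then show ?thesis using False by (simp add: u_def)
  qed
  have u0: "0 \<le> u x" for x by (simp add: u_def)
  have u_out: "u x = 0" if "R \<le> norm (x - c)" for x using that by (simp add: u_eq min_def)
  have u_lip: "(R / ?d)-lipschitz_on UNIV u"
  proof (rule lipschitz_onI)
    fix x y :: 'a
    define a b where "a = min (norm (x - c)) R" and "b = min (norm (y - c)) R"
    have ab: "0 \<le> a" "a \<le> R" "0 \<le> b" "b \<le> R" using R by (auto simp: a_def b_def)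
    have "\<bar>b - a\<bar> \<le> \<bar>norm (y - c) - norm (x - c)\<bar>" by (auto simp: a_def b_def min_def)
    also have "\<dots> \<le> dist x y" using norm_triangle_ineq3[of "y - c" "x - c"] by (simp add: dist_norm norm_minus_commute)
    finally have 1: "\<bar>b - a\<bar> \<le> dist x y" .
    have "u x - u y = (b - a) * (b + a) / (2 * ?d)"
      by (simp add: u_eq a_def[symmetric] b_def[symmetric] diff_divide_distrib[symmetric] power2_eq_square algebra_simps)
    then have "\<bar>u x - u y\<bar> = \<bar>b - a\<bar> * (b + a) / (2 * ?d)" using ab d by (simp add: abs_mult)
    also have "\<dots> \<le> dist x y * (2 * R) / (2 * ?d)" using 1 ab d by (intro divide_right_mono mult_mono) auto
    finally show "dist (u x) (u y) \<le> R / ?d * dist x y" by (simp add: dist_real_def mult_ac)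
  qed (use R d in simp)
  have g_meas: "g \<in> borel_measurable borel" unfolding g_def[abs_def]
    by (intro borel_measurable_scaleR borel_measurable_indicator borel_measurable_continuous_onI continuous_intros) auto
  have ng: "(norm (g x))\<^sup>2 = indicator (ball c R) x * (norm (x - c) / ?d)\<^sup>2" for x
    by (auto simp: g_def indicator_def power_divide)
  have der: "AE x in lebesgue. (u has_derivative (\<lambda>h. g x \<bullet> h)) (at x)"
  proof -
    have "AE x in lebesgue. x \<notin> sphere c R"
      using negligible_sphere[of c R] by (intro AE_not_in) (simp add: negligible_iff_null_sets)
    then show ?thesis
    proof eventually_elim
      case (elim x)
      then have "x \<in> ball c R \<or> x \<in> - cball c R" by (auto simp: sphere_def)
      then consider "x \<in> ball c R" | "x \<in> - cball c R" by blast
      then show ?case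
      proof cases
        case 1
        have "((\<lambda>x. (R\<^sup>2 - (x - c) \<bullet> (x - c)) / (2 * ?d)) has_derivative (\<lambda>h. (0 - ((x - c) \<bullet> h + h \<bullet> (x - c))) / (2 * ?d))) (at x)"
          by (auto intro!: derivative_eq_intros simp: fun_eq_iff field_simps)
        moreover have "(\<lambda>h. (0 - ((x - c) \<bullet> h + h \<bullet> (x - c))) / (2 * ?d)) = (\<lambda>h. g x \<bullet> h)"
        proof
          have i: "indicator (ball c R) x = (1::real)" using 1 by simp
          show "(0 - ((x - c) \<bullet> h + h \<bullet> (x - c))) / (2 * ?d) = g x \<bullet> h" for h
            using d unfolding g_def i by (simp only: inner_commute[of h] inner_scaleR_left) (simp add: field_simps)
        qed
        ultimately have "((\<lambda>x. (R\<^sup>2 - (x - c) \<bullet> (x - c)) / (2 * ?d)) has_derivative (\<lambda>h. g x \<bullet> h)) (at x)" by (simp only:)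
        then show ?thesis
        proof (rule has_derivative_transform_within_open[OF _ open_ball 1])
          fix y assume "y \<in> ball c R"
          then have "norm (y - c) < R" by (simp add: dist_norm norm_minus_commute)
          then show "(R\<^sup>2 - (y - c) \<bullet> (y - c)) / (2 * ?d) = u y"
            by (simp add: u_eq min_def power2_norm_eq_inner)
        qed
      next
        case 2
        have "((\<lambda>x. 0) has_derivative (\<lambda>h. g x \<bullet> h)) (at x)" using 2 by (auto simp: g_def)
        then show ?thesis
          by (rule has_derivative_transform_within_open[OF _ _ 2])
             (auto simp: u_out dist_norm norm_minus_commute)
      qed
    qed
  qed
  have gi: "integrable lebesgue (\<lambda>x. (norm (g x))\<^sup>2)" unfolding ng by (rule rank_ball(2)[OF R(1)])
  have w: "weak_grad_L2 u g" by (rule weak_grad_lipschitz[OF u_lip borel_imp_lebesgue[OF g_meas] der gi])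
  have ui: "integrable lebesgue u"
    by (rule integrable_compact_support[OF lipschitz_on_continuous_on[OF u_lip] compact_cball[of c R]])
       (auto simp: u_out dist_norm norm_minus_commute)
  have ul: "loc_integrable u" using w by (simp add: weak_grad_L2_def)
  define \<rho> where "\<rho> = (r - R) / 2"
  have \<rho>: "0 < \<rho>" using R by (simp add: \<rho>_def)
  obtain \<eta> :: "'a \<Rightarrow> real" where m: "mollifier \<rho> \<eta>" using mollifier_exists[OF \<rho>] by blast
  define \<phi> where "\<phi> = conv u \<eta>"
  have \<phi>: "test_fun (ball c r) \<phi>"
  proof (rule test_funI)
    show "smooth \<phi>" unfolding \<phi>_def using ul mollifierD(1)[OF m] by (rule smooth_conv)
    show "compact (cball c (R + \<rho>))" by simp
    show "cball c (R + \<rho>) \<subseteq> ball c r" using R by (auto simp: \<rho>_def field_simps)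
    fix x assume x: "x \<notin> cball c (R + \<rho>)"
    show "\<phi> x = 0" unfolding \<phi>_def
    proof (rule conv_eq_0)
      fix y assume "norm (x - y) < \<rho>"
      then have "R \<le> norm (y - c)" using x norm_triangle_ineq[of "x - y" "y - c"] by (simp add: dist_norm norm_minus_commute)
      then show "u y = 0" by (rule u_out)
    qed (rule mollifierD(3)[OF m])
  qed
  have \<phi>0: "0 \<le> \<phi> x" for x unfolding \<phi>_def by (rule conv_ge[OF ul m u0])
  have "ennreal (\<integral>x. \<phi> x \<partial>lebesgue) = (\<integral>\<^sup>+x. ennreal (\<phi> x) \<partial>lborel)"
    using test_fun_integrable[OF \<phi>] \<phi>0 by (subst nn_integral_eq_integral[symmetric]) (auto simp: nn_integral_completion)
  also have "\<dots> = ennreal (\<integral>x. u x \<partial>lebesgue)" unfolding \<phi>_def by (rule nn_integral_conv[OF ui u0 m])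
  finally have \<phi>u: "(\<integral>x. \<phi> x \<partial>lebesgue) = (\<integral>x. u x \<partial>lebesgue)"
    using u0 \<phi>0 by (subst (asm) ennreal_inj) (auto intro!: integral_nonneg_AE)
  \<comment> \<open>Only an upper bound for \<open>J\<close> is at hand. It suffices, because the
    integral of \<open>u\<close> equals \<open>R\<^sup>2\<close> times the volume over
    \<open>2 * d\<close>, minus \<open>d / 2\<close> times \<open>J\<close>, so that
    \<open>J\<close> enters the energy with the coefficient \<open>-(d + 1)\<close>.\<close>
  define J where "J = (\<integral>x. indicator (ball c R) x * (norm (x - c) / ?d)\<^sup>2 \<partial>lebesgue)"
  have J: "J \<le> torsion_const DIM('a) R" unfolding J_def by (rule rank_ball(1)[OF R(1)])
  have "u x = (R\<^sup>2 / (2 * ?d)) * indicator (ball c R) x - (?d / 2) * (indicator (ball c R) x * (norm (x - c) / ?d)\<^sup>2)" for x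
    using d u_out[of x] by (cases "x \<in> ball c R") (auto simp: u_eq min_def dist_norm norm_minus_commute power2_eq_square field_simps)
  then have "(\<integral>x. u x \<partial>lebesgue) = (\<integral>x. (R\<^sup>2 / (2 * ?d)) * indicator (ball c R) x - (?d / 2) * (indicator (ball c R) x * (norm (x - c) / ?d)\<^sup>2) \<partial>lebesgue)" by presburger
  also have "\<dots> = (R\<^sup>2 / (2 * ?d)) * measure lebesgue (ball c R) - (?d / 2) * J"
  proof -
    have "integrable lebesgue (indicator (ball c R) :: 'a \<Rightarrow> real)"
      by (intro integrable_real_indicator) (auto simp: emeasure_lborel_ball_finite[simplified])
    then show ?thesis using rank_ball(2)[OF R(1), of c] by (simp add: J_def)
  qed
  finally have Iu: "(\<integral>x. u x \<partial>lebesgue) = (R\<^sup>2 / (2 * ?d)) * (?o * R ^ DIM('a)) - (?d / 2) * J"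
    using R by (simp only: measure_lebesgue_ball less_imp_le)
  have Ig: "(\<integral>x. (norm (g x))\<^sup>2 \<partial>lebesgue) = J" unfolding ng J_def ..
  define t where "t = torsion_const DIM('a) R"
  have "R\<^sup>2 * (?o * R ^ DIM('a)) / ?d = (?d + 2) * t"
  proof -
    have "?d + 2 \<noteq> 0" using d by linarith
    then show ?thesis by (simp add: t_def power_add mult_ac power2_eq_square)
  qed
  moreover have "2 * (\<integral>x. u x \<partial>lebesgue) - J = R\<^sup>2 * (?o * R ^ DIM('a)) / ?d - (?d + 1) * J"
    unfolding Iu using d by (simp add: field_simps)
  moreover have "(?d + 1) * J \<le> (?d + 1) * t" using J d unfolding t_def by (intro mult_left_mono) auto
  moreover have "(?d + 2) * t = (?d + 1) * t + t" by (simp add: algebra_simps)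
  ultimately have "t \<le> 2 * (\<integral>x. u x \<partial>lebesgue) - J" by linarith
  also have "\<dots> \<le> energy \<phi>"
    unfolding energy_def \<phi>u Ig[symmetric] using mollified_energy_le(2)[OF w m] by (simp add: \<phi>_def)
  also have "\<dots> \<le> torsional_rigidity (ball c r)"
    using R by (intro torsional_rigidity_le(2)[OF open_ball bounded_ball _ measure_lebesgue_ball \<phi>]) auto
  finally show ?thesis unfolding t_def .
qed

lemma torsional_rigidity_ball:
  fixes c :: "'a::euclidean_space"
  assumes r: "0 < r"
  shows "torsional_rigidity (ball c r) = torsion_const DIM('a) r"
proof (rule antisym)
  show "torsional_rigidity (ball c r) \<le> torsion_const DIM('a) r"
    using r by (intro torsional_rigidity_le(1)[OF open_ball bounded_ball _ measure_lebesgue_ball]) auto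
  have "eventually (\<lambda>R. torsion_const DIM('a) R \<le> torsional_rigidity (ball c r)) (at_left r)"
    using eventually_at_left_real[OF r]
  proof eventually_elim
    case (elim R)
    then show ?case by (intro torsional_rigidity_ball_ge) auto
  qed
  moreover have "((\<lambda>R. torsion_const DIM('a) R) \<longlongrightarrow> torsion_const DIM('a) r) (at_left r)"
    by (intro tendsto_intros) (auto simp: add_nonneg_eq_0_iff)
  ultimately show "torsion_const DIM('a) r \<le> torsional_rigidity (ball c r)"
    by (intro tendsto_upperbound[where F="at_left r"]) auto
qed

subsection \<open>Capacity\<close>

text \<open>With \<open>n\<close> the dimension minus 2, the hypothesis bounds the volume of a shell
  around a body of volume \<open>V\<close>, and \<open>f ^ (2 * n + 2)\<close> is the squared
  gradient of the potential \<open>f ^ n\<close> up to a constant. Integrating over levels gives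
  \<open>V * ((2 * n + 2) / n - 1)\<close>. It serves both the competitor of a convex body and the
  Newtonian field of a ball.\<close>

lemma tail_integral:
  fixes f :: "'a::euclidean_space \<Rightarrow> real"
  assumes f[measurable]: "f \<in> borel_measurable borel" and f0: "\<And>x. 0 \<le> f x" and f1: "\<And>x. f x \<le> 1"
    and V: "0 \<le> V" and n: "1 \<le> n"
    and le: "\<And>t::real. 0 < t \<Longrightarrow> t < 1 \<Longrightarrow> emeasure lborel {x. t < f x} \<le> ennreal (V * ((1 / t) ^ (n + 2) - 1))"
  shows "(\<integral>\<^sup>+x. ennreal (f x ^ (2 * n + 2)) \<partial>lborel) \<le> ennreal (V * (real n + 2) / real n)"
proof -
  define w :: "real \<Rightarrow> real" where "w t = real (2 * n + 2) * t ^ (2 * n + 1)" for t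
  define w' :: "real \<Rightarrow> real" where "w' t = V * real (2 * n + 2) * (t ^ (n - 1) - t ^ (2 * n + 1))" for t
  define F where "F t = V * real (2 * n + 2) * (t ^ n / real n - t ^ (2 * n + 2) / real (2 * n + 2))" for t :: real
  have [measurable]: "w \<in> borel_measurable borel" "w' \<in> borel_measurable borel"
    unfolding w_def[abs_def] w'_def[abs_def] by measurable
  have "ennreal (f x ^ (2 * n + 2)) = layer w (f x)" for x
  proof -
    have "layer w (f x) = ennreal (f x ^ (2 * n + 2) - 0 ^ (2 * n + 2))"
    proof (rule layer_eq_FTC)
      show "((\<lambda>t. t ^ (2 * n + 2)) has_real_derivative w t) (at t)" for t
        unfolding w_def by (rule DERIV_cong[OF DERIV_pow]) (simp del: power_Suc)
    qed (auto simp: w_def f0)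
    then show ?thesis by simp
  qed
  then have "(\<integral>\<^sup>+x. ennreal (f x ^ (2 * n + 2)) \<partial>lborel) = (\<integral>\<^sup>+x. layer w (f x) \<partial>lborel)" by presburger
  also have "\<dots> = (\<integral>\<^sup>+t. (if 0 \<le> t then ennreal (w t) * emeasure lborel {x. t < f x} else 0) \<partial>lborel)"
    by (rule layer_cake) measurable
  also have "\<dots> \<le> (\<integral>\<^sup>+t. (if 0 \<le> t \<and> t < 1 then ennreal (w' t) else 0) \<partial>lborel)"
  proof (rule nn_integral_mono)
    fix t :: real
    consider "t < 0" | "t = 0" | "0 < t" "t < 1" | "1 \<le> t" by linarith
    then show "(if 0 \<le> t then ennreal (w t) * emeasure lborel {x. t < f x} else 0) \<le> (if 0 \<le> t \<and> t < 1 then ennreal (w' t) else 0)"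
    proof cases
      case 2
      then show ?thesis by (simp add: w_def)
    next
      case 3
      have "ennreal (w t) * emeasure lborel {x. t < f x} \<le> ennreal (w t) * ennreal (V * ((1 / t) ^ (n + 2) - 1))"
        using le[OF 3] by (rule mult_left_mono) simp
      also have "\<dots> = ennreal (w t * (V * ((1 / t) ^ (n + 2) - 1)))"
        using 3 V by (intro ennreal_mult[symmetric] mult_nonneg_nonneg) (auto simp: w_def simp del: power_Suc power_add_numeral add_2_eq_Suc' power_Suc2 intro: one_le_power)
      also have "w t * (V * ((1 / t) ^ (n + 2) - 1)) = w' t"
      proof -
        have e: "2 * n + 1 = (n - 1) + (n + 2)" using n by simp
        have "t ^ (2 * n + 1) = t ^ (n - 1) * t ^ (n + 2)" unfolding e by (rule power_add)
        moreover have "t ^ (n + 2) * (1 / t) ^ (n + 2) = 1" using 3 by (simp only: power_mult_distrib[symmetric]) simp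
        ultimately have "t ^ (2 * n + 1) * (1 / t) ^ (n + 2) = t ^ (n - 1)" by (simp only: mult.assoc mult_1_right)
        then have "t ^ (2 * n + 1) * ((1 / t) ^ (n + 2) - 1) = t ^ (n - 1) - t ^ (2 * n + 1)"
          by (simp only: right_diff_distrib mult_1_right)
        then show ?thesis unfolding w_def w'_def by (simp only: mult.assoc mult.left_commute[of _ V] mult.left_commute)
      qed
      finally show ?thesis using 3 by simp
    next
      case 4
      then have "{x. t < f x} = {}" using f1 by (auto simp: not_less intro: order_trans)
      then show ?thesis using 4 by simp
    qed simp
  qed
  also have "\<dots> = layer w' 1" by (simp add: layer_def)
  also have "\<dots> = ennreal (F 1 - F 0)"
  proof (rule layer_eq_FTC)
    show "(F has_real_derivative w' t) (at t)" for t
    proof (rule DERIV_cong)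
      show "(F has_real_derivative V * real (2 * n + 2) * (real n * t ^ (n - Suc 0) / real n - real (2 * n + 2) * t ^ (2 * n + 2 - Suc 0) / real (2 * n + 2))) (at t)"
        unfolding F_def[abs_def] by (intro DERIV_cmult DERIV_diff DERIV_cdivide DERIV_pow)
      have "real (2 * n + 2) * a / real (2 * n + 2) = a" for a by (rule nonzero_mult_div_cancel_left) simp
      then show "V * real (2 * n + 2) * (real n * t ^ (n - Suc 0) / real n - real (2 * n + 2) * t ^ (2 * n + 2 - Suc 0) / real (2 * n + 2)) = w' t"
        using n by (simp add: w'_def del: power_Suc)
    qed
    fix t :: real assume t: "0 \<le> t" "t \<le> 1"
    then have "t ^ (2 * n + 1) \<le> t ^ (n - 1)" by (intro power_decreasing) auto
    then show "0 \<le> w' t" unfolding w'_def using V by (intro mult_nonneg_nonneg) auto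
  qed simp_all
  also have "F 1 - F 0 = V * (real n + 2) / real n"
  proof -
    have "F 0 = 0" using n by (simp add: F_def power_0_left)
    moreover have "F 1 = V * (real (2 * n + 2) / real n - 1)" 
    proof -
      have "V * K * (1 / real n - 1 / K) = V * (K / real n - 1)" if "K \<noteq> 0" for K :: real using that by (simp add: right_diff_distrib)
      from this[of "real (2 * n + 2)"] show ?thesis by (simp add: F_def)
    qed
    moreover have "real (2 * n + 2) / real n - 1 = (real n + 2) / real n" using n by (simp add: field_simps)
    ultimately show ?thesis by simp
  qed
  finally show ?thesis .
qed

lemma recip_lipschitz:
  fixes s :: "'a::metric_space \<Rightarrow> real"
  assumes s: "1-lipschitz_on UNIV s" and s0: "\<And>x. 0 \<le> s x" and c: "0 \<le> c"
  shows "(real k * c)-lipschitz_on UNIV (\<lambda>x. (1 / (1 + c * s x)) ^ k)"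
proof (rule lipschitz_onI)
  fix x y
  define a b where "a = 1 + c * s x" and "b = 1 + c * s y"
  have ab: "1 \<le> a" "1 \<le> b" using s0 c by (auto simp: a_def b_def)
  have ab1: "1 \<le> a * b" using mult_mono[OF ab] ab by simp
  have "1 / a - 1 / b = (b - a) / (a * b)" using ab by (simp add: field_simps)
  then have "\<bar>1 / a - 1 / b\<bar> = \<bar>b - a\<bar> / (a * b)" using ab by (simp add: abs_mult)
  also have "\<dots> \<le> \<bar>b - a\<bar> / 1" using ab1 by (intro divide_left_mono) auto
  also have "b - a = c * (s y - s x)" by (simp add: a_def b_def algebra_simps)
  also have "\<bar>c * (s y - s x)\<bar> / 1 = c * \<bar>s y - s x\<bar>" using c by (simp add: abs_mult)
  also have "\<dots> \<le> c * dist x y"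
    using lipschitz_onD[OF s, of x y] c by (intro mult_left_mono) (auto simp: dist_real_def abs_minus_commute)
  finally have 1: "\<bar>1 / a - 1 / b\<bar> \<le> c * dist x y" .
  have "norm ((1 / a) ^ k - (1 / b) ^ k) \<le> real k * norm (1 / a - 1 / b)"
    using ab by (intro norm_power_diff) auto
  also have "\<dots> \<le> real k * (c * dist x y)" using 1 by (intro mult_left_mono) auto
  finally show "dist ((1 / (1 + c * s x)) ^ k) ((1 / (1 + c * s y)) ^ k) \<le> real k * c * dist x y"
    by (simp add: a_def b_def dist_real_def)
qed (use c in simp)

lemma newton_cap_bdd_below:
  "bdd_below {\<integral>x. (norm (g x))\<^sup>2 \<partial>lebesgue | u g. in_D1 u g \<and> continuous_on UNIV u \<and> (\<forall>x. u x \<ge> indicator K x)}"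
  by (rule bdd_belowI[of _ 0]) auto

text \<open>The competitor is the capacitary potential of a ball, transplanted to the parallel sets of \<open>\<Omega>\<close>.\<close>
lemma cap_competitor:
  fixes \<Omega> :: "'a::euclidean_space set"
  assumes \<Omega>: "cbody \<Omega>" and d: "3 \<le> DIM('a)"
  obtains u :: "'a \<Rightarrow> real" and g where "in_D1 u g" "continuous_on UNIV u" "\<And>x. u x \<ge> indicator (closure \<Omega>) x"
    "(\<integral>x. (norm (g x))\<^sup>2 \<partial>lebesgue) \<le> (DIM('a) - 2) * (perimeter \<Omega>)\<^sup>2 / (DIM('a) * measure lebesgue \<Omega>)"
proof -
  define n where "n = DIM('a) - 2"
  have n: "1 \<le> n" "DIM('a) = n + 2" using d by (auto simp: n_def)
  define V where "V = measure lebesgue \<Omega>"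
  have V: "0 < V" unfolding V_def by (rule cbody_measure_pos[OF \<Omega>])
  \<comment> \<open>With this constant \<open>measure_parallel_le\<close> bounds the volume at
    distance \<open>s\<close> by \<open>V * (1 + c * s) ^ DIM('a)\<close>.\<close>
  define c where "c = perimeter \<Omega> / (DIM('a) * V)"
  have c: "0 < c" using V perimeter_pos[OF \<Omega>] by (simp add: c_def)
  define D where "D x = infdist x \<Omega>" for x
  have ne: "\<Omega> \<noteq> {}" and cv: "convex \<Omega>" using \<Omega> by (auto simp: cbody_def)
  have Dm[measurable]: "D \<in> borel_measurable borel"
    unfolding D_def[abs_def] by (rule lipschitz_borel[OF infdist_lipschitz])
  have D0: "0 \<le> D x" for x by (simp add: D_def infdist_nonneg)
  define q where "q x = 1 / (1 + c * D x)" for x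
  have p: "0 < 1 + c * D x" for x using c D0[of x] by (simp add: add_pos_nonneg)
  have q: "0 < q x" "q x \<le> 1" for x using p[of x] c D0[of x] by (auto simp: q_def)
  have qm[measurable]: "q \<in> borel_measurable borel" unfolding q_def[abs_def] by measurable
  define u where "u x = q x ^ n" for x
  define g where "g x = (- (n * c) * q x ^ (n + 1)) *\<^sub>R dgrad \<Omega> x" for x
  have ulip: "(real n * c)-lipschitz_on UNIV u"
    unfolding u_def[abs_def] q_def[abs_def] D_def[abs_def]
    by (rule recip_lipschitz[OF infdist_lipschitz infdist_nonneg less_imp_le[OF c]])
  have dq: "(q has_derivative (\<lambda>h. - (c * (q x)\<^sup>2) * (dgrad \<Omega> x \<bullet> h))) (at x)"
    if "(D has_derivative (\<lambda>h. dgrad \<Omega> x \<bullet> h)) (at x)" for x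
    unfolding q_def[abs_def] using p[of x]
    by (auto intro!: derivative_eq_intros that simp: power2_eq_square divide_simps)
  have du: "(u has_derivative (\<lambda>h. g x \<bullet> h)) (at x)"
    if "(D has_derivative (\<lambda>h. dgrad \<Omega> x \<bullet> h)) (at x)" for x
  proof -
    have "(u has_derivative (\<lambda>h. n * (- (c * (q x)\<^sup>2) * (dgrad \<Omega> x \<bullet> h)) * q x ^ (n - 1))) (at x)"
      unfolding u_def[abs_def] by (rule has_derivative_power[OF dq[OF that]])
    moreover have "q x ^ (n + 1) = (q x)\<^sup>2 * q x ^ (n - 1)" using n by (simp add: power_add[symmetric])
    ultimately show ?thesis by (simp add: g_def mult_ac)
  qed
  have ae: "AE x in lebesgue. (u has_derivative (\<lambda>h. g x \<bullet> h)) (at x)"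
    using infdist_AE_derivative[OF cv ne] by eventually_elim (rule du, simp add: D_def[abs_def])
  have gm: "g \<in> borel_measurable borel"
    unfolding g_def[abs_def] using dgrad_borel[OF cv ne] by measurable
  \<comment> \<open>The gradient vanishes on the closure of \<open>\<Omega>\<close>. Removing it
    places the superlevel sets in the shell, which accounts for the \<open>- 1\<close> in the
    hypothesis of \<open>tail_integral\<close>.\<close>
  define f where "f x = indicator (- closure \<Omega>) x * q x" for x
  have fm[measurable]: "f \<in> borel_measurable borel"
    unfolding f_def[abs_def] by (intro borel_measurable_times borel_measurable_indicator qm) auto
  have ng: "(norm (g x))\<^sup>2 = (n * c)\<^sup>2 * f x ^ (2 * n + 2)" for x
  proof -
    have "(norm (g x))\<^sup>2 = (n * c)\<^sup>2 * (q x ^ (n + 1))\<^sup>2 * (norm (dgrad \<Omega> x))\<^sup>2"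
      by (simp add: g_def power_mult_distrib abs_mult)
    moreover have "(q x ^ (n + 1))\<^sup>2 = q x ^ (2 * n + 2)" by (simp only: power_mult[symmetric]) (simp add: mult.commute)
    ultimately show ?thesis using norm_dgrad[OF ne, of x] by (auto simp: f_def)
  qed
  have "(\<integral>\<^sup>+x. ennreal (f x ^ (2 * n + 2)) \<partial>lborel) \<le> ennreal (V * (real n + 2) / real n)"
  proof (rule tail_integral[OF fm _ _ less_imp_le[OF V] n(1)])
    show "0 \<le> f x" "f x \<le> 1" for x using q[of x] by (auto simp: f_def indicator_def)
    fix t :: real assume t: "0 < t" "t < 1"
    \<comment> \<open>The distance at which \<open>q\<close> takes the value \<open>t\<close>; the
      volume bound at \<open>s\<close> becomes a pure power of \<open>1 / t\<close>.\<close>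
    define s where "s = (1 / t - 1) / c"
    have s: "0 < s" "1 + s * c = 1 / t" using t c by (auto simp: s_def field_simps)
    have "D x < s" if "t < q x" for x
    proof -
      have "1 + c * D x < 1 / t" using that t p[of x] by (simp add: q_def field_simps)
      also have "1 / t = 1 + c * s" using s(2) by (simp add: mult.commute)
      finally show ?thesis using c by simp
    qed
    then have sub: "{x. t < f x} \<subseteq> msum \<Omega> (ball 0 s) - closure \<Omega>"
      using t infdist_less_iff[OF ne] by (auto simp: f_def indicator_def D_def split: if_splits)
    have M: "msum \<Omega> (ball 0 s) \<in> lmeasurable" by (rule cbody_lmeasurable[OF cbody_msum_ball[OF \<Omega> s(1)]])
    have C: "closure \<Omega> \<in> lmeasurable" by (rule lmeasurable_closure_cbody[OF \<Omega>])
    have MC: "msum \<Omega> (ball 0 s) - closure \<Omega> \<in> lmeasurable" using M C by (rule fmeasurable.Diff)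
    have "emeasure lborel {x. t < f x} = emeasure lebesgue {x. t < f x}" by simp
    also have "\<dots> \<le> emeasure lebesgue (msum \<Omega> (ball 0 s) - closure \<Omega>)"
      using sub fmeasurableD[OF MC] by (rule emeasure_mono)
    also have "\<dots> = ennreal (measure lebesgue (msum \<Omega> (ball 0 s) - closure \<Omega>))"
      using MC by (simp add: emeasure_eq_measure2)
    also have "measure lebesgue (msum \<Omega> (ball 0 s) - closure \<Omega>) = measure lebesgue (msum \<Omega> (ball 0 s)) - V"
      using measurable_measure_Diff[OF M fmeasurableD[OF C] cbody_subset_msum[OF s(1)]]
      unfolding measure_closure_cbody[OF \<Omega>] V_def .
    also have "ennreal \<dots> \<le> ennreal (V * ((1 / t) ^ (n + 2) - 1))"
    proof (rule ennreal_leI)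
      have "measure lebesgue (msum \<Omega> (ball 0 s)) \<le> V * (1 + s * perimeter \<Omega> / (DIM('a) * V)) ^ DIM('a)"
        unfolding V_def by (rule measure_parallel_le[OF \<Omega> s(1)])
      also have "1 + s * perimeter \<Omega> / (DIM('a) * V) = 1 / t" unfolding s(2)[symmetric] by (simp add: c_def)
      finally show "measure lebesgue (msum \<Omega> (ball 0 s)) - V \<le> V * ((1 / t) ^ (n + 2) - 1)"
        unfolding n(2) by (simp only: right_diff_distrib mult_1_right diff_right_mono)
    qed
    finally show "emeasure lborel {x. t < f x} \<le> ennreal (V * ((1 / t) ^ (n + 2) - 1))" .
  qed
  then have "(\<integral>\<^sup>+x. ennreal ((n * c)\<^sup>2) * ennreal (f x ^ (2 * n + 2)) \<partial>lborel) \<le> ennreal ((n * c)\<^sup>2) * ennreal (V * (real n + 2) / real n)"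
    by (subst nn_integral_cmult) (auto intro: mult_left_mono)
  also have "ennreal ((n * c)\<^sup>2) * ennreal (V * (real n + 2) / real n) = ennreal ((n * c)\<^sup>2 * (V * (real n + 2) / real n))"
    using V by (intro ennreal_mult[symmetric]) auto
  finally have fin: "(\<integral>\<^sup>+x. ennreal ((norm (g x))\<^sup>2) \<partial>lebesgue) \<le> ennreal ((n * c)\<^sup>2 * (V * (real n + 2) / real n))"
  proof -
    assume a: "(\<integral>\<^sup>+x. ennreal ((n * c)\<^sup>2) * ennreal (f x ^ (2 * n + 2)) \<partial>lborel) \<le> ennreal ((n * c)\<^sup>2 * (V * (real n + 2) / real n))"
    have "ennreal ((norm (g x))\<^sup>2) = ennreal ((n * c)\<^sup>2) * ennreal (f x ^ (2 * n + 2))" for x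
      unfolding ng by (rule ennreal_mult) (auto simp: f_def less_imp_le[OF q(1)])
    then have "(\<integral>\<^sup>+x. ennreal ((norm (g x))\<^sup>2) \<partial>lborel) = (\<integral>\<^sup>+x. ennreal ((n * c)\<^sup>2) * ennreal (f x ^ (2 * n + 2)) \<partial>lborel)"
      by presburger
    then show ?thesis using a gm by (simp add: nn_integral_completion)
  qed
  have gi: "integrable lebesgue (\<lambda>x. (norm (g x))\<^sup>2)"
  proof (rule integrableI_nonneg)
    show "(\<lambda>x. (norm (g x))\<^sup>2) \<in> borel_measurable lebesgue" using borel_imp_lebesgue[OF gm] by simp
    show "(\<integral>\<^sup>+x. ennreal ((norm (g x))\<^sup>2) \<partial>lebesgue) < \<infinity>"
      using le_less_trans[OF fin ennreal_less_top] by simp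
  qed simp
  have E: "(\<integral>x. (norm (g x))\<^sup>2 \<partial>lebesgue) \<le> (n * c)\<^sup>2 * (V * (real n + 2) / real n)"
    using fin V unfolding nn_integral_eq_integral[OF gi AE_I2[OF zero_le_power2]]
    by (subst (asm) ennreal_le_iff) auto
  show thesis
  proof (rule that[of u g])
    have "emeasure lebesgue {x. e < \<bar>u x\<bar>} < \<infinity>" if e: "0 < e" for e
    proof -
      \<comment> \<open>Since \<open>q \<le> 1\<close> and \<open>n \<ge> 1\<close>, the potential
        is at most \<open>q\<close>, and \<open>e < q x\<close> forces
        \<open>c * e * D x < 1\<close>.\<close>
      define s where "s = 1 / (c * e)"
      have s: "0 < s" using c e by (simp add: s_def)
      have "x \<in> msum \<Omega> (ball 0 s)" if "e < \<bar>u x\<bar>" for x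
      proof -
        have "q x ^ n \<le> q x ^ 1" using q[of x] n by (intro power_decreasing) auto
        then have "e < q x" using that q[of x] by (simp add: u_def)
        then have "e * (1 + c * D x) < 1" using p[of x] by (simp add: q_def field_simps)
        then have "c * e * D x < 1" using e by (simp add: algebra_simps)
        then have "D x < s" using c e by (simp add: s_def field_simps)
        then show ?thesis using infdist_less_iff[OF ne] by (simp add: D_def)
      qed
      then have "{x. e < \<bar>u x\<bar>} \<subseteq> msum \<Omega> (ball 0 s)" by blast
      moreover have M: "msum \<Omega> (ball 0 s) \<in> lmeasurable" by (rule cbody_lmeasurable[OF cbody_msum_ball[OF \<Omega> s]])
      ultimately have "emeasure lebesgue {x. e < \<bar>u x\<bar>} \<le> emeasure lebesgue (msum \<Omega> (ball 0 s))"
        by (intro emeasure_mono) (auto dest: fmeasurableD)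
      also have "\<dots> < \<infinity>" using M unfolding fmeasurable_def by blast
      finally show ?thesis .
    qed
    then show "in_D1 u g"
      unfolding in_D1_def using weak_grad_lipschitz[OF ulip borel_imp_lebesgue[OF gm] ae gi] by blast
    show "continuous_on UNIV u" using ulip by (rule lipschitz_on_continuous_on)
    show "u x \<ge> indicator (closure \<Omega>) x" for x
    proof (cases "x \<in> closure \<Omega>")
      case True
      then have "D x = 0" using infdist_zero_iff[OF ne] by (simp add: D_def)
      then show ?thesis by (simp add: u_def q_def)
    qed (use q[of x] in \<open>simp add: u_def\<close>)
    have "(n * c)\<^sup>2 * (V * (real n + 2) / real n) = (DIM('a) - 2) * (perimeter \<Omega>)\<^sup>2 / (DIM('a) * measure lebesgue \<Omega>)"
      using n V unfolding V_def[symmetric] c_def by (simp add: power2_eq_square divide_simps)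
    then show "(\<integral>x. (norm (g x))\<^sup>2 \<partial>lebesgue) \<le> (DIM('a) - 2) * (perimeter \<Omega>)\<^sup>2 / (DIM('a) * measure lebesgue \<Omega>)"
      using E by simp
  qed
qed

text \<open>Lower bounds on an infimum of reals require a competitor, since \<open>Inf\<close> of
  the empty set carries no information.\<close>

lemma newton_cap_nonempty:
  fixes \<Omega> :: "'a::euclidean_space set"
  assumes \<Omega>: "cbody \<Omega>" and d: "3 \<le> DIM('a)"
  shows "{\<integral>x. (norm (g x))\<^sup>2 \<partial>lebesgue | u g. in_D1 u g \<and> continuous_on UNIV u \<and> (\<forall>x. u x \<ge> indicator (closure \<Omega>) x)} \<noteq> {}"
    (is "?S \<noteq> _")
proof (rule cap_competitor[OF \<Omega> d])
  fix u :: "'a \<Rightarrow> real" and g :: "'a \<Rightarrow> 'a"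
  assume u: "in_D1 u g" "continuous_on UNIV u" "\<And>x. u x \<ge> indicator (closure \<Omega>) x"
  have "(\<integral>x. (norm (g x))\<^sup>2 \<partial>lebesgue) \<in> ?S"
    by (rule CollectI, rule exI[of _ u], rule exI[of _ g]) (intro conjI allI refl u)
  then show ?thesis by (metis empty_iff)
qed

lemma newton_cap_le:
  fixes \<Omega> :: "'a::euclidean_space set"
  assumes \<Omega>: "cbody \<Omega>" and d: "3 \<le> DIM('a)"
  shows "newton_cap (closure \<Omega>) \<le> (DIM('a) - 2) * (perimeter \<Omega>)\<^sup>2 / (DIM('a) * measure lebesgue \<Omega>)"
proof -
  obtain u :: "'a \<Rightarrow> real" and g where u: "in_D1 u g" "continuous_on UNIV u" "\<And>x. u x \<ge> indicator (closure \<Omega>) x"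
    "(\<integral>x. (norm (g x))\<^sup>2 \<partial>lebesgue) \<le> (DIM('a) - 2) * (perimeter \<Omega>)\<^sup>2 / (DIM('a) * measure lebesgue \<Omega>)"
    using cap_competitor[OF assms] by blast
  have "newton_cap (closure \<Omega>) \<le> (\<integral>x. (norm (g x))\<^sup>2 \<partial>lebesgue)"
    unfolding newton_cap_def by (rule cInf_lower[OF _ newton_cap_bdd_below]) (use u(1-3) in blast)
  with u(4) show ?thesis by simp
qed

subsection \<open>Capacity of balls\<close>

lemma DERIV_pos_part_sq: "((\<lambda>s::real. (max 0 (s + a))\<^sup>2) has_real_derivative 2 * max 0 (s + a)) (at s)"
proof -
  have "((\<lambda>s::real. (max 0 s)\<^sup>2) has_real_derivative 2 * max 0 s) (at s)" for s
  proof -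
    consider "s < 0" | "s = 0" | "0 < s" by linarith
    then show ?thesis
    proof cases
      case 1
      have "((\<lambda>s::real. 0) has_real_derivative 2 * max 0 s) (at s)" using 1 by simp
      then show ?thesis by (rule has_field_derivative_transform_within_open[where S = "{..<0}"]) (use 1 in auto)
    next
      case 2
      have "((\<lambda>h::real. (max 0 (0 + h))\<^sup>2 / h) \<longlongrightarrow> 0) (at 0)"
      proof (rule tendsto_0_le)
        show "((\<lambda>h::real. h) \<longlongrightarrow> 0) (at 0)" by (rule tendsto_ident_at)
        show "\<forall>\<^sub>F h::real in at 0. norm ((max 0 (0 + h))\<^sup>2 / h) \<le> norm h * 1"
          by (rule always_eventually) (auto simp: max_def power2_eq_square)
      qed
      then show ?thesis unfolding 2 by (simp add: DERIV_def)
    next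
      case 3
      have "((\<lambda>s::real. s\<^sup>2) has_real_derivative 2 * max 0 s) (at s)" using 3 by (auto intro!: derivative_eq_intros)
      then show ?thesis by (rule has_field_derivative_transform_within_open[where S = "{0<..}"]) (use 3 in auto)
    qed
  qed
  from DERIV_shift[of "\<lambda>s. (max 0 s)\<^sup>2" "2 * max 0 (s + a)" s a] this[of "s + a"] show ?thesis by simp
qed

text \<open>A \<open>C\<^sup>1\<close> replacement for \<open>min s 1\<close>: mollification keeps a potential only above \<open>1 - \<tau>\<close>
  on the conductor, and truncating there makes its gradient vanish on the conductor.\<close>
definition trunc :: "real \<Rightarrow> real \<Rightarrow> real" where
  "trunc \<tau> s = s - ((max 0 (s + (2 * \<tau> - 1)))\<^sup>2 - (max 0 (s + (\<tau> - 1)))\<^sup>2) / (2 * \<tau>)"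

definition dtrunc :: "real \<Rightarrow> real \<Rightarrow> real" where
  "dtrunc \<tau> s = 1 - (max 0 (s + (2 * \<tau> - 1)) - max 0 (s + (\<tau> - 1))) / \<tau>"

text \<open>The slope \<open>dtrunc\<close> falls linearly from 1 to 0 between
  \<open>1 - 2 * \<tau>\<close> and \<open>1 - \<tau>\<close>, so half of the rise \<tau> is lost on
  this interval: the final height is \<open>1 - 2 * \<tau> + \<tau> / 2\<close>.\<close>

lemma trunc:
  assumes \<tau>: "0 < \<tau>"
  shows "(trunc \<tau> has_real_derivative dtrunc \<tau> s) (at s)"
    "0 \<le> dtrunc \<tau> s" "dtrunc \<tau> s \<le> 1" "1 - \<tau> \<le> s \<Longrightarrow> dtrunc \<tau> s = 0"
    "1 - \<tau> \<le> s \<Longrightarrow> trunc \<tau> s = 1 - 3 / 2 * \<tau>" "trunc \<tau> s \<le> s" "trunc \<tau> s \<le> 1"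
    "continuous_on S (trunc \<tau>)" "continuous_on S (dtrunc \<tau>)"
proof -
  let ?a = "max 0 (s + (2 * \<tau> - 1))" and ?b = "max 0 (s + (\<tau> - 1))"
  have "(trunc \<tau> has_real_derivative 1 - (2 * ?a - 2 * ?b) / (2 * \<tau>)) (at s)"
    unfolding trunc_def[abs_def] by (intro DERIV_diff DERIV_ident DERIV_cdivide DERIV_pos_part_sq)
  moreover have "1 - (2 * ?a - 2 * ?b) / (2 * \<tau>) = dtrunc \<tau> s" using \<tau> by (simp add: dtrunc_def field_simps)
  ultimately show "(trunc \<tau> has_real_derivative dtrunc \<tau> s) (at s)" by (simp only:)
  have ab: "?b \<le> ?a" "?a - ?b \<le> \<tau>" "0 \<le> ?b" using \<tau> by (auto simp: max_def)
  show "0 \<le> dtrunc \<tau> s" "dtrunc \<tau> s \<le> 1" unfolding dtrunc_def using ab \<tau> by (auto simp: field_simps)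
  show dt: "dtrunc \<tau> s = 0" if "1 - \<tau> \<le> s" using that \<tau> by (simp add: dtrunc_def max_def)
  show t: "trunc \<tau> s = 1 - 3 / 2 * \<tau>" if "1 - \<tau> \<le> s"
  proof -
    have "?a = ?b + \<tau>" using that \<tau> by (simp add: max_def)
    moreover have "?b = s + \<tau> - 1" using that by (simp add: max_def)
    ultimately have "trunc \<tau> s = s - ((s + \<tau> - 1 + \<tau>)\<^sup>2 - (s + \<tau> - 1)\<^sup>2) / (2 * \<tau>)" by (simp only: trunc_def)
    also have "(s + \<tau> - 1 + \<tau>)\<^sup>2 - (s + \<tau> - 1)\<^sup>2 = (2 * \<tau>) * (s + 3 / 2 * \<tau> - 1)" by (simp add: power2_eq_square algebra_simps)
    finally show ?thesis using \<tau> by simp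
  qed
  have "?b\<^sup>2 \<le> ?a\<^sup>2" using ab by (intro power_mono) auto
  then show le: "trunc \<tau> s \<le> s" using \<tau> by (simp add: trunc_def)
  show "trunc \<tau> s \<le> 1"
  proof (cases "1 - \<tau> \<le> s")
    case True
    then show ?thesis using t \<tau> by simp
  next
    case False
    then show ?thesis using le \<tau> by linarith
  qed
  show "continuous_on S (trunc \<tau>)" "continuous_on S (dtrunc \<tau>)"
    unfolding trunc_def[abs_def] dtrunc_def[abs_def] using \<tau> by (auto intro!: continuous_intros)
qed

lemma trunc_smooth:
  fixes w :: "'a::euclidean_space \<Rightarrow> real"
  assumes \<tau>: "0 < \<tau>" and w: "smooth w"
  shows "((\<lambda>x. trunc \<tau> (w x)) has_derivative (\<lambda>h. (dtrunc \<tau> (w x) *\<^sub>R grad w x) \<bullet> h)) (at x)"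
    "(norm (dtrunc \<tau> (w x) *\<^sub>R grad w x))\<^sup>2 \<le> (norm (grad w x))\<^sup>2"
    "\<exists>L. L-lipschitz_on (cball 0 R) (\<lambda>x. trunc \<tau> (w x))"
proof -
  have "((\<lambda>x. trunc \<tau> (w x)) has_derivative (\<lambda>h. dtrunc \<tau> (w x) * (grad w x \<bullet> h))) (at x)"
    using has_derivative_compose[OF smooth_has_derivative_grad[OF w] trunc(1)[OF \<tau>, of "w x", unfolded has_field_derivative_def]] .
  then show "((\<lambda>x. trunc \<tau> (w x)) has_derivative (\<lambda>h. (dtrunc \<tau> (w x) *\<^sub>R grad w x) \<bullet> h)) (at x)" by simp
  have "(dtrunc \<tau> (w x))\<^sup>2 \<le> 1" using trunc(2,3)[OF \<tau>] by (simp add: power_le_one)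
  then show "(norm (dtrunc \<tau> (w x) *\<^sub>R grad w x))\<^sup>2 \<le> (norm (grad w x))\<^sup>2"
    by (simp add: power_mult_distrib mult_left_le_one_le)
  obtain L where L: "L-lipschitz_on (cball 0 R) w" using smooth_lipschitz_cball[OF w] by blast
  have "1-lipschitz_on UNIV (trunc \<tau>)"
  proof (rule bounded_derivative_imp_lipschitz)
    show "(trunc \<tau> has_derivative (*) (dtrunc \<tau> s)) (at s within UNIV)" for s
      using trunc(1)[OF \<tau>, of s] by (simp add: has_field_derivative_def)
    show "onorm ((*) (dtrunc \<tau> s)) \<le> 1" for s
    proof (rule onorm_le)
      fix h show "norm (dtrunc \<tau> s * h) \<le> 1 * norm h"
        using trunc(2,3)[OF \<tau>, of s] by (simp add: abs_mult mult_left_le_one_le)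
    qed
  qed auto
  then have "1-lipschitz_on (w ` cball 0 R) (trunc \<tau>)" by (rule lipschitz_on_subset) simp
  from lipschitz_on_compose2[OF L this] show "\<exists>L. L-lipschitz_on (cball 0 R) (\<lambda>x. trunc \<tau> (w x))" by blast
qed

text \<open>The field \<open>f *\<^sub>R (x - c)\<close> is, up to scaling, the gradient of the Newtonian potential outside the ball,
  linear inside, corrected by a multiple of \<open>x - c\<close> so as to vanish beyond radius \<open>S\<close>.\<close>
lemma newton_field:
  fixes c :: "'a::euclidean_space"
  assumes r: "0 < r" "r < S"
  obtains f :: "'a \<Rightarrow> real" and G :: "'a \<Rightarrow> 'a" and L where "L-lipschitz_on UNIV f" "\<And>x. S \<le> norm (x - c) \<Longrightarrow> f x = 0"
    "\<And>x. 0 \<le> f x" "\<And>x. r < norm (x - c) \<Longrightarrow> f x \<le> (r / norm (x - c)) ^ DIM('a)"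
    "G \<in> borel_measurable borel"
    "AE x in lebesgue. (f has_derivative (\<lambda>h. G x \<bullet> h)) (at x)"
    "\<And>x. DIM('a) * f x + (x - c) \<bullet> G x = DIM('a) * indicator (cball c r) x - DIM('a) * (r / S) ^ DIM('a) * indicator (ball c S) x"
proof -
  define d where "d = DIM('a)"
  have d: "0 < d" by (simp add: d_def)
  \<comment> \<open>The value of the Newtonian profile at radius \<open>S\<close>; subtracting it
    makes \<open>f\<close> reach 0 there continuously.\<close>
  define e where "e = (r / S) ^ d"
  \<comment> \<open>The distance to the ball, so that \<open>q\<close> is 1 inside and
    \<open>r / norm (x - c)\<close> outside, and \<open>recip_lipschitz\<close> applies.\<close>
  define s where "s x = max 0 (norm (x - c) - r)" for x
  define q where "q x = 1 / (1 + 1 / r * s x)" for x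
  define f where "f x = max 0 (q x ^ d - e)" for x
  have q_eq: "q x = (if norm (x - c) \<le> r then 1 else r / norm (x - c))" for x
    using r by (auto simp: q_def s_def max_def field_simps)
  have "1-lipschitz_on UNIV s"
  proof (rule lipschitz_onI)
    fix x y
    have "\<bar>s x - s y\<bar> \<le> \<bar>norm (x - c) - norm (y - c)\<bar>" by (auto simp: s_def max_def)
    also have "\<dots> \<le> dist x y" using norm_triangle_ineq3[of "x - c" "y - c"] by (simp add: dist_norm)
    finally show "dist (s x) (s y) \<le> 1 * dist x y" by (simp add: dist_real_def)
  qed simp
  then have "(real d * (1 / r))-lipschitz_on UNIV (\<lambda>x. q x ^ d)"
    unfolding q_def[abs_def] by (rule recip_lipschitz) (use r in \<open>auto simp: s_def\<close>)
  moreover have "dist (f x) (f y) \<le> dist (q x ^ d) (q y ^ d)" for x y by (auto simp: f_def dist_real_def max_def)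
  ultimately have L: "(real d * (1 / r))-lipschitz_on UNIV f" unfolding lipschitz_on_def by (meson order_trans)
  have out: "f x = 0" if "S \<le> norm (x - c)" for x
  proof -
    have "r / norm (x - c) \<le> r / S" using that r by (intro frac_le) auto
    then have "(r / norm (x - c)) ^ d \<le> e" unfolding e_def using r by (intro power_mono) auto
    moreover have "q x = r / norm (x - c)" using that r by (simp add: q_eq)
    ultimately show ?thesis by (simp add: f_def)
  qed
  have e: "0 \<le> e" "e \<le> 1" unfolding e_def using r by (auto intro: power_le_one)
  have inn: "f x = 1 - e" if "norm (x - c) \<le> r" for x using that e by (simp add: f_def q_eq)
  have mid: "f x = (r / norm (x - c)) ^ d - e" if "r < norm (x - c)" "norm (x - c) < S" for x
  proof -
    have "r / S \<le> r / norm (x - c)" using that r by (intro frac_le) auto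
    then have "e \<le> (r / norm (x - c)) ^ d" unfolding e_def using r by (intro power_mono) auto
    then show ?thesis using that by (simp add: f_def q_eq)
  qed
  define A where "A = ball c S - cball c r"
  have A: "open A" "x \<in> A \<longleftrightarrow> r < norm (x - c) \<and> norm (x - c) < S" for x
    by (auto simp: A_def dist_norm norm_minus_commute open_Diff)
  define G where "G x = (indicator A x * (- (d / r) * (r / norm (x - c)) ^ (d + 1))) *\<^sub>R sgn (x - c)" for x
  show thesis
  proof (rule that[of "real d * (1 / r)" f G])
    show "(real d * (1 / r))-lipschitz_on UNIV f" by (rule L)
    show "0 \<le> f x" for x by (simp add: f_def)
    show "f x \<le> (r / norm (x - c)) ^ DIM('a)" if "r < norm (x - c)" for x
      using that e r by (simp add: f_def q_eq d_def)
    show "G \<in> borel_measurable borel"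
    proof -
      have [measurable]: "A \<in> sets borel" using A(1) by simp
      show ?thesis unfolding G_def[abs_def] sgn_div_norm by measurable
    qed
    have "AE x in lebesgue. x \<notin> sphere c \<rho>" for \<rho>
      using negligible_sphere[of c \<rho>] by (intro AE_not_in) (simp add: negligible_iff_null_sets)
    from this[of r] this[of S] show "AE x in lebesgue. (f has_derivative (\<lambda>h. G x \<bullet> h)) (at x)"
    proof eventually_elim
      case (elim x)
      then have "norm (x - c) \<noteq> r" "norm (x - c) \<noteq> S" by (auto simp: dist_norm norm_minus_commute)
      then consider "x \<in> ball c r" | "x \<in> A" | "x \<in> - cball c S"
        unfolding A(2) by (simp add: dist_norm norm_minus_commute) linarith
      then show ?case
      proof cases
        case 1
        then have "G x = 0" by (simp add: G_def A_def)
        then have "((\<lambda>x. 1 - e) has_derivative (\<lambda>h. G x \<bullet> h)) (at x)" by simp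
        then show ?thesis
          by (rule has_derivative_transform_within_open[OF _ open_ball 1])
             (auto simp: inn dist_norm norm_minus_commute)
      next
        case 2
        define N where "N = norm (x - c)"
        have N: "0 < N" "x - c \<noteq> 0" using 2 r by (auto simp: A(2) N_def)
        have "((\<lambda>x. norm (x - c)) has_derivative (\<lambda>h. sgn (x - c) \<bullet> h)) (at x)"
          using has_derivative_compose[OF has_derivative_diff[OF has_derivative_ident has_derivative_const[of c]] has_derivative_norm[OF N(2)], of UNIV]
          by (simp add: inner_commute)
        then have "((\<lambda>x. r / norm (x - c)) has_derivative (\<lambda>h. - (r / N\<^sup>2) * (sgn (x - c) \<bullet> h))) (at x)"
          using N unfolding N_def by (auto intro!: derivative_eq_intros simp: power2_eq_square divide_simps)
        then have "((\<lambda>x. (r / norm (x - c)) ^ d - e) has_derivative (\<lambda>h. d * (- (r / N\<^sup>2) * (sgn (x - c) \<bullet> h)) * (r / N) ^ (d - 1) - 0)) (at x)"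
          unfolding N_def by (intro has_derivative_diff has_derivative_power has_derivative_const)
        moreover have "d * (- (r / N\<^sup>2) * t) * (r / N) ^ (d - 1) - 0 = (- (d / r) * (r / N) ^ (d + 1)) * t" for t
        proof -
          have "(r / N) ^ (d + 1) = (r / N) ^ (d - 1) * (r / N)\<^sup>2" using d by (simp only: power_add[symmetric]) simp
          then show ?thesis using r N by (simp add: power2_eq_square)
        qed
        ultimately have "((\<lambda>x. (r / norm (x - c)) ^ d - e) has_derivative (\<lambda>h. G x \<bullet> h)) (at x)"
          using 2 by (simp add: G_def N_def)
        then show ?thesis
          by (rule has_derivative_transform_within_open[OF _ A(1) 2]) (simp add: mid A(2))
      next
        case 3
        then have "G x = 0" by (simp add: G_def A_def)
        then have "((\<lambda>x. 0) has_derivative (\<lambda>h. G x \<bullet> h)) (at x)" by simp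
        then show ?thesis
          by (rule has_derivative_transform_within_open[OF _ _ 3]) (auto simp: out dist_norm norm_minus_commute)
      qed
    qed
    \<comment> \<open>This is the divergence of \<open>f x *\<^sub>R (x - c)\<close>. In the annulus
      the Newtonian part is divergence free and only the correction \<open>- e\<close> contributes;
      in the inner ball \<open>f\<close> is the constant \<open>1 - e\<close>.\<close>
    show "DIM('a) * f x + (x - c) \<bullet> G x = DIM('a) * indicator (cball c r) x - DIM('a) * (r / S) ^ DIM('a) * indicator (ball c S) x" for x
    proof -
      consider "norm (x - c) \<le> r" | "r < norm (x - c)" "norm (x - c) < S" | "S \<le> norm (x - c)" by linarith
      then have "d * f x + (x - c) \<bullet> G x = d * indicator (cball c r) x - d * e * indicator (ball c S) x"
      proof cases
        case 1
        then have "x \<notin> A" "x \<in> cball c r" "x \<in> ball c S" using r by (auto simp: A(2) dist_norm norm_minus_commute)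
        then show ?thesis using inn[OF 1] by (simp add: G_def right_diff_distrib)
      next
        case 2
        then have i: "x \<in> A" "x \<notin> cball c r" "x \<in> ball c S" by (auto simp: A(2) dist_norm norm_minus_commute)
        have N: "0 < norm (x - c)" using 2 r by linarith
        have "(x - c) \<bullet> sgn (x - c) = norm (x - c)"
          using N by (simp add: sgn_div_norm power2_norm_eq_inner[symmetric] power2_eq_square)
        then have "(x - c) \<bullet> G x = - d * (r / norm (x - c)) ^ d"
          using i r N by (simp add: G_def)
        then show ?thesis using mid[OF 2] i by (simp add: right_diff_distrib)
      next
        case 3
        then have "x \<notin> A" "x \<notin> cball c r" "x \<notin> ball c S" using r by (auto simp: A(2) dist_norm norm_minus_commute)
        then show ?thesis using out[OF 3] by (simp add: G_def)
      qed
      then show ?thesis by (simp add: e_def d_def)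
    qed
  qed (rule out)
qed

text \<open>Superlevel sets of \<open>h\<close> at height \<open>t\<close> lie between the radii
  \<open>r\<close> and \<open>r / t\<close>, so \<open>tail_integral\<close> applies with the volume
  of the ball as \<open>V\<close>. Up to the factor \<open>r\<^sup>2\<close> the integral bounds the
  squared norm of the Newtonian field outside the ball.\<close>

lemma newton_tail:
  fixes c :: "'a::euclidean_space"
  assumes r: "0 < r" and n: "1 \<le> n" "DIM('a) = n + 2"
  defines "h \<equiv> \<lambda>x. indicator (- cball c r) x * (r / norm (x - c))"
  shows "h \<in> borel_measurable borel" "integrable lebesgue (\<lambda>x. h x ^ (2 * n + 2))"
    "(\<integral>x. h x ^ (2 * n + 2) \<partial>lebesgue) \<le> unit_ball_vol (real DIM('a)) * r ^ DIM('a) * DIM('a) / n"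
proof -
  let ?o = "unit_ball_vol (real DIM('a))"
  have hm[measurable]: "h \<in> borel_measurable borel"
    unfolding h_def by (intro borel_measurable_times borel_measurable_indicator borel_measurable_divide borel_measurable_continuous_onI continuous_intros) auto
  then show "h \<in> borel_measurable borel" .
  have h0: "0 \<le> h x" for x using r by (simp add: h_def)
  have le: "(\<integral>\<^sup>+x. ennreal (h x ^ (2 * n + 2)) \<partial>lborel) \<le> ennreal (?o * r ^ DIM('a) * (real n + 2) / real n)"
  proof (rule tail_integral[OF hm h0 _ _ n(1)])
    show "h x \<le> 1" for x using r by (cases "x \<in> cball c r") (auto simp: h_def dist_norm norm_minus_commute divide_simps)
    show "0 \<le> ?o * r ^ DIM('a)" using r by simp
    fix t :: real assume t: "0 < t" "t < 1"
    have rt: "0 \<le> r / t" "r \<le> r / t" using r t by (auto simp: field_simps)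
    have sub: "{x. t < h x} \<subseteq> ball c (r / t) - cball c r"
    proof
      fix x assume "x \<in> {x. t < h x}"
      then have x: "t < h x" by simp
      then have o: "x \<notin> cball c r" using t by (auto simp: h_def indicator_def split: if_splits)
      then have N: "0 < norm (x - c)" using r by (auto simp: dist_norm norm_minus_commute)
      have "t < r / norm (x - c)" using x o by (simp add: h_def)
      then have "norm (x - c) < r / t" using N t by (simp add: field_simps)
      then show "x \<in> ball c (r / t) - cball c r" using o by (simp add: dist_norm norm_minus_commute)
    qed
    have "emeasure lborel {x. t < h x} \<le> emeasure lborel (ball c (r / t) - cball c r)" by (rule emeasure_mono[OF sub]) simp
    also have "\<dots> = emeasure lborel (ball c (r / t)) - emeasure lborel (cball c r)"
    proof (rule emeasure_Diff)
      have "r < r / t" using r t by (simp add: field_simps)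
      then show "cball c r \<subseteq> ball c (r / t)" by auto
    qed (use r in \<open>auto simp: emeasure_cball\<close>)
    also have "\<dots> = ennreal (?o * (r / t) ^ DIM('a)) - ennreal (?o * r ^ DIM('a))"
      using r rt by (simp only: emeasure_ball emeasure_cball less_imp_le)
    also have "\<dots> = ennreal (?o * (r / t) ^ DIM('a) - ?o * r ^ DIM('a))" using r by (intro ennreal_minus) simp
    also have "?o * (r / t) ^ DIM('a) - ?o * r ^ DIM('a) = ?o * r ^ DIM('a) * ((1 / t) ^ DIM('a) - 1)"
      by (simp only: power_divide right_diff_distrib power_one mult_1_right times_divide_eq_right)
    finally show "emeasure lborel {x. t < h x} \<le> ennreal (?o * r ^ DIM('a) * ((1 / t) ^ (n + 2) - 1))"
      by (simp only: n(2))
  qed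
  have le': "(\<integral>\<^sup>+x. ennreal (h x ^ (2 * n + 2)) \<partial>lebesgue) \<le> ennreal (?o * r ^ DIM('a) * DIM('a) / n)"
    using le by (simp add: nn_integral_completion n(2) add.commute)
  show i: "integrable lebesgue (\<lambda>x. h x ^ (2 * n + 2))"
  proof (rule integrableI_nonneg)
    show "(\<lambda>x. h x ^ (2 * n + 2)) \<in> borel_measurable lebesgue" using borel_imp_lebesgue[OF hm] by simp
    show "(\<integral>\<^sup>+x. ennreal (h x ^ (2 * n + 2)) \<partial>lebesgue) < \<infinity>"
      using le_less_trans[OF le' ennreal_less_top] by simp
  qed (simp add: h0)
  have a: "AE x in lebesgue. 0 \<le> h x ^ (2 * n + 2)" by (simp add: h0)
  show "(\<integral>x. h x ^ (2 * n + 2) \<partial>lebesgue) \<le> ?o * r ^ DIM('a) * DIM('a) / n"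
    using le' r unfolding nn_integral_eq_integral[OF i a] by (subst (asm) ennreal_le_iff) auto
qed

text \<open>Duality: integrating by parts, the mass that the divergence of the Newtonian field
  assigns to the potential is bounded through Cauchy-Schwarz by the two energies. The potential is
  first mollified and truncated so that its gradient vanishes on the ball; then only the exterior
  part of the field counts, which gives the sharp constant.\<close>

lemma cap_ball_step:
  fixes c :: "'a::euclidean_space" and g :: "'a \<Rightarrow> 'a"
  assumes n: "1 \<le> n" "DIM('a) = n + 2" and r: "0 < r" "r < S" and \<tau>: "0 < \<tau>"
    and w: "weak_grad_L2 u g" and uc: "continuous_on UNIV u" and ge: "\<And>x. u x \<ge> indicator (cball c r) x"
    and fin: "{x. \<tau> < \<bar>u x\<bar>} \<in> lmeasurable"
  shows "DIM('a) * (1 - 3 / 2 * \<tau>) * (unit_ball_vol (real DIM('a)) * r ^ DIM('a)) - DIM('a) * (r / S) ^ DIM('a) *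
      (2 * \<tau> * (unit_ball_vol (real DIM('a)) * S ^ DIM('a)) + measure lebesgue {x. \<tau> < \<bar>u x\<bar>})
    \<le> sqrt ((\<integral>x. (norm (g x))\<^sup>2 \<partial>lebesgue) * (r\<^sup>2 * (unit_ball_vol (real DIM('a)) * r ^ DIM('a) * DIM('a) / n)))"
proof -
  let ?o = "unit_ball_vol (real DIM('a))" and ?d = "DIM('a)"
  have ul: "loc_integrable u" using w by (simp add: weak_grad_L2_def)
  have u0: "0 \<le> u x" for x using ge[of x] order_trans[OF _ ge[of x], of 0] by simp
  \<comment> \<open>The radius \<open>S + 1\<close> leaves room for the mollification, whose radius
    is capped at 1; on the ball of radius \<open>S\<close> mollifying then changes \<open>u\<close>
    by at most \<tau>.\<close>
  have "uniformly_continuous_on (cball c (S + 1)) u"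
    by (rule compact_uniformly_continuous[OF continuous_on_subset[OF uc]]) auto
  then obtain \<delta>0 where \<delta>0: "0 < \<delta>0" "\<And>x y. x \<in> cball c (S + 1) \<Longrightarrow> y \<in> cball c (S + 1) \<Longrightarrow> dist y x < \<delta>0 \<Longrightarrow> dist (u y) (u x) < \<tau>"
    using \<tau> unfolding uniformly_continuous_on_def by metis
  define \<delta> where "\<delta> = min \<delta>0 1"
  have "0 < \<delta>" using \<delta>0(1) by (simp add: \<delta>_def)
  then obtain \<eta> :: "'a \<Rightarrow> real" where m: "mollifier \<delta> \<eta>" using mollifier_exists by blast
  define z where "z = conv u \<eta>"
  have zs: "smooth z" unfolding z_def using ul mollifierD(1)[OF m] by (rule smooth_conv)
  have near: "dist (u y) (u x) < \<tau>" if "norm (x - c) \<le> S" "norm (x - y) < \<delta>" for x y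
  proof (rule \<delta>0(2))
    show "x \<in> cball c (S + 1)" using that by (simp add: dist_norm norm_minus_commute)
    show "y \<in> cball c (S + 1)" using that norm_triangle_ineq[of "y - x" "x - c"] by (simp add: dist_norm norm_minus_commute \<delta>_def)
    show "dist y x < \<delta>0" using that by (simp add: dist_norm norm_minus_commute \<delta>_def)
  qed
  have z_le: "z x \<le> u x + \<tau>" if "norm (x - c) \<le> S" for x
    unfolding z_def
  proof (rule conv_le[OF ul m])
    show "u y \<le> u x + \<tau>" if "norm (x - y) < \<delta>" for y using near[OF \<open>norm (x - c) \<le> S\<close> that] by (simp add: dist_real_def abs_if split: if_splits)
  qed
  have z_ge: "u x - \<tau> \<le> z x" if "norm (x - c) \<le> S" for x
    unfolding z_def
  proof (rule conv_ge[OF ul m])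
    show "u x - \<tau> \<le> u y" if "norm (x - y) < \<delta>" for y using near[OF \<open>norm (x - c) \<le> S\<close> that] by (simp add: dist_real_def abs_if split: if_splits)
  qed
  define v where "v x = trunc \<tau> (z x)" for x
  define gv where "gv x = dtrunc \<tau> (z x) *\<^sub>R grad z x" for x
  have inball: "1 - \<tau> \<le> z x" if "x \<in> cball c r" for x
  proof -
    have "1 \<le> u x" using ge[of x] that by simp
    then show ?thesis using z_ge[of x] that r by (simp add: dist_norm norm_minus_commute)
  qed
  have v_in: "v x = 1 - 3 / 2 * \<tau>" if "x \<in> cball c r" for x unfolding v_def by (rule trunc(5)[OF \<tau> inball[OF that]])
  have gv_in: "gv x = 0" if "x \<in> cball c r" for x unfolding gv_def using trunc(4)[OF \<tau> inball[OF that]] by simp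
  have vm: "v \<in> borel_measurable lebesgue"
    unfolding v_def[abs_def]
    by (rule borel_imp_lebesgue, rule borel_measurable_continuous_onI, rule continuous_on_compose2[OF trunc(8)[OF \<tau>, of UNIV] smooth_continuous_on[OF zs]]) simp
  have gvm: "gv \<in> borel_measurable lebesgue"
    unfolding gv_def[abs_def]
    by (rule borel_imp_lebesgue, rule borel_measurable_continuous_onI)
       (intro continuous_on_scaleR grad_continuous[OF zs] continuous_on_compose2[OF trunc(9)[OF \<tau>, of UNIV] smooth_continuous_on[OF zs]], simp)
  have dv: "(v has_derivative (\<lambda>h. gv x \<bullet> h)) (at x)" for x
    unfolding v_def[abs_def] gv_def by (rule trunc_smooth(1)[OF \<tau> zs])
  define R where "R = norm c + S"
  obtain L where L: "L-lipschitz_on (cball 0 R) v" unfolding v_def[abs_def] using trunc_smooth(3)[OF \<tau> zs] by blast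
  obtain f :: "'a \<Rightarrow> real" and G :: "'a \<Rightarrow> 'a" and M where
    f: "M-lipschitz_on UNIV f" "\<And>x. S \<le> norm (x - c) \<Longrightarrow> f x = 0"
    "\<And>x. 0 \<le> f x" "\<And>x. r < norm (x - c) \<Longrightarrow> f x \<le> (r / norm (x - c)) ^ ?d"
    and G: "G \<in> borel_measurable borel"
    "AE x in lebesgue. (f has_derivative (\<lambda>h. G x \<bullet> h)) (at x)"
    "\<And>x. ?d * f x + (x - c) \<bullet> G x = ?d * indicator (cball c r) x - ?d * (r / S) ^ ?d * indicator (ball c S) x"
    by (rule newton_field[OF r, of c]) (rule that; assumption)
  have fb: "f \<in> borel_measurable borel" using f(1) by (rule lipschitz_borel)
  have fR: "f x = 0" if "R < norm x" for x
    using f(2)[of x] that norm_triangle_ineq2[of x c] by (simp add: R_def)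
  define F where "F b x = ((x - c) \<bullet> b) * f x" for b x
  define gF where "gF b x = f x *\<^sub>R b + ((x - c) \<bullet> b) *\<^sub>R G x" for b x
  have ibp: "integrable lebesgue (\<lambda>x. (gv x \<bullet> b) * F b x)" "integrable lebesgue (\<lambda>x. v x * (gF b x \<bullet> b))"
    "(\<integral>x. v x * (gF b x \<bullet> b) \<partial>lebesgue) = - (\<integral>x. (gv x \<bullet> b) * F b x \<partial>lebesgue)" if b: "b \<in> Basis" for b
  proof -
    have l: "1-lipschitz_on (cball 0 R) (\<lambda>x. (x - c) \<bullet> b)"
    proof (rule lipschitz_onI)
      fix x y
      have "\<bar>(x - y) \<bullet> b\<bar> \<le> norm (x - y)" by (rule Basis_le_norm[OF b])
      then show "dist ((x - c) \<bullet> b) ((y - c) \<bullet> b) \<le> 1 * dist x y" by (simp add: dist_real_def dist_norm inner_diff_left)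
    qed simp
    obtain M' where M': "M'-lipschitz_on UNIV (F b)"
      using lipschitz_mult_compact_support[OF l f(1) fR] unfolding F_def[abs_def] by blast
    have F0: "F b x = 0" if "R < norm x" for x using fR[OF that] by (simp add: F_def)
    have gFm: "gF b \<in> borel_measurable lebesgue"
    proof -
      note [measurable] = fb G(1)
      show ?thesis unfolding gF_def[abs_def] by (rule borel_imp_lebesgue) measurable
    qed
    have dF: "AE x in lebesgue. (F b has_derivative (\<lambda>h. gF b x \<bullet> h)) (at x)"
      using G(2)
    proof eventually_elim
      case (elim x)
      have 1: "((\<lambda>x. (x - c) \<bullet> b) has_derivative (\<lambda>h. h \<bullet> b)) (at x)" by (auto intro!: derivative_eq_intros)
      have 2: "(\<lambda>h. gF b x \<bullet> h) = (\<lambda>h. ((x - c) \<bullet> b) * (G x \<bullet> h) + (h \<bullet> b) * f x)"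
        by (rule ext) (simp add: gF_def inner_add_left inner_commute[of b])
      show ?case unfolding F_def[abs_def] 2 by (rule has_derivative_mult[OF 1 elim])
    qed
    note I = lipschitz_ibp[OF L M' _ vm gvm gFm AE_I2[OF dv] dF]
    show "integrable lebesgue (\<lambda>x. (gv x \<bullet> b) * F b x)" by (rule I(1)) (rule F0)
    show "integrable lebesgue (\<lambda>x. v x * (gF b x \<bullet> b))" by (rule I(2)) (rule F0)
    show "(\<integral>x. v x * (gF b x \<bullet> b) \<partial>lebesgue) = - (\<integral>x. (gv x \<bullet> b) * F b x \<partial>lebesgue)"
      by (rule I(3)) (rule F0)
  qed
  define e where "e = (r / S) ^ ?d"
  have e0: "0 \<le> e" using r by (simp add: e_def)
  define k where "k x = ?d * indicator (cball c r) x - ?d * e * indicator (ball c S) x" for x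
  \<comment> \<open>The field with its interior part removed, which the vanishing of
    \<open>gv\<close> on the ball permits; the sign absorbs the one from integration by
    parts.\<close>
  define W where "W x = (- (indicator (- cball c r) x * f x)) *\<^sub>R (x - c)" for x
  have sF: "(\<Sum>b\<in>Basis. v x * (gF b x \<bullet> b)) = v x * k x" for x
  proof -
    have "(\<Sum>b\<in>Basis. gF b x \<bullet> b) = (\<Sum>b\<in>Basis. f x + ((x - c) \<bullet> b) * (G x \<bullet> b))"
      by (rule sum.cong) (auto simp: gF_def inner_add_left inner_Basis)
    also have "\<dots> = ?d * f x + (x - c) \<bullet> G x" by (simp add: sum.distrib euclidean_inner[of "x - c" "G x"])
    also have "\<dots> = k x" unfolding k_def e_def by (rule G(3))
    finally show ?thesis by (simp add: sum_distrib_left[symmetric])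
  qed
  have sg: "(\<Sum>b\<in>Basis. (gv x \<bullet> b) * F b x) = - (gv x \<bullet> W x)" for x
  proof -
    have "(\<Sum>b\<in>Basis. (gv x \<bullet> b) * F b x) = f x * (\<Sum>b\<in>Basis. (gv x \<bullet> b) * ((x - c) \<bullet> b))"
      by (simp add: F_def sum_distrib_left mult_ac)
    also have "\<dots> = f x * (gv x \<bullet> (x - c))" by (simp only: euclidean_inner[of "gv x" "x - c"])
    also have "\<dots> = - (gv x \<bullet> W x)" using gv_in[of x] by (cases "x \<in> cball c r") (auto simp: W_def)
    finally show ?thesis .
  qed
  have kv: "integrable lebesgue (\<lambda>x. v x * k x)" unfolding sF[symmetric] by (intro Bochner_Integration.integrable_sum ibp(2))
  have "(\<integral>x. v x * k x \<partial>lebesgue) = (\<Sum>b\<in>Basis. \<integral>x. v x * (gF b x \<bullet> b) \<partial>lebesgue)"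
    unfolding sF[symmetric] by (rule Bochner_Integration.integral_sum) (rule ibp(2))
  also have "\<dots> = (\<Sum>b\<in>Basis. - (\<integral>x. (gv x \<bullet> b) * F b x \<partial>lebesgue))" by (rule sum.cong[OF refl]) (rule ibp(3))
  also have "\<dots> = - (\<integral>x. (\<Sum>b\<in>Basis. (gv x \<bullet> b) * F b x) \<partial>lebesgue)"
    by (subst Bochner_Integration.integral_sum) (auto simp: sum_negf ibp(1))
  also have "\<dots> = (\<integral>x. gv x \<bullet> W x \<partial>lebesgue)" unfolding sg by simp
  finally have eq: "(\<integral>x. v x * k x \<partial>lebesgue) = (\<integral>x. gv x \<bullet> W x \<partial>lebesgue)" .
  define h where "h x = indicator (- cball c r) x * (r / norm (x - c))" for x
  note tail = newton_tail[OF r(1) n, of c, folded h_def]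
  have W_le: "(norm (W x))\<^sup>2 \<le> r\<^sup>2 * h x ^ (2 * n + 2)" for x
  proof (cases "x \<in> cball c r")
    case True
    then show ?thesis by (simp add: W_def h_def)
  next
    case False
    then have N: "r < norm (x - c)" by (simp add: dist_norm norm_minus_commute)
    define p where "p = r / norm (x - c)"
    have p: "0 \<le> p" "p * norm (x - c) = r" using r N by (auto simp: p_def)
    have "norm (W x) = f x * norm (x - c)" using False f(3)[of x] by (simp add: W_def)
    also have "\<dots> \<le> p ^ ?d * norm (x - c)" unfolding p_def using f(4)[OF N] by (rule mult_right_mono) simp
    also have "\<dots> = p ^ (n + 1) * (p * norm (x - c))" unfolding n(2) by (simp add: mult_ac)
    also have "\<dots> = r * p ^ (n + 1)" unfolding p(2) by (rule mult.commute)
    finally have "(norm (W x))\<^sup>2 \<le> (r * p ^ (n + 1))\<^sup>2" by (intro power_mono) auto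
    also have "\<dots> = r\<^sup>2 * p ^ (2 * n + 2)" unfolding power_mult_distrib by (simp only: power_mult[symmetric]) (simp add: mult.commute)
    also have "p = h x" using False by (simp add: p_def h_def)
    finally show ?thesis .
  qed
  have Wm: "W \<in> borel_measurable lebesgue"
  proof -
    note [measurable] = fb
    have [measurable]: "- cball c r \<in> sets borel" by simp
    show ?thesis unfolding W_def[abs_def] by (rule borel_imp_lebesgue) measurable
  qed
  have hi: "integrable lebesgue (\<lambda>x. r\<^sup>2 * h x ^ (2 * n + 2))" by (rule integrable_mult_right) (rule tail(2))
  have Wi: "integrable lebesgue (\<lambda>x. (norm (W x))\<^sup>2)"
    by (rule Bochner_Integration.integrable_bound[OF hi]) (use Wm W_le in \<open>auto intro: order_trans[OF _ abs_ge_self]\<close>)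
  have W2: "(\<integral>x. (norm (W x))\<^sup>2 \<partial>lebesgue) \<le> r\<^sup>2 * (?o * r ^ ?d * ?d / n)"
  proof -
    have "(\<integral>x. (norm (W x))\<^sup>2 \<partial>lebesgue) \<le> (\<integral>x. r\<^sup>2 * h x ^ (2 * n + 2) \<partial>lebesgue)" by (rule integral_mono[OF Wi hi W_le])
    also have "\<dots> = r\<^sup>2 * (\<integral>x. h x ^ (2 * n + 2) \<partial>lebesgue)" by (rule integral_mult_right_zero)
    also have "\<dots> \<le> r\<^sup>2 * (?o * r ^ ?d * ?d / n)" by (rule mult_left_mono[OF tail(3)]) simp
    finally show ?thesis .
  qed
  note en = mollified_energy_le[OF w m, folded z_def]
  have gv_le: "(norm (gv x))\<^sup>2 \<le> (norm (grad z x))\<^sup>2" for x unfolding gv_def by (rule trunc_smooth(2)[OF \<tau> zs])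
  have gvi: "integrable lebesgue (\<lambda>x. (norm (gv x))\<^sup>2)"
    by (rule Bochner_Integration.integrable_bound[OF en(1)]) (use gvm gv_le in auto)
  have gv2: "(\<integral>x. (norm (gv x))\<^sup>2 \<partial>lebesgue) \<le> (\<integral>x. (norm (g x))\<^sup>2 \<partial>lebesgue)"
    using integral_mono[OF gvi en(1) gv_le] en(2) by (rule order_trans)
  have "(\<integral>x. gv x \<bullet> W x \<partial>lebesgue)\<^sup>2 \<le> (\<integral>x. (norm (gv x))\<^sup>2 \<partial>lebesgue) * (\<integral>x. (norm (W x))\<^sup>2 \<partial>lebesgue)"
    by (rule sqint_Cauchy_Schwarz) (use gvm gvi Wm Wi in \<open>auto simp: sqint_def\<close>)
  also have "\<dots> \<le> (\<integral>x. (norm (g x))\<^sup>2 \<partial>lebesgue) * (r\<^sup>2 * (?o * r ^ ?d * ?d / n))"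
    by (rule mult_mono[OF gv2 W2]) (auto intro!: integral_nonneg_AE)
  finally have up: "(\<integral>x. v x * k x \<partial>lebesgue) \<le> sqrt ((\<integral>x. (norm (g x))\<^sup>2 \<partial>lebesgue) * (r\<^sup>2 * (?o * r ^ ?d * ?d / n)))"
    unfolding eq by (rule real_le_rsqrt)
  let ?N = "{x. \<tau> < \<bar>u x\<bar>}"
  \<comment> \<open>A lower bound for the left side of the duality. On the ball of radius
    \<open>S\<close> the truncated potential is at most \<open>2 * \<tau>\<close> where
    \<open>u\<close> is at most \<tau>, and at most 1 on the remaining set, which has finite
    measure.\<close>
  define l where "l x = ?d * (1 - 3 / 2 * \<tau>) * indicator (cball c r) x - ?d * e * (2 * \<tau> * indicator (ball c S) x + indicator ?N x)" for x
  have l_le: "l x \<le> v x * k x" for x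
  proof -
    have 1: "v x * (?d * indicator (cball c r) x) = ?d * (1 - 3 / 2 * \<tau>) * indicator (cball c r) x"
      using v_in[of x] by (cases "x \<in> cball c r") simp_all
    have "v x * indicator (ball c S) x \<le> 2 * \<tau> * indicator (ball c S) x + indicator ?N x"
    proof (cases "x \<in> ball c S")
      case True
      show ?thesis
      proof (cases "x \<in> ?N")
        case xN: True
        have "v x \<le> 1" unfolding v_def by (rule trunc(7)[OF \<tau>])
        then show ?thesis using True xN \<tau> by simp
      next
        case False
        have "v x \<le> z x" unfolding v_def by (rule trunc(6)[OF \<tau>])
        also have "z x \<le> u x + \<tau>" using True by (intro z_le) (simp add: dist_norm norm_minus_commute)
        also have "u x \<le> \<tau>" using False u0[of x] by simp
        finally show ?thesis using True False by simp
      qed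
    qed simp
    then have "?d * e * (v x * indicator (ball c S) x) \<le> ?d * e * (2 * \<tau> * indicator (ball c S) x + indicator ?N x)"
      using e0 by (intro mult_left_mono) auto
    moreover have "v x * k x = v x * (?d * indicator (cball c r) x) - ?d * e * (v x * indicator (ball c S) x)"
      by (simp add: k_def right_diff_distrib mult_ac)
    ultimately show ?thesis unfolding l_def 1 by linarith
  qed
  have ii: "integrable lebesgue (indicator A :: 'a \<Rightarrow> real)" if "A \<in> lmeasurable" for A
    using that by (intro integrable_real_indicator) (auto simp: fmeasurable_def)
  have i1: "integrable lebesgue (indicator (cball c r) :: 'a \<Rightarrow> real)" "integrable lebesgue (indicator (ball c S) :: 'a \<Rightarrow> real)"
    "integrable lebesgue (indicator ?N :: 'a \<Rightarrow> real)" using fin by (auto intro!: ii)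
  have li: "integrable lebesgue l" unfolding l_def[abs_def] using i1 by simp
  have "(\<integral>x. l x \<partial>lebesgue) = ?d * (1 - 3 / 2 * \<tau>) * measure lebesgue (cball c r) - ?d * e * (2 * \<tau> * measure lebesgue (ball c S) + measure lebesgue ?N)"
    unfolding l_def[abs_def] using i1 by simp
  moreover have "measure lebesgue (cball c r) = ?o * r ^ ?d" using r by (simp add: content_cball)
  moreover have "measure lebesgue (ball c S) = ?o * S ^ ?d" using r by (intro measure_lebesgue_ball) simp
  ultimately have "(\<integral>x. l x \<partial>lebesgue) = ?d * (1 - 3 / 2 * \<tau>) * (?o * r ^ ?d) - ?d * e * (2 * \<tau> * (?o * S ^ ?d) + measure lebesgue ?N)"
    by (simp only:)
  then show ?thesis using integral_mono[OF li kv l_le] up unfolding e_def by linarith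
qed

text \<open>The outer radius \<open>S\<close> goes to infinity before \<tau> goes to 0, because the
  measure of the set where \<open>u\<close> exceeds \<tau> is finite for each \<tau> but not
  uniformly bounded.\<close>

lemma cap_ball_ge:
  fixes c :: "'a::euclidean_space" and g :: "'a \<Rightarrow> 'a"
  assumes d: "3 \<le> DIM('a)" and r: "0 < r"
    and u: "in_D1 u g" "continuous_on UNIV u" "\<And>x. u x \<ge> indicator (cball c r) x"
  shows "real (DIM('a) - 2) * DIM('a) * unit_ball_vol (real DIM('a)) * r ^ (DIM('a) - 2) \<le> (\<integral>x. (norm (g x))\<^sup>2 \<partial>lebesgue)"
proof -
  define n where "n = DIM('a) - 2"
  have n: "1 \<le> n" "DIM('a) = n + 2" using d by (auto simp: n_def)
  let ?d = "real DIM('a)"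
  define V where "V = unit_ball_vol (real DIM('a)) * r ^ DIM('a)"
  define E where "E = (\<integral>x. (norm (g x))\<^sup>2 \<partial>lebesgue)"
  define Q where "Q = sqrt (E * (r\<^sup>2 * (V * ?d / n)))"
  have V: "0 < V" using r by (simp add: V_def)
  have w: "weak_grad_L2 u g" using u(1) by (simp add: in_D1_def)
  have lim\<tau>: "?d * (1 - 7 / 2 * \<tau>) * V \<le> Q" if \<tau>: "0 < \<tau>" for \<tau> :: real
  proof -
    have "{x. \<tau> < \<bar>u x\<bar>} \<in> lmeasurable"
    proof (rule fmeasurableI)
      have "open {x. \<tau> < \<bar>u x\<bar>}" using u(2) by (intro open_Collect_less continuous_intros)
      then show "{x. \<tau> < \<bar>u x\<bar>} \<in> sets lebesgue" by simp
      show "emeasure lebesgue {x. \<tau> < \<bar>u x\<bar>} < \<infinity>" using u(1) \<tau> unfolding in_D1_def by blast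
    qed
    note step = cap_ball_step[OF n r _ \<tau> w u(2,3) this]
    define N where "N = measure lebesgue {x. \<tau> < \<bar>u x\<bar>}"
    \<comment> \<open>The factor \<open>(r / S) ^ DIM('a)\<close> turns the volume of the large ball
      into \<open>V\<close>, so its share \<open>2 * \<tau> * V\<close> survives and raises
      \<open>3 / 2 * \<tau>\<close> to \<open>7 / 2 * \<tau>\<close>; only the term with
      \<open>N\<close> decays in \<open>S\<close>.\<close>
    have "?d * (1 - 7 / 2 * \<tau>) * V - ?d * N * (r / S) ^ DIM('a) \<le> Q" if S: "r < S" for S
    proof -
      have "(r / S) ^ DIM('a) * (2 * \<tau> * (unit_ball_vol (real DIM('a)) * S ^ DIM('a)) + N) = 2 * \<tau> * V + N * (r / S) ^ DIM('a)"
        using S r by (simp add: V_def power_divide field_simps)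
      then have "?d * (1 - 7 / 2 * \<tau>) * V - ?d * N * (r / S) ^ DIM('a) = ?d * (1 - 3 / 2 * \<tau>) * V - ?d * ((r / S) ^ DIM('a) * (2 * \<tau> * (unit_ball_vol (real DIM('a)) * S ^ DIM('a)) + N))"
        by (simp add: algebra_simps)
      then show ?thesis using step[OF S] unfolding V_def[symmetric] N_def[symmetric] E_def[symmetric] Q_def[symmetric] by (simp only: mult.assoc)
    qed
    then have "eventually (\<lambda>S. ?d * (1 - 7 / 2 * \<tau>) * V - ?d * N * (r / S) ^ DIM('a) \<le> Q) at_top"
      by (rule eventually_mono[OF eventually_gt_at_top])
    moreover have "((\<lambda>S. ?d * (1 - 7 / 2 * \<tau>) * V - ?d * N * (r / S) ^ DIM('a)) \<longlongrightarrow> ?d * (1 - 7 / 2 * \<tau>) * V - ?d * N * 0 ^ DIM('a)) at_top"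
      using tendsto_divide_0[OF tendsto_const filterlim_at_top_imp_at_infinity[OF filterlim_ident], of r] by (intro tendsto_intros)
    ultimately have "?d * (1 - 7 / 2 * \<tau>) * V - ?d * N * 0 ^ DIM('a) \<le> Q" by (intro tendsto_upperbound) auto
    then show ?thesis by (simp add: power_0_left)
  qed
  have "eventually (\<lambda>\<tau>. ?d * (1 - 7 / 2 * \<tau>) * V \<le> Q) (at_right 0)"
    by (rule eventually_mono[OF eventually_at_right_less]) (rule lim\<tau>)
  moreover have "((\<lambda>\<tau>. ?d * (1 - 7 / 2 * \<tau>) * V) \<longlongrightarrow> ?d * (1 - 7 / 2 * 0) * V) (at_right 0)"
    by (intro tendsto_intros)
  ultimately have "?d * (1 - 7 / 2 * 0) * V \<le> Q" by (intro tendsto_upperbound) auto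
  then have "?d * V \<le> Q" by simp
  then have "(?d * V)\<^sup>2 \<le> Q\<^sup>2" using V by (intro power_mono) auto
  also have "Q\<^sup>2 = E * (r\<^sup>2 * (V * ?d / n))" unfolding Q_def using V r by (simp add: E_def)
  finally have "?d * V * (?d * V * n) \<le> ?d * V * (E * r\<^sup>2)" using n(1) by (simp add: power2_eq_square field_simps)
  then have "?d * V * n \<le> E * r\<^sup>2" using V by simp
  moreover have "V = unit_ball_vol (real DIM('a)) * r ^ (DIM('a) - 2) * r\<^sup>2" unfolding V_def n(2) by (simp add: power_add power2_eq_square)
  ultimately have "(real n * ?d * unit_ball_vol (real DIM('a)) * r ^ (DIM('a) - 2)) * r\<^sup>2 \<le> E * r\<^sup>2" by (simp add: mult_ac)
  then have "real n * ?d * unit_ball_vol (real DIM('a)) * r ^ (DIM('a) - 2) \<le> E" using r by simp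
  then show ?thesis unfolding E_def n_def .
qed

lemma perimeter_sq_ball:
  fixes c :: "'a::euclidean_space"
  assumes d: "3 \<le> DIM('a)" and r: "0 < r"
  shows "real (DIM('a) - 2) * (perimeter (ball c r))\<^sup>2 / (DIM('a) * measure lebesgue (ball c r))
    = real (DIM('a) - 2) * DIM('a) * unit_ball_vol (real DIM('a)) * r ^ (DIM('a) - 2)"
proof -
  define w where "w = unit_ball_vol (real DIM('a))"
  have w: "0 < w" by (simp add: w_def)
  obtain k where k: "DIM('a) = Suc (Suc k)" using d by (metis Suc_le_D numeral_3_eq_3 Suc_le_mono)
  have rd: "r ^ DIM('a) = r\<^sup>2 * r ^ (DIM('a) - 2)" "r ^ (DIM('a) - 1) = r * r ^ (DIM('a) - 2)"
    unfolding k by (simp_all add: power2_eq_square)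
  show ?thesis
    unfolding perimeter_ball[OF r] measure_lebesgue_ball[OF less_imp_le[OF r]] w_def[symmetric] rd
    using w r by (simp add: power2_eq_square field_simps)
qed

lemma newton_cap_ball:
  fixes c :: "'a::euclidean_space"
  assumes d: "3 \<le> DIM('a)" and r: "0 < r"
  shows "newton_cap (closure (ball c r)) = real (DIM('a) - 2) * DIM('a) * unit_ball_vol (real DIM('a)) * r ^ (DIM('a) - 2)"
proof (rule antisym)
  note b = cbody_ball[OF r, of c]
  show "newton_cap (closure (ball c r)) \<le> real (DIM('a) - 2) * DIM('a) * unit_ball_vol (real DIM('a)) * r ^ (DIM('a) - 2)"
    using newton_cap_le[OF b d] unfolding perimeter_sq_ball[OF d r] .
  have cl: "closure (ball c r) = cball c r" using r by simp
  show "real (DIM('a) - 2) * DIM('a) * unit_ball_vol (real DIM('a)) * r ^ (DIM('a) - 2) \<le> newton_cap (closure (ball c r))"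
    unfolding newton_cap_def
  proof (rule cInf_greatest)
    show "{\<integral>x. (norm (g x))\<^sup>2 \<partial>lebesgue | u g. in_D1 u g \<and> continuous_on UNIV u \<and> (\<forall>x. u x \<ge> indicator (closure (ball c r)) x)} \<noteq> {}"
      by (rule newton_cap_nonempty[OF b d])
    fix E assume "E \<in> {\<integral>x. (norm (g x))\<^sup>2 \<partial>lebesgue | u g. in_D1 u g \<and> continuous_on UNIV u \<and> (\<forall>x. u x \<ge> indicator (closure (ball c r)) x)}"
    then obtain u and g :: "'a \<Rightarrow> 'a" where u: "in_D1 u g" "continuous_on UNIV u" "\<And>x. u x \<ge> indicator (cball c r) x"
      and E: "E = (\<integral>x. (norm (g x))\<^sup>2 \<partial>lebesgue)" unfolding cl by blast
    show "real (DIM('a) - 2) * DIM('a) * unit_ball_vol (real DIM('a)) * r ^ (DIM('a) - 2) \<le> E"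
      unfolding E by (rule cap_ball_ge[OF d r u])
  qed
qed

subsection \<open>The shape functional\<close>

text \<open>Scale invariance: torsion and capacity contribute the powers \<open>d + 2\<close> and
  \<open>d - 2\<close> of the radius, the denominator \<open>d * \<alpha>\<close> and
  \<open>d * (2 - \<alpha>)\<close>, and both sides total \<open>2 * d\<close>.\<close>

lemma G_alpha_ball:
  fixes c :: "'a::euclidean_space"
  assumes d: "3 \<le> DIM('a)" and r: "0 < r"
  shows "G_alpha \<alpha> (ball c r) = G_alpha \<alpha> (ball (0::'a) 1)"
proof -
  define w where "w = unit_ball_vol (real DIM('a))"
  define p where "p = real DIM('a) * (2 - \<alpha>) / (real DIM('a) - 1)"
  let ?d = "real DIM('a)"
  have w: "0 < w" by (simp add: w_def)
  have "G_alpha \<alpha> (ball c r) = w / (?d * (?d + 2)) * (real (DIM('a) - 2) * ?d * w) / (w powr \<alpha> * (?d * w) powr p)"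
    if r: "0 < r" for c :: 'a and r :: real
  proof -
    have exponent: "?d * \<alpha> + real (DIM('a) - 1) * p = 2 * ?d"
    proof -
      have "real (DIM('a) - 1) = ?d - 1" "?d - 1 \<noteq> 0" using d by auto
      then have "real (DIM('a) - 1) * p = ?d * (2 - \<alpha>)" unfolding p_def by (simp only:) simp
      then show ?thesis by (simp add: algebra_simps)
    qed
    have "(w * r ^ DIM('a)) powr \<alpha> = w powr \<alpha> * r powr (?d * \<alpha>)"
      using w r by (simp add: powr_mult powr_realpow[symmetric] powr_powr)
    moreover have "(?d * w * r ^ (DIM('a) - 1)) powr p = (?d * w) powr p * r powr (real (DIM('a) - 1) * p)"
      using w r by (subst powr_mult) (simp_all add: powr_realpow[symmetric] powr_powr)
    ultimately have "(w * r ^ DIM('a)) powr \<alpha> * (?d * w * r ^ (DIM('a) - 1)) powr p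
        = (w powr \<alpha> * (?d * w) powr p) * (r powr (?d * \<alpha>) * r powr (real (DIM('a) - 1) * p))"
      by (simp only: mult_ac)
    also have "r powr (?d * \<alpha>) * r powr (real (DIM('a) - 1) * p) = r powr (2 * ?d)"
      by (simp only: powr_add[symmetric] exponent)
    also have "r powr (2 * ?d) = r ^ (2 * DIM('a))" using r by (simp add: powr_realpow[symmetric])
    finally have den: "(w * r ^ DIM('a)) powr \<alpha> * (?d * w * r ^ (DIM('a) - 1)) powr p = (w powr \<alpha> * (?d * w) powr p) * r ^ (2 * DIM('a))" .
    have "DIM('a) + 2 + (DIM('a) - 2) = 2 * DIM('a)" using d by simp
    then have "r ^ (DIM('a) + 2) * r ^ (DIM('a) - 2) = r ^ (2 * DIM('a))" by (simp only: power_add[symmetric])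
    then have num: "w * r ^ (DIM('a) + 2) / (?d * (?d + 2)) * (real (DIM('a) - 2) * ?d * w * r ^ (DIM('a) - 2))
        = w / (?d * (?d + 2)) * (real (DIM('a) - 2) * ?d * w) * r ^ (2 * DIM('a))"
      by (simp only: times_divide_eq_right times_divide_eq_left mult_ac)
    have "G_alpha \<alpha> (ball c r) = w * r ^ (DIM('a) + 2) / (?d * (?d + 2)) * (real (DIM('a) - 2) * ?d * w * r ^ (DIM('a) - 2))
        / ((w * r ^ DIM('a)) powr \<alpha> * (?d * w * r ^ (DIM('a) - 1)) powr p)"
      unfolding G_alpha_def w_def p_def
      by (simp only: torsional_rigidity_ball[OF r] newton_cap_ball[OF d r] perimeter_ball[OF r] measure_lebesgue_ball[OF less_imp_le[OF r]])
    also have "\<dots> = w / (?d * (?d + 2)) * (real (DIM('a) - 2) * ?d * w) / (w powr \<alpha> * (?d * w) powr p)"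
      unfolding den num using r by simp
    finally show ?thesis .
  qed
  from this[OF r, of c] this[of 1 0] show ?thesis by simp
qed

text \<open>The comparison is with the ball \<open>B\<close> of equal volume. After the torsion and
  capacity bounds the functional is at most \<open>K\<close> times a power of
  \<open>perimeter \<Omega>\<close>, and the same expression at \<open>perimeter B\<close> equals
  \<open>G_alpha \<alpha> B\<close> because the capacity bound is attained by balls.\<close>

lemma G_alpha_le_ball:
  fixes \<Omega> :: "'a::euclidean_space set"
  assumes d: "3 \<le> DIM('a)" and \<alpha>: "\<alpha> \<le> 2 / real DIM('a)" and \<Omega>: "cbody \<Omega>"
  shows "G_alpha \<alpha> \<Omega> \<le> G_alpha \<alpha> (ball (0::'a) 1)"
proof -
  let ?d = "real DIM('a)" and ?w = "unit_ball_vol (real DIM('a))"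
  define V where "V = measure lebesgue \<Omega>"
  define R where "R = root DIM('a) (V / ?w)"
  define p where "p = ?d * (2 - \<alpha>) / (?d - 1)"
  define B where "B = ball (0::'a) R"
  have V: "0 < V" unfolding V_def by (rule cbody_measure_pos[OF \<Omega>])
  have w: "0 < ?w" by simp
  have R: "0 < R" using V w by (simp add: R_def)
  have "R ^ DIM('a) = V / ?w" unfolding R_def using V w by (intro real_root_pow_pos2) auto
  then have VR: "V = ?w * R ^ DIM('a)" unfolding nonzero_eq_divide_eq[OF less_imp_neq[OF w, symmetric]] by (simp only: mult.commute)
  have B: "cbody B" "measure lebesgue B = V" unfolding B_def VR
    by (rule cbody_ball[OF R], rule measure_lebesgue_ball[OF less_imp_le[OF R]])
  have P: "0 < perimeter B" "perimeter B \<le> perimeter \<Omega>"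
    using perimeter_pos[OF B(1)] perimeter_ge_ball[OF \<Omega> R VR[unfolded V_def]] by (simp_all add: B_def perimeter_ball[OF R])
  \<comment> \<open>The only use of the upper bound on \<alpha>: it makes the remaining exponent of
    the perimeter nonpositive, so the smaller perimeter of \<open>B\<close> gives the larger
    value.\<close>
  have "\<alpha> * ?d \<le> 2" using \<alpha> by (simp add: field_simps)
  then have "2 * (?d - 1) \<le> ?d * (2 - \<alpha>)" by (simp add: algebra_simps)
  then have p2: "2 - p \<le> 0" using d unfolding p_def by (simp add: field_simps)
  have T: "torsional_rigidity \<Omega> \<le> torsional_rigidity B"
    unfolding B_def torsional_rigidity_ball[OF R]
    by (rule torsional_rigidity_le(1)) (use \<Omega> R VR in \<open>simp_all only: cbody_def V_def less_imp_le\<close>)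
  have TB: "0 \<le> torsional_rigidity B" unfolding B_def torsional_rigidity_ball[OF R] using R w by simp
  have cap: "newton_cap (closure \<Omega>) \<le> real (DIM('a) - 2) * (perimeter \<Omega>)\<^sup>2 / (?d * V)"
    unfolding V_def by (rule newton_cap_le[OF \<Omega> d])
  have capB: "newton_cap (closure B) = real (DIM('a) - 2) * (perimeter B)\<^sup>2 / (?d * V)"
    unfolding B(2)[symmetric] B_def newton_cap_ball[OF d R] by (rule perimeter_sq_ball[OF d R, symmetric])
  have pw: "x\<^sup>2 / x powr p = x powr (2 - p)" if "0 < x" for x :: real
    using that by (simp add: powr_diff powr_realpow)
  have cap0: "0 \<le> newton_cap (closure \<Omega>)"
    unfolding newton_cap_def
  proof (rule cInf_greatest)
    show "{\<integral>x. (norm (g x))\<^sup>2 \<partial>lebesgue | u g. in_D1 u g \<and> continuous_on UNIV u \<and> (\<forall>x. u x \<ge> indicator (closure \<Omega>) x)} \<noteq> {}"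
      by (rule newton_cap_nonempty[OF \<Omega> d])
  qed auto
  \<comment> \<open>Everything that \<open>\<Omega>\<close> and \<open>B\<close> share once the
    torsion is replaced by that of \<open>B\<close> and the volumes agree.\<close>
  define K where "K = torsional_rigidity B * real (DIM('a) - 2) / (?d * V) / V powr \<alpha>"
  have K: "0 \<le> K" unfolding K_def using TB V by simp
  have split: "torsional_rigidity B * (real (DIM('a) - 2) * x\<^sup>2 / (?d * V)) / (V powr \<alpha> * x powr p) = K * x powr (2 - p)"
    if "0 < x" for x
    unfolding pw[OF that, symmetric] K_def by (simp add: mult_ac)
  have "G_alpha \<alpha> \<Omega> \<le> torsional_rigidity B * (real (DIM('a) - 2) * (perimeter \<Omega>)\<^sup>2 / (?d * V)) / (V powr \<alpha> * perimeter \<Omega> powr p)"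
    unfolding G_alpha_def p_def[symmetric] V_def[symmetric]
    by (intro divide_right_mono mult_mono T cap TB cap0) simp
  also have "\<dots> = K * perimeter \<Omega> powr (2 - p)" using P by (intro split) simp
  also have "\<dots> \<le> K * perimeter B powr (2 - p)" using P p2 K by (intro mult_left_mono powr_mono2') auto
  also have "\<dots> = G_alpha \<alpha> B"
    unfolding G_alpha_def B(2) capB p_def[symmetric] by (rule split[OF P(1), symmetric])
  also have "\<dots> = G_alpha \<alpha> (ball (0::'a) 1)" unfolding B_def by (rule G_alpha_ball[OF d R])
  finally show ?thesis .
qed

theorem theorem3:
  fixes \<alpha> :: real
  assumes "DIM('a::euclidean_space) \<ge> 3"
    and "0 \<le> \<alpha>" and "\<alpha> \<le> 2 / real DIM('a)"
  shows "(\<forall>\<Omega>::'a set. \<Omega> \<noteq> {} \<and> open \<Omega> \<and> bounded \<Omega> \<and> convex \<Omega> \<longrightarrow>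
            G_alpha \<alpha> \<Omega> \<le> G_alpha \<alpha> (ball (0::'a) 1))
      \<and> (SUP \<Omega>\<in>{\<Omega>::'a set. \<Omega> \<noteq> {} \<and> open \<Omega> \<and> bounded \<Omega> \<and> convex \<Omega>}. G_alpha \<alpha> \<Omega>)
          = G_alpha \<alpha> (ball (0::'a) 1)
      \<and> (\<forall>(c::'a) r. r > 0 \<longrightarrow> G_alpha \<alpha> (ball c r) = G_alpha \<alpha> (ball (0::'a) 1))"
proof (intro conjI)
  show le: "\<forall>\<Omega>::'a set. \<Omega> \<noteq> {} \<and> open \<Omega> \<and> bounded \<Omega> \<and> convex \<Omega> \<longrightarrow>
      G_alpha \<alpha> \<Omega> \<le> G_alpha \<alpha> (ball (0::'a) 1)"
    using G_alpha_le_ball[OF assms(1,3)] unfolding cbody_def by blast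
  show "(SUP \<Omega>\<in>{\<Omega>::'a set. \<Omega> \<noteq> {} \<and> open \<Omega> \<and> bounded \<Omega> \<and> convex \<Omega>}. G_alpha \<alpha> \<Omega>) = G_alpha \<alpha> (ball (0::'a) 1)"
    by (rule cSup_eq_maximum) (use le in auto)
  show "\<forall>(c::'a) r. r > 0 \<longrightarrow> G_alpha \<alpha> (ball c r) = G_alpha \<alpha> (ball (0::'a) 1)"
    using G_alpha_ball[OF assms(1)] by blast
qed

end
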